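(* Let $\mathscr{J}$ be a system of arities in a symmetric monoidal closed category $\mathscr{V}$ such that $\mathscr{V}_0$ has pullbacks, and let $\mathscr{C}$ be a $\mathscr{J}$-admissible $\mathscr{V}$-category. The category of bifold algebras and strong cross-morphisms, $\mathrm{BAlg}^{\mathrm{sc}}(\mathscr{C})$, is equivalent to the category of commuting algebra pairs with strong cross-morphisms, $\mathrm{CPair}^{\mathrm{sc}}(\mathscr{C})$. Indeed, $$\mathrm{BAlg}^{\mathrm{sc}}(\mathscr{C})\;\simeq\;\mathrm{CPair}^{\mathrm{sc}}(\mathscr{C})$$ by way of an equivalence $\Theta:\mathrm{BAlg}^{\mathrm{sc}}(\mathscr{C})\to\mathrm{CPair}^{\mathrm{sc}}(\mathscr{C})$ that is given on objects by $D\mapsto(D_\ell,D_r)$ and has $L'\Theta=L$ and $R'\Theta=R$.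
   Context: Base setting. $\mathscr{V}$ is a symmetric monoidal closed category with unit object $I$ and underlying ordinary category $\mathscr{V}_0$. By universe enlargement, $\mathscr{V}$ is a full subcategory of a symmetric monoidal closed category $\mathscr{V}'$ that is complete and cocomplete relative to a universe in which everything considered is small, with $\mathscr{V}\hookrightarrow\mathscr{V}'$ preserving all limits that exist in $\mathscr{V}$; $\mathscr{V}$-functor categories exist as $\mathscr{V}'$-categories. A system of arities is a fully faithful symmetric strong monoidal $\mathscr{V}$-functor $\mathscr{J}\to\mathscr{V}$, written as the inclusion of a full sub-$\mathscr{V}$-category containing $I$ and closed under $\otimes$ ($\mathscr{J}$ need not be small). A $\mathscr{J}$-cotensor in a $\mathscr{V}$-category is a cotensor $[J,C]$ with $J\in\mathrm{ob}\,\mathscr{J}$; $\mathscr{V}$-categories with $\mathscr{J}$-cotensors are equipped with designated ones, with $[I,C]=C$ (and identity counit). A $\mathscr{J}$-theory is a $\mathscr{V}$-category $\mathscr{T}$ equipped with an identity-on-objects $\mathscr{V}$-functor $\tau:\mathscr{J}^{\mathrm{op}}\to\mathscr{T}$ that preserves $\mathscr{J}$-cotensors; equivalently, $\mathrm{ob}\,\mathscr{T}=\mathrm{ob}\,\mathscr{J}$ and each object $J$ is equipped with a morphism $J\to\mathscr{T}(J,I)$ exhibiting $J$ as a cotensor $[J,I]$ in $\mathscr{T}$, which for $J=I$ is the identity on $I$. A morphism of $\mathscr{J}$-theories is a $\mathscr{V}$-functor commuting with the structure $\mathscr{V}$-functors $\tau$. For a $\mathscr{V}$-category $\mathscr{C}$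 with $\mathscr{J}$-cotensors, a $\mathscr{T}$-algebra in $\mathscr{C}$ is a $\mathscr{V}$-functor $A:\mathscr{T}\to\mathscr{C}$ preserving $\mathscr{J}$-cotensors; its carrier is $|A|=A(I)$. $\mathscr{T}\text{-}\mathrm{Alg}(\mathscr{C})$ is the full sub-$\mathscr{V}'$-category of $[\mathscr{T},\mathscr{C}]$ on the $\mathscr{T}$-algebras; for a morphism $f$ in it, $|f|=f_I$. $\mathscr{C}$ is $\mathscr{J}$-admissible if it has $\mathscr{J}$-cotensors and for every $\mathscr{J}$-theory $\mathscr{T}$ the ends defining the hom-objects of $\mathscr{T}\text{-}\mathrm{Alg}(\mathscr{C})$ exist in $\mathscr{V}$ (so it is a $\mathscr{V}$-category). $\mathscr{J}$-cotensors in $\mathscr{T}\text{-}\mathrm{Alg}(\mathscr{C})$ are pointwise, with designated ones chosen so that evaluation at $I$ sends them to the designated ones in $\mathscr{C}$. Strong morphisms. An algebra in $\mathscr{C}$ is a pair $(\mathscr{T},A)$ (also written $A$) with $\mathscr{T}$ a $\mathscr{J}$-theory and $A$ a $\mathscr{T}$-algebra in $\mathscr{C}$. $\mathrm{Alg}^{\mathrm{s}}(\mathscr{C})$ is the category of algebras, where a (strong) morphism $(M,f):(\mathscr{T},A)\to(\mathscr{U},B)$ consists of a morphism of $\mathscr{J}$-theories $M:\mathscr{T}\to\mathscr{U}$ and an isomorphism $f:A\to BM$ of $\mathscr{T}$-algebras; $(N,g)(M,f)=(NM,(gM)\cdot f)$. The underlying isomorphism of $(M,f)$ is $|f|:|A|\to|B|$.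 For an object $C$ of $\mathscr{C}$, $\mathrm{Alg}(C)$ is the (non-full) subcategory of algebras with carrier $C$ and morphisms $(M,f)$ with $|f|=1_C$. Commutation. The commutant of $(\mathscr{T},A)$ is the algebra $A^\perp=(\mathscr{T}^\perp_A,A^\perp)$, where $\mathscr{T}^\perp_A$ is the $\mathscr{J}$-theory with $\mathscr{T}^\perp_A(J,K)=\mathscr{T}\text{-}\mathrm{Alg}(\mathscr{C})([J,A],[K,A])$ ($J,K\in\mathrm{ob}\,\mathscr{J}$), with composition and identities as in $\mathscr{T}\text{-}\mathrm{Alg}(\mathscr{C})$ and structure morphisms $J\to\mathscr{T}\text{-}\mathrm{Alg}(\mathscr{C})([J,A],A)$ the cotensor counits, and $A^\perp:\mathscr{T}^\perp_A\to\mathscr{C}$ is the algebra on $|A|$ given by $J\mapsto[J,|A|]$ and on homs by evaluation at $I$. Given algebras $A$ and $B$ on $C$, $A$ commutes with $B$ if there is a (necessarily unique) morphism $B\to A^\perp$ in $\mathrm{Alg}(C)$. Pairs. An algebra pair in $\mathscr{C}$ is a pair $(A,B)$ of algebras with $|A|=|B|$; it is a commuting algebra pair if $A$ commutes with $B$. A strong cross-morphism of algebra pairs $(f,g):(A,B)\to(X,Y)$ consists of strong morphisms $f:A\to X$ and $g:Y\to B$ in $\mathrm{Alg}^{\mathrm{s}}(\mathscr{C})$ whose underlying isomorphisms satisfy $|f|=|g|^{-1}$; composition is componentwise. $\mathrm{CPair}^{\mathrm{sc}}(\mathscr{C})$ is the category of commuting algebra pairs and strong cross-morphisms. $L':\mathrm{CPair}^{\mathrm{sc}}(\mathscr{C})\to\mathrm{Alg}^{\mathrm{s}}(\mathscr{C})$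 and $R':\mathrm{CPair}^{\mathrm{sc}}(\mathscr{C})\to\mathrm{Alg}^{\mathrm{s}}(\mathscr{C})^{\mathrm{op}}$ are the projections $L'(A,B)=A$, $R'(A,B)=B$. Bifold algebras. For $\mathscr{J}$-theories $\mathscr{T},\mathscr{U}$, a $(\mathscr{T},\mathscr{U})$-algebra in $\mathscr{C}$ is a $\mathscr{V}$-functor $D:\mathscr{T}\otimes\mathscr{U}\to\mathscr{C}$ preserving $\mathscr{J}$-cotensors in each variable separately. A bifold algebra is a triple $(\mathscr{T},\mathscr{U},D)$ with $D$ such (written $D$). Its left face is the algebra $(\mathscr{T},D_\ell)$ with $D_\ell=D(-,I)$, and its right face is $(\mathscr{U},D_r)$ with $D_r=D(I,-)$. $\mathrm{BAlg}^{\mathrm{sc}}(\mathscr{C})$ is the category of bifold algebras, where a (strong cross-)morphism $(M,N,f):(\mathscr{T},\mathscr{U},D)\to(\mathscr{T}',\mathscr{U}',D')$ consists of morphisms of $\mathscr{J}$-theories $M:\mathscr{T}\to\mathscr{T}'$ and $N:\mathscr{U}'\to\mathscr{U}$ and a $\mathscr{V}$-natural isomorphism $f_{JK}:D(J,NK)\to D'(MJ,K)$ ($J\in\mathscr{T}$, $K\in\mathscr{U}'$); the composite with $(M',N',f'):(\mathscr{T}',\mathscr{U}',D')\to(\mathscr{T}'',\mathscr{U}'',D'')$ is $(M'M,NN',g)$ with $g_{JK}=f'_{MJ,K}\cdot f_{J,N'K}$. The face functors $L:\mathrm{BAlg}^{\mathrm{sc}}(\mathscr{C})\to\mathrm{Alg}^{\mathrm{s}}(\mathscr{C})$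 and $R:\mathrm{BAlg}^{\mathrm{sc}}(\mathscr{C})\to\mathrm{Alg}^{\mathrm{s}}(\mathscr{C})^{\mathrm{op}}$ are given by $L(\mathscr{T},\mathscr{U},D)=(\mathscr{T},D_\ell)$, $L(M,N,f)=(M,f_{-,I})$, $R(\mathscr{T},\mathscr{U},D)=(\mathscr{U},D_r)$, $R(M,N,f)=(N,(f_{I,-})^{-1})$. *)

theory Defs
  imports "HOL-Library.FuncSet"
begin

text \<open>
  Conventions. An ordinary category has explicit sets of objects and arrows. The base \<open>V\<close> of the
  enrichment is an ordinary category with chosen symmetric monoidal closed structure. Data indexed
  by the objects of a \<open>V\<close>-category (hom-objects, composition, units, the maps of a \<open>V\<close>-functor,
  components of \<open>V\<close>-natural transformations), and the maps of ordinary functors, are extensional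
  (\<open>undefined\<close> outside the intended domain), so that equality of HOL values is equality of
  \<open>V\<close>-categories, \<open>V\<close>-functors, and so on.
\<close>

section \<open>Ordinary categories\<close>

record ('a, 'm) cat =
  Ob :: "'a set"
  Ar :: "'m set"
  Dom :: "'m \<Rightarrow> 'a"
  Cod :: "'m \<Rightarrow> 'a"
  Ident :: "'a \<Rightarrow> 'm"
  Comp :: "'m \<Rightarrow> 'm \<Rightarrow> 'm" (infixr "\<cdot>\<index>" 55)

definition hom :: "('a, 'm, 'z) cat_scheme \<Rightarrow> 'a \<Rightarrow> 'a \<Rightarrow> 'm set" where
  "hom C a b = {f \<in> Ar C. Dom C f = a \<and> Cod C f = b}"

locale category =
  fixes C :: "('a, 'm, 'z) cat_scheme" (structure)
  assumes Dom_Ob: "f \<in> Ar C \<Longrightarrow> Dom C f \<in> Ob C"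
    and Cod_Ob: "f \<in> Ar C \<Longrightarrow> Cod C f \<in> Ob C"
    and Ident_hom: "a \<in> Ob C \<Longrightarrow> Ident C a \<in> hom C a a"
    and Comp_hom: "f \<in> hom C a b \<Longrightarrow> g \<in> hom C b c \<Longrightarrow> g \<cdot> f \<in> hom C a c"
    and Comp_Ident_right: "f \<in> hom C a b \<Longrightarrow> f \<cdot> Ident C a = f"
    and Comp_Ident_left: "f \<in> hom C a b \<Longrightarrow> Ident C b \<cdot> f = f"
    and Comp_assoc: "f \<in> hom C a b \<Longrightarrow> g \<in> hom C b c \<Longrightarrow> h \<in> hom C c d
      \<Longrightarrow> (h \<cdot> g) \<cdot> f = h \<cdot> (g \<cdot> f)"

definition inverse_arrows :: "('a, 'm, 'z) cat_scheme \<Rightarrow> 'm \<Rightarrow> 'm \<Rightarrow> bool" where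
  "inverse_arrows C f g \<longleftrightarrow> f \<in> Ar C \<and> g \<in> hom C (Cod C f) (Dom C f) \<and>
     Comp C g f = Ident C (Dom C f) \<and> Comp C f g = Ident C (Cod C f)"

definition iso_arrow :: "('a, 'm, 'z) cat_scheme \<Rightarrow> 'm \<Rightarrow> bool" where
  "iso_arrow C f \<longleftrightarrow> (\<exists>g. inverse_arrows C f g)"

definition inv_arrow :: "('a, 'm, 'z) cat_scheme \<Rightarrow> 'm \<Rightarrow> 'm" where
  "inv_arrow C f = (THE g. inverse_arrows C f g)"

definition is_pullback ::
  "('a, 'm, 'z) cat_scheme \<Rightarrow> 'm \<Rightarrow> 'm \<Rightarrow> 'a \<Rightarrow> 'm \<Rightarrow> 'm \<Rightarrow> bool" where
  "is_pullback C f g p p1 p2 \<longleftrightarrow>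
     p1 \<in> hom C p (Dom C f) \<and> p2 \<in> hom C p (Dom C g) \<and> Comp C f p1 = Comp C g p2 \<and>
     (\<forall>q \<in> Ob C. \<forall>q1 \<in> hom C q (Dom C f). \<forall>q2 \<in> hom C q (Dom C g).
        Comp C f q1 = Comp C g q2 \<longrightarrow>
        (\<exists>!h. h \<in> hom C q p \<and> Comp C p1 h = q1 \<and> Comp C p2 h = q2))"

definition has_pullbacks :: "('a, 'm, 'z) cat_scheme \<Rightarrow> bool" where
  "has_pullbacks C \<longleftrightarrow>
     (\<forall>f \<in> Ar C. \<forall>g \<in> Ar C. Cod C f = Cod C g \<longrightarrow>
        (\<exists>p \<in> Ob C. \<exists>p1 p2. is_pullback C f g p p1 p2))"

record ('a, 'm, 'b, 'n) ftor =
  Fo :: "'a \<Rightarrow> 'b"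
  Fa :: "'m \<Rightarrow> 'n"

locale cat_functor = A: category A + B: category B
  for A :: "('a, 'm) cat" and B :: "('b, 'n) cat" +
  fixes F :: "('a, 'm, 'b, 'n) ftor"
  assumes Fo_PiE: "Fo F \<in> Ob A \<rightarrow>\<^sub>E Ob B"
    and Fa_ext: "Fa F \<in> extensional (Ar A)"
    and Fa_hom: "f \<in> hom A a b \<Longrightarrow> Fa F f \<in> hom B (Fo F a) (Fo F b)"
    and Fa_Ident: "a \<in> Ob A \<Longrightarrow> Fa F (Ident A a) = Ident B (Fo F a)"
    and Fa_Comp: "f \<in> hom A a b \<Longrightarrow> g \<in> hom A b c
      \<Longrightarrow> Fa F (Comp A g f) = Comp B (Fa F g) (Fa F f)"

definition id_ftor :: "('a, 'm) cat \<Rightarrow> ('a, 'm, 'a, 'm) ftor" where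
  "id_ftor A = \<lparr>Fo = (\<lambda>a\<in>Ob A. a), Fa = (\<lambda>f\<in>Ar A. f)\<rparr>"

definition comp_ftor ::
  "('a, 'm) cat \<Rightarrow> ('b, 'n, 'c, 'k) ftor \<Rightarrow> ('a, 'm, 'b, 'n) ftor \<Rightarrow> ('a, 'm, 'c, 'k) ftor" where
  "comp_ftor A G F = \<lparr>Fo = compose (Ob A) (Fo G) (Fo F), Fa = compose (Ar A) (Fa G) (Fa F)\<rparr>"

definition natural_iso ::
  "('a, 'm) cat \<Rightarrow> ('b, 'n) cat \<Rightarrow> ('a, 'm, 'b, 'n) ftor \<Rightarrow> ('a, 'm, 'b, 'n) ftor
    \<Rightarrow> ('a \<Rightarrow> 'n) \<Rightarrow> bool" where
  "natural_iso A B F G \<eta> \<longleftrightarrow>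
     (\<forall>a \<in> Ob A. \<eta> a \<in> hom B (Fo F a) (Fo G a) \<and> iso_arrow B (\<eta> a)) \<and>
     (\<forall>f \<in> Ar A. Comp B (\<eta> (Cod A f)) (Fa F f) = Comp B (Fa G f) (\<eta> (Dom A f)))"

definition equivalence_of_categories ::
  "('a, 'm) cat \<Rightarrow> ('b, 'n) cat \<Rightarrow> ('a, 'm, 'b, 'n) ftor \<Rightarrow> bool" where
  "equivalence_of_categories A B F \<longleftrightarrow>
     cat_functor A B F \<and>
     (\<exists>G \<eta> \<epsilon>. cat_functor B A G \<and>
        natural_iso A A (id_ftor A) (comp_ftor A G F) \<eta> \<and>
        natural_iso B B (comp_ftor B F G) (id_ftor B) \<epsilon>)"


section \<open>Symmetric monoidal closed categories\<close>

record ('o, 'm) smc = "('o, 'm) cat" +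
  tensor :: "'o \<Rightarrow> 'o \<Rightarrow> 'o" (infixr "\<otimes>\<index>" 75)
  tensor_ar :: "'m \<Rightarrow> 'm \<Rightarrow> 'm" (infixr "\<boxtimes>\<index>" 70)
  unit_ob :: "'o" ("\<one>\<index>")
  assoc :: "'o \<Rightarrow> 'o \<Rightarrow> 'o \<Rightarrow> 'm"
  lunit :: "'o \<Rightarrow> 'm"
  runit :: "'o \<Rightarrow> 'm"
  braid :: "'o \<Rightarrow> 'o \<Rightarrow> 'm"
  ihom :: "'o \<Rightarrow> 'o \<Rightarrow> 'o"
  ev :: "'o \<Rightarrow> 'o \<Rightarrow> 'm"

text \<open>The axiom \<open>ev_universal\<close> says that \<open>ihom V a\<close> is right adjoint to tensoring with \<open>a\<close> on the
  right.\<close>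

locale symmetric_monoidal_closed_category = category V
  for V :: "('o, 'm) smc" (structure) +
  assumes tensor_Ob: "a \<in> Ob V \<Longrightarrow> b \<in> Ob V \<Longrightarrow> a \<otimes> b \<in> Ob V"
    and tensor_hom: "f \<in> hom V a b \<Longrightarrow> g \<in> hom V c d \<Longrightarrow> f \<boxtimes> g \<in> hom V (a \<otimes> c) (b \<otimes> d)"
    and tensor_Ident: "a \<in> Ob V \<Longrightarrow> b \<in> Ob V
      \<Longrightarrow> Ident V a \<boxtimes> Ident V b = Ident V (a \<otimes> b)"
    and tensor_Comp: "f \<in> hom V a b \<Longrightarrow> f' \<in> hom V b c \<Longrightarrow> g \<in> hom V a' b' \<Longrightarrow> g' \<in> hom V b' c'
      \<Longrightarrow> (f' \<cdot> f) \<boxtimes> (g' \<cdot> g) = (f' \<boxtimes> g') \<cdot> (f \<boxtimes> g)"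
    and unit_Ob: "\<one> \<in> Ob V"
    and assoc_hom: "a \<in> Ob V \<Longrightarrow> b \<in> Ob V \<Longrightarrow> c \<in> Ob V
      \<Longrightarrow> assoc V a b c \<in> hom V ((a \<otimes> b) \<otimes> c) (a \<otimes> (b \<otimes> c))"
    and assoc_iso: "a \<in> Ob V \<Longrightarrow> b \<in> Ob V \<Longrightarrow> c \<in> Ob V \<Longrightarrow> iso_arrow V (assoc V a b c)"
    and assoc_natural: "f \<in> hom V a a' \<Longrightarrow> g \<in> hom V b b' \<Longrightarrow> h \<in> hom V c c'
      \<Longrightarrow> assoc V a' b' c' \<cdot> ((f \<boxtimes> g) \<boxtimes> h) = (f \<boxtimes> (g \<boxtimes> h)) \<cdot> assoc V a b c"
    and lunit_hom: "a \<in> Ob V \<Longrightarrow> lunit V a \<in> hom V (\<one> \<otimes> a) a"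
    and lunit_iso: "a \<in> Ob V \<Longrightarrow> iso_arrow V (lunit V a)"
    and lunit_natural: "f \<in> hom V a b \<Longrightarrow> lunit V b \<cdot> (Ident V \<one> \<boxtimes> f) = f \<cdot> lunit V a"
    and runit_hom: "a \<in> Ob V \<Longrightarrow> runit V a \<in> hom V (a \<otimes> \<one>) a"
    and runit_iso: "a \<in> Ob V \<Longrightarrow> iso_arrow V (runit V a)"
    and runit_natural: "f \<in> hom V a b \<Longrightarrow> runit V b \<cdot> (f \<boxtimes> Ident V \<one>) = f \<cdot> runit V a"
    and braid_hom: "a \<in> Ob V \<Longrightarrow> b \<in> Ob V \<Longrightarrow> braid V a b \<in> hom V (a \<otimes> b) (b \<otimes> a)"
    and braid_natural: "f \<in> hom V a a' \<Longrightarrow> g \<in> hom V b b'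
      \<Longrightarrow> braid V a' b' \<cdot> (f \<boxtimes> g) = (g \<boxtimes> f) \<cdot> braid V a b"
    and braid_symmetric: "a \<in> Ob V \<Longrightarrow> b \<in> Ob V \<Longrightarrow> braid V b a \<cdot> braid V a b = Ident V (a \<otimes> b)"
    and pentagon: "a \<in> Ob V \<Longrightarrow> b \<in> Ob V \<Longrightarrow> c \<in> Ob V \<Longrightarrow> d \<in> Ob V
      \<Longrightarrow> assoc V a b (c \<otimes> d) \<cdot> assoc V (a \<otimes> b) c d
        = (Ident V a \<boxtimes> assoc V b c d) \<cdot> assoc V a (b \<otimes> c) d \<cdot> (assoc V a b c \<boxtimes> Ident V d)"
    and triangle: "a \<in> Ob V \<Longrightarrow> b \<in> Ob V
      \<Longrightarrow> (Ident V a \<boxtimes> lunit V b) \<cdot> assoc V a \<one> b = runit V a \<boxtimes> Ident V b"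
    and hexagon: "a \<in> Ob V \<Longrightarrow> b \<in> Ob V \<Longrightarrow> c \<in> Ob V
      \<Longrightarrow> assoc V b c a \<cdot> braid V a (b \<otimes> c) \<cdot> assoc V a b c
        = (Ident V b \<boxtimes> braid V a c) \<cdot> assoc V b a c \<cdot> (braid V a b \<boxtimes> Ident V c)"
    and ihom_Ob: "a \<in> Ob V \<Longrightarrow> b \<in> Ob V \<Longrightarrow> ihom V a b \<in> Ob V"
    and ev_hom: "a \<in> Ob V \<Longrightarrow> b \<in> Ob V \<Longrightarrow> ev V a b \<in> hom V (ihom V a b \<otimes> a) b"
    and ev_universal: "a \<in> Ob V \<Longrightarrow> b \<in> Ob V \<Longrightarrow> c \<in> Ob V \<Longrightarrow> f \<in> hom V (c \<otimes> a) b
      \<Longrightarrow> \<exists>!g. g \<in> hom V c (ihom V a b) \<and> ev V a b \<cdot> (g \<boxtimes> Ident V a) = f"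

text \<open>\<open>curry V c a b f\<close> is the transpose \<open>c \<rightarrow> [a, b]\<close> of \<open>f : c \<otimes> a \<rightarrow> b\<close>, and \<open>interchange\<close>
  is the middle-four interchange \<open>(p \<otimes> q) \<otimes> (r \<otimes> s) \<rightarrow> (p \<otimes> r) \<otimes> (q \<otimes> s)\<close>.\<close>

context fixes V :: "('o, 'm) smc" (structure)
begin

definition curry :: "'o \<Rightarrow> 'o \<Rightarrow> 'o \<Rightarrow> 'm \<Rightarrow> 'm" where
  "curry c a b f = (THE g. g \<in> hom V c (ihom V a b) \<and> ev V a b \<cdot> (g \<boxtimes> Ident V a) = f)"

definition interchange :: "'o \<Rightarrow> 'o \<Rightarrow> 'o \<Rightarrow> 'o \<Rightarrow> 'm" where
  "interchange p q r s =
     inv_arrow V (assoc V p r (q \<otimes> s)) \<cdot>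
     (Ident V p \<boxtimes>
        (assoc V r q s \<cdot> (braid V q r \<boxtimes> Ident V s) \<cdot> inv_arrow V (assoc V q r s))) \<cdot>
     assoc V p q (r \<otimes> s)"

end


section \<open>Enriched categories and functors\<close>

text \<open>\<open>VCmp A a b c : A(b, c) \<otimes> A(a, b) \<rightarrow> A(a, c)\<close> and \<open>VId A a : I \<rightarrow> A(a, a)\<close>.\<close>

record ('a, 'o, 'm) vcat =
  VOb :: "'a set"
  VHom :: "'a \<Rightarrow> 'a \<Rightarrow> 'o"
  VCmp :: "'a \<Rightarrow> 'a \<Rightarrow> 'a \<Rightarrow> 'm"
  VId :: "'a \<Rightarrow> 'm"

locale enriched_category = symmetric_monoidal_closed_category V
  for V :: "('o, 'm) smc" (structure) +
  fixes A :: "('a, 'o, 'm) vcat"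
  assumes VHom_PiE: "VHom A \<in> VOb A \<rightarrow>\<^sub>E VOb A \<rightarrow>\<^sub>E Ob V"
    and VCmp_PiE: "VCmp A \<in> (\<Pi>\<^sub>E a \<in> VOb A. \<Pi>\<^sub>E b \<in> VOb A. \<Pi>\<^sub>E c \<in> VOb A.
      hom V (VHom A b c \<otimes> VHom A a b) (VHom A a c))"
    and VId_PiE: "VId A \<in> (\<Pi>\<^sub>E a \<in> VOb A. hom V \<one> (VHom A a a))"
    and VCmp_assoc: "a \<in> VOb A \<Longrightarrow> b \<in> VOb A \<Longrightarrow> c \<in> VOb A \<Longrightarrow> d \<in> VOb A
      \<Longrightarrow> VCmp A a b d \<cdot> (VCmp A b c d \<boxtimes> Ident V (VHom A a b))
        = VCmp A a c d \<cdot> (Ident V (VHom A c d) \<boxtimes> VCmp A a b c)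
            \<cdot> assoc V (VHom A c d) (VHom A b c) (VHom A a b)"
    and VCmp_VId_left: "a \<in> VOb A \<Longrightarrow> b \<in> VOb A
      \<Longrightarrow> VCmp A a b b \<cdot> (VId A b \<boxtimes> Ident V (VHom A a b)) = lunit V (VHom A a b)"
    and VCmp_VId_right: "a \<in> VOb A \<Longrightarrow> b \<in> VOb A
      \<Longrightarrow> VCmp A a a b \<cdot> (Ident V (VHom A a b) \<boxtimes> VId A a) = runit V (VHom A a b)"

record ('a, 'b, 'm) vfun =
  FOb :: "'a \<Rightarrow> 'b"
  FHm :: "'a \<Rightarrow> 'a \<Rightarrow> 'm"

locale enriched_functor = A: enriched_category V A + B: enriched_category V B
  for V :: "('o, 'm) smc" (structure)
    and A :: "('a, 'o, 'm) vcat" and B :: "('b, 'o, 'm) vcat" +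
  fixes F :: "('a, 'b, 'm) vfun"
  assumes FOb_PiE: "FOb F \<in> VOb A \<rightarrow>\<^sub>E VOb B"
    and FHm_PiE: "FHm F \<in> (\<Pi>\<^sub>E a \<in> VOb A. \<Pi>\<^sub>E b \<in> VOb A.
      hom V (VHom A a b) (VHom B (FOb F a) (FOb F b)))"
    and FHm_VId: "a \<in> VOb A \<Longrightarrow> FHm F a a \<cdot> VId A a = VId B (FOb F a)"
    and FHm_VCmp: "a \<in> VOb A \<Longrightarrow> b \<in> VOb A \<Longrightarrow> c \<in> VOb A
      \<Longrightarrow> FHm F a c \<cdot> VCmp A a b c
        = VCmp B (FOb F a) (FOb F b) (FOb F c) \<cdot> (FHm F b c \<boxtimes> FHm F a b)"

context fixes V :: "('o, 'm) smc" (structure)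
begin

definition self_enriched :: "('o, 'o, 'm) vcat" where
  "self_enriched = \<lparr>VOb = Ob V,
     VHom = (\<lambda>a\<in>Ob V. \<lambda>b\<in>Ob V. ihom V a b),
     VCmp = (\<lambda>a\<in>Ob V. \<lambda>b\<in>Ob V. \<lambda>c\<in>Ob V.
       curry V (ihom V b c \<otimes> ihom V a b) a c
         (ev V b c \<cdot> (Ident V (ihom V b c) \<boxtimes> ev V a b) \<cdot> assoc V (ihom V b c) (ihom V a b) a)),
     VId = (\<lambda>a\<in>Ob V. curry V \<one> a a (lunit V a))\<rparr>"

definition full_subcategory :: "('a, 'o, 'm) vcat \<Rightarrow> 'a set \<Rightarrow> ('a, 'o, 'm) vcat" where
  "full_subcategory A S = \<lparr>VOb = S,
     VHom = (\<lambda>a\<in>S. \<lambda>b\<in>S. VHom A a b),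
     VCmp = (\<lambda>a\<in>S. \<lambda>b\<in>S. \<lambda>c\<in>S. VCmp A a b c),
     VId = (\<lambda>a\<in>S. VId A a)\<rparr>"

definition op_vcat :: "('a, 'o, 'm) vcat \<Rightarrow> ('a, 'o, 'm) vcat" where
  "op_vcat A = \<lparr>VOb = VOb A,
     VHom = (\<lambda>a\<in>VOb A. \<lambda>b\<in>VOb A. VHom A b a),
     VCmp = (\<lambda>a\<in>VOb A. \<lambda>b\<in>VOb A. \<lambda>c\<in>VOb A.
       VCmp A c b a \<cdot> braid V (VHom A c b) (VHom A b a)),
     VId = VId A\<rparr>"

definition tensor_vcat ::
  "('a, 'o, 'm) vcat \<Rightarrow> ('b, 'o, 'm) vcat \<Rightarrow> ('a \<times> 'b, 'o, 'm) vcat" where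
  "tensor_vcat A B = \<lparr>VOb = VOb A \<times> VOb B,
     VHom = (\<lambda>(a, a') \<in> VOb A \<times> VOb B. \<lambda>(b, b') \<in> VOb A \<times> VOb B. VHom A a b \<otimes> VHom B a' b'),
     VCmp = (\<lambda>(a, a') \<in> VOb A \<times> VOb B. \<lambda>(b, b') \<in> VOb A \<times> VOb B. \<lambda>(c, c') \<in> VOb A \<times> VOb B.
       (VCmp A a b c \<boxtimes> VCmp B a' b' c') \<cdot>
       interchange V (VHom A b c) (VHom B b' c') (VHom A a b) (VHom B a' b')),
     VId = (\<lambda>(a, a') \<in> VOb A \<times> VOb B. (VId A a \<boxtimes> VId B a') \<cdot> inv_arrow V (lunit V \<one>))\<rparr>"

definition id_vfun :: "('a, 'o, 'm) vcat \<Rightarrow> ('a, 'a, 'm) vfun" where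
  "id_vfun A = \<lparr>FOb = (\<lambda>a\<in>VOb A. a),
     FHm = (\<lambda>a\<in>VOb A. \<lambda>b\<in>VOb A. Ident V (VHom A a b))\<rparr>"

definition comp_vfun ::
  "('a, 'o, 'm) vcat \<Rightarrow> ('b, 'c, 'm) vfun \<Rightarrow> ('a, 'b, 'm) vfun \<Rightarrow> ('a, 'c, 'm) vfun" where
  "comp_vfun A G F = \<lparr>FOb = (\<lambda>a\<in>VOb A. FOb G (FOb F a)),
     FHm = (\<lambda>a\<in>VOb A. \<lambda>b\<in>VOb A. FHm G (FOb F a) (FOb F b) \<cdot> FHm F a b)\<rparr>"

definition tensor_vfun :: "('a, 'o, 'm) vcat \<Rightarrow> ('a', 'o, 'm) vcat \<Rightarrow>
    ('a, 'b, 'm) vfun \<Rightarrow> ('a', 'b', 'm) vfun \<Rightarrow> ('a \<times> 'a', 'b \<times> 'b', 'm) vfun" where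
  "tensor_vfun A A' F F' = \<lparr>
     FOb = (\<lambda>(a, a') \<in> VOb A \<times> VOb A'. (FOb F a, FOb F' a')),
     FHm = (\<lambda>(a, a') \<in> VOb A \<times> VOb A'. \<lambda>(b, b') \<in> VOb A \<times> VOb A'. FHm F a b \<boxtimes> FHm F' a' b')\<rparr>"

text \<open>The partial functors \<open>D(-, b) : A \<rightarrow> C\<close> and \<open>D(a, -) : B \<rightarrow> C\<close> of \<open>D : A \<otimes> B \<rightarrow> C\<close>.\<close>

definition partial_left :: "('a, 'o, 'm) vcat \<Rightarrow> ('b, 'o, 'm) vcat \<Rightarrow> 'b \<Rightarrow>
    ('a \<times> 'b, 'c, 'm) vfun \<Rightarrow> ('a, 'c, 'm) vfun" where
  "partial_left A B b D = \<lparr>FOb = (\<lambda>a\<in>VOb A. FOb D (a, b)),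
     FHm = (\<lambda>a\<in>VOb A. \<lambda>a'\<in>VOb A. FHm D (a, b) (a', b) \<cdot>
       (Ident V (VHom A a a') \<boxtimes> VId B b) \<cdot> inv_arrow V (runit V (VHom A a a')))\<rparr>"

definition partial_right :: "('a, 'o, 'm) vcat \<Rightarrow> ('b, 'o, 'm) vcat \<Rightarrow> 'a \<Rightarrow>
    ('a \<times> 'b, 'c, 'm) vfun \<Rightarrow> ('b, 'c, 'm) vfun" where
  "partial_right A B a D = \<lparr>FOb = (\<lambda>b\<in>VOb B. FOb D (a, b)),
     FHm = (\<lambda>b\<in>VOb B. \<lambda>b'\<in>VOb B. FHm D (a, b) (a, b') \<cdot>
       (VId A a \<boxtimes> Ident V (VHom B b b')) \<cdot> inv_arrow V (lunit V (VHom B b b')))\<rparr>"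

text \<open>Arrows \<open>a \<rightarrow> b\<close> of the underlying ordinary category of \<open>A\<close> are arrows \<open>I \<rightarrow> A(a, b)\<close> of \<open>V\<close>;
  \<open>comp0 A a b c g f\<close> is the composite of \<open>f : a \<rightarrow> b\<close> and \<open>g : b \<rightarrow> c\<close>.\<close>

definition comp0 :: "('a, 'o, 'm) vcat \<Rightarrow> 'a \<Rightarrow> 'a \<Rightarrow> 'a \<Rightarrow> 'm \<Rightarrow> 'm \<Rightarrow> 'm" where
  "comp0 A a b c g f = VCmp A a b c \<cdot> (g \<boxtimes> f) \<cdot> inv_arrow V (lunit V \<one>)"

definition inverse0 :: "('a, 'o, 'm) vcat \<Rightarrow> 'a \<Rightarrow> 'a \<Rightarrow> 'm \<Rightarrow> 'm \<Rightarrow> bool" where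
  "inverse0 A a b f g \<longleftrightarrow>
     f \<in> hom V \<one> (VHom A a b) \<and> g \<in> hom V \<one> (VHom A b a) \<and>
     comp0 A a b a g f = VId A a \<and> comp0 A b a b f g = VId A b"

definition inv0 :: "('a, 'o, 'm) vcat \<Rightarrow> 'a \<Rightarrow> 'a \<Rightarrow> 'm \<Rightarrow> 'm" where
  "inv0 A a b f = (THE g. inverse0 A a b f g)"

definition vnatural :: "('a, 'o, 'm) vcat \<Rightarrow> ('b, 'o, 'm) vcat \<Rightarrow>
    ('a, 'b, 'm) vfun \<Rightarrow> ('a, 'b, 'm) vfun \<Rightarrow> ('a \<Rightarrow> 'm) \<Rightarrow> bool" where
  "vnatural A B F G \<alpha> \<longleftrightarrow>
     \<alpha> \<in> (\<Pi>\<^sub>E a \<in> VOb A. hom V \<one> (VHom B (FOb F a) (FOb G a))) \<and>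
     (\<forall>a \<in> VOb A. \<forall>b \<in> VOb A.
        VCmp B (FOb F a) (FOb F b) (FOb G b) \<cdot> (\<alpha> b \<boxtimes> FHm F a b) \<cdot>
          inv_arrow V (lunit V (VHom A a b))
        = VCmp B (FOb F a) (FOb G a) (FOb G b) \<cdot> (FHm G a b \<boxtimes> \<alpha> a) \<cdot>
          inv_arrow V (runit V (VHom A a b)))"

definition vnatural_iso :: "('a, 'o, 'm) vcat \<Rightarrow> ('b, 'o, 'm) vcat \<Rightarrow>
    ('a, 'b, 'm) vfun \<Rightarrow> ('a, 'b, 'm) vfun \<Rightarrow> ('a \<Rightarrow> 'm) \<Rightarrow> bool" where
  "vnatural_iso A B F G \<alpha> \<longleftrightarrow> vnatural A B F G \<alpha> \<and>
     (\<exists>\<beta>. vnatural A B G F \<beta> \<and> (\<forall>a \<in> VOb A. inverse0 B (FOb F a) (FOb G a) (\<alpha> a) (\<beta> a)))"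


section \<open>Cotensors\<close>

text \<open>\<open>\<gamma> : j \<rightarrow> A(p, x)\<close> exhibits \<open>p\<close> as a cotensor \<open>[j, x]\<close>: for every object \<open>y\<close> the induced
  arrow \<open>A(y, p) \<rightarrow> [j, A(y, x)]\<close> is invertible in \<open>V\<close>.\<close>

definition is_cotensor :: "('a, 'o, 'm) vcat \<Rightarrow> 'o \<Rightarrow> 'a \<Rightarrow> 'a \<Rightarrow> 'm \<Rightarrow> bool" where
  "is_cotensor A j x p \<gamma> \<longleftrightarrow>
     x \<in> VOb A \<and> p \<in> VOb A \<and> \<gamma> \<in> hom V j (VHom A p x) \<and>
     (\<forall>y \<in> VOb A. iso_arrow V
        (curry V (VHom A y p) j (VHom A y x)
          (VCmp A y p x \<cdot> (\<gamma> \<boxtimes> Ident V (VHom A y p)) \<cdot> braid V (VHom A y p) j)))"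

definition preserves_cotensors ::
  "'o set \<Rightarrow> ('a, 'o, 'm) vcat \<Rightarrow> ('b, 'o, 'm) vcat \<Rightarrow> ('a, 'b, 'm) vfun \<Rightarrow> bool" where
  "preserves_cotensors J A B F \<longleftrightarrow>
     (\<forall>j \<in> J. \<forall>x p \<gamma>. is_cotensor A j x p \<gamma> \<longrightarrow>
        is_cotensor B j (FOb F x) (FOb F p) (FHm F p x \<cdot> \<gamma>))"

text \<open>Designated cotensors are given by objects \<open>ct j x = [j, x]\<close> and counits \<open>cu j x\<close>. For these,
  \<open>cotensor_hom ct cu C j x y : C(x, y) \<rightarrow> C([j, x], [j, y])\<close> is the action on homs of the
  \<open>V\<close>-functor \<open>[j, -]\<close>, that is, the one making the counits \<open>V\<close>-natural.\<close>

definition designated_cotensors ::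
  "'o set \<Rightarrow> ('c, 'o, 'm) vcat \<Rightarrow> ('o \<Rightarrow> 'c \<Rightarrow> 'c) \<Rightarrow> ('o \<Rightarrow> 'c \<Rightarrow> 'm) \<Rightarrow> bool" where
  "designated_cotensors J C ct cu \<longleftrightarrow>
     (\<forall>j \<in> J. \<forall>x \<in> VOb C. is_cotensor C j x (ct j x) (cu j x)) \<and>
     (\<forall>x \<in> VOb C. ct \<one> x = x \<and> cu \<one> x = VId C x)"

definition cotensor_hom ::
  "('c, 'o, 'm) vcat \<Rightarrow> ('o \<Rightarrow> 'c \<Rightarrow> 'c) \<Rightarrow> ('o \<Rightarrow> 'c \<Rightarrow> 'm) \<Rightarrow> 'o \<Rightarrow> 'c \<Rightarrow> 'c \<Rightarrow> 'm" where
  "cotensor_hom C ct cu j x y = (THE h.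
     h \<in> hom V (VHom C x y) (VHom C (ct j x) (ct j y)) \<and>
     VCmp C (ct j x) (ct j y) y \<cdot> (cu j y \<boxtimes> h) \<cdot> braid V (VHom C x y) j
     = VCmp C (ct j x) x y \<cdot> (Ident V (VHom C x y) \<boxtimes> cu j x))"

end


section \<open>Systems of arities, theories and algebras\<close>

locale system_of_arities = symmetric_monoidal_closed_category V
  for V :: "('o, 'm) smc" (structure) +
  fixes J :: "'o set"
  assumes J_Ob: "J \<subseteq> Ob V"
    and J_unit: "\<one> \<in> J"
    and J_tensor: "j \<in> J \<Longrightarrow> k \<in> J \<Longrightarrow> j \<otimes> k \<in> J"

record ('o, 'm) jtheory =
  Tcat :: "('o, 'o, 'm) vcat"
  Tau :: "('o, 'o, 'm) vfun"

type_synonym ('o, 'c, 'm) alg = "('o, 'm) jtheory \<times> ('o, 'c, 'm) vfun"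

text \<open>Arrows of the ordinary categories below carry their domain and codomain: an arrow of algebras
  is \<open>((T, A), (M, f), (U, B))\<close>.\<close>

type_synonym ('o, 'c, 'm) alg_arrow =
  "('o, 'c, 'm) alg \<times> (('o, 'o, 'm) vfun \<times> ('o \<Rightarrow> 'm)) \<times> ('o, 'c, 'm) alg"

type_synonym ('o, 'c, 'm) pair = "('o, 'c, 'm) alg \<times> ('o, 'c, 'm) alg"

type_synonym ('o, 'c, 'm) pair_arrow =
  "('o, 'c, 'm) pair \<times> (('o, 'c, 'm) alg_arrow \<times> ('o, 'c, 'm) alg_arrow) \<times> ('o, 'c, 'm) pair"

type_synonym ('o, 'c, 'm) bifold =
  "('o, 'm) jtheory \<times> ('o, 'm) jtheory \<times> ('o \<times> 'o, 'c, 'm) vfun"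

type_synonym ('o, 'c, 'm) bifold_arrow =
  "('o, 'c, 'm) bifold \<times> (('o, 'o, 'm) vfun \<times> ('o, 'o, 'm) vfun \<times> ('o \<times> 'o \<Rightarrow> 'm))
    \<times> ('o, 'c, 'm) bifold"

context fixes V :: "('o, 'm) smc" (structure) and J :: "'o set"
begin

definition arity_op :: "('o, 'o, 'm) vcat" where
  "arity_op = op_vcat V (full_subcategory (self_enriched V) J)"

definition is_theory :: "('o, 'm) jtheory \<Rightarrow> bool" where
  "is_theory T \<longleftrightarrow> VOb (Tcat T) = J \<and> enriched_functor V arity_op (Tcat T) (Tau T) \<and>
     (\<forall>j \<in> J. FOb (Tau T) j = j) \<and> preserves_cotensors V J arity_op (Tcat T) (Tau T)"

definition theory_morphism ::
  "('o, 'm) jtheory \<Rightarrow> ('o, 'm) jtheory \<Rightarrow> ('o, 'o, 'm) vfun \<Rightarrow> bool" where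
  "theory_morphism T U M \<longleftrightarrow>
     enriched_functor V (Tcat T) (Tcat U) M \<and> comp_vfun V arity_op M (Tau T) = Tau U"

text \<open>The theory with \<open>V\<close>-category \<open>T\<close> (on the objects \<open>J\<close>) and structure morphisms
  \<open>s j : j \<rightarrow> T(j, I)\<close>: the component \<open>[k, j] \<rightarrow> T(j, k)\<close> of its structure functor corresponds,
  as \<open>s k\<close> exhibits \<open>k\<close> as \<open>[k, I]\<close> in \<open>T\<close>, to \<open>s j\<close> composed with evaluation \<open>[k, j] \<otimes> k \<rightarrow> j\<close>.\<close>

definition theory_of_structure :: "('o, 'o, 'm) vcat \<Rightarrow> ('o \<Rightarrow> 'm) \<Rightarrow> ('o, 'm) jtheory" where
  "theory_of_structure T s = \<lparr>Tcat = T, Tau = \<lparr>FOb = (\<lambda>j\<in>J. j),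
     FHm = (\<lambda>j\<in>J. \<lambda>k\<in>J. THE t. t \<in> hom V (ihom V k j) (VHom T j k) \<and>
       VCmp T j k \<one> \<cdot> (s k \<boxtimes> t) \<cdot> braid V (ihom V k j) k = s j \<cdot> ev V k j)\<rparr>\<rparr>"

definition is_algebra ::
  "('c, 'o, 'm) vcat \<Rightarrow> ('o, 'm) jtheory \<Rightarrow> ('o, 'c, 'm) vfun \<Rightarrow> bool" where
  "is_algebra C T A \<longleftrightarrow> enriched_functor V (Tcat T) C A \<and> preserves_cotensors V J (Tcat T) C A"

definition carrier :: "('o, 'c, 'm) alg \<Rightarrow> 'c" where
  "carrier X = FOb (snd X) \<one>"

text \<open>The hom-object of \<open>A, B : T \<rightarrow> C\<close> in \<open>T-Alg(C)\<close> is the end of \<open>C(A-, B-)\<close>: a universal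
  family \<open>\<pi>\<^sub>x : e \<rightarrow> C(A x, B x)\<close> that is \<open>V\<close>-natural in \<open>x\<close>.\<close>

definition hom_wedge :: "('c, 'o, 'm) vcat \<Rightarrow> ('o, 'm) jtheory \<Rightarrow>
    ('o, 'c, 'm) vfun \<Rightarrow> ('o, 'c, 'm) vfun \<Rightarrow> 'o \<Rightarrow> ('o \<Rightarrow> 'm) \<Rightarrow> bool" where
  "hom_wedge C T A B e \<pi> \<longleftrightarrow> e \<in> Ob V \<and>
     \<pi> \<in> (\<Pi>\<^sub>E x \<in> VOb (Tcat T). hom V e (VHom C (FOb A x) (FOb B x))) \<and>
     (\<forall>x \<in> VOb (Tcat T). \<forall>y \<in> VOb (Tcat T).
        VCmp C (FOb A x) (FOb A y) (FOb B y) \<cdot> (\<pi> y \<boxtimes> FHm A x y)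
        = VCmp C (FOb A x) (FOb B x) (FOb B y) \<cdot> (FHm B x y \<boxtimes> \<pi> x)
            \<cdot> braid V e (VHom (Tcat T) x y))"

definition is_hom_end :: "('c, 'o, 'm) vcat \<Rightarrow> ('o, 'm) jtheory \<Rightarrow>
    ('o, 'c, 'm) vfun \<Rightarrow> ('o, 'c, 'm) vfun \<Rightarrow> 'o \<Rightarrow> ('o \<Rightarrow> 'm) \<Rightarrow> bool" where
  "is_hom_end C T A B e \<pi> \<longleftrightarrow> hom_wedge C T A B e \<pi> \<and>
     (\<forall>e' \<pi>'. hom_wedge C T A B e' \<pi>' \<longrightarrow>
        (\<exists>!h. h \<in> hom V e' e \<and> (\<forall>x \<in> VOb (Tcat T). \<pi> x \<cdot> h = \<pi>' x)))"

text \<open>The ends are only required to exist in \<open>V\<close>; an ambient category of larger objects is not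
  needed, since an embedding of \<open>V\<close> preserving all limits of \<open>V\<close> has the same ends lying in \<open>V\<close>.\<close>

definition admissible ::
  "('c, 'o, 'm) vcat \<Rightarrow> ('o \<Rightarrow> 'c \<Rightarrow> 'c) \<Rightarrow> ('o \<Rightarrow> 'c \<Rightarrow> 'm) \<Rightarrow> bool" where
  "admissible C ct cu \<longleftrightarrow> enriched_category V C \<and> designated_cotensors V J C ct cu \<and>
     (\<forall>T A B. is_theory T \<longrightarrow> is_algebra C T A \<longrightarrow> is_algebra C T B \<longrightarrow>
        (\<exists>e \<pi>. is_hom_end C T A B e \<pi>))"

text \<open>A choice of ends, by which \<open>T-Alg(C)\<close> becomes a \<open>V\<close>-category when \<open>C\<close> is admissible.\<close>

definition hom_end :: "('c, 'o, 'm) vcat \<Rightarrow> ('o, 'm) jtheory \<Rightarrow>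
    ('o, 'c, 'm) vfun \<Rightarrow> ('o, 'c, 'm) vfun \<Rightarrow> 'o \<times> ('o \<Rightarrow> 'm)" where
  "hom_end C T A B = (SOME (e, \<pi>). is_hom_end C T A B e \<pi>)"

definition alg_hom :: "('c, 'o, 'm) vcat \<Rightarrow> ('o, 'm) jtheory \<Rightarrow>
    ('o, 'c, 'm) vfun \<Rightarrow> ('o, 'c, 'm) vfun \<Rightarrow> 'o" where
  "alg_hom C T A B = fst (hom_end C T A B)"

definition alg_eval :: "('c, 'o, 'm) vcat \<Rightarrow> ('o, 'm) jtheory \<Rightarrow>
    ('o, 'c, 'm) vfun \<Rightarrow> ('o, 'c, 'm) vfun \<Rightarrow> 'o \<Rightarrow> 'm" where
  "alg_eval C T A B = snd (hom_end C T A B)"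

definition Alg_vcat :: "('c, 'o, 'm) vcat \<Rightarrow> ('o, 'm) jtheory \<Rightarrow>
    (('o, 'c, 'm) vfun, 'o, 'm) vcat" where
  "Alg_vcat C T = (let S = {A. is_algebra C T A} in \<lparr>VOb = S,
     VHom = (\<lambda>A\<in>S. \<lambda>B\<in>S. alg_hom C T A B),
     VCmp = (\<lambda>A\<in>S. \<lambda>B\<in>S. \<lambda>D\<in>S. THE h.
       h \<in> hom V (alg_hom C T B D \<otimes> alg_hom C T A B) (alg_hom C T A D) \<and>
       (\<forall>x \<in> VOb (Tcat T). alg_eval C T A D x \<cdot> h
          = VCmp C (FOb A x) (FOb B x) (FOb D x) \<cdot> (alg_eval C T B D x \<boxtimes> alg_eval C T A B x))),
     VId = (\<lambda>A\<in>S. THE h. h \<in> hom V \<one> (alg_hom C T A A) \<and>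
       (\<forall>x \<in> VOb (Tcat T). alg_eval C T A A x \<cdot> h = VId C (FOb A x)))\<rparr>)"


section \<open>Commutants\<close>

text \<open>The pointwise cotensor \<open>[j, A]\<close> in \<open>T-Alg(C)\<close>, formed with the designated cotensors of \<open>C\<close>,
  and its counit \<open>j \<rightarrow> T-Alg(C)([j, A], A)\<close>. With \<open>[I, x] = x\<close> and identity counits in \<open>C\<close> one has
  \<open>[I, A] = A\<close>.\<close>

definition alg_cotensor :: "('c, 'o, 'm) vcat \<Rightarrow> ('o \<Rightarrow> 'c \<Rightarrow> 'c) \<Rightarrow> ('o \<Rightarrow> 'c \<Rightarrow> 'm) \<Rightarrow>
    ('o, 'm) jtheory \<Rightarrow> 'o \<Rightarrow> ('o, 'c, 'm) vfun \<Rightarrow> ('o, 'c, 'm) vfun" where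
  "alg_cotensor C ct cu T j A = \<lparr>FOb = (\<lambda>x\<in>VOb (Tcat T). ct j (FOb A x)),
     FHm = (\<lambda>x\<in>VOb (Tcat T). \<lambda>y\<in>VOb (Tcat T).
       cotensor_hom V C ct cu j (FOb A x) (FOb A y) \<cdot> FHm A x y)\<rparr>"

definition alg_cotensor_counit :: "('c, 'o, 'm) vcat \<Rightarrow> ('o \<Rightarrow> 'c \<Rightarrow> 'c) \<Rightarrow> ('o \<Rightarrow> 'c \<Rightarrow> 'm) \<Rightarrow>
    ('o, 'm) jtheory \<Rightarrow> 'o \<Rightarrow> ('o, 'c, 'm) vfun \<Rightarrow> 'm" where
  "alg_cotensor_counit C ct cu T j A = (THE h.
     h \<in> hom V j (alg_hom C T (alg_cotensor C ct cu T j A) A) \<and>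
     (\<forall>x \<in> VOb (Tcat T). alg_eval C T (alg_cotensor C ct cu T j A) A x \<cdot> h = cu j (FOb A x)))"

definition commutant_vcat :: "('c, 'o, 'm) vcat \<Rightarrow> ('o \<Rightarrow> 'c \<Rightarrow> 'c) \<Rightarrow> ('o \<Rightarrow> 'c \<Rightarrow> 'm) \<Rightarrow>
    ('o, 'c, 'm) alg \<Rightarrow> ('o, 'o, 'm) vcat" where
  "commutant_vcat C ct cu X = (case X of (T, A) \<Rightarrow>
     let cA = (\<lambda>j. alg_cotensor C ct cu T j A) in
     \<lparr>VOb = J,
      VHom = (\<lambda>j\<in>J. \<lambda>k\<in>J. VHom (Alg_vcat C T) (cA j) (cA k)),
      VCmp = (\<lambda>j\<in>J. \<lambda>k\<in>J. \<lambda>l\<in>J. VCmp (Alg_vcat C T) (cA j) (cA k) (cA l)),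
      VId = (\<lambda>j\<in>J. VId (Alg_vcat C T) (cA j))\<rparr>)"

definition commutant_theory :: "('c, 'o, 'm) vcat \<Rightarrow> ('o \<Rightarrow> 'c \<Rightarrow> 'c) \<Rightarrow> ('o \<Rightarrow> 'c \<Rightarrow> 'm) \<Rightarrow>
    ('o, 'c, 'm) alg \<Rightarrow> ('o, 'm) jtheory" where
  "commutant_theory C ct cu X = theory_of_structure (commutant_vcat C ct cu X)
     (\<lambda>j. alg_cotensor_counit C ct cu (fst X) j (snd X))"

definition commutant :: "('c, 'o, 'm) vcat \<Rightarrow> ('o \<Rightarrow> 'c \<Rightarrow> 'c) \<Rightarrow> ('o \<Rightarrow> 'c \<Rightarrow> 'm) \<Rightarrow>
    ('o, 'c, 'm) alg \<Rightarrow> ('o, 'c, 'm) alg" where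
  "commutant C ct cu X = (commutant_theory C ct cu X,
     \<lparr>FOb = (\<lambda>j\<in>J. ct j (carrier X)),
      FHm = (\<lambda>j\<in>J. \<lambda>k\<in>J. alg_eval C (fst X)
        (alg_cotensor C ct cu (fst X) j (snd X)) (alg_cotensor C ct cu (fst X) k (snd X)) \<one>)\<rparr>)"


section \<open>The categories of algebras, commuting pairs and bifold algebras\<close>

definition AlgS :: "('c, 'o, 'm) vcat \<Rightarrow> (('o, 'c, 'm) alg, ('o, 'c, 'm) alg_arrow) cat" where
  "AlgS C = \<lparr>
     Ob = {(T, A). is_theory T \<and> is_algebra C T A},
     Ar = {((T, A), (M, f), (U, B)) | T A M f U B.
       is_theory T \<and> is_algebra C T A \<and> is_theory U \<and> is_algebra C U B \<and>
       theory_morphism T U M \<and> vnatural_iso V (Tcat T) C A (comp_vfun V (Tcat T) B M) f},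
     Dom = (\<lambda>(X, _, _). X),
     Cod = (\<lambda>(_, _, Y). Y),
     Ident = (\<lambda>(T, A). ((T, A), (id_vfun V (Tcat T), \<lambda>j\<in>J. VId C (FOb A j)), (T, A))),
     Comp = (\<lambda>((_, B), (N, g), (W, E)) ((T, A), (M, f), _).
       ((T, A),
        (comp_vfun V (Tcat T) N M,
         \<lambda>j\<in>J. comp0 V C (FOb A j) (FOb B (FOb M j)) (FOb E (FOb N (FOb M j))) (g (FOb M j)) (f j)),
        (W, E)))\<rparr>"

definition underlying :: "('o, 'c, 'm) alg_arrow \<Rightarrow> 'm" where
  "underlying h = (case h of (_, (_, f), _) \<Rightarrow> f \<one>)"

definition AlgOn ::
  "('c, 'o, 'm) vcat \<Rightarrow> 'c \<Rightarrow> (('o, 'c, 'm) alg, ('o, 'c, 'm) alg_arrow) cat" where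
  "AlgOn C c = (AlgS C)\<lparr>
     Ob := {X \<in> Ob (AlgS C). carrier X = c},
     Ar := {h \<in> Ar (AlgS C). carrier (Dom (AlgS C) h) = c \<and> carrier (Cod (AlgS C) h) = c \<and>
       underlying h = VId C c}\<rparr>"

definition commutes_with :: "('c, 'o, 'm) vcat \<Rightarrow> ('o \<Rightarrow> 'c \<Rightarrow> 'c) \<Rightarrow> ('o \<Rightarrow> 'c \<Rightarrow> 'm) \<Rightarrow>
    ('o, 'c, 'm) alg \<Rightarrow> ('o, 'c, 'm) alg \<Rightarrow> bool" where
  "commutes_with C ct cu A B \<longleftrightarrow>
     (\<exists>h. h \<in> hom (AlgOn C (carrier A)) B (commutant C ct cu A))"

definition CPair :: "('c, 'o, 'm) vcat \<Rightarrow> ('o \<Rightarrow> 'c \<Rightarrow> 'c) \<Rightarrow> ('o \<Rightarrow> 'c \<Rightarrow> 'm) \<Rightarrow>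
    (('o, 'c, 'm) pair, ('o, 'c, 'm) pair_arrow) cat" where
  "CPair C ct cu = (let S = {(A, B). A \<in> Ob (AlgS C) \<and> B \<in> Ob (AlgS C) \<and>
       carrier A = carrier B \<and> commutes_with C ct cu A B} in \<lparr>
     Ob = S,
     Ar = {((A, B), (f, g), (X, Y)) | A B f g X Y. (A, B) \<in> S \<and> (X, Y) \<in> S \<and>
       f \<in> hom (AlgS C) A X \<and> g \<in> hom (AlgS C) Y B \<and>
       underlying f = inv0 V C (carrier Y) (carrier B) (underlying g)},
     Dom = (\<lambda>(P, _, _). P),
     Cod = (\<lambda>(_, _, Q). Q),
     Ident = (\<lambda>(A, B). ((A, B), (Ident (AlgS C) A, Ident (AlgS C) B), (A, B))),
     Comp = (\<lambda>(_, (f', g'), R) (P, (f, g), _).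
       (P, (Comp (AlgS C) f' f, Comp (AlgS C) g g'), R))\<rparr>)"

definition CPair_left :: "('c, 'o, 'm) vcat \<Rightarrow> ('o \<Rightarrow> 'c \<Rightarrow> 'c) \<Rightarrow> ('o \<Rightarrow> 'c \<Rightarrow> 'm) \<Rightarrow>
    (('o, 'c, 'm) pair, ('o, 'c, 'm) pair_arrow, ('o, 'c, 'm) alg, ('o, 'c, 'm) alg_arrow) ftor"
  where
  "CPair_left C ct cu = \<lparr>Fo = (\<lambda>(A, B) \<in> Ob (CPair C ct cu). A),
     Fa = (\<lambda>(_, (f, g), _) \<in> Ar (CPair C ct cu). f)\<rparr>"

definition CPair_right :: "('c, 'o, 'm) vcat \<Rightarrow> ('o \<Rightarrow> 'c \<Rightarrow> 'c) \<Rightarrow> ('o \<Rightarrow> 'c \<Rightarrow> 'm) \<Rightarrow>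
    (('o, 'c, 'm) pair, ('o, 'c, 'm) pair_arrow, ('o, 'c, 'm) alg, ('o, 'c, 'm) alg_arrow) ftor"
  where
  "CPair_right C ct cu = \<lparr>Fo = (\<lambda>(A, B) \<in> Ob (CPair C ct cu). B),
     Fa = (\<lambda>(_, (f, g), _) \<in> Ar (CPair C ct cu). g)\<rparr>"

definition is_bifold_algebra :: "('c, 'o, 'm) vcat \<Rightarrow> ('o, 'm) jtheory \<Rightarrow> ('o, 'm) jtheory \<Rightarrow>
    ('o \<times> 'o, 'c, 'm) vfun \<Rightarrow> bool" where
  "is_bifold_algebra C T U D \<longleftrightarrow>
     enriched_functor V (tensor_vcat V (Tcat T) (Tcat U)) C D \<and>
     (\<forall>k \<in> VOb (Tcat U).
        preserves_cotensors V J (Tcat T) C (partial_left V (Tcat T) (Tcat U) k D)) \<and>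
     (\<forall>j \<in> VOb (Tcat T).
        preserves_cotensors V J (Tcat U) C (partial_right V (Tcat T) (Tcat U) j D))"

definition left_face :: "('o, 'c, 'm) bifold \<Rightarrow> ('o, 'c, 'm) alg" where
  "left_face = (\<lambda>(T, U, D). (T, partial_left V (Tcat T) (Tcat U) \<one> D))"

definition right_face :: "('o, 'c, 'm) bifold \<Rightarrow> ('o, 'c, 'm) alg" where
  "right_face = (\<lambda>(T, U, D). (U, partial_right V (Tcat T) (Tcat U) \<one> D))"

definition BAlg ::
  "('c, 'o, 'm) vcat \<Rightarrow> (('o, 'c, 'm) bifold, ('o, 'c, 'm) bifold_arrow) cat" where
  "BAlg C = (let S = {(T, U, D). is_theory T \<and> is_theory U \<and> is_bifold_algebra C T U D} in \<lparr>
     Ob = S,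
     Ar = {((T, U, D), (M, N, f), (T', U', D')) | T U D M N f T' U' D'.
       (T, U, D) \<in> S \<and> (T', U', D') \<in> S \<and> theory_morphism T T' M \<and> theory_morphism U' U N \<and>
       vnatural_iso V (tensor_vcat V (Tcat T) (Tcat U')) C
         (comp_vfun V (tensor_vcat V (Tcat T) (Tcat U')) D
           (tensor_vfun V (Tcat T) (Tcat U') (id_vfun V (Tcat T)) N))
         (comp_vfun V (tensor_vcat V (Tcat T) (Tcat U')) D'
           (tensor_vfun V (Tcat T) (Tcat U') M (id_vfun V (Tcat U'))))
         f},
     Dom = (\<lambda>(X, _, _). X),
     Cod = (\<lambda>(_, _, Y). Y),
     Ident = (\<lambda>(T, U, D).
       ((T, U, D), (id_vfun V (Tcat T), id_vfun V (Tcat U), \<lambda>x \<in> J \<times> J. VId C (FOb D x)),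
        (T, U, D))),
     Comp = (\<lambda>((_, _, D'), (M', N', f'), (T'', U'', D'')) ((T, U, D), (M, N, f), _).
       ((T, U, D),
        (comp_vfun V (Tcat T) M' M, comp_vfun V (Tcat U'') N N',
         \<lambda>(j, k) \<in> J \<times> J. comp0 V C
           (FOb D (j, FOb N (FOb N' k)))
           (FOb D' (FOb M j, FOb N' k))
           (FOb D'' (FOb M' (FOb M j), k))
           (f' (FOb M j, k)) (f (j, FOb N' k))),
        (T'', U'', D'')))\<rparr>)"

definition BAlg_left :: "('c, 'o, 'm) vcat \<Rightarrow>
    (('o, 'c, 'm) bifold, ('o, 'c, 'm) bifold_arrow, ('o, 'c, 'm) alg, ('o, 'c, 'm) alg_arrow) ftor"
  where
  "BAlg_left C = \<lparr>Fo = (\<lambda>D \<in> Ob (BAlg C). left_face D),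
     Fa = (\<lambda>(D, (M, N, f), D') \<in> Ar (BAlg C).
       (left_face D, (M, \<lambda>j\<in>J. f (j, \<one>)), left_face D'))\<rparr>"

text \<open>As \<open>f (I, k) : D(I, N k) \<rightarrow> D'(M I, k)\<close>, its inverse is an arrow from \<open>D'(I, k)\<close> to
  \<open>D(I, N k)\<close>, so the image of \<open>D \<rightarrow> D'\<close> is an arrow of algebras from the right face of \<open>D'\<close> to that
  of \<open>D\<close>; this makes \<open>BAlg_right\<close> a functor into the opposite of \<open>AlgS\<close>.\<close>

definition BAlg_right :: "('c, 'o, 'm) vcat \<Rightarrow>
    (('o, 'c, 'm) bifold, ('o, 'c, 'm) bifold_arrow, ('o, 'c, 'm) alg, ('o, 'c, 'm) alg_arrow) ftor"
  where
  "BAlg_right C = \<lparr>Fo = (\<lambda>D \<in> Ob (BAlg C). right_face D),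
     Fa = (\<lambda>((T, U, D), (M, N, f), (T', U', D')) \<in> Ar (BAlg C).
       (right_face (T', U', D'),
        (N, \<lambda>k\<in>J. inv0 V C (FOb D (\<one>, FOb N k)) (FOb D' (FOb M \<one>, k)) (f (\<one>, k))),
        right_face (T, U, D)))\<rparr>"

end

end

theory Submission
  imports Defs
begin

text \<open>
  A commuting pair \<open>(A, B)\<close>, with \<open>B \<rightarrow> A\<^sup>\<bottom>\<close> given by \<open>N\<close>, yields the bifold algebra
  \<open>D(x, k) = [k, A x]\<close>: \<open>T\<close> acts through the pointwise cotensors \<open>[k, A]\<close>, and \<open>U\<close> acts through \<open>N\<close> and
  evaluation at \<open>x\<close>. Conversely, for a bifold algebra \<open>D\<close> the functor \<open>D(x, -)\<close> exhibits \<open>D(x, k)\<close> as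
  \<open>[k, D(x, I)]\<close>; transported along these isomorphisms, the functors \<open>D(x, -)\<close> form a morphism from
  the right face to the commutant of the left face. An arrow of bifold algebras is determined by its
  components at \<open>(j, I)\<close> through the same cotensors, and naturality in the second variable need only
  be checked at \<open>(I, k)\<close>, where it is the datum on right faces.

  Equations between composites in a \<open>V\<close>-category are proved on generalised elements: arrows
  \<open>tn S \<rightarrow> A(a, b)\<close> out of the tensor product of a finite set \<open>S\<close> of labelled objects of \<open>V\<close>. Elements
  with disjoint label sets compose, and this composition is strictly associative and unital, so that
  all coherence is confined to the merging of label sets.\<close>

section \<open>Typed arrows and coherence\<close>

text \<open>Passing from a commuting pair to a bifold algebra recovers the left face exactly,
  because [I, x] = x with identity counit gives [I, A] = A. It recovers the right face only up to
  isomorphism: B k is some cotensor of B I by k, whereas D(I, k) is the designated one. Hence an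
  equivalence rather than an isomorphism of categories, obtained from full faithfulness and
  essential surjectivity. The same normalisation makes the comparison isomorphisms identities at I,
  so that the morphism into the commutant has identity underlying arrow, as commutation demands.

  Universal properties are used in one shape throughout. Invertibility of the comparison map of a
  cotensor becomes unique lifting of elements through the counit at a fresh label; the ends that
  define hom-objects of algebras become unique gluing of natural families of elements. An equation
  into a cotensor is then proved after composition with the counit, and an equation in T-Alg(C)
  after evaluation at each x. A label is an object together with a number, and the number keeps
  several generic elements of one object apart.\<close>

text \<open>\<open>ty f\<close> packages membership, domain and codomain of an arrow, so that the simplifier infers the
  type of a composite in a single pass; injectivity must not be a simp rule for this to work.\<close>

datatype 'o arr_type = No_Arr | Arr 'o 'o

declare arr_type.inject [simp del]

section \<open>Ordinary categories: types of composites and cancellation of isomorphisms\<close>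

context category
begin

definition ty :: "'m \<Rightarrow> 'a arr_type" where
  "ty f = (if f \<in> Ar C then Arr (Dom C f) (Cod C f) else No_Arr)"

lemma hom_ty: "f \<in> hom C a b \<longleftrightarrow> ty f = Arr a b"
  by (auto simp: hom_def ty_def arr_type.inject)

lemma ty_iff: "ty f = Arr a b \<longleftrightarrow> f \<in> Ar C \<and> Dom C f = a \<and> Cod C f = b"
  by (auto simp: ty_def arr_type.inject)

lemma ty_obs: "ty f = Arr a b \<Longrightarrow> a \<in> Ob C" "ty f = Arr a b \<Longrightarrow> b \<in> Ob C"
  using Dom_Ob Cod_Ob by (auto simp: ty_iff)

lemmas comp_ty = Comp_hom[unfolded hom_ty]
lemmas ident_ty = Ident_hom[unfolded hom_ty]
lemmas comp_assoc = Comp_assoc[unfolded hom_ty]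
lemmas comp_ident = Comp_Ident_right[unfolded hom_ty] Comp_Ident_left[unfolded hom_ty]
lemmas cat_ty = comp_ty ident_ty comp_ident

text \<open>Composites are kept nested to the right, so an equation between two adjacent factors has
  to be applied in front of a further arrow.\<close>

lemma comp_reduce:
  assumes "h \<cdot> g = k" "ty f = Arr a b" "ty g = Arr b c" "ty h = Arr c d"
  shows "h \<cdot> g \<cdot> f = k \<cdot> f"
  using comp_assoc assms by metis

lemma inverse_arrows_ty:
  "inverse_arrows C f g \<longleftrightarrow>
    (\<exists>a b. ty f = Arr a b \<and> ty g = Arr b a \<and> g \<cdot> f = Ident C a \<and> f \<cdot> g = Ident C b)"
  by (auto simp: inverse_arrows_def hom_ty ty_iff)

lemma inverse_unique:
  assumes "inverse_arrows C f g" "inverse_arrows C f g'"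
  shows "g = g'"
proof -
  obtain a b where *: "ty f = Arr a b" "ty g = Arr b a" "g \<cdot> f = Ident C a" "f \<cdot> g' = Ident C b"
    "ty g' = Arr b a"
    using assms by (auto simp: inverse_arrows_ty arr_type.inject)
  have "g = g \<cdot> (f \<cdot> g')" using * by (simp add: comp_ident)
  also have "\<dots> = (g \<cdot> f) \<cdot> g'" using comp_assoc[OF *(5,1,2)] by simp
  also have "\<dots> = g'" using * by (simp add: comp_ident)
  finally show ?thesis .
qed

lemma inv_arrow_inverse: "iso_arrow C f \<Longrightarrow> inverse_arrows C f (inv_arrow C f)"
  unfolding iso_arrow_def inv_arrow_def using inverse_unique by (metis theI)

lemma inv_arrow_eq: "inverse_arrows C f g \<Longrightarrow> inv_arrow C f = g"
  using inverse_unique inv_arrow_inverse iso_arrow_def by metis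

lemma iso_ty: "iso_arrow C f \<Longrightarrow> \<exists>a b. ty f = Arr a b"
  by (auto simp: iso_arrow_def inverse_arrows_ty)

lemma inv_ty: "ty f = Arr a b \<Longrightarrow> iso_arrow C f \<Longrightarrow> ty (inv_arrow C f) = Arr b a"
  and inv_left: "ty f = Arr a b \<Longrightarrow> iso_arrow C f \<Longrightarrow> inv_arrow C f \<cdot> f = Ident C a"
  and inv_right: "ty f = Arr a b \<Longrightarrow> iso_arrow C f \<Longrightarrow> f \<cdot> inv_arrow C f = Ident C b"
  using inv_arrow_inverse[of f] by (auto simp: inverse_arrows_ty arr_type.inject)

lemma inv_cancel_left: "ty f = Arr a b \<Longrightarrow> iso_arrow C f \<Longrightarrow> ty h = Arr c a \<Longrightarrow> inv_arrow C f \<cdot> f \<cdot> h = h"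
  by (subst comp_assoc[symmetric]) (auto simp: inv_ty inv_left comp_ident)

lemma inv_cancel_right: "ty f = Arr a b \<Longrightarrow> iso_arrow C f \<Longrightarrow> ty h = Arr c b \<Longrightarrow> f \<cdot> inv_arrow C f \<cdot> h = h"
  by (subst comp_assoc[symmetric]) (auto simp: inv_ty inv_right comp_ident)

lemmas inv_simps = inv_left inv_right inv_cancel_left inv_cancel_right

lemma isoI:
  assumes "ty f = Arr a b" "ty g = Arr b a" "g \<cdot> f = Ident C a" "f \<cdot> g = Ident C b"
  shows "iso_arrow C f" "inv_arrow C f = g"
proof -
  have "inverse_arrows C f g" using assms by (auto simp: inverse_arrows_ty)
  then show "iso_arrow C f" "inv_arrow C f = g" by (auto simp: inv_arrow_eq iso_arrow_def)
qed

lemma iso_ident: "a \<in> Ob C \<Longrightarrow> iso_arrow C (Ident C a)" "a \<in> Ob C \<Longrightarrow> inv_arrow C (Ident C a) = Ident C a"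
  using isoI[of "Ident C a" a a "Ident C a"] by (auto simp: cat_ty)

lemma iso_inv: "iso_arrow C f \<Longrightarrow> iso_arrow C (inv_arrow C f)"
  using iso_ty[of f] isoI[of "inv_arrow C f" _ _ f] by (auto simp: inv_ty inv_simps)

lemma iso_comp:
  assumes "iso_arrow C f" "iso_arrow C g" "ty f = Arr a b" "ty g = Arr b c"
  shows "iso_arrow C (g \<cdot> f)" "inv_arrow C (g \<cdot> f) = inv_arrow C f \<cdot> inv_arrow C g"
proof -
  have *: "ty (inv_arrow C f) = Arr b a" "ty (inv_arrow C g) = Arr c b"
    using assms by (simp_all add: inv_ty)
  have "(inv_arrow C f \<cdot> inv_arrow C g) \<cdot> g \<cdot> f = Ident C a"
    "(g \<cdot> f) \<cdot> inv_arrow C f \<cdot> inv_arrow C g = Ident C c"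
    using assms * by (simp_all add: comp_assoc cat_ty inv_simps)
  then show "iso_arrow C (g \<cdot> f)" "inv_arrow C (g \<cdot> f) = inv_arrow C f \<cdot> inv_arrow C g"
    using isoI[of "g \<cdot> f" a c "inv_arrow C f \<cdot> inv_arrow C g"] assms * by (simp_all add: cat_ty)
qed

lemma iso_cancel_left:
  assumes "h \<cdot> f = h \<cdot> g" "iso_arrow C h" "ty h = Arr b c" "ty f = Arr a b" "ty g = Arr a b"
  shows "f = g"
  using assms inv_cancel_left by metis

lemma iso_cancel_right:
  assumes "f \<cdot> h = g \<cdot> h" "iso_arrow C h" "ty h = Arr a b" "ty f = Arr b c" "ty g = Arr b c"
  shows "f = g"
proof -
  have "(f \<cdot> h) \<cdot> inv_arrow C h = (g \<cdot> h) \<cdot> inv_arrow C h" using assms by simp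
  then show ?thesis using assms(2-) by (simp add: comp_assoc inv_ty cat_ty inv_simps)
qed

lemma inv_move_left:
  assumes "h \<cdot> f = g" "iso_arrow C h" "ty h = Arr b c" "ty f = Arr a b"
  shows "f = inv_arrow C h \<cdot> g"
  using assms inv_cancel_left by metis

lemma inv_move_right:
  assumes "f \<cdot> h = g" "iso_arrow C h" "ty h = Arr a b" "ty f = Arr b c"
  shows "f = g \<cdot> inv_arrow C h"
  unfolding assms(1)[symmetric] using assms(2-) by (simp add: comp_assoc inv_ty inv_simps cat_ty)

end

section \<open>Symmetric monoidal categories: naturality, unit coherence and the hexagon\<close>

context symmetric_monoidal_closed_category
begin

abbreviation inv :: "'m \<Rightarrow> 'm" where "inv \<equiv> inv_arrow V"
abbreviation iso :: "'m \<Rightarrow> bool" where "iso \<equiv> iso_arrow V"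
abbreviation \<iota> :: "'o \<Rightarrow> 'm" where "\<iota> \<equiv> Ident V"
abbreviation \<alpha> :: "'o \<Rightarrow> 'o \<Rightarrow> 'o \<Rightarrow> 'm" where "\<alpha> \<equiv> assoc V"
abbreviation \<beta> :: "'o \<Rightarrow> 'o \<Rightarrow> 'm" where "\<beta> \<equiv> braid V"

lemmas mon_ob = tensor_Ob unit_Ob ihom_Ob

lemma braid_iso:
  assumes "a \<in> Ob V" "b \<in> Ob V"
  shows "iso (\<beta> a b)" "inv (\<beta> a b) = \<beta> b a"
  using isoI[OF braid_hom[unfolded hom_ty] braid_hom[unfolded hom_ty], of a b] assms
  by (auto simp: braid_symmetric)

lemmas mon_iso = assoc_iso lunit_iso runit_iso braid_iso(1) iso_ident(1)

lemmas mon_ty = cat_ty tensor_hom[unfolded hom_ty] assoc_hom[unfolded hom_ty]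
  lunit_hom[unfolded hom_ty] runit_hom[unfolded hom_ty] braid_hom[unfolded hom_ty]
  ev_hom[unfolded hom_ty] inv_ty mon_ob mon_iso

lemmas tensor_comp = tensor_Comp[unfolded hom_ty, symmetric]

lemma tensor_comp2:
  assumes "ty f = Arr a b" "ty f' = Arr b c" "ty g = Arr a' b'" "ty g' = Arr b' c'"
    "ty h = Arr d (a \<otimes> a')"
  shows "(f' \<boxtimes> g') \<cdot> (f \<boxtimes> g) \<cdot> h = ((f' \<cdot> f) \<boxtimes> (g' \<cdot> g)) \<cdot> h"
  by (rule comp_reduce[OF tensor_comp]) (use assms in \<open>simp_all add: mon_ty\<close>)

lemma tensor_iso:
  assumes "iso f" "iso g"
  shows "iso (f \<boxtimes> g)" "inv (f \<boxtimes> g) = inv f \<boxtimes> inv g"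
proof -
  obtain a b c d where *: "ty f = Arr a b" "ty g = Arr c d" using assms iso_ty by blast
  have "iso (f \<boxtimes> g) \<and> inv (f \<boxtimes> g) = inv f \<boxtimes> inv g"
    using isoI[of "f \<boxtimes> g" "a \<otimes> c" "b \<otimes> d" "inv f \<boxtimes> inv g"] assms * ty_obs[OF *(1)] ty_obs[OF *(2)]
    by (simp add: mon_ty tensor_comp inv_simps tensor_Ident)
  then show "iso (f \<boxtimes> g)" "inv (f \<boxtimes> g) = inv f \<boxtimes> inv g" by auto
qed

lemmas assoc_nat = assoc_natural[unfolded hom_ty]
lemmas lunit_nat = lunit_natural[unfolded hom_ty]
lemmas runit_nat = runit_natural[unfolded hom_ty]
lemmas braid_nat = braid_natural[unfolded hom_ty]

lemma assoc_nat2: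
  "\<lbrakk>ty f = Arr a a'; ty g = Arr b b'; ty h = Arr c c'; ty k = Arr d ((a \<otimes> b) \<otimes> c)\<rbrakk>
    \<Longrightarrow> \<alpha> a' b' c' \<cdot> ((f \<boxtimes> g) \<boxtimes> h) \<cdot> k = (f \<boxtimes> (g \<boxtimes> h)) \<cdot> \<alpha> a b c \<cdot> k"
  by (subst (1 2) comp_assoc[symmetric]) (simp_all add: mon_ty ty_obs assoc_nat)

lemma lunit_nat2:
  "\<lbrakk>ty f = Arr a b; ty k = Arr d (\<one> \<otimes> a)\<rbrakk>
    \<Longrightarrow> lunit V b \<cdot> (\<iota> \<one> \<boxtimes> f) \<cdot> k = f \<cdot> lunit V a \<cdot> k"
  by (subst (1 2) comp_assoc[symmetric]) (simp_all add: mon_ty ty_obs lunit_nat)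

lemma braid_nat2:
  "\<lbrakk>ty f = Arr a a'; ty g = Arr b b'; ty k = Arr d (a \<otimes> b)\<rbrakk>
    \<Longrightarrow> \<beta> a' b' \<cdot> (f \<boxtimes> g) \<cdot> k = (g \<boxtimes> f) \<cdot> \<beta> a b \<cdot> k"
  by (subst (1 2) comp_assoc[symmetric]) (simp_all add: mon_ty ty_obs braid_nat)

lemma triangle2:
  "\<lbrakk>a \<in> Ob V; b \<in> Ob V; ty k = Arr d ((a \<otimes> \<one>) \<otimes> b)\<rbrakk>
    \<Longrightarrow> (\<iota> a \<boxtimes> lunit V b) \<cdot> \<alpha> a \<one> b \<cdot> k = (runit V a \<boxtimes> \<iota> b) \<cdot> k"
  by (subst comp_assoc[symmetric]) (simp_all add: mon_ty triangle)

lemma assoc_inv_nat: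
  assumes t: "ty f = Arr a a'" "ty g = Arr b b'" "ty h = Arr c c'"
  shows "inv (\<alpha> a' b' c') \<cdot> (f \<boxtimes> (g \<boxtimes> h)) = ((f \<boxtimes> g) \<boxtimes> h) \<cdot> inv (\<alpha> a b c)"
proof -
  note o = ty_obs[OF t(1)] ty_obs[OF t(2)] ty_obs[OF t(3)]
  have "\<alpha> a' b' c' \<cdot> (((f \<boxtimes> g) \<boxtimes> h) \<cdot> inv (\<alpha> a b c)) = ((f \<boxtimes> (g \<boxtimes> h)) \<cdot> \<alpha> a b c) \<cdot> inv (\<alpha> a b c)"
    by (rule comp_reduce[OF assoc_nat[OF t]]) (use t o in \<open>simp_all add: mon_ty\<close>)
  also have "\<dots> = f \<boxtimes> (g \<boxtimes> h)" using t o by (simp add: mon_ty comp_assoc inv_simps)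
  finally show ?thesis
    by (rule inv_move_left[symmetric]) (use t o in \<open>simp_all add: mon_ty\<close>)
qed

lemma inv_lunit_nat:
  assumes t: "ty f = Arr a b"
  shows "(\<iota> \<one> \<boxtimes> f) \<cdot> inv (lunit V a) = inv (lunit V b) \<cdot> f"
proof -
  have "lunit V b \<cdot> (\<iota> \<one> \<boxtimes> f) \<cdot> inv (lunit V a) = (f \<cdot> lunit V a) \<cdot> inv (lunit V a)"
    by (rule comp_reduce[OF lunit_nat[OF t]]) (use t ty_obs[OF t] in \<open>simp_all add: mon_ty\<close>)
  also have "\<dots> = f" using t ty_obs[OF t] by (simp add: mon_ty comp_assoc inv_simps)
  finally show ?thesis by (rule inv_move_left) (use t ty_obs[OF t] in \<open>simp_all add: mon_ty\<close>)
qed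

lemma inv_runit_nat:
  assumes t: "ty f = Arr a b"
  shows "(f \<boxtimes> \<iota> \<one>) \<cdot> inv (runit V a) = inv (runit V b) \<cdot> f"
proof -
  have "runit V b \<cdot> (f \<boxtimes> \<iota> \<one>) \<cdot> inv (runit V a) = (f \<cdot> runit V a) \<cdot> inv (runit V a)"
    by (rule comp_reduce[OF runit_nat[OF t]]) (use t ty_obs[OF t] in \<open>simp_all add: mon_ty\<close>)
  also have "\<dots> = f" using t ty_obs[OF t] by (simp add: mon_ty comp_assoc inv_simps)
  finally show ?thesis by (rule inv_move_left) (use t ty_obs[OF t] in \<open>simp_all add: mon_ty\<close>)
qed

text \<open>Tensoring with the unit is naturally isomorphic to the identity functor, hence
  faithful.\<close>

lemma unit_tensor_faithful:
  assumes "\<iota> \<one> \<boxtimes> f = \<iota> \<one> \<boxtimes> g" "ty f = Arr a b" "ty g = Arr a b"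
  shows "f = g"
  using lunit_nat[of f a b] lunit_nat[of g a b] assms ty_obs[OF assms(2)]
    iso_cancel_right[of f "lunit V a" g] by (simp add: mon_ty)

lemma tensor_unit_faithful:
  assumes "f \<boxtimes> \<iota> \<one> = g \<boxtimes> \<iota> \<one>" "ty f = Arr a b" "ty g = Arr a b"
  shows "f = g"
  using runit_nat[of f a b] runit_nat[of g a b] assms ty_obs[OF assms(2)]
    iso_cancel_right[of f "runit V a" g] by (simp add: mon_ty)

text \<open>Kelly's lemmas: the remaining unit coherences follow from the pentagon, triangle and hexagon.\<close>

lemma lunit_tensor:
  assumes "a \<in> Ob V" "b \<in> Ob V"
  shows "lunit V (a \<otimes> b) \<cdot> \<alpha> \<one> a b = lunit V a \<boxtimes> \<iota> b"
proof (rule unit_tensor_faithful)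
  \<comment> \<open>Composed with \<open>?X\<close>, the arrow
    \<open>\<iota> \<one> \<boxtimes> \<alpha> \<one> a b\<close> becomes the long side of the
    pentagon on I, I, a, b. Being invertible, \<open>?X\<close> is cancelled at the end.\<close>
  let ?X = "\<alpha> \<one> (\<one> \<otimes> a) b \<cdot> (\<alpha> \<one> \<one> a \<boxtimes> \<iota> b)"
  have "(\<iota> \<one> \<boxtimes> (lunit V (a \<otimes> b) \<cdot> \<alpha> \<one> a b)) \<cdot> ?X
      = (\<iota> \<one> \<boxtimes> lunit V (a \<otimes> b)) \<cdot> (\<iota> \<one> \<boxtimes> \<alpha> \<one> a b) \<cdot> ?X"
    using assms by (simp add: tensor_comp2 mon_ty)
  also have "\<dots> = (\<iota> \<one> \<boxtimes> lunit V (a \<otimes> b)) \<cdot> \<alpha> \<one> \<one> (a \<otimes> b) \<cdot> \<alpha> (\<one> \<otimes> \<one>) a b"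
    using assms by (simp add: pentagon mon_ty)
  also have "\<dots> = (runit V \<one> \<boxtimes> \<iota> (a \<otimes> b)) \<cdot> \<alpha> (\<one> \<otimes> \<one>) a b"
    using assms by (simp add: triangle2 mon_ty)
  also have "\<dots> = \<alpha> \<one> a b \<cdot> ((runit V \<one> \<boxtimes> \<iota> a) \<boxtimes> \<iota> b)"
    using assms by (simp add: assoc_nat mon_ty tensor_Ident)
  also have "\<dots> = \<alpha> \<one> a b \<cdot> (((\<iota> \<one> \<boxtimes> lunit V a) \<boxtimes> \<iota> b) \<cdot> (\<alpha> \<one> \<one> a \<boxtimes> \<iota> b))"
    using assms by (simp add: tensor_comp triangle mon_ty)
  also have "\<dots> = (\<iota> \<one> \<boxtimes> (lunit V a \<boxtimes> \<iota> b)) \<cdot> ?X"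
    using assms by (simp add: assoc_nat2 mon_ty)
  finally show "\<iota> \<one> \<boxtimes> (lunit V (a \<otimes> b) \<cdot> \<alpha> \<one> a b) = \<iota> \<one> \<boxtimes> (lunit V a \<boxtimes> \<iota> b)"
    by (rule iso_cancel_right) (use assms in \<open>simp_all add: mon_ty iso_comp tensor_iso\<close>)
qed (use assms in \<open>simp_all add: mon_ty\<close>)

lemma lunit_tensor2:
  "\<lbrakk>a \<in> Ob V; b \<in> Ob V; ty k = Arr d ((\<one> \<otimes> a) \<otimes> b)\<rbrakk>
    \<Longrightarrow> lunit V (a \<otimes> b) \<cdot> \<alpha> \<one> a b \<cdot> k = (lunit V a \<boxtimes> \<iota> b) \<cdot> k"
  by (subst comp_assoc[symmetric]) (simp_all add: mon_ty lunit_tensor)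

text \<open>The mirror image of \<open>lunit_tensor\<close>, from the pentagon on a, b, I, I and
  faithfulness of tensoring with I on the right.\<close>

lemma runit_tensor:
  assumes "a \<in> Ob V" "b \<in> Ob V"
  shows "(\<iota> a \<boxtimes> runit V b) \<cdot> \<alpha> a b \<one> = runit V (a \<otimes> b)"
proof (rule tensor_unit_faithful)
  have "\<alpha> a b \<one> \<cdot> (((\<iota> a \<boxtimes> runit V b) \<cdot> \<alpha> a b \<one>) \<boxtimes> \<iota> \<one>)
      = \<alpha> a b \<one> \<cdot> ((\<iota> a \<boxtimes> runit V b) \<boxtimes> \<iota> \<one>) \<cdot> (\<alpha> a b \<one> \<boxtimes> \<iota> \<one>)"
    using assms by (simp add: tensor_comp mon_ty)
  also have "\<dots> = (\<iota> a \<boxtimes> (runit V b \<boxtimes> \<iota> \<one>)) \<cdot> \<alpha> a (b \<otimes> \<one>) \<one> \<cdot> (\<alpha> a b \<one> \<boxtimes> \<iota> \<one>)"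
    using assms by (simp add: assoc_nat2 mon_ty)
  also have "\<dots> = (\<iota> a \<boxtimes> (\<iota> b \<boxtimes> lunit V \<one>)) \<cdot> (\<iota> a \<boxtimes> \<alpha> b \<one> \<one>) \<cdot> \<alpha> a (b \<otimes> \<one>) \<one> \<cdot> (\<alpha> a b \<one> \<boxtimes> \<iota> \<one>)"
    using assms by (simp add: tensor_comp2 triangle mon_ty)
  also have "\<dots> = (\<iota> a \<boxtimes> (\<iota> b \<boxtimes> lunit V \<one>)) \<cdot> \<alpha> a b (\<one> \<otimes> \<one>) \<cdot> \<alpha> (a \<otimes> b) \<one> \<one>"
    using assms by (simp add: pentagon mon_ty)
  also have "\<dots> = (\<alpha> a b \<one> \<cdot> (\<iota> (a \<otimes> b) \<boxtimes> lunit V \<one>)) \<cdot> \<alpha> (a \<otimes> b) \<one> \<one>"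
    using assms by (simp add: assoc_nat assoc_nat2 mon_ty tensor_Ident[symmetric] comp_assoc)
  also have "\<dots> = \<alpha> a b \<one> \<cdot> (runit V (a \<otimes> b) \<boxtimes> \<iota> \<one>)"
    using assms by (simp add: comp_assoc triangle mon_ty)
  finally show "((\<iota> a \<boxtimes> runit V b) \<cdot> \<alpha> a b \<one>) \<boxtimes> \<iota> \<one> = runit V (a \<otimes> b) \<boxtimes> \<iota> \<one>"
    by (rule iso_cancel_left) (use assms in \<open>simp_all add: mon_ty\<close>)
qed (use assms in \<open>simp_all add: mon_ty\<close>)

text \<open>Naturality of the left unitor at itself identifies the left unitor of I \<otimes> I with
  \<open>\<iota> \<one> \<boxtimes> lunit V \<one>\<close>. The triangle and
  \<open>lunit_tensor\<close> then compute the same composite in two ways.\<close>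

lemma lunit_unit: "lunit V \<one> = runit V \<one>"
proof (rule tensor_unit_faithful)
  have "\<iota> \<one> \<boxtimes> lunit V \<one> = lunit V (\<one> \<otimes> \<one>)"
    by (rule iso_cancel_left[of "lunit V \<one>"]) (simp_all add: lunit_nat mon_ty)
  then show "lunit V \<one> \<boxtimes> \<iota> \<one> = runit V \<one> \<boxtimes> \<iota> \<one>"
    using lunit_tensor[of \<one> \<one>] triangle[of \<one> \<one>] by (simp add: mon_ty)
qed (simp_all add: mon_ty)

text \<open>In the hexagon on a, I, I the triangle and \<open>lunit_tensor\<close> remove all
  associators; what remains can be cancelled by the invertible braiding.\<close>

lemma lunit_braid:
  assumes "a \<in> Ob V"
  shows "lunit V a \<cdot> \<beta> a \<one> = runit V a"
proof (rule tensor_unit_faithful)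
  have "\<beta> a \<one> \<cdot> (runit V a \<boxtimes> \<iota> \<one>) = \<beta> a \<one> \<cdot> (\<iota> a \<boxtimes> lunit V \<one>) \<cdot> \<alpha> a \<one> \<one>"
    using assms by (simp add: triangle mon_ty)
  also have "\<dots> = (lunit V \<one> \<boxtimes> \<iota> a) \<cdot> \<beta> a (\<one> \<otimes> \<one>) \<cdot> \<alpha> a \<one> \<one>"
    using assms by (simp add: braid_nat2 mon_ty)
  also have "\<dots> = lunit V (\<one> \<otimes> a) \<cdot> \<alpha> \<one> \<one> a \<cdot> \<beta> a (\<one> \<otimes> \<one>) \<cdot> \<alpha> a \<one> \<one>"
    using assms by (simp add: lunit_tensor2 mon_ty)
  also have "\<dots> = lunit V (\<one> \<otimes> a) \<cdot> (\<iota> \<one> \<boxtimes> \<beta> a \<one>) \<cdot> \<alpha> \<one> a \<one> \<cdot> (\<beta> a \<one> \<boxtimes> \<iota> \<one>)"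
    using assms by (simp add: hexagon mon_ty)
  also have "\<dots> = \<beta> a \<one> \<cdot> lunit V (a \<otimes> \<one>) \<cdot> \<alpha> \<one> a \<one> \<cdot> (\<beta> a \<one> \<boxtimes> \<iota> \<one>)"
    using assms by (simp add: lunit_nat2 mon_ty)
  also have "\<dots> = \<beta> a \<one> \<cdot> (lunit V a \<boxtimes> \<iota> \<one>) \<cdot> (\<beta> a \<one> \<boxtimes> \<iota> \<one>)"
    using assms by (simp add: lunit_tensor2 mon_ty)
  also have "\<dots> = \<beta> a \<one> \<cdot> ((lunit V a \<cdot> \<beta> a \<one>) \<boxtimes> \<iota> \<one>)"
    using assms by (simp add: tensor_comp mon_ty)
  finally have "\<beta> a \<one> \<cdot> ((lunit V a \<cdot> \<beta> a \<one>) \<boxtimes> \<iota> \<one>) = \<beta> a \<one> \<cdot> (runit V a \<boxtimes> \<iota> \<one>)" ..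
  then show "(lunit V a \<cdot> \<beta> a \<one>) \<boxtimes> \<iota> \<one> = runit V a \<boxtimes> \<iota> \<one>"
    by (rule iso_cancel_left) (use assms in \<open>simp_all add: mon_ty\<close>)
qed (use assms in \<open>simp_all add: mon_ty\<close>)

text \<open>This pulls the second block in front of a first factor x. It is the step of
  \<open>shuffle\<close> in which the head of the second list is the smaller one.\<close>

definition swap_in :: "'o \<Rightarrow> 'o \<Rightarrow> 'o \<Rightarrow> 'm" where
  "swap_in x a b = \<alpha> a x b \<cdot> (\<beta> x a \<boxtimes> \<iota> b) \<cdot> inv (\<alpha> x a b)"

lemma swap_in_ty:
  "\<lbrakk>x \<in> Ob V; a \<in> Ob V; b \<in> Ob V\<rbrakk> \<Longrightarrow> ty (swap_in x a b) = Arr (x \<otimes> (a \<otimes> b)) (a \<otimes> (x \<otimes> b))"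
  by (simp add: swap_in_def mon_ty)

lemma swap_in_iso:
  assumes "x \<in> Ob V" "a \<in> Ob V" "b \<in> Ob V"
  shows "iso (swap_in x a b)"
  unfolding swap_in_def
  by (rule iso_comp(1), rule iso_comp(1), rule iso_inv) (use assms in \<open>simp_all add: mon_ty tensor_iso\<close>)

lemma swap_in_nat:
  assumes t: "ty f = Arr a a'" "ty g = Arr b b'" and x: "x \<in> Ob V"
  shows "swap_in x a' b' \<cdot> (\<iota> x \<boxtimes> (f \<boxtimes> g)) = (f \<boxtimes> (\<iota> x \<boxtimes> g)) \<cdot> swap_in x a b"
proof -
  note o = ty_obs[OF t(1)] ty_obs[OF t(2)] x
  have "swap_in x a' b' \<cdot> (\<iota> x \<boxtimes> (f \<boxtimes> g))
      = \<alpha> a' x b' \<cdot> (\<beta> x a' \<boxtimes> \<iota> b') \<cdot> ((\<iota> x \<boxtimes> f) \<boxtimes> g) \<cdot> inv (\<alpha> x a b)"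
    using t o by (simp add: swap_in_def comp_assoc mon_ty assoc_inv_nat)
  also have "\<dots> = \<alpha> a' x b' \<cdot> ((f \<boxtimes> \<iota> x) \<boxtimes> g) \<cdot> (\<beta> x a \<boxtimes> \<iota> b) \<cdot> inv (\<alpha> x a b)"
    using t o by (simp add: tensor_comp2 braid_nat mon_ty)
  also have "\<dots> = (f \<boxtimes> (\<iota> x \<boxtimes> g)) \<cdot> swap_in x a b"
    using t o by (simp add: assoc_nat2 swap_in_def mon_ty)
  finally show ?thesis .
qed

lemma pentagon_inv:
  assumes "x \<in> Ob V" "a \<in> Ob V" "b \<in> Ob V" "c \<in> Ob V"
  shows "(inv (\<alpha> x a b) \<boxtimes> \<iota> c) \<cdot> inv (\<alpha> x (a \<otimes> b) c)
      = inv (\<alpha> (x \<otimes> a) b c) \<cdot> inv (\<alpha> x a (b \<otimes> c)) \<cdot> (\<iota> x \<boxtimes> \<alpha> a b c)"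
proof (rule iso_cancel_left)
  let ?h = "(\<iota> x \<boxtimes> \<alpha> a b c) \<cdot> \<alpha> x (a \<otimes> b) c \<cdot> (\<alpha> x a b \<boxtimes> \<iota> c)"
  have "?h \<cdot> (inv (\<alpha> x a b) \<boxtimes> \<iota> c) \<cdot> inv (\<alpha> x (a \<otimes> b) c) = \<iota> x \<boxtimes> \<alpha> a b c"
    using assms by (simp add: comp_assoc mon_ty tensor_comp2 inv_simps tensor_Ident)
  moreover have "(\<alpha> x a (b \<otimes> c) \<cdot> \<alpha> (x \<otimes> a) b c) \<cdot> inv (\<alpha> (x \<otimes> a) b c) \<cdot> inv (\<alpha> x a (b \<otimes> c)) \<cdot> (\<iota> x \<boxtimes> \<alpha> a b c)
      = \<iota> x \<boxtimes> \<alpha> a b c"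
    using assms by (simp add: comp_assoc mon_ty inv_simps)
  ultimately show "?h \<cdot> ((inv (\<alpha> x a b) \<boxtimes> \<iota> c) \<cdot> inv (\<alpha> x (a \<otimes> b) c))
    = ?h \<cdot> (inv (\<alpha> (x \<otimes> a) b c) \<cdot> inv (\<alpha> x a (b \<otimes> c)) \<cdot> (\<iota> x \<boxtimes> \<alpha> a b c))"
    using assms by (simp add: pentagon)
  show "iso ?h" using assms by (simp add: iso_comp(1) mon_ty tensor_iso)
qed (use assms in \<open>simp_all add: mon_ty\<close>)

text \<open>The position of \<open>x\<close> decides which of the next three equations is a step of the proof that
  shuffles are coassociative.\<close>

lemma shuffle_coassoc_1:
  assumes "x \<in> Ob V" "a \<in> Ob V" "b \<in> Ob V" "c \<in> Ob V"
  shows "\<alpha> (x \<otimes> a) b c \<cdot> (inv (\<alpha> x a b) \<boxtimes> \<iota> c) \<cdot> inv (\<alpha> x (a \<otimes> b) c)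
      = inv (\<alpha> x a (b \<otimes> c)) \<cdot> (\<iota> x \<boxtimes> \<alpha> a b c)"
  using assms by (simp add: pentagon_inv inv_simps mon_ty)

lemma shuffle_coassoc_2:
  assumes "x \<in> Ob V" "a \<in> Ob V" "b \<in> Ob V" "c \<in> Ob V"
  shows "\<alpha> a (x \<otimes> b) c \<cdot> (swap_in x a b \<boxtimes> \<iota> c) \<cdot> inv (\<alpha> x (a \<otimes> b) c)
      = (\<iota> a \<boxtimes> inv (\<alpha> x b c)) \<cdot> swap_in x a (b \<otimes> c) \<cdot> (\<iota> x \<boxtimes> \<alpha> a b c)"
proof -
  have "\<alpha> a (x \<otimes> b) c \<cdot> (swap_in x a b \<boxtimes> \<iota> c) \<cdot> inv (\<alpha> x (a \<otimes> b) c)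
      = \<alpha> a (x \<otimes> b) c \<cdot> (\<alpha> a x b \<boxtimes> \<iota> c) \<cdot> ((\<beta> x a \<boxtimes> \<iota> b) \<boxtimes> \<iota> c)
        \<cdot> (inv (\<alpha> x a b) \<boxtimes> \<iota> c) \<cdot> inv (\<alpha> x (a \<otimes> b) c)"
    using assms by (simp add: swap_in_def tensor_comp2 mon_ty)
  also have "\<dots> = \<alpha> a (x \<otimes> b) c \<cdot> (\<alpha> a x b \<boxtimes> \<iota> c) \<cdot> ((\<beta> x a \<boxtimes> \<iota> b) \<boxtimes> \<iota> c)
        \<cdot> inv (\<alpha> (x \<otimes> a) b c) \<cdot> inv (\<alpha> x a (b \<otimes> c)) \<cdot> (\<iota> x \<boxtimes> \<alpha> a b c)"
    using assms by (simp add: pentagon_inv mon_ty)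
  also have "\<dots> = \<alpha> a (x \<otimes> b) c \<cdot> (\<alpha> a x b \<boxtimes> \<iota> c) \<cdot> inv (\<alpha> (a \<otimes> x) b c)
        \<cdot> (\<beta> x a \<boxtimes> \<iota> (b \<otimes> c)) \<cdot> inv (\<alpha> x a (b \<otimes> c)) \<cdot> (\<iota> x \<boxtimes> \<alpha> a b c)"
    using comp_reduce[OF assoc_inv_nat[of "\<beta> x a" "x \<otimes> a" "a \<otimes> x" "\<iota> b" b b "\<iota> c" c c],
        of "inv (\<alpha> x a (b \<otimes> c)) \<cdot> (\<iota> x \<boxtimes> \<alpha> a b c)" "x \<otimes> ((a \<otimes> b) \<otimes> c)"] assms
    by (simp add: mon_ty tensor_Ident comp_assoc)
  also have "\<dots> = (\<iota> a \<boxtimes> inv (\<alpha> x b c)) \<cdot> ((\<iota> a \<boxtimes> \<alpha> x b c) \<cdot> \<alpha> a (x \<otimes> b) c \<cdot> (\<alpha> a x b \<boxtimes> \<iota> c))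
        \<cdot> inv (\<alpha> (a \<otimes> x) b c) \<cdot> (\<beta> x a \<boxtimes> \<iota> (b \<otimes> c)) \<cdot> inv (\<alpha> x a (b \<otimes> c)) \<cdot> (\<iota> x \<boxtimes> \<alpha> a b c)"
    using assms by (simp add: comp_assoc mon_ty tensor_comp2 inv_simps tensor_Ident)
  also have "\<dots> = (\<iota> a \<boxtimes> inv (\<alpha> x b c)) \<cdot> swap_in x a (b \<otimes> c) \<cdot> (\<iota> x \<boxtimes> \<alpha> a b c)"
    using assms by (simp add: pentagon[symmetric] comp_assoc mon_ty inv_simps swap_in_def)
  finally show ?thesis .
qed

lemma shuffle_coassoc_3:
  assumes "x \<in> Ob V" "a \<in> Ob V" "b \<in> Ob V" "c \<in> Ob V"
  shows "\<alpha> a b (x \<otimes> c) \<cdot> swap_in x (a \<otimes> b) c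
      = (\<iota> a \<boxtimes> swap_in x b c) \<cdot> swap_in x a (b \<otimes> c) \<cdot> (\<iota> x \<boxtimes> \<alpha> a b c)"
proof -
  \<comment> \<open>The hexagon in the form in which braiding x past a \<otimes> b is braiding it
    past a and then past b.\<close>
  have hex: "\<alpha> a b x \<cdot> \<beta> x (a \<otimes> b) = (\<iota> a \<boxtimes> \<beta> x b) \<cdot> swap_in x a b"
  proof (rule iso_cancel_right[of _ "\<alpha> x a b"])
    show "(\<alpha> a b x \<cdot> \<beta> x (a \<otimes> b)) \<cdot> \<alpha> x a b = ((\<iota> a \<boxtimes> \<beta> x b) \<cdot> swap_in x a b) \<cdot> \<alpha> x a b"
      using assms by (simp add: comp_assoc mon_ty hexagon swap_in_def inv_simps)
  qed (use assms in \<open>simp_all add: mon_ty swap_in_ty\<close>)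
  have "\<alpha> a b (x \<otimes> c) \<cdot> swap_in x (a \<otimes> b) c
      = (\<alpha> a b (x \<otimes> c) \<cdot> \<alpha> (a \<otimes> b) x c) \<cdot> (\<beta> x (a \<otimes> b) \<boxtimes> \<iota> c) \<cdot> inv (\<alpha> x (a \<otimes> b) c)"
    using assms by (simp add: swap_in_def comp_assoc mon_ty)
  also have "\<dots> = (\<iota> a \<boxtimes> \<alpha> b x c) \<cdot> \<alpha> a (b \<otimes> x) c \<cdot> ((\<alpha> a b x \<cdot> \<beta> x (a \<otimes> b)) \<boxtimes> \<iota> c) \<cdot> inv (\<alpha> x (a \<otimes> b) c)"
    using assms by (simp add: pentagon comp_assoc tensor_comp2 mon_ty)
  also have "\<dots> = (\<iota> a \<boxtimes> \<alpha> b x c) \<cdot> \<alpha> a (b \<otimes> x) c \<cdot> ((\<iota> a \<boxtimes> \<beta> x b) \<boxtimes> \<iota> c) \<cdot> (swap_in x a b \<boxtimes> \<iota> c) \<cdot> inv (\<alpha> x (a \<otimes> b) c)"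
    using assms by (simp add: hex tensor_comp2 mon_ty swap_in_ty)
  also have "\<dots> = (\<iota> a \<boxtimes> \<alpha> b x c) \<cdot> (\<iota> a \<boxtimes> (\<beta> x b \<boxtimes> \<iota> c)) \<cdot> \<alpha> a (x \<otimes> b) c \<cdot> (swap_in x a b \<boxtimes> \<iota> c) \<cdot> inv (\<alpha> x (a \<otimes> b) c)"
    using assms by (simp add: assoc_nat2 mon_ty swap_in_ty)
  also have "\<dots> = (\<iota> a \<boxtimes> swap_in x b c) \<cdot> swap_in x a (b \<otimes> c) \<cdot> (\<iota> x \<boxtimes> \<alpha> a b c)"
    using assms by (simp add: shuffle_coassoc_2 tensor_comp2 mon_ty swap_in_ty comp_assoc) (simp add: swap_in_def)
  finally show ?thesis .
qed

lemma hexagon2: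
  "\<lbrakk>a \<in> Ob V; b \<in> Ob V; c \<in> Ob V; ty k = Arr d ((a \<otimes> b) \<otimes> c)\<rbrakk>
    \<Longrightarrow> \<alpha> b c a \<cdot> \<beta> a (b \<otimes> c) \<cdot> \<alpha> a b c \<cdot> k
      = (\<iota> b \<boxtimes> \<beta> a c) \<cdot> \<alpha> b a c \<cdot> (\<beta> a b \<boxtimes> \<iota> c) \<cdot> k"
  using arg_cong[OF hexagon, of a b c "\<lambda>h. h \<cdot> k"] by (simp add: comp_assoc mon_ty)

lemma braid_symmetric2:
  "\<lbrakk>a \<in> Ob V; b \<in> Ob V; ty k = Arr d (a \<otimes> b)\<rbrakk> \<Longrightarrow> \<beta> b a \<cdot> \<beta> a b \<cdot> k = k"
  by (subst comp_assoc[symmetric]) (simp_all add: mon_ty braid_symmetric)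

text \<open>Together with \<open>braid_swap_in\<close> this is the inductive step of
  \<open>shuffle_comm\<close>: the braiding exchanges taking a head from the left list with taking
  it from the right list.\<close>

lemma braid_assoc_inv:
  assumes "x \<in> Ob V" "a \<in> Ob V" "b \<in> Ob V"
  shows "\<beta> (x \<otimes> a) b \<cdot> inv (\<alpha> x a b) = swap_in x b a \<cdot> (\<iota> x \<boxtimes> \<beta> a b)"
proof (rule iso_cancel_left[of "\<beta> b (x \<otimes> a)"])
  have eq: "\<alpha> x a b \<cdot> \<beta> b (x \<otimes> a) \<cdot> swap_in x b a = \<iota> x \<boxtimes> \<beta> b a"
    using assms by (simp add: swap_in_def hexagon2 comp_assoc mon_ty tensor_comp2 braid_symmetric tensor_Ident inv_simps)
  then have "inv (\<alpha> x a b) \<cdot> (\<iota> x \<boxtimes> \<beta> b a) = \<beta> b (x \<otimes> a) \<cdot> swap_in x b a"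
    by (intro inv_move_left[symmetric]) (use assms in \<open>simp_all add: mon_ty swap_in_ty\<close>)
  then have "(\<beta> b (x \<otimes> a) \<cdot> swap_in x b a) \<cdot> (\<iota> x \<boxtimes> \<beta> a b) = (inv (\<alpha> x a b) \<cdot> (\<iota> x \<boxtimes> \<beta> b a)) \<cdot> (\<iota> x \<boxtimes> \<beta> a b)"
    by simp
  then show "\<beta> b (x \<otimes> a) \<cdot> \<beta> (x \<otimes> a) b \<cdot> inv (\<alpha> x a b) = \<beta> b (x \<otimes> a) \<cdot> swap_in x b a \<cdot> (\<iota> x \<boxtimes> \<beta> a b)"
    using assms by (simp add: braid_symmetric2 comp_assoc mon_ty swap_in_ty tensor_comp braid_symmetric tensor_Ident)
qed (use assms in \<open>simp_all add: mon_ty swap_in_ty\<close>)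

lemma braid_swap_in:
  assumes "x \<in> Ob V" "a \<in> Ob V" "b \<in> Ob V"
  shows "\<beta> a (x \<otimes> b) \<cdot> swap_in x a b = inv (\<alpha> x b a) \<cdot> (\<iota> x \<boxtimes> \<beta> a b)"
proof -
  have "\<beta> a (x \<otimes> b) \<cdot> swap_in x a b = \<beta> a (x \<otimes> b) \<cdot> (swap_in x a b \<cdot> (\<iota> x \<boxtimes> \<beta> b a)) \<cdot> (\<iota> x \<boxtimes> \<beta> a b)"
    using assms by (simp add: comp_assoc mon_ty swap_in_ty tensor_comp braid_symmetric tensor_Ident)
  also have "\<dots> = inv (\<alpha> x b a) \<cdot> (\<iota> x \<boxtimes> \<beta> a b)"
    unfolding braid_assoc_inv[OF assms(1,3,2), symmetric]
    using assms by (simp add: braid_symmetric2 comp_assoc mon_ty)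
  finally show ?thesis .
qed

end

section \<open>Merging label sets\<close>

text \<open>Labels carry no order of their own. Any strict total order will do: it is chosen once,
  so that a finite set of labels determines one list and hence one tensor product.\<close>

definition lab_less :: "'l \<Rightarrow> 'l \<Rightarrow> bool" where
  "lab_less = (SOME r. (\<forall>x. \<not> r x x) \<and> (\<forall>x y z. r x y \<longrightarrow> r y z \<longrightarrow> r x z) \<and> (\<forall>x y. x \<noteq> y \<longrightarrow> r x y \<or> r y x))"

lemma lab_less_order:
  "(\<forall>x::'l. \<not> lab_less x x) \<and> (\<forall>x y z::'l. lab_less x y \<longrightarrow> lab_less y z \<longrightarrow> lab_less x z) \<and>
   (\<forall>x y::'l. x \<noteq> y \<longrightarrow> lab_less x y \<or> lab_less y x)"
proof -
  obtain r :: "'l rel" where r: "Well_order r \<and> Field r = UNIV" using well_ordering[where 'a = 'l] by (elim exE)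
  then have *: "trans r" "antisym r" "total r"
    unfolding well_order_on_def linear_order_on_def partial_order_on_def preorder_on_def by auto
  define l where "l x y \<longleftrightarrow> (x, y) \<in> r \<and> x \<noteq> y" for x y
  have "l x z" if "l x y" "l y z" for x y z
    using that * unfolding l_def by (metis transE antisymD)
  moreover have "l x y \<or> l y x" if "x \<noteq> y" for x y
    using that * r unfolding l_def total_on_def by auto
  moreover have "\<not> l x x" for x unfolding l_def by simp
  ultimately have "(\<forall>x. \<not> l x x) \<and> (\<forall>x y z. l x y \<longrightarrow> l y z \<longrightarrow> l x z) \<and> (\<forall>x y. x \<noteq> y \<longrightarrow> l x y \<or> l y x)"
    by blast
  then show ?thesis unfolding lab_less_def by (rule someI[of _ l])
qed

lemmas lab_less_irrefl = lab_less_order[THEN conjunct1, rule_format]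
lemmas lab_less_trans = lab_less_order[THEN conjunct2, THEN conjunct1, rule_format]
lemmas lab_less_total = lab_less_order[THEN conjunct2, THEN conjunct2, rule_format]

lemma lab_less_asym: "lab_less x y \<Longrightarrow> \<not> lab_less y x"
  using lab_less_trans[of x y x] lab_less_irrefl[of x] by blast

fun lmerge :: "'l list \<Rightarrow> 'l list \<Rightarrow> 'l list" where
  "lmerge [] ys = ys"
| "lmerge (x # xs) [] = x # xs"
| "lmerge (x # xs) (y # ys) = (if lab_less x y then x # lmerge xs (y # ys) else y # lmerge (x # xs) ys)"

lemma lmerge_Nil_right [simp]: "lmerge xs [] = xs"
  by (cases xs) auto

lemma set_lmerge [simp]: "set (lmerge xs ys) = set xs \<union> set ys"
  by (induction xs ys rule: lmerge.induct) auto

lemma sorted_lmerge: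
  "sorted_wrt lab_less xs \<Longrightarrow> sorted_wrt lab_less ys \<Longrightarrow> set xs \<inter> set ys = {}
    \<Longrightarrow> sorted_wrt lab_less (lmerge xs ys)"
proof (induction xs ys rule: lmerge.induct)
  case (3 x xs y ys)
  then have "x \<noteq> y" by auto
  then show ?case using 3 lab_less_trans[of x y] lab_less_trans[of y x] lab_less_total[of x y] by auto
qed auto

lemma sorted_lab_unique:
  "sorted_wrt lab_less xs \<Longrightarrow> sorted_wrt lab_less ys \<Longrightarrow> set xs = set ys \<Longrightarrow> xs = ys"
proof (induction xs arbitrary: ys)
  case (Cons x xs)
  then obtain y zs where ys: "ys = y # zs" by (cases ys) auto
  have "x = y"
  proof (rule ccontr)
    assume n: "x \<noteq> y"
    have "x \<in> set zs" "y \<in> set xs" using Cons.prems(3) n ys by (auto simp: set_eq_iff)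
    then show False using Cons.prems(1,2) lab_less_asym[of x y] by (auto simp: ys)
  qed
  moreover have "x \<notin> set xs" "y \<notin> set zs"
    using Cons.prems(1,2) lab_less_irrefl[of x] lab_less_irrefl[of y] by (auto simp: ys)
  ultimately show ?case using Cons.IH[of zs] Cons.prems ys by (auto simp: insert_eq_iff)
qed auto

definition slist :: "'l set \<Rightarrow> 'l list" where
  "slist S = (THE xs. sorted_wrt lab_less xs \<and> set xs = S)"

lemma slist_eq: "sorted_wrt lab_less xs \<Longrightarrow> slist (set xs) = xs"
  unfolding slist_def using sorted_lab_unique by (intro the_equality) auto

lemma slist:
  assumes "finite S"
  shows "sorted_wrt lab_less (slist S)" "set (slist S) = S"
proof -
  have "\<exists>xs. sorted_wrt lab_less xs \<and> set xs = S" using assms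
  proof induction
    case (insert x F)
    then obtain xs where "sorted_wrt lab_less xs" "set xs = F" by auto
    then have "sorted_wrt lab_less (lmerge [x] xs) \<and> set (lmerge [x] xs) = insert x F"
      using sorted_lmerge[of "[x]" xs] insert by auto
    then show ?case by blast
  qed (auto intro!: exI[of _ "[]"])
  then obtain xs where "sorted_wrt lab_less xs" "set xs = S" by blast
  then show "sorted_wrt lab_less (slist S)" "set (slist S) = S" using slist_eq[of xs] by auto
qed

lemma slist_simps: "slist {} = []" "slist {x} = [x]"
  using slist_eq[of "[]"] slist_eq[of "[x]"] by auto

lemma slist_Un:
  assumes "finite S" "finite T" "S \<inter> T = {}"
  shows "slist (S \<union> T) = lmerge (slist S) (slist T)"
  using slist_eq[of "lmerge (slist S) (slist T)"] slist[of S] slist[of T] assms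
  by (simp add: sorted_lmerge)

section \<open>Shuffle isomorphisms between tensor products of lists\<close>

context symmetric_monoidal_closed_category
begin

text \<open>The number in a label does not enter the product; it only separates occurrences of one
  object. The product always ends in the unit, which is why even a single label needs a unitor in
  \<open>var\<close>.\<close>

primrec tens :: "('o \<times> nat) list \<Rightarrow> 'o" where
  "tens [] = \<one>"
| "tens (x # xs) = fst x \<otimes> tens xs"

lemma tens_ob: "set xs \<subseteq> Ob V \<times> UNIV \<Longrightarrow> tens xs \<in> Ob V"
  by (induction xs) (auto simp: mon_ob mem_Times_iff)

text \<open>The recursion is that of \<open>lmerge\<close>, so list and arrow are computed by the
  same case distinctions. The arrow goes from the merged product to the separate ones: two arrows
  out of the separate products are to be combined into one out of the merged product.\<close>

fun shuffle :: "('o \<times> nat) list \<Rightarrow> ('o \<times> nat) list \<Rightarrow> 'm" where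
  "shuffle [] ys = inv (lunit V (tens ys))"
| "shuffle (x # xs) [] = inv (runit V (tens (x # xs)))"
| "shuffle (x # xs) (y # ys) =
    (if lab_less x y then inv (\<alpha> (fst x) (tens xs) (tens (y # ys))) \<cdot> (\<iota> (fst x) \<boxtimes> shuffle xs (y # ys))
     else swap_in (fst y) (tens (x # xs)) (tens ys) \<cdot> (\<iota> (fst y) \<boxtimes> shuffle (x # xs) ys))"

lemma shuffle_Nil_right: "shuffle xs [] = inv (runit V (tens xs))"
  by (cases xs) (auto simp: lunit_unit)

lemma shuffle_ty:
  "set xs \<subseteq> Ob V \<times> UNIV \<Longrightarrow> set ys \<subseteq> Ob V \<times> UNIV
    \<Longrightarrow> ty (shuffle xs ys) = Arr (tens (lmerge xs ys)) (tens xs \<otimes> tens ys)"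
  by (induction xs ys rule: shuffle.induct) (simp_all add: mon_ty tens_ob swap_in_ty mem_Times_iff)

lemma shuffle_iso:
  "set xs \<subseteq> Ob V \<times> UNIV \<Longrightarrow> set ys \<subseteq> Ob V \<times> UNIV \<Longrightarrow> iso (shuffle xs ys)"
proof (induction xs ys rule: shuffle.induct)
  case (3 x xs y ys)
  have o: "fst x \<in> Ob V" "fst y \<in> Ob V" "tens xs \<in> Ob V" "tens ys \<in> Ob V"
    "tens (lmerge xs (y # ys)) \<in> Ob V" "tens (lmerge (x # xs) ys) \<in> Ob V"
    using 3(3,4) by (auto intro!: tens_ob simp: mem_Times_iff)
  show ?case
  proof (cases "lab_less x y")
    case True
    have t: "ty (shuffle xs (y # ys)) = Arr (tens (lmerge xs (y # ys))) (tens xs \<otimes> tens (y # ys))"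
      using shuffle_ty[of xs "y # ys"] 3 by auto
    have i: "iso (shuffle xs (y # ys))" using 3 True by auto
    show ?thesis using True t i o
      by (auto intro!: iso_comp(1) simp: tensor_iso iso_inv mon_ty)
  next
    case False
    have t: "ty (shuffle (x # xs) ys) = Arr (tens (lmerge (x # xs) ys)) (tens (x # xs) \<otimes> tens ys)"
      using shuffle_ty[of "x # xs" "ys"] 3 by auto
    have i: "iso (shuffle (x # xs) ys)" using 3 False by auto
    show ?thesis using False t i o
      by (auto intro!: iso_comp(1) simp: tensor_iso iso_inv mon_ty swap_in_iso swap_in_ty)
  qed
qed (simp_all add: iso_inv mon_ty tens_ob mem_Times_iff)

lemma braid_inv_lunit:
  assumes "a \<in> Ob V"
  shows "\<beta> \<one> a \<cdot> inv (lunit V a) = inv (runit V a)" "\<beta> a \<one> \<cdot> inv (runit V a) = inv (lunit V a)"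
proof -
  show 1: "\<beta> \<one> a \<cdot> inv (lunit V a) = inv (runit V a)"
    using iso_comp(2)[of "\<beta> a \<one>" "lunit V a" "a \<otimes> \<one>" "\<one> \<otimes> a" a] assms
    by (simp add: mon_ty lunit_braid braid_iso(2))
  show "\<beta> a \<one> \<cdot> inv (runit V a) = inv (lunit V a)"
    unfolding 1[symmetric] using assms by (simp add: braid_symmetric2 mon_ty)
qed

text \<open>The induction follows the recursion, with the braiding moved past the head. Disjointness
  excludes equal heads, for which both orders of the arguments would take the head from the second
  list.\<close>

lemma shuffle_comm:
  "set xs \<subseteq> Ob V \<times> UNIV \<Longrightarrow> set ys \<subseteq> Ob V \<times> UNIV \<Longrightarrow> set xs \<inter> set ys = {}
    \<Longrightarrow> \<beta> (tens xs) (tens ys) \<cdot> shuffle xs ys = shuffle ys xs"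
proof (induction xs ys rule: shuffle.induct)
  case (1 ys)
  then show ?case using braid_inv_lunit[of "tens ys"] by (simp add: shuffle_Nil_right tens_ob)
next
  case (2 x xs)
  then show ?case using braid_inv_lunit[of "tens (x # xs)"] by (simp add: tens_ob mon_ob mem_Times_iff)
next
  case (3 x xs y ys)
  have o: "fst x \<in> Ob V" "fst y \<in> Ob V" "tens xs \<in> Ob V" "tens ys \<in> Ob V"
    using 3(3,4) by (auto intro!: tens_ob simp: mem_Times_iff)
  have ne: "x \<noteq> y" using 3 by auto
  show ?case
  proof (cases "lab_less x y")
    case True
    then have n: "\<not> lab_less y x" by (rule lab_less_asym)
    have IH: "\<beta> (tens xs) (tens (y # ys)) \<cdot> shuffle xs (y # ys) = shuffle (y # ys) xs"
      using 3 True by auto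
    have t: "ty (shuffle xs (y # ys)) = Arr (tens (lmerge xs (y # ys))) (tens xs \<otimes> tens (y # ys))"
      using shuffle_ty[of xs "y # ys"] 3 by auto
    have "\<beta> (tens (x # xs)) (tens (y # ys)) \<cdot> inv (\<alpha> (fst x) (tens xs) (tens (y # ys))) \<cdot> (\<iota> (fst x) \<boxtimes> shuffle xs (y # ys))
      = (swap_in (fst x) (tens (y # ys)) (tens xs) \<cdot> (\<iota> (fst x) \<boxtimes> \<beta> (tens xs) (tens (y # ys)))) \<cdot> (\<iota> (fst x) \<boxtimes> shuffle xs (y # ys))"
      unfolding tens.simps(2)[of x] using o t
      by (intro comp_reduce[OF braid_assoc_inv]) (simp_all add: mon_ty ty_obs[OF t])
    also have "\<dots> = swap_in (fst x) (tens (y # ys)) (tens xs) \<cdot> (\<iota> (fst x) \<boxtimes> shuffle (y # ys) xs)"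
      unfolding IH[symmetric] using o t ty_obs[OF t]
      by (simp add: comp_assoc mon_ty tensor_comp swap_in_ty)
    finally show ?thesis using True n by simp
  next
    case False
    then have l: "lab_less y x" using lab_less_total[OF ne] by blast
    have IH: "\<beta> (tens (x # xs)) (tens ys) \<cdot> shuffle (x # xs) ys = shuffle ys (x # xs)"
      using 3 False by auto
    have t: "ty (shuffle (x # xs) ys) = Arr (tens (lmerge (x # xs) ys)) (tens (x # xs) \<otimes> tens ys)"
      using shuffle_ty[of "x # xs" "ys"] 3 by auto
    have "\<beta> (tens (x # xs)) (tens (y # ys)) \<cdot> swap_in (fst y) (tens (x # xs)) (tens ys) \<cdot> (\<iota> (fst y) \<boxtimes> shuffle (x # xs) ys)
      = (inv (\<alpha> (fst y) (tens ys) (tens (x # xs))) \<cdot> (\<iota> (fst y) \<boxtimes> \<beta> (tens (x # xs)) (tens ys))) \<cdot> (\<iota> (fst y) \<boxtimes> shuffle (x # xs) ys)"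
      unfolding tens.simps(2)[of y] using o t
      by (intro comp_reduce[OF braid_swap_in]) (simp_all add: mon_ty ty_obs[OF t] swap_in_ty)
    also have "\<dots> = inv (\<alpha> (fst y) (tens ys) (tens (x # xs))) \<cdot> (\<iota> (fst y) \<boxtimes> shuffle ys (x # xs))"
      unfolding IH[symmetric] using o t ty_obs[OF t]
      by (simp add: comp_assoc mon_ty tensor_comp)
    finally show ?thesis using False l by simp
  qed
qed

text \<open>The three steps of coassociativity; \<open>x\<close> is the smallest label.\<close>

context
  fixes x X Y Z P R Q m m2 n n2
  assumes ob: "x \<in> Ob V" "X \<in> Ob V" "Y \<in> Ob V" "Z \<in> Ob V" "P \<in> Ob V" "R \<in> Ob V" "Q \<in> Ob V"
    and mty: "ty m = Arr P (X \<otimes> Y)" "ty m2 = Arr Q (P \<otimes> Z)" "ty n = Arr R (Y \<otimes> Z)" "ty n2 = Arr Q (X \<otimes> R)"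
    and IH: "\<alpha> X Y Z \<cdot> (m \<boxtimes> \<iota> Z) \<cdot> m2 = (\<iota> X \<boxtimes> n) \<cdot> n2"
begin

lemma shuffle_IH: "(\<iota> x \<boxtimes> \<alpha> X Y Z) \<cdot> (\<iota> x \<boxtimes> (m \<boxtimes> \<iota> Z)) \<cdot> (\<iota> x \<boxtimes> m2) = (\<iota> x \<boxtimes> (\<iota> X \<boxtimes> n)) \<cdot> (\<iota> x \<boxtimes> n2)"
  using ob mty IH by (simp add: tensor_comp mon_ty)

lemma shuffle_step1:
  "\<alpha> (x \<otimes> X) Y Z \<cdot> ((inv (\<alpha> x X Y) \<cdot> (\<iota> x \<boxtimes> m)) \<boxtimes> \<iota> Z) \<cdot> inv (\<alpha> x P Z) \<cdot> (\<iota> x \<boxtimes> m2)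
    = (\<iota> (x \<otimes> X) \<boxtimes> n) \<cdot> inv (\<alpha> x X R) \<cdot> (\<iota> x \<boxtimes> n2)"
proof -
  have "\<alpha> (x \<otimes> X) Y Z \<cdot> ((inv (\<alpha> x X Y) \<cdot> (\<iota> x \<boxtimes> m)) \<boxtimes> \<iota> Z) \<cdot> inv (\<alpha> x P Z) \<cdot> (\<iota> x \<boxtimes> m2)
    = \<alpha> (x \<otimes> X) Y Z \<cdot> (inv (\<alpha> x X Y) \<boxtimes> \<iota> Z) \<cdot> (((\<iota> x \<boxtimes> m) \<boxtimes> \<iota> Z) \<cdot> inv (\<alpha> x P Z)) \<cdot> (\<iota> x \<boxtimes> m2)"
    using ob mty by (simp add: tensor_comp2 mon_ty comp_assoc)
  also have "\<dots> = (\<alpha> (x \<otimes> X) Y Z \<cdot> (inv (\<alpha> x X Y) \<boxtimes> \<iota> Z) \<cdot> inv (\<alpha> x (X \<otimes> Y) Z)) \<cdot> (\<iota> x \<boxtimes> (m \<boxtimes> \<iota> Z)) \<cdot> (\<iota> x \<boxtimes> m2)"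
    using ob mty by (simp add: assoc_inv_nat[symmetric] mon_ty comp_assoc)
  also have "\<dots> = inv (\<alpha> x X (Y \<otimes> Z)) \<cdot> (\<iota> x \<boxtimes> (\<iota> X \<boxtimes> n)) \<cdot> (\<iota> x \<boxtimes> n2)"
    using ob mty by (simp add: shuffle_coassoc_1 shuffle_IH mon_ty comp_assoc)
  also have "\<dots> = (inv (\<alpha> x X (Y \<otimes> Z)) \<cdot> (\<iota> x \<boxtimes> (\<iota> X \<boxtimes> n))) \<cdot> (\<iota> x \<boxtimes> n2)"
    using ob mty by (simp add: mon_ty comp_assoc)
  also have "\<dots> = (\<iota> (x \<otimes> X) \<boxtimes> n) \<cdot> inv (\<alpha> x X R) \<cdot> (\<iota> x \<boxtimes> n2)"
    using ob mty by (simp add: mon_ty comp_assoc assoc_inv_nat tensor_Ident)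
  finally show ?thesis .
qed

lemma shuffle_step2:
  "\<alpha> X (x \<otimes> Y) Z \<cdot> ((swap_in x X Y \<cdot> (\<iota> x \<boxtimes> m)) \<boxtimes> \<iota> Z) \<cdot> inv (\<alpha> x P Z) \<cdot> (\<iota> x \<boxtimes> m2)
    = (\<iota> X \<boxtimes> (inv (\<alpha> x Y Z) \<cdot> (\<iota> x \<boxtimes> n))) \<cdot> swap_in x X R \<cdot> (\<iota> x \<boxtimes> n2)"
proof -
  have "\<alpha> X (x \<otimes> Y) Z \<cdot> ((swap_in x X Y \<cdot> (\<iota> x \<boxtimes> m)) \<boxtimes> \<iota> Z) \<cdot> inv (\<alpha> x P Z) \<cdot> (\<iota> x \<boxtimes> m2)
    = \<alpha> X (x \<otimes> Y) Z \<cdot> (swap_in x X Y \<boxtimes> \<iota> Z) \<cdot> (((\<iota> x \<boxtimes> m) \<boxtimes> \<iota> Z) \<cdot> inv (\<alpha> x P Z)) \<cdot> (\<iota> x \<boxtimes> m2)"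
    using ob mty by (simp add: tensor_comp2 mon_ty comp_assoc swap_in_ty)
  also have "\<dots> = (\<alpha> X (x \<otimes> Y) Z \<cdot> (swap_in x X Y \<boxtimes> \<iota> Z) \<cdot> inv (\<alpha> x (X \<otimes> Y) Z)) \<cdot> (\<iota> x \<boxtimes> (m \<boxtimes> \<iota> Z)) \<cdot> (\<iota> x \<boxtimes> m2)"
    using ob mty by (simp add: assoc_inv_nat[symmetric] mon_ty comp_assoc swap_in_ty)
  also have "\<dots> = (\<iota> X \<boxtimes> inv (\<alpha> x Y Z)) \<cdot> swap_in x X (Y \<otimes> Z) \<cdot> (\<iota> x \<boxtimes> (\<iota> X \<boxtimes> n)) \<cdot> (\<iota> x \<boxtimes> n2)"
    using ob mty by (simp add: shuffle_coassoc_2 shuffle_IH mon_ty comp_assoc swap_in_ty)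
  also have "\<dots> = (\<iota> X \<boxtimes> inv (\<alpha> x Y Z)) \<cdot> (swap_in x X (Y \<otimes> Z) \<cdot> (\<iota> x \<boxtimes> (\<iota> X \<boxtimes> n))) \<cdot> (\<iota> x \<boxtimes> n2)"
    using ob mty by (simp add: mon_ty comp_assoc swap_in_ty)
  also have "\<dots> = (\<iota> X \<boxtimes> (inv (\<alpha> x Y Z) \<cdot> (\<iota> x \<boxtimes> n))) \<cdot> swap_in x X R \<cdot> (\<iota> x \<boxtimes> n2)"
    using ob mty by (simp add: mon_ty comp_assoc swap_in_nat swap_in_ty tensor_comp2)
  finally show ?thesis .
qed

lemma shuffle_step3:
  "\<alpha> X Y (x \<otimes> Z) \<cdot> (m \<boxtimes> \<iota> (x \<otimes> Z)) \<cdot> swap_in x P Z \<cdot> (\<iota> x \<boxtimes> m2)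
    = (\<iota> X \<boxtimes> (swap_in x Y Z \<cdot> (\<iota> x \<boxtimes> n))) \<cdot> swap_in x X R \<cdot> (\<iota> x \<boxtimes> n2)"
proof -
  have "\<alpha> X Y (x \<otimes> Z) \<cdot> (m \<boxtimes> \<iota> (x \<otimes> Z)) \<cdot> swap_in x P Z \<cdot> (\<iota> x \<boxtimes> m2)
    = \<alpha> X Y (x \<otimes> Z) \<cdot> ((m \<boxtimes> (\<iota> x \<boxtimes> \<iota> Z)) \<cdot> swap_in x P Z) \<cdot> (\<iota> x \<boxtimes> m2)"
    using ob mty by (simp add: tensor_Ident mon_ty comp_assoc swap_in_ty)
  also have "\<dots> = (\<alpha> X Y (x \<otimes> Z) \<cdot> swap_in x (X \<otimes> Y) Z) \<cdot> (\<iota> x \<boxtimes> (m \<boxtimes> \<iota> Z)) \<cdot> (\<iota> x \<boxtimes> m2)"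
    using ob mty by (simp add: swap_in_nat[symmetric] mon_ty comp_assoc swap_in_ty)
  also have "\<dots> = (\<iota> X \<boxtimes> swap_in x Y Z) \<cdot> swap_in x X (Y \<otimes> Z) \<cdot> (\<iota> x \<boxtimes> (\<iota> X \<boxtimes> n)) \<cdot> (\<iota> x \<boxtimes> n2)"
    using ob mty by (simp add: shuffle_coassoc_3 shuffle_IH mon_ty comp_assoc swap_in_ty)
  also have "\<dots> = (\<iota> X \<boxtimes> swap_in x Y Z) \<cdot> (swap_in x X (Y \<otimes> Z) \<cdot> (\<iota> x \<boxtimes> (\<iota> X \<boxtimes> n))) \<cdot> (\<iota> x \<boxtimes> n2)"
    using ob mty by (simp add: mon_ty comp_assoc swap_in_ty)
  also have "\<dots> = (\<iota> X \<boxtimes> (swap_in x Y Z \<cdot> (\<iota> x \<boxtimes> n))) \<cdot> swap_in x X R \<cdot> (\<iota> x \<boxtimes> n2)"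
    using ob mty by (simp add: mon_ty comp_assoc swap_in_nat swap_in_ty tensor_comp2)
  finally show ?thesis .
qed

end

text \<open>These are the cases of coassociativity in which one of the three lists is empty.\<close>

lemma unit_coassoc:
  assumes "a \<in> Ob V" "b \<in> Ob V"
  shows "\<alpha> \<one> a b \<cdot> (inv (lunit V a) \<boxtimes> \<iota> b) = inv (lunit V (a \<otimes> b))"
    "\<alpha> a \<one> b \<cdot> (inv (runit V a) \<boxtimes> \<iota> b) = \<iota> a \<boxtimes> inv (lunit V b)"
    "\<alpha> a b \<one> \<cdot> inv (runit V (a \<otimes> b)) = \<iota> a \<boxtimes> inv (runit V b)"
proof -
  show "\<alpha> \<one> a b \<cdot> (inv (lunit V a) \<boxtimes> \<iota> b) = inv (lunit V (a \<otimes> b))"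
    by (rule iso_cancel_left[of "lunit V (a \<otimes> b)"])
      (use assms in \<open>simp_all add: mon_ty lunit_tensor2 tensor_comp inv_simps tensor_Ident\<close>)
  show "\<alpha> a \<one> b \<cdot> (inv (runit V a) \<boxtimes> \<iota> b) = \<iota> a \<boxtimes> inv (lunit V b)"
    by (rule iso_cancel_left[of "\<iota> a \<boxtimes> lunit V b"])
      (use assms in \<open>simp_all add: mon_ty triangle2 tensor_comp inv_simps tensor_Ident tensor_iso\<close>)
  show "\<alpha> a b \<one> \<cdot> inv (runit V (a \<otimes> b)) = \<iota> a \<boxtimes> inv (runit V b)"
  proof (rule iso_cancel_left[of "\<iota> a \<boxtimes> runit V b"])
    show "(\<iota> a \<boxtimes> runit V b) \<cdot> \<alpha> a b \<one> \<cdot> inv (runit V (a \<otimes> b)) = (\<iota> a \<boxtimes> runit V b) \<cdot> (\<iota> a \<boxtimes> inv (runit V b))"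
      using assms by (subst comp_assoc[symmetric])
        (simp_all add: mon_ty runit_tensor tensor_comp inv_simps tensor_Ident)
  qed (use assms in \<open>simp_all add: mon_ty tensor_iso\<close>)
qed

text \<open>The smallest of the three heads is removed first by every shuffle that sees it, and the
  list that owns it selects one of \<open>shuffle_step1\<close>, \<open>shuffle_step2\<close>,
  \<open>shuffle_step3\<close>. Associativity of \<open>lmerge\<close> is proved along with it
  because the types of the arrows depend on it.\<close>

lemma shuffle_assoc:
  "set xs \<subseteq> Ob V \<times> UNIV \<Longrightarrow> set ys \<subseteq> Ob V \<times> UNIV \<Longrightarrow> set zs \<subseteq> Ob V \<times> UNIV
    \<Longrightarrow> set xs \<inter> set ys = {} \<Longrightarrow> set xs \<inter> set zs = {} \<Longrightarrow> set ys \<inter> set zs = {}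
    \<Longrightarrow> lmerge (lmerge xs ys) zs = lmerge xs (lmerge ys zs) \<and>
      \<alpha> (tens xs) (tens ys) (tens zs) \<cdot> (shuffle xs ys \<boxtimes> \<iota> (tens zs)) \<cdot> shuffle (lmerge xs ys) zs
      = (\<iota> (tens xs) \<boxtimes> shuffle ys zs) \<cdot> shuffle xs (lmerge ys zs)"
proof (induction "length xs + length ys + length zs" arbitrary: xs ys zs rule: less_induct)
  case less
  note prems = less.prems
  have o: "tens xs \<in> Ob V" "tens ys \<in> Ob V" "tens zs \<in> Ob V" "tens (lmerge xs ys) \<in> Ob V" "tens (lmerge ys zs) \<in> Ob V"
    "tens (lmerge (lmerge xs ys) zs) \<in> Ob V"
    using prems by (auto intro!: tens_ob)
  have t: "ty (shuffle xs ys) = Arr (tens (lmerge xs ys)) (tens xs \<otimes> tens ys)"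
    "ty (shuffle ys zs) = Arr (tens (lmerge ys zs)) (tens ys \<otimes> tens zs)"
    "ty (shuffle (lmerge xs ys) zs) = Arr (tens (lmerge (lmerge xs ys) zs)) (tens (lmerge xs ys) \<otimes> tens zs)"
    using prems by (auto intro!: shuffle_ty)
  show ?case
  proof (cases "xs = [] \<or> ys = [] \<or> zs = []")
    case True
    then show ?thesis
    proof (elim disjE)
      assume "xs = []"
      then show ?thesis using o t comp_reduce[OF unit_coassoc(1), of "tens ys" "tens zs" "shuffle ys zs"]
        by (simp add: inv_lunit_nat mon_ty)
    next
      assume "ys = []"
      then show ?thesis using o t
        by (simp add: shuffle_Nil_right mon_ty)
          (subst comp_assoc[symmetric], simp_all add: mon_ty unit_coassoc)
    next
      assume "zs = []"
      then show ?thesis using o t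
        by (simp add: shuffle_Nil_right mon_ty inv_runit_nat)
          (subst comp_assoc[symmetric], simp_all add: mon_ty unit_coassoc)
    qed
  next
    case False
    then obtain x xs' y ys' z zs' where e: "xs = x # xs'" "ys = y # ys'" "zs = z # zs'"
      by (auto simp: neq_Nil_conv)
    have ne: "x \<noteq> y" "x \<noteq> z" "y \<noteq> z" using prems e by auto
    have ob: "fst x \<in> Ob V" "fst y \<in> Ob V" "fst z \<in> Ob V" "tens xs' \<in> Ob V" "tens ys' \<in> Ob V" "tens zs' \<in> Ob V"
      using prems e by (auto intro!: tens_ob simp: mem_Times_iff)
    have tt: "set us \<subseteq> set xs \<union> set ys \<union> set zs \<Longrightarrow> tens us \<in> Ob V" for us
      using prems by (intro tens_ob) auto
    have sty: "set us \<subseteq> set xs \<union> set ys \<union> set zs \<Longrightarrow> set vs \<subseteq> set xs \<union> set ys \<union> set zs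
      \<Longrightarrow> ty (shuffle us vs) = Arr (tens (lmerge us vs)) (tens us \<otimes> tens vs)" for us vs
      using prems by (intro shuffle_ty) auto
    have tens_e: "tens xs = fst x \<otimes> tens xs'" "tens ys = fst y \<otimes> tens ys'" "tens zs = fst z \<otimes> tens zs'"
      using e by simp_all
    consider (x) "lab_less x y" "lab_less x z" | (y) "lab_less y x" "lab_less y z"
      | (z) "lab_less z x" "lab_less z y"
      using lab_less_total[OF ne(1)] lab_less_total[OF ne(2)] lab_less_total[OF ne(3)]
        lab_less_trans[of x y z] lab_less_trans[of y x z] lab_less_trans[of z x y] lab_less_trans[of z y x] by blast
    then show ?thesis
    proof cases
      case x
      have IH: "lmerge (lmerge xs' ys) zs = lmerge xs' (lmerge ys zs)"
        "\<alpha> (tens xs') (tens ys) (tens zs) \<cdot> (shuffle xs' ys \<boxtimes> \<iota> (tens zs)) \<cdot> shuffle (lmerge xs' ys) zs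
        = (\<iota> (tens xs') \<boxtimes> shuffle ys zs) \<cdot> shuffle xs' (lmerge ys zs)"
        using less.hyps[of xs' ys zs] prems e by auto
      \<comment> \<open>The merge of \<open>ys\<close> and \<open>zs\<close> also begins with a
        label after x, so the shuffle of \<open>xs\<close> with it takes x first.\<close>
      obtain w ws where w: "lmerge ys zs = w # ws" "lab_less x w"
        using e x by (cases "lab_less y z") auto
      have s: "lmerge xs ys = x # lmerge xs' ys" "lmerge xs (lmerge ys zs) = x # lmerge xs' (lmerge ys zs)"
        "lmerge (x # lmerge xs' ys) zs = x # lmerge (lmerge xs' ys) zs"
        "shuffle xs ys = inv (\<alpha> (fst x) (tens xs') (tens ys)) \<cdot> (\<iota> (fst x) \<boxtimes> shuffle xs' ys)"
        "shuffle xs (lmerge ys zs) = inv (\<alpha> (fst x) (tens xs') (tens (lmerge ys zs))) \<cdot> (\<iota> (fst x) \<boxtimes> shuffle xs' (lmerge ys zs))"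
        "shuffle (x # lmerge xs' ys) zs = inv (\<alpha> (fst x) (tens (lmerge xs' ys)) (tens zs)) \<cdot> (\<iota> (fst x) \<boxtimes> shuffle (lmerge xs' ys) zs)"
        using x e unfolding w(1) by (simp_all add: w)
      have sub: "set xs' \<subseteq> set xs" using e by auto
      have ty': "tens (lmerge xs' ys) \<in> Ob V" "tens (lmerge xs' (lmerge ys zs)) \<in> Ob V"
        "ty (shuffle xs' ys) = Arr (tens (lmerge xs' ys)) (tens xs' \<otimes> tens ys)"
        "ty (shuffle (lmerge xs' ys) zs) = Arr (tens (lmerge (lmerge xs' ys) zs)) (tens (lmerge xs' ys) \<otimes> tens zs)"
        "ty (shuffle xs' (lmerge ys zs)) = Arr (tens (lmerge xs' (lmerge ys zs))) (tens xs' \<otimes> tens (lmerge ys zs))"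
        by ((rule tt sty; use sub in auto)+)
      note ty' = ty'[unfolded IH(1)]
      show ?thesis
        using shuffle_step1[OF ob(1,4) o(2,3) ty'(1) o(5) ty'(2,3,4) t(2) ty'(5) IH(2)]
        unfolding s tens_e by (simp add: IH(1))
    next
      case y
      have IH: "lmerge (lmerge xs ys') zs = lmerge xs (lmerge ys' zs)"
        "\<alpha> (tens xs) (tens ys') (tens zs) \<cdot> (shuffle xs ys' \<boxtimes> \<iota> (tens zs)) \<cdot> shuffle (lmerge xs ys') zs
        = (\<iota> (tens xs) \<boxtimes> shuffle ys' zs) \<cdot> shuffle xs (lmerge ys' zs)"
        using less.hyps[of xs ys' zs] prems e by auto
      have s: "lmerge xs ys = y # lmerge xs ys'" "lmerge ys zs = y # lmerge ys' zs"
        "lmerge xs (y # lmerge ys' zs) = y # lmerge xs (lmerge ys' zs)"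
        "lmerge (y # lmerge xs ys') zs = y # lmerge (lmerge xs ys') zs"
        "shuffle xs ys = swap_in (fst y) (tens xs) (tens ys') \<cdot> (\<iota> (fst y) \<boxtimes> shuffle xs ys')"
        "shuffle (y # lmerge xs ys') zs = inv (\<alpha> (fst y) (tens (lmerge xs ys')) (tens zs)) \<cdot> (\<iota> (fst y) \<boxtimes> shuffle (lmerge xs ys') zs)"
        "shuffle ys zs = inv (\<alpha> (fst y) (tens ys') (tens zs)) \<cdot> (\<iota> (fst y) \<boxtimes> shuffle ys' zs)"
        "shuffle xs (y # lmerge ys' zs) = swap_in (fst y) (tens xs) (tens (lmerge ys' zs)) \<cdot> (\<iota> (fst y) \<boxtimes> shuffle xs (lmerge ys' zs))"
        using y lab_less_asym[of y x] e by simp_all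
      have sub: "set ys' \<subseteq> set ys" using e by auto
      have ty': "tens (lmerge xs ys') \<in> Ob V" "tens (lmerge ys' zs) \<in> Ob V" "tens (lmerge xs (lmerge ys' zs)) \<in> Ob V"
        "ty (shuffle xs ys') = Arr (tens (lmerge xs ys')) (tens xs \<otimes> tens ys')"
        "ty (shuffle (lmerge xs ys') zs) = Arr (tens (lmerge (lmerge xs ys') zs)) (tens (lmerge xs ys') \<otimes> tens zs)"
        "ty (shuffle ys' zs) = Arr (tens (lmerge ys' zs)) (tens ys' \<otimes> tens zs)"
        "ty (shuffle xs (lmerge ys' zs)) = Arr (tens (lmerge xs (lmerge ys' zs))) (tens xs \<otimes> tens (lmerge ys' zs))"
        by ((rule tt sty; use sub in auto)+)
      note ty' = ty'[unfolded IH(1)]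
      show ?thesis
        using shuffle_step2[OF ob(2) o(1) ob(5) o(3) ty' IH(2)]
        unfolding s tens_e by (simp add: IH(1))
    next
      case z
      have IH: "lmerge (lmerge xs ys) zs' = lmerge xs (lmerge ys zs')"
        "\<alpha> (tens xs) (tens ys) (tens zs') \<cdot> (shuffle xs ys \<boxtimes> \<iota> (tens zs')) \<cdot> shuffle (lmerge xs ys) zs'
        = (\<iota> (tens xs) \<boxtimes> shuffle ys zs') \<cdot> shuffle xs (lmerge ys zs')"
        using less.hyps[of xs ys zs'] prems e by auto
      \<comment> \<open>Equality in the order is decided in favour of the second list, so it is
        enough that the head of the merge is not less than z.\<close>
      obtain w ws where w: "lmerge xs ys = w # ws" "\<not> lab_less w z"
        using e z lab_less_asym[of z x] lab_less_asym[of z y] by (cases "lab_less x y") auto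
      have s: "lmerge (lmerge xs ys) zs = z # lmerge (lmerge xs ys) zs'" "lmerge ys zs = z # lmerge ys zs'"
        "lmerge xs (z # lmerge ys zs') = z # lmerge xs (lmerge ys zs')"
        "shuffle ys zs = swap_in (fst z) (tens ys) (tens zs') \<cdot> (\<iota> (fst z) \<boxtimes> shuffle ys zs')"
        "shuffle (lmerge xs ys) zs = swap_in (fst z) (tens (lmerge xs ys)) (tens zs') \<cdot> (\<iota> (fst z) \<boxtimes> shuffle (lmerge xs ys) zs')"
        "shuffle xs (z # lmerge ys zs') = swap_in (fst z) (tens xs) (tens (lmerge ys zs')) \<cdot> (\<iota> (fst z) \<boxtimes> shuffle xs (lmerge ys zs'))"
        using z lab_less_asym[of z x] lab_less_asym[of z y] e unfolding w(1) by (simp_all add: w)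
      have sub: "set zs' \<subseteq> set zs" using e by auto
      have ty': "tens (lmerge ys zs') \<in> Ob V" "tens (lmerge xs (lmerge ys zs')) \<in> Ob V"
        "ty (shuffle (lmerge xs ys) zs') = Arr (tens (lmerge (lmerge xs ys) zs')) (tens (lmerge xs ys) \<otimes> tens zs')"
        "ty (shuffle ys zs') = Arr (tens (lmerge ys zs')) (tens ys \<otimes> tens zs')"
        "ty (shuffle xs (lmerge ys zs')) = Arr (tens (lmerge xs (lmerge ys zs'))) (tens xs \<otimes> tens (lmerge ys zs'))"
        by ((rule tt sty; use sub in auto)+)
      note ty' = ty'[unfolded IH(1)]
      show ?thesis
        using shuffle_step3[OF ob(3) o(1,2) ob(6) o(4) ty'(1,2) t(1) ty'(3,4,5) IH(2)]
        unfolding s tens_e by (simp add: IH(1))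
    qed
  qed
qed

end

section \<open>Generalised elements\<close>

text \<open>The analogue of \<open>arr_type\<close>: one equation \<open>el A x = El a b S\<close>
  states that x is well formed and gives its endpoints and its label set, which lets rewriting infer
  types.\<close>

datatype ('a, 'l) el_type = No_El | El 'a 'a "'l set"

declare el_type.inject [simp del]

text \<open>An element carries endpoints and label set besides its arrow, so that composition and
  application of functors need no object indices.\<close>

type_synonym ('a, 'o, 'm) elt = "'a \<times> 'a \<times> ('o \<times> nat) set \<times> 'm"

definition el_arr :: "('a, 'o, 'm) elt \<Rightarrow> 'm" where
  "el_arr x = snd (snd (snd x))"

section \<open>Stages and pairing of elements\<close>

context symmetric_monoidal_closed_category
begin

definition stage :: "('o \<times> nat) set \<Rightarrow> bool" where
  "stage S \<longleftrightarrow> finite S \<and> S \<subseteq> Ob V \<times> UNIV"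

definition tn :: "('o \<times> nat) set \<Rightarrow> 'o" where
  "tn S = tens (slist S)"

definition mg :: "('o \<times> nat) set \<Rightarrow> ('o \<times> nat) set \<Rightarrow> 'm" where
  "mg S T = shuffle (slist S) (slist T)"

text \<open>An element of X at stage S and one of Y at stage T are paired to an element of X
  \<otimes> Y at stage S \<union> T.\<close>

definition pr :: "('o \<times> nat) set \<Rightarrow> ('o \<times> nat) set \<Rightarrow> 'm \<Rightarrow> 'm \<Rightarrow> 'm" where
  "pr S T f g = (f \<boxtimes> g) \<cdot> mg S T"

text \<open>The generic element of the object of the label; the right unitor removes the unit at the
  end of \<open>tens\<close>. It is invertible, so an equation tested on it is not weakened.\<close>

definition var :: "'o \<times> nat \<Rightarrow> 'm" where
  "var l = runit V (fst l)"

lemma stage_simps: "stage {}" "stage (insert l S) \<longleftrightarrow> fst l \<in> Ob V \<and> stage S"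
  "stage (S \<union> T) \<longleftrightarrow> stage S \<and> stage T"
  by (auto simp: stage_def mem_Times_iff)

lemma stage_slist: "stage S \<Longrightarrow> set (slist S) \<subseteq> Ob V \<times> UNIV" "stage S \<Longrightarrow> finite S" "stage S \<Longrightarrow> S \<subseteq> Ob V \<times> UNIV"
  by (auto simp: stage_def slist)

lemma tn_ob: "stage S \<Longrightarrow> tn S \<in> Ob V"
  unfolding tn_def by (rule tens_ob) (rule stage_slist)

lemma tn_simps: "tn {} = \<one>" "tn {l} = fst l \<otimes> \<one>"
  by (simp_all add: tn_def slist_simps)

lemma mg_ty: "stage S \<Longrightarrow> stage T \<Longrightarrow> S \<inter> T = {} \<Longrightarrow> ty (mg S T) = Arr (tn (S \<union> T)) (tn S \<otimes> tn T)"
  unfolding mg_def tn_def using shuffle_ty[of "slist S" "slist T"] by (simp add: slist_Un stage_slist)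

lemma mg_iso: "stage S \<Longrightarrow> stage T \<Longrightarrow> iso (mg S T)"
  unfolding mg_def by (simp add: shuffle_iso stage_slist)

lemma mg_comm:
  "stage S \<Longrightarrow> stage T \<Longrightarrow> S \<inter> T = {} \<Longrightarrow> \<beta> (tn S) (tn T) \<cdot> mg S T = mg T S"
  unfolding mg_def tn_def by (intro shuffle_comm) (simp_all add: stage_slist slist)

lemma mg_assoc:
  "\<lbrakk>stage S; stage T; stage U; S \<inter> T = {}; S \<inter> U = {}; T \<inter> U = {}\<rbrakk>
    \<Longrightarrow> \<alpha> (tn S) (tn T) (tn U) \<cdot> (mg S T \<boxtimes> \<iota> (tn U)) \<cdot> mg (S \<union> T) U
      = (\<iota> (tn S) \<boxtimes> mg T U) \<cdot> mg S (T \<union> U)"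
  unfolding mg_def tn_def using shuffle_assoc[of "slist S" "slist T" "slist U"]
  by (simp add: slist_Un stage_slist slist)

lemma mg_unit: "mg {} S = inv (lunit V (tn S))" "mg S {} = inv (runit V (tn S))"
  by (simp_all add: mg_def tn_def slist_simps shuffle_Nil_right)

lemma var_ty: "fst l \<in> Ob V \<Longrightarrow> ty (var l) = Arr (tn {l}) (fst l)"
  by (simp add: var_def tn_simps mon_ty)

lemma var_iso: "fst l \<in> Ob V \<Longrightarrow> iso (var l)"
  by (simp add: var_def mon_ty)

lemma pr_ty:
  "\<lbrakk>ty f = Arr (tn S) X; ty g = Arr (tn T) Y; stage S; stage T; S \<inter> T = {}\<rbrakk>
    \<Longrightarrow> ty (pr S T f g) = Arr (tn (S \<union> T)) (X \<otimes> Y)"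
  by (simp add: pr_def mon_ty mg_ty)

lemma pr_comp:
  "\<lbrakk>ty f = Arr (tn S) X; ty g = Arr (tn T) Y; ty h = Arr X X'; ty k = Arr Y Y'; stage S; stage T; S \<inter> T = {}\<rbrakk>
    \<Longrightarrow> (h \<boxtimes> k) \<cdot> pr S T f g = pr S T (h \<cdot> f) (k \<cdot> g)"
  by (simp add: pr_def tensor_comp2 mg_ty mon_ty)

lemma pr_iso:
  "\<lbrakk>ty f = Arr (tn S) X; ty g = Arr (tn T) Y; stage S; stage T; S \<inter> T = {}; iso f; iso g\<rbrakk>
    \<Longrightarrow> iso (pr S T f g)"
  unfolding pr_def by (rule iso_comp(1)) (simp_all add: mg_iso tensor_iso mg_ty mon_ty)

lemma pr_comm:
  "\<lbrakk>ty f = Arr (tn S) X; ty g = Arr (tn T) Y; stage S; stage T; S \<inter> T = {}\<rbrakk>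
    \<Longrightarrow> \<beta> X Y \<cdot> pr S T f g = pr T S g f"
  by (simp add: pr_def braid_nat2 mg_ty mg_comm)

text \<open>Since stages are sets, both bracketings live at literally the same stage, and the
  associator only regroups a pairing. From here on no associator has to be carried along.\<close>

lemma pr_assoc:
  assumes "ty f = Arr (tn S) X" "ty g = Arr (tn T) Y" "ty h = Arr (tn U) Z"
    "stage S" "stage T" "stage U" "S \<inter> T = {}" "S \<inter> U = {}" "T \<inter> U = {}"
  shows "\<alpha> X Y Z \<cdot> pr (S \<union> T) U (pr S T f g) h = pr S (T \<union> U) f (pr T U g h)"
proof -
  have o: "tn S \<in> Ob V" "tn T \<in> Ob V" "tn U \<in> Ob V" using assms by (simp_all add: tn_ob)
  have d: "(S \<union> T) \<inter> U = {}" "S \<inter> (T \<union> U) = {}" using assms by auto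
  have m: "ty (mg S T) = Arr (tn (S \<union> T)) (tn S \<otimes> tn T)" "ty (mg T U) = Arr (tn (T \<union> U)) (tn T \<otimes> tn U)"
    "ty (mg (S \<union> T) U) = Arr (tn (S \<union> T \<union> U)) (tn (S \<union> T) \<otimes> tn U)"
    "ty (mg S (T \<union> U)) = Arr (tn (S \<union> T \<union> U)) (tn S \<otimes> tn (T \<union> U))"
    using assms d by (simp_all add: mg_ty stage_simps Un_assoc)
  have "\<alpha> X Y Z \<cdot> pr (S \<union> T) U (pr S T f g) h
      = \<alpha> X Y Z \<cdot> ((f \<boxtimes> g) \<boxtimes> h) \<cdot> (mg S T \<boxtimes> \<iota> (tn U)) \<cdot> mg (S \<union> T) U"
    using assms(1-3) o m by (simp add: pr_def tensor_comp2 mon_ty)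
  also have "\<dots> = (f \<boxtimes> (g \<boxtimes> h)) \<cdot> (\<iota> (tn S) \<boxtimes> mg T U) \<cdot> mg S (T \<union> U)"
    using assms o m by (simp add: assoc_nat2 mg_assoc mon_ty)
  also have "\<dots> = pr S (T \<union> U) f (pr T U g h)"
    using assms(1-3) o m by (simp add: pr_def tensor_comp2 mon_ty)
  finally show ?thesis .
qed

lemma pr_assoc_inv:
  assumes "ty f = Arr (tn S) X" "ty g = Arr (tn T) Y" "ty h = Arr (tn U) Z"
    "stage S" "stage T" "stage U" "S \<inter> T = {}" "S \<inter> U = {}" "T \<inter> U = {}"
  shows "inv (\<alpha> X Y Z) \<cdot> pr S (T \<union> U) f (pr T U g h) = pr (S \<union> T) U (pr S T f g) h"
proof -
  have "(S \<union> T) \<inter> U = {}" using assms by auto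
  then show ?thesis
    unfolding pr_assoc[OF assms, symmetric] using assms
    by (intro inv_cancel_left) (simp_all add: mon_ty pr_ty stage_simps ty_obs)
qed

lemma runit_nat2:
  "\<lbrakk>ty f = Arr a b; ty k = Arr d (a \<otimes> \<one>)\<rbrakk>
    \<Longrightarrow> runit V b \<cdot> (f \<boxtimes> \<iota> \<one>) \<cdot> k = f \<cdot> runit V a \<cdot> k"
  by (subst (1 2) comp_assoc[symmetric]) (simp_all add: mon_ty ty_obs runit_nat)

lemma pr_unit:
  assumes "ty f = Arr (tn S) X" "stage S"
  shows "lunit V X \<cdot> pr {} S (\<iota> \<one>) f = f" "runit V X \<cdot> pr S {} f (\<iota> \<one>) = f"
  using assms ty_obs[OF assms(1)]
  by (simp_all add: pr_def mg_unit lunit_nat2 runit_nat2 mon_ty tn_ob inv_simps)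

text \<open>On elements, middle-four interchange is a reordering of four stages. The steps follow
  its definition: reassociate, exchange the two inner factors, reassociate back.\<close>

lemma pr_interchange:
  assumes t: "ty f = Arr (tn S) p" "ty g = Arr (tn T) q" "ty h = Arr (tn U) r" "ty k = Arr (tn W) s"
    and st: "stage S" "stage T" "stage U" "stage W"
    and d: "S \<inter> T = {}" "S \<inter> U = {}" "S \<inter> W = {}" "T \<inter> U = {}" "T \<inter> W = {}" "U \<inter> W = {}"
  shows "interchange V p q r s \<cdot> pr (S \<union> T) (U \<union> W) (pr S T f g) (pr U W h k)
    = pr (S \<union> U) (T \<union> W) (pr S U f h) (pr T W g k)"
proof -
  let ?m = "\<alpha> r q s \<cdot> (\<beta> q r \<boxtimes> \<iota> s) \<cdot> inv (\<alpha> q r s)"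
  have o: "p \<in> Ob V" "q \<in> Ob V" "r \<in> Ob V" "s \<in> Ob V" using t ty_obs by blast+
  have d': "U \<inter> T = {}" "(S \<union> T) \<inter> (U \<union> W) = {}" "S \<inter> (T \<union> (U \<union> W)) = {}" "T \<inter> (U \<union> W) = {}" "(T \<union> U) \<inter> W = {}"
    "(U \<union> T) \<inter> W = {}" "U \<inter> (T \<union> W) = {}" "S \<inter> (U \<union> W) = {}" "S \<inter> (T \<union> W) = {}"
    using d by auto
  note ts = t st d d' o stage_simps pr_ty mon_ty
  have 1: "\<alpha> p q (r \<otimes> s) \<cdot> pr (S \<union> T) (U \<union> W) (pr S T f g) (pr U W h k)
      = pr S (T \<union> (U \<union> W)) f (pr T (U \<union> W) g (pr U W h k))"
    by (rule pr_assoc) (simp_all add: ts)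
  have 2: "?m \<cdot> pr T (U \<union> W) g (pr U W h k)
      = pr U (T \<union> W) h (pr T W g k)"
  proof -
    have "inv (\<alpha> q r s) \<cdot> pr T (U \<union> W) g (pr U W h k) = pr (T \<union> U) W (pr T U g h) k"
      by (rule pr_assoc_inv) (simp_all add: ts)
    moreover have "(\<beta> q r \<boxtimes> \<iota> s) \<cdot> pr (T \<union> U) W (pr T U g h) k = pr (U \<union> T) W (pr U T h g) k"
      by (simp add: pr_comp pr_comm ts Un_commute)
    moreover have "\<alpha> r q s \<cdot> pr (U \<union> T) W (pr U T h g) k = pr U (T \<union> W) h (pr T W g k)"
      by (rule pr_assoc) (simp_all add: ts)
    ultimately show ?thesis by (simp add: comp_assoc ts)
  qed
  have 3: "inv (\<alpha> p r (q \<otimes> s)) \<cdot> pr S (U \<union> (T \<union> W)) f (pr U (T \<union> W) h (pr T W g k))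
      = pr (S \<union> U) (T \<union> W) (pr S U f h) (pr T W g k)"
    by (rule pr_assoc_inv) (simp_all add: ts)
  have "(\<iota> p \<boxtimes> ?m) \<cdot> pr S (T \<union> (U \<union> W)) f (pr T (U \<union> W) g (pr U W h k))
      = pr S (T \<union> (U \<union> W)) (\<iota> p \<cdot> f) (?m \<cdot> pr T (U \<union> W) g (pr U W h k))"
    by (rule pr_comp) (simp_all add: ts)
  also have "\<dots> = pr S (U \<union> (T \<union> W)) f (pr U (T \<union> W) h (pr T W g k))"
    unfolding 2 by (simp add: ts Un_left_commute)
  finally have 4: "(\<iota> p \<boxtimes> ?m) \<cdot> pr S (T \<union> (U \<union> W)) f (pr T (U \<union> W) g (pr U W h k))
      = pr S (U \<union> (T \<union> W)) f (pr U (T \<union> W) h (pr T W g k))" .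
  have "interchange V p q r s \<cdot> pr (S \<union> T) (U \<union> W) (pr S T f g) (pr U W h k)
      = inv (\<alpha> p r (q \<otimes> s)) \<cdot> (\<iota> p \<boxtimes> ?m)
        \<cdot> \<alpha> p q (r \<otimes> s) \<cdot> pr (S \<union> T) (U \<union> W) (pr S T f g) (pr U W h k)"
    unfolding interchange_def by (simp add: comp_assoc ts)
  then show ?thesis unfolding 1 4 3 .
qed

lemma interchange_ty:
  "\<lbrakk>p \<in> Ob V; q \<in> Ob V; r \<in> Ob V; s \<in> Ob V\<rbrakk>
    \<Longrightarrow> ty (interchange V p q r s) = Arr ((p \<otimes> q) \<otimes> (r \<otimes> s)) ((p \<otimes> r) \<otimes> (q \<otimes> s))"
  by (simp add: interchange_def mon_ty)

section \<open>Elements of an enriched category\<close>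

definition el :: "('a, 'o, 'm) vcat \<Rightarrow> ('a, 'o, 'm) elt \<Rightarrow> ('a, 'o \<times> nat) el_type" where
  "el A x = (case x of (a, b, S, f) \<Rightarrow>
     if a \<in> VOb A \<and> b \<in> VOb A \<and> stage S \<and> ty f = Arr (tn S) (VHom A a b) then El a b S else No_El)"

definition ecomp :: "('a, 'o, 'm) elt \<Rightarrow> ('a, 'o, 'm) vcat \<Rightarrow> ('a, 'o, 'm) elt \<Rightarrow> ('a, 'o, 'm) elt"
    ("(_ \<odot>[_]/ _)" [66, 0, 65] 65) where
  "x \<odot>[A] y = (case x of (_, c, S, f) \<Rightarrow> case y of (a, b, T, g) \<Rightarrow> (a, c, S \<union> T, VCmp A a b c \<cdot> pr S T f g))"

definition idn :: "('a, 'o, 'm) vcat \<Rightarrow> 'a \<Rightarrow> ('a, 'o, 'm) elt" where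
  "idn A a = (a, a, {}, VId A a)"

definition fap :: "('a, 'b, 'm) vfun \<Rightarrow> ('a, 'o, 'm) elt \<Rightarrow> ('b, 'o, 'm) elt" where
  "fap F x = (case x of (a, b, S, f) \<Rightarrow> (FOb F a, FOb F b, S, FHm F a b \<cdot> f))"

text \<open>The generic element of a hom-object. The number keeps two of them composable when their
  hom-objects coincide.\<close>

definition gvar :: "('a, 'o, 'm) vcat \<Rightarrow> nat \<Rightarrow> 'a \<Rightarrow> 'a \<Rightarrow> ('a, 'o, 'm) elt" where
  "gvar A n a b = (a, b, {(VHom A a b, n)}, var (VHom A a b, n))"

text \<open>The typed data without the axioms. Tensor products of categories, categories of algebras
  and commutants get their axioms by computing with elements, which already needs composites to be
  typed.\<close>

definition pre_enriched :: "('a, 'o, 'm) vcat \<Rightarrow> bool" where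
  "pre_enriched A \<longleftrightarrow> VHom A \<in> VOb A \<rightarrow>\<^sub>E VOb A \<rightarrow>\<^sub>E Ob V \<and>
     VCmp A \<in> (\<Pi>\<^sub>E a \<in> VOb A. \<Pi>\<^sub>E b \<in> VOb A. \<Pi>\<^sub>E c \<in> VOb A.
       hom V (VHom A b c \<otimes> VHom A a b) (VHom A a c)) \<and>
     VId A \<in> (\<Pi>\<^sub>E a \<in> VOb A. hom V \<one> (VHom A a a))"

lemma enriched_pre: "enriched_category V A \<Longrightarrow> pre_enriched A"
  unfolding pre_enriched_def
  using enriched_category.VHom_PiE enriched_category.VCmp_PiE enriched_category.VId_PiE by blast

lemma VHom_ob: "pre_enriched A \<Longrightarrow> a \<in> VOb A \<Longrightarrow> b \<in> VOb A \<Longrightarrow> VHom A a b \<in> Ob V"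
  unfolding pre_enriched_def by (blast dest: PiE_mem)

lemma VCmp_ty: "pre_enriched A \<Longrightarrow> a \<in> VOb A \<Longrightarrow> b \<in> VOb A \<Longrightarrow> c \<in> VOb A
    \<Longrightarrow> ty (VCmp A a b c) = Arr (VHom A b c \<otimes> VHom A a b) (VHom A a c)"
  unfolding hom_ty[symmetric] pre_enriched_def by (blast dest: PiE_mem)

lemma VId_ty: "pre_enriched A \<Longrightarrow> a \<in> VOb A \<Longrightarrow> ty (VId A a) = Arr \<one> (VHom A a a)"
  unfolding hom_ty[symmetric] pre_enriched_def by (blast dest: PiE_mem)

lemma el_tuple: "el A (a, b, S, f) = El a' b' S' \<longleftrightarrow> a = a' \<and> b = b' \<and> S = S' \<and>
    a \<in> VOb A \<and> b \<in> VOb A \<and> stage S \<and> ty f = Arr (tn S) (VHom A a b)"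
  by (auto simp: el_def el_type.inject)

lemma elE:
  assumes "el A x = El a b S"
  obtains f where "x = (a, b, S, f)" "a \<in> VOb A" "b \<in> VOb A" "stage S" "ty f = Arr (tn S) (VHom A a b)"
  using assms by (cases x) (auto simp: el_tuple)

lemma el_obs: "el A x = El a b S \<Longrightarrow> a \<in> VOb A" "el A x = El a b S \<Longrightarrow> b \<in> VOb A" "el A x = El a b S \<Longrightarrow> stage S"
  by (auto elim: elE)

lemma el_eqI:
  assumes "el A x = El a b S" "el A y = El a b S" "el_arr x = el_arr y"
  shows "x = y"
  using assms by (auto elim!: elE simp: el_arr_def)

lemma ecomp_el:
  assumes "pre_enriched A" "el A x = El b c S" "el A y = El a b T" "S \<inter> T = {}"
  shows "el A (x \<odot>[A] y) = El a c (S \<union> T)"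
  using assms(2,3)
  by (auto elim!: elE simp: ecomp_def el_tuple assms(1,4) stage_simps mon_ty VCmp_ty pr_ty)

lemma idn_el: "pre_enriched A \<Longrightarrow> a \<in> VOb A \<Longrightarrow> el A (idn A a) = El a a {}"
  by (simp add: idn_def el_tuple stage_simps VId_ty tn_simps)

lemma gvar_el: "pre_enriched A \<Longrightarrow> a \<in> VOb A \<Longrightarrow> b \<in> VOb A \<Longrightarrow> el A (gvar A n a b) = El a b {(VHom A a b, n)}"
  using var_ty[of "(VHom A a b, n)"] by (simp add: gvar_def el_tuple stage_simps VHom_ob)

lemma gvar_iso: "pre_enriched A \<Longrightarrow> a \<in> VOb A \<Longrightarrow> b \<in> VOb A \<Longrightarrow> iso (el_arr (gvar A n a b))"
  by (simp add: gvar_def el_arr_def var_iso VHom_ob)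

text \<open>Both bracketings are a fixed arrow of V after the same pairing. This is used in two
  directions: the axiom of A gives associativity on elements, and associativity on a cover gives the
  axiom back.\<close>

lemma ecomp_assoc_arrows:
  assumes A: "pre_enriched A"
    and x: "x = (c, d, S, f)" "el A x = El c d S" and y: "y = (b, c, T, g)" "el A y = El b c T"
    and z: "z = (a, b, U, h)" "el A z = El a b U"
    and d: "S \<inter> T = {}" "S \<inter> U = {}" "T \<inter> U = {}"
  shows "el_arr ((x \<odot>[A] y) \<odot>[A] z)
      = (VCmp A a b d \<cdot> (VCmp A b c d \<boxtimes> \<iota> (VHom A a b))) \<cdot> pr (S \<union> T) U (pr S T f g) h" (is ?l)
    and "el_arr (x \<odot>[A] (y \<odot>[A] z))
      = (VCmp A a c d \<cdot> (\<iota> (VHom A c d) \<boxtimes> VCmp A a b c) \<cdot> \<alpha> (VHom A c d) (VHom A b c) (VHom A a b))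
        \<cdot> pr (S \<union> T) U (pr S T f g) h" (is ?r)
    and "ty (pr (S \<union> T) U (pr S T f g) h)
      = Arr (tn (S \<union> T \<union> U)) ((VHom A c d \<otimes> VHom A b c) \<otimes> VHom A a b)" (is ?t)
proof -
  have t: "ty f = Arr (tn S) (VHom A c d)" "ty g = Arr (tn T) (VHom A b c)" "ty h = Arr (tn U) (VHom A a b)"
    "stage S" "stage T" "stage U" "a \<in> VOb A" "b \<in> VOb A" "c \<in> VOb A" "d \<in> VOb A"
    using x y z by (simp_all add: el_tuple)
  have d': "(S \<union> T) \<inter> U = {}" "S \<inter> (T \<union> U) = {}" using d by auto
  show ?t using t d d' by (simp add: pr_ty stage_simps)
  show ?l using t d d' A
    by (simp add: x(1) y(1) z(1) ecomp_def el_arr_def comp_assoc pr_comp pr_ty VCmp_ty VHom_ob mon_ty stage_simps)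
  show ?r using t d d' A
    by (simp add: x(1) y(1) z(1) ecomp_def el_arr_def comp_assoc pr_assoc pr_comp pr_ty VCmp_ty VHom_ob mon_ty stage_simps)
qed

lemma ecomp_assoc:
  assumes A: "enriched_category V A" and x: "el A x = El c d S" and y: "el A y = El b c T" and z: "el A z = El a b U"
    and d: "S \<inter> T = {}" "S \<inter> U = {}" "T \<inter> U = {}"
  shows "(x \<odot>[A] y) \<odot>[A] z = x \<odot>[A] (y \<odot>[A] z)"
proof -
  note P = enriched_pre[OF A]
  obtain f where f: "x = (c, d, S, f)" using x by (rule elE)
  obtain g where g: "y = (b, c, T, g)" using y by (rule elE)
  obtain h where h: "z = (a, b, U, h)" using z by (rule elE)
  note arr = ecomp_assoc_arrows[OF P f x g y h z d]
  have "(S \<union> T) \<inter> U = {}" "S \<inter> (T \<union> U) = {}" using d by auto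
  then have t: "el A ((x \<odot>[A] y) \<odot>[A] z) = El a d (S \<union> T \<union> U)" "el A (x \<odot>[A] (y \<odot>[A] z)) = El a d (S \<union> T \<union> U)"
    using P x y z d by (simp_all add: ecomp_el Un_assoc)
  have "VCmp A a b d \<cdot> (VCmp A b c d \<boxtimes> \<iota> (VHom A a b))
      = VCmp A a c d \<cdot> (\<iota> (VHom A c d) \<boxtimes> VCmp A a b c) \<cdot> \<alpha> (VHom A c d) (VHom A b c) (VHom A a b)"
    by (rule enriched_category.VCmp_assoc[OF A]) (use el_obs[OF x] el_obs[OF y] el_obs[OF z] in auto)
  then show ?thesis using el_eqI[OF t] arr by simp
qed

text \<open>An element at the empty stage is an arrow of the underlying category. Composing with it
  is postcomposition with a fixed arrow between hom-objects, by naturality of the left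
  unitor.\<close>

lemma ecomp_const_left:
  assumes "pre_enriched A" "el A (b, c, {}, k) = El b c {}" "el A (a, b, S, f) = El a b S"
  shows "(b, c, {}, k) \<odot>[A] (a, b, S, f)
    = (a, c, S, (VCmp A a b c \<cdot> (k \<boxtimes> \<iota> (VHom A a b)) \<cdot> inv (lunit V (VHom A a b))) \<cdot> f)"
proof -
  have t: "ty k = Arr \<one> (VHom A b c)" "ty f = Arr (tn S) (VHom A a b)" "stage S" "a \<in> VOb A" "b \<in> VOb A" "c \<in> VOb A"
    using assms(2,3) by (auto simp: el_tuple tn_simps)
  have "(k \<boxtimes> f) \<cdot> inv (lunit V (tn S)) = (k \<boxtimes> \<iota> (VHom A a b)) \<cdot> (\<iota> \<one> \<boxtimes> f) \<cdot> inv (lunit V (tn S))"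
    using t assms(1) by (simp add: tensor_comp2 mon_ty tn_ob VHom_ob)
  then show ?thesis using t assms(1)
    by (simp add: ecomp_def pr_def mg_unit inv_lunit_nat comp_assoc mon_ty tn_ob VHom_ob VCmp_ty)
qed

lemma ecomp_const_right:
  assumes "pre_enriched A" "el A (b, c, S, f) = El b c S" "el A (a, b, {}, k) = El a b {}"
  shows "(b, c, S, f) \<odot>[A] (a, b, {}, k)
    = (a, c, S, (VCmp A a b c \<cdot> (\<iota> (VHom A b c) \<boxtimes> k) \<cdot> inv (runit V (VHom A b c))) \<cdot> f)"
proof -
  have t: "ty k = Arr \<one> (VHom A a b)" "ty f = Arr (tn S) (VHom A b c)" "stage S" "a \<in> VOb A" "b \<in> VOb A" "c \<in> VOb A"
    using assms(2,3) by (auto simp: el_tuple tn_simps)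
  have "(f \<boxtimes> k) \<cdot> inv (runit V (tn S)) = (\<iota> (VHom A b c) \<boxtimes> k) \<cdot> (f \<boxtimes> \<iota> \<one>) \<cdot> inv (runit V (tn S))"
    using t assms(1) by (simp add: tensor_comp2 mon_ty tn_ob VHom_ob)
  then show ?thesis using t assms(1)
    by (simp add: ecomp_def pr_def mg_unit inv_runit_nat comp_assoc mon_ty tn_ob VHom_ob VCmp_ty)
qed

lemma ecomp_idn:
  assumes A: "enriched_category V A" and x: "el A x = El a b S"
  shows "idn A b \<odot>[A] x = x" "x \<odot>[A] idn A a = x"
proof -
  note P = enriched_pre[OF A]
  obtain f where f: "x = (a, b, S, f)" and t: "a \<in> VOb A" "b \<in> VOb A" "stage S" "ty f = Arr (tn S) (VHom A a b)"
    using x by (rule elE)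
  have i: "el A (b, b, {}, VId A b) = El b b {}" "el A (a, a, {}, VId A a) = El a a {}"
    using idn_el[OF P] t by (simp_all add: idn_def)
  have l: "VCmp A a b b \<cdot> (VId A b \<boxtimes> \<iota> (VHom A a b)) \<cdot> inv (lunit V (VHom A a b)) = \<iota> (VHom A a b)"
    using enriched_category.VCmp_VId_left[OF A, of a b] t P
    by (subst comp_assoc[symmetric]) (simp_all add: mon_ty VCmp_ty VHom_ob VId_ty inv_simps)
  have r: "VCmp A a a b \<cdot> (\<iota> (VHom A a b) \<boxtimes> VId A a) \<cdot> inv (runit V (VHom A a b)) = \<iota> (VHom A a b)"
    using enriched_category.VCmp_VId_right[OF A, of a b] t P
    by (subst comp_assoc[symmetric]) (simp_all add: mon_ty VCmp_ty VHom_ob VId_ty inv_simps)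
  show "idn A b \<odot>[A] x = x" "x \<odot>[A] idn A a = x"
    unfolding idn_def f using ecomp_const_left[OF P i(1) x[unfolded f]] ecomp_const_right[OF P x[unfolded f] i(2)] l r t
    by (simp_all add: comp_ident)
qed

text \<open>A family \<open>z\<close> of elements with invertible arrows, one for each hom-object, tests equations.\<close>

definition cover :: "('a, 'o, 'm) vcat \<Rightarrow> (nat \<Rightarrow> 'a \<Rightarrow> 'a \<Rightarrow> ('o \<times> nat) set) \<Rightarrow> (nat \<Rightarrow> 'a \<Rightarrow> 'a \<Rightarrow> ('a, 'o, 'm) elt) \<Rightarrow> bool" where
  "cover A st z \<longleftrightarrow> (\<forall>n. \<forall>a \<in> VOb A. \<forall>b \<in> VOb A. el A (z n a b) = El a b (st n a b) \<and> iso (el_arr (z n a b))) \<and>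
     (\<forall>m n a b c d. m \<noteq> n \<longrightarrow> st m a b \<inter> st n c d = {})"

lemma coverD:
  assumes "cover A st z"
  shows "a \<in> VOb A \<Longrightarrow> b \<in> VOb A \<Longrightarrow> el A (z n a b) = El a b (st n a b)"
    "a \<in> VOb A \<Longrightarrow> b \<in> VOb A \<Longrightarrow> iso (el_arr (z n a b))" "m \<noteq> n \<Longrightarrow> st m a b \<inter> st n c d = {}"
  using assms unfolding cover_def by blast+

lemma gvar_cover: "pre_enriched A \<Longrightarrow> cover A (\<lambda>n a b. {(VHom A a b, n)}) (gvar A)"
  by (simp add: cover_def gvar_el gvar_iso)

text \<open>The pairing of elements of a cover is invertible, so it can be cancelled from an
  equation between elements. Covers are left general because on a tensor product of categories the
  convenient one consists of pairs (\<open>tcov\<close>), not of generic elements of the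
  product.\<close>

lemma enriched_categoryI:
  assumes P: "pre_enriched A" and cov: "cover A st z"
    and assoc: "\<And>a b c d. \<lbrakk>a \<in> VOb A; b \<in> VOb A; c \<in> VOb A; d \<in> VOb A\<rbrakk>
      \<Longrightarrow> (z 2 c d \<odot>[A] z 1 b c) \<odot>[A] z 0 a b = z 2 c d \<odot>[A] (z 1 b c \<odot>[A] z 0 a b)"
    and unit: "\<And>a b. \<lbrakk>a \<in> VOb A; b \<in> VOb A\<rbrakk> \<Longrightarrow> idn A b \<odot>[A] z 0 a b = z 0 a b"
      "\<And>a b. \<lbrakk>a \<in> VOb A; b \<in> VOb A\<rbrakk> \<Longrightarrow> z 0 a b \<odot>[A] idn A a = z 0 a b"
  shows "enriched_category V A"
proof
  show "VHom A \<in> VOb A \<rightarrow>\<^sub>E VOb A \<rightarrow>\<^sub>E Ob V"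
    "VCmp A \<in> (\<Pi>\<^sub>E a \<in> VOb A. \<Pi>\<^sub>E b \<in> VOb A. \<Pi>\<^sub>E c \<in> VOb A. hom V (VHom A b c \<otimes> VHom A a b) (VHom A a c))"
    "VId A \<in> (\<Pi>\<^sub>E a \<in> VOb A. hom V \<one> (VHom A a a))"
    using P unfolding pre_enriched_def by blast+
next
  fix a b c d assume ob: "a \<in> VOb A" "b \<in> VOb A" "c \<in> VOb A" "d \<in> VOb A"
  note zt = coverD(1)[OF cov]
  obtain f where f: "z 2 c d = (c, d, st 2 c d, f)" using zt[OF ob(3,4)] by (rule elE)
  obtain g where g: "z 1 b c = (b, c, st 1 b c, g)" using zt[OF ob(2,3)] by (rule elE)
  obtain h where h: "z 0 a b = (a, b, st 0 a b, h)" using zt[OF ob(1,2)] by (rule elE)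
  have d: "st 2 c d \<inter> st 1 b c = {}" "st 2 c d \<inter> st 0 a b = {}" "st 1 b c \<inter> st 0 a b = {}"
    by (rule coverD(3)[OF cov], simp)+
  note arr = ecomp_assoc_arrows[OF P f zt[OF ob(3,4)] g zt[OF ob(2,3)] h zt[OF ob(1,2)] d]
  have fgh: "iso f" "iso g" "iso h"
    using coverD(2)[OF cov ob(3,4), of 2] coverD(2)[OF cov ob(2,3), of 1] coverD(2)[OF cov ob(1,2), of 0]
    by (simp_all add: f g h el_arr_def del: One_nat_def)
  have t: "ty f = Arr (tn (st 2 c d)) (VHom A c d)" "ty g = Arr (tn (st 1 b c)) (VHom A b c)"
    "ty h = Arr (tn (st 0 a b)) (VHom A a b)" "stage (st 2 c d)" "stage (st 1 b c)" "stage (st 0 a b)"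
    using zt[OF ob(3,4), of 2] zt[OF ob(2,3), of 1] zt[OF ob(1,2), of 0] by (simp_all add: f g h el_tuple del: One_nat_def)
  show "VCmp A a b d \<cdot> (VCmp A b c d \<boxtimes> \<iota> (VHom A a b))
      = VCmp A a c d \<cdot> (\<iota> (VHom A c d) \<boxtimes> VCmp A a b c) \<cdot> \<alpha> (VHom A c d) (VHom A b c) (VHom A a b)"
  proof (rule iso_cancel_right)
    show "(VCmp A a b d \<cdot> (VCmp A b c d \<boxtimes> \<iota> (VHom A a b))) \<cdot> pr (st 2 c d \<union> st 1 b c) (st 0 a b) (pr (st 2 c d) (st 1 b c) f g) h
      = (VCmp A a c d \<cdot> (\<iota> (VHom A c d) \<boxtimes> VCmp A a b c) \<cdot> \<alpha> (VHom A c d) (VHom A b c) (VHom A a b))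
        \<cdot> pr (st 2 c d \<union> st 1 b c) (st 0 a b) (pr (st 2 c d) (st 1 b c) f g) h"
      using arg_cong[OF assoc[OF ob], of el_arr] unfolding arr .
    show "iso (pr (st 2 c d \<union> st 1 b c) (st 0 a b) (pr (st 2 c d) (st 1 b c) f g) h)"
      by (rule pr_iso[OF pr_ty]) (use t fgh d in \<open>auto simp: stage_simps pr_iso\<close>)
  qed (use arr(3) P ob in \<open>simp_all add: mon_ty VCmp_ty VHom_ob\<close>)
next
  fix a b assume ob: "a \<in> VOb A" "b \<in> VOb A"
  note zt = coverD(1)[OF cov ob, of 0]
  obtain f where f: "z 0 a b = (a, b, st 0 a b, f)" and t: "ty f = Arr (tn (st 0 a b)) (VHom A a b)" using zt by (rule elE)
  have fi: "iso f" using coverD(2)[OF cov ob, of 0] by (simp add: f el_arr_def)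
  have i: "el A (b, b, {}, VId A b) = El b b {}" "el A (a, a, {}, VId A a) = El a a {}"
    using idn_el[OF P] ob by (simp_all add: idn_def)
  have l: "(VCmp A a b b \<cdot> (VId A b \<boxtimes> \<iota> (VHom A a b)) \<cdot> inv (lunit V (VHom A a b))) \<cdot> f = \<iota> (VHom A a b) \<cdot> f"
    using unit(1)[OF ob] ecomp_const_left[OF P i(1) zt[unfolded f]] t by (simp add: idn_def f comp_ident)
  have r: "(VCmp A a a b \<cdot> (\<iota> (VHom A a b) \<boxtimes> VId A a) \<cdot> inv (runit V (VHom A a b))) \<cdot> f = \<iota> (VHom A a b) \<cdot> f"
    using unit(2)[OF ob] ecomp_const_right[OF P zt[unfolded f] i(2)] t by (simp add: idn_def f comp_ident)
  have l': "VCmp A a b b \<cdot> (VId A b \<boxtimes> \<iota> (VHom A a b)) \<cdot> inv (lunit V (VHom A a b)) = \<iota> (VHom A a b)"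
    by (rule iso_cancel_right[OF l fi t]) (use P ob in \<open>simp_all add: mon_ty VCmp_ty VHom_ob VId_ty\<close>)
  have r': "VCmp A a a b \<cdot> (\<iota> (VHom A a b) \<boxtimes> VId A a) \<cdot> inv (runit V (VHom A a b)) = \<iota> (VHom A a b)"
    by (rule iso_cancel_right[OF r fi t]) (use P ob in \<open>simp_all add: mon_ty VCmp_ty VHom_ob VId_ty\<close>)
  have "(VCmp A a b b \<cdot> (VId A b \<boxtimes> \<iota> (VHom A a b)) \<cdot> inv (lunit V (VHom A a b))) \<cdot> lunit V (VHom A a b) = lunit V (VHom A a b)"
    unfolding l' using P ob by (simp add: mon_ty VHom_ob)
  then show "VCmp A a b b \<cdot> (VId A b \<boxtimes> \<iota> (VHom A a b)) = lunit V (VHom A a b)"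
    using P ob by (simp add: mon_ty VCmp_ty VHom_ob VId_ty comp_assoc inv_simps)
  have "(VCmp A a a b \<cdot> (\<iota> (VHom A a b) \<boxtimes> VId A a) \<cdot> inv (runit V (VHom A a b))) \<cdot> runit V (VHom A a b) = runit V (VHom A a b)"
    unfolding r' using P ob by (simp add: mon_ty VHom_ob)
  then show "VCmp A a a b \<cdot> (\<iota> (VHom A a b) \<boxtimes> VId A a) = runit V (VHom A a b)"
    using P ob by (simp add: mon_ty VCmp_ty VHom_ob VId_ty comp_assoc inv_simps)
qed

section \<open>Enriched functors acting on elements\<close>

lemma enr_functor_cats:
  assumes "enriched_functor V A B F"
  shows "enriched_category V A" "enriched_category V B"
  using assms by (simp_all add: enriched_functor_def)

lemma FOb_ob: "enriched_functor V A B F \<Longrightarrow> a \<in> VOb A \<Longrightarrow> FOb F a \<in> VOb B"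
  using enriched_functor.FOb_PiE by (blast dest: PiE_mem)

lemma FHm_ty: "enriched_functor V A B F \<Longrightarrow> a \<in> VOb A \<Longrightarrow> b \<in> VOb A
    \<Longrightarrow> ty (FHm F a b) = Arr (VHom A a b) (VHom B (FOb F a) (FOb F b))"
  unfolding hom_ty[symmetric] by (blast dest: PiE_mem enriched_functor.FHm_PiE)

lemma fap_el:
  assumes "enriched_functor V A B F" "el A x = El a b S"
  shows "el B (fap F x) = El (FOb F a) (FOb F b) S"
  using assms(2) by (auto elim!: elE simp: fap_def el_tuple FOb_ob[OF assms(1)] FHm_ty[OF assms(1)] mon_ty)

lemma fap_ecomp:
  assumes F: "enriched_functor V A B F" and x: "el A x = El b c S" and y: "el A y = El a b T" and d: "S \<inter> T = {}"
  shows "fap F (x \<odot>[A] y) = fap F x \<odot>[B] fap F y"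
proof -
  obtain f where f: "x = (b, c, S, f)" "stage S" "ty f = Arr (tn S) (VHom A b c)" using x by (rule elE)
  obtain g where g: "y = (a, b, T, g)" "stage T" "ty g = Arr (tn T) (VHom A a b)" using y by (rule elE)
  note ob = el_obs[OF x] el_obs[OF y]
  note P = enriched_pre[OF enr_functor_cats(1)[OF F]] enriched_pre[OF enr_functor_cats(2)[OF F]]
  have "FHm F a c \<cdot> VCmp A a b c \<cdot> pr S T f g = (FHm F a c \<cdot> VCmp A a b c) \<cdot> pr S T f g"
    using f g ob d P by (simp add: comp_assoc mon_ty FHm_ty[OF F] VCmp_ty pr_ty)
  also have "\<dots> = VCmp B (FOb F a) (FOb F b) (FOb F c) \<cdot> pr S T (FHm F b c \<cdot> f) (FHm F a b \<cdot> g)"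
    using f g ob d P enriched_functor.FHm_VCmp[OF F, of a b c]
    by (simp add: comp_assoc mon_ty FHm_ty[OF F] FOb_ob[OF F] VCmp_ty pr_ty pr_comp)
  finally show ?thesis by (simp add: f g fap_def ecomp_def)
qed

lemma fap_idn: "enriched_functor V A B F \<Longrightarrow> a \<in> VOb A \<Longrightarrow> fap F (idn A a) = idn B (FOb F a)"
  using enriched_functor.FHm_VId by (auto simp: fap_def idn_def)

text \<open>As in \<open>enriched_categoryI\<close>, an invertible pairing is cancelled; only two
  composable elements are involved.\<close>

lemma enriched_functorI:
  assumes A: "enriched_category V A" and B: "enriched_category V B"
    and Fo: "FOb F \<in> VOb A \<rightarrow>\<^sub>E VOb B"
    and Fh: "FHm F \<in> (\<Pi>\<^sub>E a \<in> VOb A. \<Pi>\<^sub>E b \<in> VOb A. hom V (VHom A a b) (VHom B (FOb F a) (FOb F b)))"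
    and cov: "cover A st z"
    and id: "\<And>a. a \<in> VOb A \<Longrightarrow> fap F (idn A a) = idn B (FOb F a)"
    and comp: "\<And>a b c. \<lbrakk>a \<in> VOb A; b \<in> VOb A; c \<in> VOb A\<rbrakk>
      \<Longrightarrow> fap F (z 1 b c \<odot>[A] z 0 a b) = fap F (z 1 b c) \<odot>[B] fap F (z 0 a b)"
  shows "enriched_functor V A B F"
proof -
  note P = enriched_pre[OF A] enriched_pre[OF B]
  have Fob: "a \<in> VOb A \<Longrightarrow> FOb F a \<in> VOb B" for a using Fo by (blast dest: PiE_mem)
  have Fty: "a \<in> VOb A \<Longrightarrow> b \<in> VOb A \<Longrightarrow> ty (FHm F a b) = Arr (VHom A a b) (VHom B (FOb F a) (FOb F b))" for a b
    unfolding hom_ty[symmetric] using Fh by (blast dest: PiE_mem)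
  have "FHm F a a \<cdot> VId A a = VId B (FOb F a)" if "a \<in> VOb A" for a
    using id[OF that] by (simp add: fap_def idn_def)
  moreover have "FHm F a c \<cdot> VCmp A a b c = VCmp B (FOb F a) (FOb F b) (FOb F c) \<cdot> (FHm F b c \<boxtimes> FHm F a b)"
    if ob: "a \<in> VOb A" "b \<in> VOb A" "c \<in> VOb A" for a b c
  proof -
    obtain f where f: "z 1 b c = (b, c, st 1 b c, f)" "stage (st 1 b c)" "ty f = Arr (tn (st 1 b c)) (VHom A b c)"
      using coverD(1)[OF cov ob(2,3)] by (rule elE)
    obtain g where g: "z 0 a b = (a, b, st 0 a b, g)" "stage (st 0 a b)" "ty g = Arr (tn (st 0 a b)) (VHom A a b)"
      using coverD(1)[OF cov ob(1,2)] by (rule elE)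
    have fi: "iso f" "iso g"
      using coverD(2)[OF cov ob(2,3), of 1] coverD(2)[OF cov ob(1,2), of 0] by (simp_all add: f g el_arr_def del: One_nat_def)
    have d: "st 1 b c \<inter> st 0 a b = {}" by (rule coverD(3)[OF cov]) simp
    show ?thesis
    proof (rule iso_cancel_right)
      show "(FHm F a c \<cdot> VCmp A a b c) \<cdot> pr (st 1 b c) (st 0 a b) f g
        = (VCmp B (FOb F a) (FOb F b) (FOb F c) \<cdot> (FHm F b c \<boxtimes> FHm F a b)) \<cdot> pr (st 1 b c) (st 0 a b) f g"
        using comp[OF ob] f g ob d P
        by (simp add: f g fap_def ecomp_def comp_assoc mon_ty Fty Fob VCmp_ty pr_ty pr_comp del: One_nat_def)
      show "iso (pr (st 1 b c) (st 0 a b) f g)" using f g d fi by (simp add: pr_iso del: One_nat_def)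
    qed (use f g ob d P in \<open>simp_all add: comp_assoc mon_ty Fty Fob VCmp_ty pr_ty VHom_ob del: One_nat_def\<close>)
  qed
  ultimately show ?thesis using A B Fo Fh
    by (auto simp: enriched_functor_def enriched_functor_axioms_def)
qed

lemma vfun_eqI:
  assumes F: "enriched_functor V A B F" and G: "enriched_functor V A B G"
    and ob: "\<And>a. a \<in> VOb A \<Longrightarrow> FOb F a = FOb G a"
    and ar: "\<And>a b. a \<in> VOb A \<Longrightarrow> b \<in> VOb A \<Longrightarrow> FHm F a b = FHm G a b"
  shows "F = G"
proof -
  have "FOb F = FOb G"
    by (rule PiE_ext[OF enriched_functor.FOb_PiE[OF F] enriched_functor.FOb_PiE[OF G] ob])
  moreover have "FHm F = FHm G"
  proof
    fix a show "FHm F a = FHm G a"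
    proof (cases "a \<in> VOb A")
      case True
      have "FHm F a \<in> extensional (VOb A)" "FHm G a \<in> extensional (VOb A)"
        using PiE_mem[OF enriched_functor.FHm_PiE[OF F] True] PiE_mem[OF enriched_functor.FHm_PiE[OF G] True]
        by (auto simp: PiE_def)
      then show ?thesis by (rule extensionalityI) (use ar True in auto)
    next
      case False
      then show ?thesis using enriched_functor.FHm_PiE[OF F] enriched_functor.FHm_PiE[OF G]
        by (auto simp: PiE_def extensional_def)
    qed
  qed
  ultimately show ?thesis by simp
qed

lemma fap_id_vfun: "el A x = El a b S \<Longrightarrow> fap (id_vfun V A) x = x"
  by (auto elim!: elE simp: fap_def id_vfun_def mon_ty)

lemma fap_comp_vfun:
  assumes F: "enriched_functor V A B F" and G: "enriched_functor V B C G" and x: "el A x = El a b S"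
  shows "fap (comp_vfun V A G F) x = fap G (fap F x)"
  using x by (auto elim!: elE simp: fap_def comp_vfun_def comp_assoc FHm_ty[OF F] FHm_ty[OF G] FOb_ob[OF F])

lemma id_vfun_functor:
  assumes "enriched_category V A"
  shows "enriched_functor V A A (id_vfun V A)"
proof (rule enriched_functorI[OF assms assms _ _ gvar_cover])
  show P: "pre_enriched A" using enriched_pre[OF assms] .
  fix a b c assume ob: "a \<in> VOb A" "b \<in> VOb A" "c \<in> VOb A"
  note g = gvar_el[OF P ob(2,3), of 1] gvar_el[OF P ob(1,2), of 0]
  show "fap (id_vfun V A) (idn A a) = idn A (FOb (id_vfun V A) a)"
    using fap_id_vfun[OF idn_el[OF P ob(1)]] ob by (simp add: id_vfun_def)
  show "fap (id_vfun V A) (gvar A 1 b c \<odot>[A] gvar A 0 a b) = fap (id_vfun V A) (gvar A 1 b c) \<odot>[A] fap (id_vfun V A) (gvar A 0 a b)"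
    using fap_id_vfun[OF g(1)] fap_id_vfun[OF g(2)] fap_id_vfun[OF ecomp_el[OF P g]] by simp
qed (auto simp: id_vfun_def hom_ty mon_ty VHom_ob enriched_pre[OF assms])

lemma comp_vfun_functor:
  assumes F: "enriched_functor V A B F" and G: "enriched_functor V B C G"
  shows "enriched_functor V A C (comp_vfun V A G F)"
proof (rule enriched_functorI[OF _ _ _ _ gvar_cover])
  show E: "enriched_category V A" "enriched_category V C" using F G enr_functor_cats by blast+
  show P: "pre_enriched A" using enriched_pre E by blast
  fix a b c assume ob: "a \<in> VOb A" "b \<in> VOb A" "c \<in> VOb A"
  note g = gvar_el[OF P ob(2,3), of 1] gvar_el[OF P ob(1,2), of 0]
  show "fap (comp_vfun V A G F) (idn A a) = idn C (FOb (comp_vfun V A G F) a)"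
    using fap_comp_vfun[OF F G idn_el[OF P ob(1)]] fap_idn[OF F] fap_idn[OF G] FOb_ob[OF F] ob
    by (simp add: comp_vfun_def)
  show "fap (comp_vfun V A G F) (gvar A 1 b c \<odot>[A] gvar A 0 a b) = fap (comp_vfun V A G F) (gvar A 1 b c) \<odot>[C] fap (comp_vfun V A G F) (gvar A 0 a b)"
    using fap_comp_vfun[OF F G g(1)] fap_comp_vfun[OF F G g(2)] fap_comp_vfun[OF F G ecomp_el[OF P g]]
      fap_ecomp[OF F g] fap_ecomp[OF G fap_el[OF F g(1)] fap_el[OF F g(2)]] by simp
qed (auto simp: comp_vfun_def hom_ty mon_ty FOb_ob[OF F] FOb_ob[OF G] FHm_ty[OF F] FHm_ty[OF G])

section \<open>Natural transformations and isomorphisms on elements\<close>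

definition nt :: "('a, 'b, 'm) vfun \<Rightarrow> ('a, 'b, 'm) vfun \<Rightarrow> ('a \<Rightarrow> 'm) \<Rightarrow> 'a \<Rightarrow> ('b, 'o, 'm) elt" where
  "nt F G \<phi> a = (FOb F a, FOb G a, {}, \<phi> a)"

lemma nt_el:
  assumes "vnatural V A B F G \<phi>" "enriched_functor V A B F" "enriched_functor V A B G" "a \<in> VOb A"
  shows "el B (nt F G \<phi> a) = El (FOb F a) (FOb G a) {}"
proof -
  have "\<phi> a \<in> hom V \<one> (VHom B (FOb F a) (FOb G a))"
    using assms(1,4) unfolding vnatural_def by (blast dest: PiE_mem)
  then show ?thesis using assms(2-4) by (simp add: nt_def el_tuple hom_ty stage_simps tn_simps FOb_ob)
qed

text \<open>The two legs of a naturality square are fixed arrows of V applied to f, namely the two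
  sides of the equation in \<open>vnatural\<close>. Naturality on an invertible f is therefore the
  naturality axiom.\<close>

lemma nt_naturality_arrows:
  assumes P: "pre_enriched B" and F: "enriched_functor V A B F" and G: "enriched_functor V A B G"
    and t: "el B (nt F G \<phi> a) = El (FOb F a) (FOb G a) {}" "el B (nt F G \<phi> b) = El (FOb F b) (FOb G b) {}"
    and x: "el A (a, b, S, f) = El a b S"
  shows "nt F G \<phi> b \<odot>[B] fap F (a, b, S, f) = (FOb F a, FOb G b, S,
      (VCmp B (FOb F a) (FOb F b) (FOb G b) \<cdot> (\<phi> b \<boxtimes> FHm F a b) \<cdot> inv (lunit V (VHom A a b))) \<cdot> f)" (is ?l)
    and "fap G (a, b, S, f) \<odot>[B] nt F G \<phi> a = (FOb F a, FOb G b, S,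
      (VCmp B (FOb F a) (FOb G a) (FOb G b) \<cdot> (FHm G a b \<boxtimes> \<phi> a) \<cdot> inv (runit V (VHom A a b))) \<cdot> f)" (is ?r)
proof -
  have ob: "a \<in> VOb A" "b \<in> VOb A" and f: "ty f = Arr (tn S) (VHom A a b)" "stage S" using x by (simp_all add: el_tuple)
  note PA = enriched_pre[OF enr_functor_cats(1)[OF F]]
  have \<phi>: "ty (\<phi> a) = Arr \<one> (VHom B (FOb F a) (FOb G a))" "ty (\<phi> b) = Arr \<one> (VHom B (FOb F b) (FOb G b))"
    using t by (simp_all add: nt_def el_tuple tn_simps)
  have "(\<phi> b \<boxtimes> (FHm F a b \<cdot> f)) \<cdot> inv (lunit V (tn S)) = (\<phi> b \<boxtimes> FHm F a b) \<cdot> (\<iota> \<one> \<boxtimes> f) \<cdot> inv (lunit V (tn S))"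
    using f ob \<phi> by (simp add: tensor_comp2 mon_ty tn_ob FHm_ty[OF F])
  then show ?l using f ob \<phi> P PA
    by (simp add: nt_def fap_def ecomp_def pr_def mg_unit inv_lunit_nat comp_assoc mon_ty tn_ob VHom_ob VCmp_ty
        FHm_ty[OF F] FOb_ob[OF F] FOb_ob[OF G])
  have "((FHm G a b \<cdot> f) \<boxtimes> \<phi> a) \<cdot> inv (runit V (tn S)) = (FHm G a b \<boxtimes> \<phi> a) \<cdot> (f \<boxtimes> \<iota> \<one>) \<cdot> inv (runit V (tn S))"
    using f ob \<phi> by (simp add: tensor_comp2 mon_ty tn_ob FHm_ty[OF G])
  then show ?r using f ob \<phi> P PA
    by (simp add: nt_def fap_def ecomp_def pr_def mg_unit inv_runit_nat comp_assoc mon_ty tn_ob VHom_ob VCmp_ty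
        FHm_ty[OF G] FOb_ob[OF F] FOb_ob[OF G])
qed

lemma vnaturalD:
  assumes n: "vnatural V A B F G \<phi>" and F: "enriched_functor V A B F" and G: "enriched_functor V A B G"
    and x: "el A x = El a b S"
  shows "nt F G \<phi> b \<odot>[B] fap F x = fap G x \<odot>[B] nt F G \<phi> a"
proof -
  obtain f where f: "x = (a, b, S, f)" using x by (rule elE)
  note P = enriched_pre[OF enr_functor_cats(2)[OF F]]
  show ?thesis
    unfolding f nt_naturality_arrows[OF P F G nt_el[OF n F G el_obs(1)[OF x]] nt_el[OF n F G el_obs(2)[OF x]] x[unfolded f]]
    using n el_obs[OF x] unfolding vnatural_def by simp
qed

lemma vnaturalI:
  assumes F: "enriched_functor V A B F" and G: "enriched_functor V A B G" and cov: "cover A st z"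
    and ext: "\<phi> \<in> extensional (VOb A)"
    and t: "\<And>a. a \<in> VOb A \<Longrightarrow> el B (nt F G \<phi> a) = El (FOb F a) (FOb G a) {}"
    and n: "\<And>a b. a \<in> VOb A \<Longrightarrow> b \<in> VOb A \<Longrightarrow>
      nt F G \<phi> b \<odot>[B] fap F (z 0 a b) = fap G (z 0 a b) \<odot>[B] nt F G \<phi> a"
  shows "vnatural V A B F G \<phi>"
  unfolding vnatural_def
proof (intro conjI ballI)
  have "\<phi> a \<in> hom V \<one> (VHom B (FOb F a) (FOb G a))" if "a \<in> VOb A" for a
    using t[OF that] by (simp add: nt_def el_tuple tn_simps hom_ty)
  then show "\<phi> \<in> (\<Pi>\<^sub>E a\<in>VOb A. hom V \<one> (VHom B (FOb F a) (FOb G a)))" using ext by (auto simp: PiE_def)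
  note P = enriched_pre[OF enr_functor_cats(2)[OF F]]
  note PA = enriched_pre[OF enr_functor_cats(1)[OF F]]
  fix a b assume ob: "a \<in> VOb A" "b \<in> VOb A"
  note zt = coverD(1)[OF cov ob, of 0]
  obtain f where f: "z 0 a b = (a, b, st 0 a b, f)" "ty f = Arr (tn (st 0 a b)) (VHom A a b)" using zt by (rule elE)
  have fi: "iso f" using coverD(2)[OF cov ob, of 0] by (simp add: f el_arr_def)
  note e = nt_naturality_arrows[OF P F G t[OF ob(1)] t[OF ob(2)] zt[unfolded f(1)]]
  have \<phi>: "ty (\<phi> a) = Arr \<one> (VHom B (FOb F a) (FOb G a))" "ty (\<phi> b) = Arr \<one> (VHom B (FOb F b) (FOb G b))"
    using t[OF ob(1)] t[OF ob(2)] by (simp_all add: nt_def el_tuple tn_simps)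
  show "VCmp B (FOb F a) (FOb F b) (FOb G b) \<cdot> (\<phi> b \<boxtimes> FHm F a b) \<cdot> inv (lunit V (VHom A a b))
     = VCmp B (FOb F a) (FOb G a) (FOb G b) \<cdot> (FHm G a b \<boxtimes> \<phi> a) \<cdot> inv (runit V (VHom A a b))"
    by (rule iso_cancel_right[of _ f])
      (use n[OF ob, unfolded f(1) e] ob \<phi> fi f(2) P PA in
        \<open>simp_all add: mon_ty VHom_ob VCmp_ty FHm_ty[OF F] FHm_ty[OF G] FOb_ob[OF F] FOb_ob[OF G]\<close>)
qed

lemma ecomp_comp0: "(b, c, {}, g) \<odot>[A] (a, b, {}, f) = (a, c, {}, comp0 V A a b c g f)"
  by (simp add: ecomp_def comp0_def pr_def mg_unit tn_simps lunit_unit)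

lemma inverse0_iff:
  "inverse0 V A a b f g \<longleftrightarrow> ty f = Arr \<one> (VHom A a b) \<and> ty g = Arr \<one> (VHom A b a) \<and>
    (b, a, {}, g) \<odot>[A] (a, b, {}, f) = idn A a \<and> (a, b, {}, f) \<odot>[A] (b, a, {}, g) = idn A b"
  by (auto simp: inverse0_def ecomp_comp0 idn_def hom_ty)

lemma el_const: "a \<in> VOb A \<Longrightarrow> b \<in> VOb A \<Longrightarrow> ty f = Arr \<one> (VHom A a b) \<Longrightarrow> el A (a, b, {}, f) = El a b {}"
  by (simp add: el_tuple stage_simps tn_simps)

lemma inverse0_unique:
  assumes A: "enriched_category V A" and ob: "a \<in> VOb A" "b \<in> VOb A"
    and i: "inverse0 V A a b f g" "inverse0 V A a b f g'"
  shows "g = g'"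
proof -
  have t: "el A (b, a, {}, g) = El b a {}" "el A (a, b, {}, f) = El a b {}" "el A (b, a, {}, g') = El b a {}"
    using i ob by (auto simp: inverse0_iff el_const)
  have "(b, a, {}, g) = (b, a, {}, g) \<odot>[A] ((a, b, {}, f) \<odot>[A] (b, a, {}, g'))"
    using i ecomp_idn(2)[OF A t(1)] by (auto simp: inverse0_iff)
  also have "\<dots> = (b, a, {}, g')"
    using i ecomp_idn(1)[OF A t(3)] ecomp_assoc[OF A t] by (auto simp: inverse0_iff)
  finally show ?thesis by simp
qed

lemma inv0_eq:
  assumes "enriched_category V A" "a \<in> VOb A" "b \<in> VOb A" "inverse0 V A a b f g"
  shows "inv0 V A a b f = g"
  unfolding inv0_def by (rule the_equality, rule assms(4)) (rule inverse0_unique[OF assms(1-3) _ assms(4)])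

lemma inverse0_sym: "inverse0 V A a b f g \<Longrightarrow> inverse0 V A b a g f"
  by (simp add: inverse0_iff)

lemma inverse0_id:
  assumes A: "enriched_category V A" and "a \<in> VOb A"
  shows "inverse0 V A a a (VId A a) (VId A a)"
  using ecomp_idn(1)[OF A idn_el[OF enriched_pre[OF A]], of a] assms VId_ty[OF enriched_pre[OF A]]
  by (simp add: inverse0_iff idn_def)

lemma inverse0_comp0:
  assumes A: "enriched_category V A" and ob: "a \<in> VOb A" "b \<in> VOb A" "c \<in> VOb A"
    and i: "inverse0 V A a b f f'" "inverse0 V A b c g g'"
  shows "inverse0 V A a c (comp0 V A a b c g f) (comp0 V A c b a f' g')"
proof -
  note P = enriched_pre[OF A]
  have t: "el A (a, b, {}, f) = El a b {}" "el A (b, a, {}, f') = El b a {}" "el A (b, c, {}, g) = El b c {}"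
    "el A (c, b, {}, g') = El c b {}"
    using i ob by (auto simp: inverse0_iff el_const)
  have i': "(b, a, {}, f') \<odot>[A] (a, b, {}, f) = idn A a" "(a, b, {}, f) \<odot>[A] (b, a, {}, f') = idn A b"
    "(c, b, {}, g') \<odot>[A] (b, c, {}, g) = idn A b" "(b, c, {}, g) \<odot>[A] (c, b, {}, g') = idn A c"
    using i by (auto simp: inverse0_iff)
  have c: "el A ((b, c, {}, g) \<odot>[A] (a, b, {}, f)) = El a c {}" "el A ((b, a, {}, f') \<odot>[A] (c, b, {}, g')) = El c a {}"
    using ecomp_el[OF P t(3,1)] ecomp_el[OF P t(2,4)] by simp_all
  have "((b, a, {}, f') \<odot>[A] (c, b, {}, g')) \<odot>[A] ((b, c, {}, g) \<odot>[A] (a, b, {}, f)) = idn A a"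
    using ecomp_assoc[OF A t(2,4) c(1)] ecomp_assoc[OF A t(4,3,1)] ecomp_idn[OF A t(1)] i' by simp
  moreover have "((b, c, {}, g) \<odot>[A] (a, b, {}, f)) \<odot>[A] ((b, a, {}, f') \<odot>[A] (c, b, {}, g')) = idn A c"
    using ecomp_assoc[OF A t(3,1) c(2)] ecomp_assoc[OF A t(1,2,4)] ecomp_idn[OF A t(4)] i' by simp
  ultimately show ?thesis using c
    by (auto simp: inverse0_iff ecomp_comp0 el_tuple tn_simps)
qed

text \<open>Composing the square with both inverses reverses two of its sides. In this form
  naturality passes to inverse families, which is needed for right faces, where the arrows of
  algebras run backwards.\<close>

lemma square_inverse:
  assumes A: "enriched_category V A" and x: "el A x = El a a' S" and y: "el A y = El b b' S"
    and i: "inverse0 V A a b f g" and i': "inverse0 V A a' b' f' g'"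
    and sq: "(a', b', {}, f') \<odot>[A] x = y \<odot>[A] (a, b, {}, f)"
  shows "(b', a', {}, g') \<odot>[A] y = x \<odot>[A] (b, a, {}, g)"
proof -
  note ob = el_obs[OF x] el_obs[OF y]
  note i = i[unfolded inverse0_iff] and i' = i'[unfolded inverse0_iff]
  have e: "el A (a, b, {}, f) = El a b {}" "el A (b, a, {}, g) = El b a {}"
    "el A (a', b', {}, f') = El a' b' {}" "el A (b', a', {}, g') = El b' a' {}"
    using i i' ob by (auto intro: el_const)
  have "(b', a', {}, g') \<odot>[A] y = (b', a', {}, g') \<odot>[A] (y \<odot>[A] idn A b)" using ecomp_idn[OF A y] by simp
  also have "\<dots> = (b', a', {}, g') \<odot>[A] ((y \<odot>[A] (a, b, {}, f)) \<odot>[A] (b, a, {}, g))"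
    using i ecomp_assoc[OF A y e(1,2)] by simp
  also have "\<dots> = (b', a', {}, g') \<odot>[A] ((a', b', {}, f') \<odot>[A] (x \<odot>[A] (b, a, {}, g)))"
    unfolding sq[symmetric] using ecomp_assoc[OF A e(3) x e(2)] by simp
  also have "\<dots> = x \<odot>[A] (b, a, {}, g)"
    using ecomp_el[OF enriched_pre[OF A] x e(2)] ecomp_assoc[OF A e(4,3) ecomp_el[OF enriched_pre[OF A] x e(2)]] i'
      ecomp_idn[OF A ecomp_el[OF enriched_pre[OF A] x e(2)]] by simp
  finally show ?thesis .
qed

lemma vnatural_inverse:
  assumes F: "enriched_functor V A B F" and G: "enriched_functor V A B G" and n: "vnatural V A B F G \<phi>"
    and ext: "\<psi> \<in> extensional (VOb A)"
    and i: "\<And>a. a \<in> VOb A \<Longrightarrow> inverse0 V B (FOb F a) (FOb G a) (\<phi> a) (\<psi> a)"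
  shows "vnatural V A B G F \<psi>"
proof (rule vnaturalI[OF G F gvar_cover ext])
  have A: "enriched_category V A" and B: "enriched_category V B" using F enr_functor_cats by auto
  show PA: "pre_enriched A" using A enriched_pre by auto
  show t: "el B (nt G F \<psi> a) = El (FOb G a) (FOb F a) {}" if "a \<in> VOb A" for a
    using i[OF that] that by (auto simp: inverse0_iff nt_def FOb_ob[OF F] FOb_ob[OF G] intro: el_const)
  fix a b assume ob: "a \<in> VOb A" "b \<in> VOb A"
  note x = gvar_el[OF PA ob, of 0]
  show "nt G F \<psi> b \<odot>[B] fap G (gvar A 0 a b) = fap F (gvar A 0 a b) \<odot>[B] nt G F \<psi> a"
    using square_inverse[OF B fap_el[OF F x] fap_el[OF G x] i[OF ob(1)] i[OF ob(2)]] vnaturalD[OF n F G x] by (simp add: nt_def)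
qed

text \<open>Pointwise inverses are automatically natural by \<open>vnatural_inverse\<close>, so they
  may be chosen independently of each other.\<close>

lemma vnatural_isoI:
  assumes F: "enriched_functor V A B F" and G: "enriched_functor V A B G" and n: "vnatural V A B F G \<phi>"
    and i: "\<And>a. a \<in> VOb A \<Longrightarrow> \<exists>g. inverse0 V B (FOb F a) (FOb G a) (\<phi> a) g"
  shows "vnatural_iso V A B F G \<phi>"
proof -
  obtain g where g: "\<And>a. a \<in> VOb A \<Longrightarrow> inverse0 V B (FOb F a) (FOb G a) (\<phi> a) (g a)" using i by metis
  have "vnatural V A B G F (restrict g (VOb A))"
    by (rule vnatural_inverse[OF F G n]) (simp_all add: g)
  then show ?thesis unfolding vnatural_iso_def using n g by (intro conjI exI[of _ "restrict g (VOb A)"]) simp_all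
qed

lemma vnatural_iso_inv0:
  assumes "vnatural_iso V A B F G \<phi>" "enriched_functor V A B F" "enriched_functor V A B G" "a \<in> VOb A"
  shows "inverse0 V B (FOb F a) (FOb G a) (\<phi> a) (inv0 V B (FOb F a) (FOb G a) (\<phi> a))"
proof -
  obtain g where g: "inverse0 V B (FOb F a) (FOb G a) (\<phi> a) g"
    using assms(1,4) unfolding vnatural_iso_def by blast
  then show ?thesis
    using inv0_eq[OF enr_functor_cats(2)[OF assms(2)] FOb_ob[OF assms(2,4)] FOb_ob[OF assms(3,4)] g] by simp
qed

end

section \<open>Cotensors\<close>

context symmetric_monoidal_closed_category
begin

lemma curry:
  assumes "a \<in> Ob V" "b \<in> Ob V" "ty f = Arr (c \<otimes> a) b" "c \<in> Ob V"
  shows "ty (curry V c a b f) = Arr c (ihom V a b)" "ev V a b \<cdot> (curry V c a b f \<boxtimes> \<iota> a) = f"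
    "ty g = Arr c (ihom V a b) \<Longrightarrow> ev V a b \<cdot> (g \<boxtimes> \<iota> a) = f \<Longrightarrow> g = curry V c a b f"
proof -
  have u: "\<exists>!g. g \<in> hom V c (ihom V a b) \<and> ev V a b \<cdot> (g \<boxtimes> \<iota> a) = f"
    using ev_universal[OF assms(1,2,4)] assms(3) by (simp add: hom_ty)
  note c = theI'[OF u, folded curry_def]
  show "ty (curry V c a b f) = Arr c (ihom V a b)" "ev V a b \<cdot> (curry V c a b f \<boxtimes> \<iota> a) = f"
    using c by (simp_all add: hom_ty)
  show "ty g = Arr c (ihom V a b) \<Longrightarrow> ev V a b \<cdot> (g \<boxtimes> \<iota> a) = f \<Longrightarrow> g = curry V c a b f"
    using u c unfolding hom_ty by blast
qed

text \<open>The Yoneda argument: the preimage of the identity of b is a right inverse t of f, and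
  uniqueness of the preimage of f forces \<open>t \<cdot> f\<close> to be the identity.\<close>

lemma iso_iff_bij:
  assumes "ty f = Arr a b"
  shows "iso f \<longleftrightarrow> (\<forall>X \<in> Ob V. \<forall>u. ty u = Arr X b \<longrightarrow> (\<exists>!t. ty t = Arr X a \<and> f \<cdot> t = u))"
proof (intro iffI ballI allI impI)
  fix X u assume i: "iso f" and u: "ty u = Arr X b"
  show "\<exists>!t. ty t = Arr X a \<and> f \<cdot> t = u"
  proof (rule ex1I[of _ "inv f \<cdot> u"])
    show "ty (inv f \<cdot> u) = Arr X a \<and> f \<cdot> inv f \<cdot> u = u" using i u assms by (simp add: mon_ty inv_simps)
    show "t = inv f \<cdot> u" if "ty t = Arr X a \<and> f \<cdot> t = u" for t
      using that i assms inv_move_left by blast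
  qed
next
  assume h: "\<forall>X \<in> Ob V. \<forall>u. ty u = Arr X b \<longrightarrow> (\<exists>!t. ty t = Arr X a \<and> f \<cdot> t = u)"
  have o: "a \<in> Ob V" "b \<in> Ob V" using ty_obs[OF assms] .
  then have "\<exists>!t. ty t = Arr b a \<and> f \<cdot> t = \<iota> b" using h by (simp add: mon_ty)
  then obtain t where t: "ty t = Arr b a" "f \<cdot> t = \<iota> b" by blast
  have "\<exists>!u. ty u = Arr a a \<and> f \<cdot> u = f" using h o assms by blast
  moreover have "ty (t \<cdot> f) = Arr a a \<and> f \<cdot> t \<cdot> f = f"
    using t assms o by (simp add: mon_ty comp_assoc[symmetric])
  moreover have "ty (\<iota> a) = Arr a a \<and> f \<cdot> \<iota> a = f" using assms o by (simp add: mon_ty)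
  ultimately have "t \<cdot> f = \<iota> a" by blast
  then show "iso f" using isoI(1)[OF assms t(1)] t by blast
qed

text \<open>By \<open>key\<close>, composing with the comparison arrow and transposing back is
  composing with \<gamma>. Hence bijectivity of the one operation is bijectivity of the other, and
  internal homs disappear from the condition.\<close>

lemma cot_iff_hom:
  assumes P: "pre_enriched A" and j: "j \<in> Ob V"
  shows "is_cotensor V A j x p \<gamma> \<longleftrightarrow> x \<in> VOb A \<and> p \<in> VOb A \<and> ty \<gamma> = Arr j (VHom A p x) \<and>
    (\<forall>y \<in> VOb A. \<forall>X \<in> Ob V. \<forall>r. ty r = Arr (X \<otimes> j) (VHom A y x) \<longrightarrow>
      (\<exists>!t. ty t = Arr X (VHom A y p) \<and> VCmp A y p x \<cdot> (\<gamma> \<boxtimes> t) \<cdot> \<beta> X j = r))"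
proof -
  have "iso (curry V (VHom A y p) j (VHom A y x) (VCmp A y p x \<cdot> (\<gamma> \<boxtimes> \<iota> (VHom A y p)) \<cdot> \<beta> (VHom A y p) j))
     \<longleftrightarrow> (\<forall>X \<in> Ob V. \<forall>r. ty r = Arr (X \<otimes> j) (VHom A y x) \<longrightarrow>
      (\<exists>!t. ty t = Arr X (VHom A y p) \<and> VCmp A y p x \<cdot> (\<gamma> \<boxtimes> t) \<cdot> \<beta> X j = r))"
    (is "iso ?c \<longleftrightarrow> ?R")
    if x: "x \<in> VOb A" "p \<in> VOb A" "ty \<gamma> = Arr j (VHom A p x)" "y \<in> VOb A" for y
  proof -
    let ?k = "VCmp A y p x \<cdot> (\<gamma> \<boxtimes> \<iota> (VHom A y p)) \<cdot> \<beta> (VHom A y p) j"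
    note o = VHom_ob[OF P x(4) x(1)] VHom_ob[OF P x(4) x(2)] VHom_ob[OF P x(2) x(1)] j
    have k: "ty ?k = Arr (VHom A y p \<otimes> j) (VHom A y x)" using x o P by (simp add: mon_ty VCmp_ty)
    note c = curry[OF j o(1) k o(2)]
    have key: "ev V j (VHom A y x) \<cdot> ((?c \<cdot> t) \<boxtimes> \<iota> j) = VCmp A y p x \<cdot> (\<gamma> \<boxtimes> t) \<cdot> \<beta> X j"
      if t: "ty t = Arr X (VHom A y p)" for t X
    proof -
      have "ev V j (VHom A y x) \<cdot> ((?c \<cdot> t) \<boxtimes> \<iota> j) = (ev V j (VHom A y x) \<cdot> (?c \<boxtimes> \<iota> j)) \<cdot> (t \<boxtimes> \<iota> j)"
        using t c(1) o by (simp add: comp_assoc tensor_comp mon_ty)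
      also have "\<dots> = VCmp A y p x \<cdot> (\<gamma> \<boxtimes> t) \<cdot> \<beta> X j"
        unfolding c(2) using t o x P ty_obs[OF t]
        by (simp add: comp_assoc tensor_comp2 mon_ty braid_nat VCmp_ty)
      finally show ?thesis .
    qed
    have eq: "(ty t = Arr X (VHom A y p) \<and> VCmp A y p x \<cdot> (\<gamma> \<boxtimes> t) \<cdot> \<beta> X j = r) \<longleftrightarrow>
        (ty t = Arr X (VHom A y p) \<and> ?c \<cdot> t = curry V X j (VHom A y x) r)"
      if r: "ty r = Arr (X \<otimes> j) (VHom A y x)" and X: "X \<in> Ob V" for r X t
      using key[of t X] curry(2)[OF j o(1) r X] curry(3)[OF j o(1) r X, of "?c \<cdot> t"] c(1)
      by (auto simp: mon_ty)
    have "iso ?c \<longleftrightarrow> (\<forall>X \<in> Ob V. \<forall>u. ty u = Arr X (ihom V j (VHom A y x)) \<longrightarrow> (\<exists>!t. ty t = Arr X (VHom A y p) \<and> ?c \<cdot> t = u))"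
      by (rule iso_iff_bij[OF c(1)])
    also have "\<dots> \<longleftrightarrow> ?R"
    proof (intro iffI ballI allI impI)
      fix X r assume h: "\<forall>X\<in>Ob V. \<forall>u. ty u = Arr X (ihom V j (VHom A y x)) \<longrightarrow> (\<exists>!t. ty t = Arr X (VHom A y p) \<and> ?c \<cdot> t = u)"
        and X: "X \<in> Ob V" and r: "ty r = Arr (X \<otimes> j) (VHom A y x)"
      show "\<exists>!t. ty t = Arr X (VHom A y p) \<and> VCmp A y p x \<cdot> (\<gamma> \<boxtimes> t) \<cdot> \<beta> X j = r"
        unfolding eq[OF r X] using h X curry(1)[OF j o(1) r X] by blast
    next
      fix X u assume h: ?R and X: "X \<in> Ob V" and u: "ty u = Arr X (ihom V j (VHom A y x))"
      let ?r = "ev V j (VHom A y x) \<cdot> (u \<boxtimes> \<iota> j)"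
      have r: "ty ?r = Arr (X \<otimes> j) (VHom A y x)" using u o by (simp add: mon_ty)
      have "u = curry V X j (VHom A y x) ?r" by (rule curry(3)[OF j o(1) r X u]) simp
      then show "\<exists>!t. ty t = Arr X (VHom A y p) \<and> ?c \<cdot> t = u"
        using h X r eq[OF r X] by metis
    qed
    finally show ?thesis .
  qed
  then show ?thesis unfolding is_cotensor_def hom_ty by blast
qed

lemma gen_ecomp:
  assumes P: "pre_enriched A" and U: "stage U" "ty i = Arr (tn U) j" and g: "ty \<gamma> = Arr j (VHom A p x)"
    and t: "ty t = Arr X (VHom A y p)" and w: "ty w = Arr (tn S) X" "stage S" "S \<inter> U = {}"
    and ob: "x \<in> VOb A" "p \<in> VOb A" "y \<in> VOb A"
  shows "(p, x, U, \<gamma> \<cdot> i) \<odot>[A] (y, p, S, t \<cdot> w) = (y, x, U \<union> S, (VCmp A y p x \<cdot> (\<gamma> \<boxtimes> t) \<cdot> \<beta> X j) \<cdot> pr S U w i)"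
proof -
  have d: "U \<inter> S = {}" using w by auto
  have o: "X \<in> Ob V" "j \<in> Ob V" using ty_obs[OF t] ty_obs[OF g] by auto
  show ?thesis using assms d o
    by (simp add: ecomp_def comp_assoc mon_ty VCmp_ty VHom_ob pr_ty pr_comm pr_comp Un_commute)
qed

text \<open>The stage \<open>U\<close> and the isomorphism \<open>i : tn U \<rightarrow> j\<close> provide a generic element of \<open>j\<close>.\<close>

lemma cot_iff_el:
  assumes P: "pre_enriched A" and U: "stage U" "ty i = Arr (tn U) j" "iso i" and W: "finite W"
  shows "is_cotensor V A j x p \<gamma> \<longleftrightarrow> x \<in> VOb A \<and> p \<in> VOb A \<and> ty \<gamma> = Arr j (VHom A p x) \<and>
    (\<forall>y S h. S \<inter> U = {} \<longrightarrow> S \<inter> W = {} \<longrightarrow> el A h = El y x (U \<union> S) \<longrightarrow>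
      (\<exists>!g. el A g = El y p S \<and> (p, x, U, \<gamma> \<cdot> i) \<odot>[A] g = h))"
proof -
  let ?z = "(p, x, U, \<gamma> \<cdot> i)"
  have j: "j \<in> Ob V" using ty_obs[OF U(2)] by simp
  show ?thesis
    unfolding cot_iff_hom[OF P j]
  proof (intro iffI conjI allI impI ballI; (elim conjE)?)
    fix y S h
    assume ob: "x \<in> VOb A" "p \<in> VOb A" and \<gamma>: "ty \<gamma> = Arr j (VHom A p x)"
      and H: "\<forall>y\<in>VOb A. \<forall>X\<in>Ob V. \<forall>r. ty r = Arr (X \<otimes> j) (VHom A y x) \<longrightarrow>
         (\<exists>!t. ty t = Arr X (VHom A y p) \<and> VCmp A y p x \<cdot> (\<gamma> \<boxtimes> t) \<cdot> \<beta> X j = r)"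
      and d: "S \<inter> U = {}" and h: "el A h = El y x (U \<union> S)"
    obtain f where f: "h = (y, x, U \<union> S, f)" "y \<in> VOb A" "stage (U \<union> S)" "ty f = Arr (tn (U \<union> S)) (VHom A y x)"
      using h by (rule elE)
    have S: "stage S" "tn S \<in> Ob V" using f(3) by (simp_all add: stage_simps tn_ob)
    \<comment> \<open>As i is invertible, \<open>?c\<close> identifies the stage U \<union> S with
      \<open>tn S \<otimes> j\<close>. The arrow of h then corresponds to the arrow r of
      \<open>cot_iff_hom\<close>.\<close>
    let ?c = "pr S U (\<iota> (tn S)) i"
    have c: "ty ?c = Arr (tn (U \<union> S)) (tn S \<otimes> j)" "iso ?c"
      using S U d by (simp_all add: pr_ty pr_iso mon_ty Un_commute)
    have "ty (f \<cdot> inv ?c) = Arr (tn S \<otimes> j) (VHom A y x)" using f c by (simp add: mon_ty)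
    then have ex: "\<exists>!t. ty t = Arr (tn S) (VHom A y p) \<and> VCmp A y p x \<cdot> (\<gamma> \<boxtimes> t) \<cdot> \<beta> (tn S) j = f \<cdot> inv ?c"
      using H f(2) S by blast
    have key: "el A (y', p', S', t) = El y p S \<and> ?z \<odot>[A] (y', p', S', t) = h \<longleftrightarrow>
        y' = y \<and> p' = p \<and> S' = S \<and> ty t = Arr (tn S) (VHom A y p) \<and> VCmp A y p x \<cdot> (\<gamma> \<boxtimes> t) \<cdot> \<beta> (tn S) j = f \<cdot> inv ?c"
      for y' p' S' t
    proof -
      have "?z \<odot>[A] (y, p, S, t) = h \<longleftrightarrow> VCmp A y p x \<cdot> (\<gamma> \<boxtimes> t) \<cdot> \<beta> (tn S) j = f \<cdot> inv ?c"
        if t: "ty t = Arr (tn S) (VHom A y p)"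
      proof -
        let ?k = "VCmp A y p x \<cdot> (\<gamma> \<boxtimes> t) \<cdot> \<beta> (tn S) j"
        have k: "ty ?k = Arr (tn S \<otimes> j) (VHom A y x)" using t \<gamma> S P ob f j by (simp add: mon_ty VCmp_ty)
        have "?z \<odot>[A] (y, p, S, t \<cdot> \<iota> (tn S)) = (y, x, U \<union> S, ?k \<cdot> ?c)"
          by (rule gen_ecomp[OF P U(1,2) \<gamma> t _ S(1) d ob f(2)]) (simp add: S mon_ty)
        moreover have "?k \<cdot> ?c = f \<longleftrightarrow> ?k = f \<cdot> inv ?c"
        proof
          show "?k \<cdot> ?c = f \<Longrightarrow> ?k = f \<cdot> inv ?c" using inv_move_right[OF _ c(2,1) k] by blast
          show "?k = f \<cdot> inv ?c \<Longrightarrow> ?k \<cdot> ?c = f" using c f by (simp add: comp_assoc inv_ty inv_simps comp_ident)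
        qed
        ultimately show ?thesis using t f by (simp add: comp_ident)
      qed
      then show ?thesis using S f ob by (auto simp: el_tuple)
    qed
    show "\<exists>!g. el A g = El y p S \<and> ?z \<odot>[A] g = h"
    proof -
      obtain t where t: "ty t = Arr (tn S) (VHom A y p) \<and> VCmp A y p x \<cdot> (\<gamma> \<boxtimes> t) \<cdot> \<beta> (tn S) j = f \<cdot> inv ?c"
        using ex by blast
      show ?thesis
      proof (rule ex1I[of _ "(y, p, S, t)"])
        show "el A (y, p, S, t) = El y p S \<and> ?z \<odot>[A] (y, p, S, t) = h" using t key by blast
        fix g assume g: "el A g = El y p S \<and> ?z \<odot>[A] g = h"
        obtain y' p' S' t' where "g = (y', p', S', t')" by (cases g) auto
        then show "g = (y, p, S, t)" using g key[of y' p' S' t'] t ex by auto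
      qed
    qed
  next
    fix y X r
    assume ob: "x \<in> VOb A" "p \<in> VOb A" and \<gamma>: "ty \<gamma> = Arr j (VHom A p x)"
      and H: "\<forall>y S h. S \<inter> U = {} \<longrightarrow> S \<inter> W = {} \<longrightarrow> el A h = El y x (U \<union> S) \<longrightarrow>
           (\<exists>!g. el A g = El y p S \<and> ?z \<odot>[A] g = h)"
      and y: "y \<in> VOb A" and X: "X \<in> Ob V" and r: "ty r = Arr (X \<otimes> j) (VHom A y x)"
    have "finite {n. (X, n) \<in> U \<union> W}"
      using stage_slist(2)[OF U(1)] W finite_vimageI[of "U \<union> W" "Pair X"] by (simp add: vimage_def inj_on_def)
    \<comment> \<open>A fresh number keeps the generic element of X away from U and from the
      forbidden labels W.\<close>
    then obtain n :: nat where n: "(X, n) \<notin> U \<union> W" using ex_new_if_finite[of "{n. (X, n) \<in> U \<union> W}"] by auto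
    let ?S = "{(X, n)}" and ?v = "var (X, n)"
    have v: "ty ?v = Arr (tn ?S) X" "iso ?v" using var_ty[of "(X, n)"] var_iso[of "(X, n)"] X by simp_all
    have S: "stage ?S" "?S \<inter> U = {}" "?S \<inter> W = {}" using X n by (simp_all add: stage_simps)
    let ?c = "pr ?S U ?v i"
    have "ty ?c = Arr (tn (?S \<union> U)) (X \<otimes> j)" by (rule pr_ty[OF v(1) U(2) S(1) U(1) S(2)])
    then have c: "ty ?c = Arr (tn (U \<union> ?S)) (X \<otimes> j)" by (simp add: Un_commute)
    have ci: "iso ?c" by (rule pr_iso[OF v(1) U(2) S(1) U(1) S(2) v(2) U(3)])
    let ?h = "(y, x, U \<union> ?S, r \<cdot> ?c)"
    have h: "el A ?h = El y x (U \<union> ?S)" using c r y ob S U by (simp only: el_tuple stage_simps) (simp add: mon_ty)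
    have eq: "?z \<odot>[A] (y, p, ?S, t \<cdot> ?v) = ?h \<longleftrightarrow> VCmp A y p x \<cdot> (\<gamma> \<boxtimes> t) \<cdot> \<beta> X j = r"
      if t: "ty t = Arr X (VHom A y p)" for t
    proof -
      have "(VCmp A y p x \<cdot> (\<gamma> \<boxtimes> t) \<cdot> \<beta> X j) \<cdot> ?c = r \<cdot> ?c \<longleftrightarrow> VCmp A y p x \<cdot> (\<gamma> \<boxtimes> t) \<cdot> \<beta> X j = r"
        using iso_cancel_right[of "VCmp A y p x \<cdot> (\<gamma> \<boxtimes> t) \<cdot> \<beta> X j" ?c r, OF _ ci c] t \<gamma> P ob y r X j
        by (auto simp: mon_ty VCmp_ty)
      then show ?thesis unfolding gen_ecomp[OF P U(1,2) \<gamma> t v(1) S(1,2) ob y] by simp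
    qed
    have elt: "el A (y, p, ?S, t \<cdot> ?v) = El y p ?S" if "ty t = Arr X (VHom A y p)" for t
      using that v ob y S by (simp add: el_tuple mon_ty)
    have ex: "\<exists>!g. el A g = El y p ?S \<and> ?z \<odot>[A] g = ?h"
      by (rule H[rule_format, OF S(2,3) h])
    then obtain g where g: "el A g = El y p ?S" "?z \<odot>[A] g = ?h" by (elim ex1E conjE)
    obtain t where t: "g = (y, p, ?S, t)" "ty t = Arr (tn ?S) (VHom A y p)" using g(1) by (rule elE)
    have t': "(t \<cdot> inv ?v) \<cdot> ?v = t" "ty (t \<cdot> inv ?v) = Arr X (VHom A y p)"
      using t v by (simp_all add: comp_assoc mon_ty inv_simps)
    show "\<exists>!t. ty t = Arr X (VHom A y p) \<and> VCmp A y p x \<cdot> (\<gamma> \<boxtimes> t) \<cdot> \<beta> X j = r"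
    proof (rule ex1I[of _ "t \<cdot> inv ?v"])
      show "ty (t \<cdot> inv ?v) = Arr X (VHom A y p) \<and> VCmp A y p x \<cdot> (\<gamma> \<boxtimes> (t \<cdot> inv ?v)) \<cdot> \<beta> X j = r"
        using eq[OF t'(2)] t' g(2) t(1) by simp
      fix u assume u: "ty u = Arr X (VHom A y p) \<and> VCmp A y p x \<cdot> (\<gamma> \<boxtimes> u) \<cdot> \<beta> X j = r"
      then have "el A (y, p, ?S, u \<cdot> ?v) = El y p ?S \<and> ?z \<odot>[A] (y, p, ?S, u \<cdot> ?v) = ?h"
        using elt[of u] eq[of u] by simp
      then have "(y, p, ?S, u \<cdot> ?v) = g" using ex1E[OF ex] g by metis
      then have "u \<cdot> ?v = t" using t by simp
      then show "u = t \<cdot> inv ?v" using inv_move_right[OF _ v(2,1)] u by blast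
    qed
  qed simp_all
qed

text \<open>The element that \<gamma>, an arrow from the object of l to a hom-object, takes at the
  generic element of its domain. Counits of cotensors and structure morphisms are handled in this
  form.\<close>

definition gel :: "'a \<Rightarrow> 'a \<Rightarrow> 'o \<times> nat \<Rightarrow> 'm \<Rightarrow> ('a, 'o, 'm) elt" where
  "gel p x l \<gamma> = (p, x, {l}, \<gamma> \<cdot> var l)"

lemma cot_obs:
  assumes "is_cotensor V A j x p \<gamma>"
  shows "x \<in> VOb A" "p \<in> VOb A" "ty \<gamma> = Arr j (VHom A p x)" "j \<in> Ob V"
  using assms ty_obs(1)[of \<gamma> j "VHom A p x"] by (auto simp: is_cotensor_def hom_ty)

lemma gel_el: "p \<in> VOb A \<Longrightarrow> x \<in> VOb A \<Longrightarrow> ty \<gamma> = Arr (fst l) (VHom A p x) \<Longrightarrow> el A (gel p x l \<gamma>) = El p x {l}"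
  using ty_obs(1)[of \<gamma> "fst l" "VHom A p x"] by (simp add: gel_def el_tuple stage_simps mon_ty var_ty)

lemma gel_inj:
  assumes "gel p x l \<gamma> = gel p x l \<gamma>'" "ty \<gamma> = Arr (fst l) X" "ty \<gamma>' = Arr (fst l) X"
  shows "\<gamma> = \<gamma>'"
  using assms ty_obs(1)[OF assms(2)] iso_cancel_right[of \<gamma> "var l" \<gamma>'] by (simp add: gel_def var_iso var_ty)

lemma fap_gel: "enriched_functor V A B F \<Longrightarrow> p \<in> VOb A \<Longrightarrow> x \<in> VOb A \<Longrightarrow> ty \<gamma> = Arr (fst l) (VHom A p x)
    \<Longrightarrow> fap F (gel p x l \<gamma>) = gel (FOb F p) (FOb F x) l (FHm F p x \<cdot> \<gamma>)"
  using ty_obs(1)[of \<gamma> "fst l" "VHom A p x"]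
  by (simp add: gel_def fap_def comp_assoc FHm_ty var_ty)

lemma cot_lift:
  assumes P: "pre_enriched A" and c: "is_cotensor V A j x p \<gamma>" and l: "fst l = j" "l \<notin> S"
    and h: "el A h = El y x (insert l S)"
  shows "\<exists>!g. el A g = El y p S \<and> gel p x l \<gamma> \<odot>[A] g = h"
proof -
  have "\<forall>y S h. S \<inter> {l} = {} \<longrightarrow> el A h = El y x ({l} \<union> S) \<longrightarrow>
      (\<exists>!g. el A g = El y p S \<and> (p, x, {l}, \<gamma> \<cdot> var l) \<odot>[A] g = h)"
    using c l cot_obs(4)[OF c] cot_iff_el[OF P _ var_ty[of l] var_iso[of l], of "{}" x p \<gamma>] by (simp add: stage_simps)
  moreover have "S \<inter> {l} = {}" "el A h = El y x ({l} \<union> S)" using l h by simp_all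
  ultimately show ?thesis unfolding gel_def by blast
qed

text \<open>The uniqueness half of lifting. Nearly every equation between elements into a cotensor
  below is reduced by it to an equation after composition with the counit at a label outside the
  stage.\<close>

lemma cot_mono:
  assumes P: "pre_enriched A" and c: "is_cotensor V A j x p \<gamma>" and l: "fst l = j" "l \<notin> S"
    and g: "el A g = El y p S" "el A g' = El y p S" and e: "gel p x l \<gamma> \<odot>[A] g = gel p x l \<gamma> \<odot>[A] g'"
  shows "g = g'"
proof -
  have "el A (gel p x l \<gamma> \<odot>[A] g) = El y x (insert l S)"
    using ecomp_el[OF P gel_el g(1)] cot_obs[OF c] l by auto
  from cot_lift[OF P c l this] show ?thesis using g e by metis
qed

text \<open>The labels in W may be excluded from the stages on which lifting is tested, which leaves
  room for the counit of a second cotensor in the same argument.\<close>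

lemma cotI:
  assumes P: "pre_enriched A" and ob: "x \<in> VOb A" "p \<in> VOb A" "ty \<gamma> = Arr (fst l) (VHom A p x)"
    and W: "finite W"
    and H: "\<And>y S h. l \<notin> S \<Longrightarrow> S \<inter> W = {} \<Longrightarrow> el A h = El y x (insert l S) \<Longrightarrow> \<exists>!g. el A g = El y p S \<and> gel p x l \<gamma> \<odot>[A] g = h"
  shows "is_cotensor V A (fst l) x p \<gamma>"
  using cot_iff_el[OF P _ var_ty[of l] var_iso[of l] W, of x p \<gamma>] ob H ty_obs(1)[OF ob(3)]
  by (simp add: gel_def stage_simps)

text \<open>[k \<otimes> j, r] is [j, [k, r]]: a lift through the composite counit is a lift through
  s followed by one through \<gamma>, and in the other direction s is cancelled.\<close>

lemma cot_compose:
  assumes A: "enriched_category V A" and s: "is_cotensor V A k r q s" and \<gamma>: "ty \<gamma> = Arr j (VHom A p q)"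
    and p: "p \<in> VOb A"
  shows "is_cotensor V A (k \<otimes> j) r p (VCmp A p q r \<cdot> (s \<boxtimes> \<gamma>)) \<longleftrightarrow> is_cotensor V A j q p \<gamma>"
proof -
  note P = enriched_pre[OF A]
  note so = cot_obs[OF s]
  have j: "j \<in> Ob V" using ty_obs[OF \<gamma>] by simp
  \<comment> \<open>The numbers 0 and 1 keep the two labels apart when k = j.\<close>
  let ?k = "(k, 0 :: nat)" and ?j = "(j, Suc 0)"
  let ?i = "pr {?k} {?j} (var ?k) (var ?j)"
  have v: "ty (var ?k) = Arr (tn {?k}) k" "ty (var ?j) = Arr (tn {?j}) j" "stage {?k}" "stage {?j}" "{?k} \<inter> {?j} = {}"
    using var_ty[of ?k] var_ty[of ?j] so j by (simp_all add: stage_simps)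
  have i: "ty ?i = Arr (tn {?k, ?j}) (k \<otimes> j)" "iso ?i" "stage {?k, ?j}"
    using pr_ty[OF v] pr_iso[OF v var_iso var_iso] so j by (simp_all add: stage_simps insert_commute)
  let ?s = "gel q r ?k s" and ?g = "gel p q ?j \<gamma>"
  have sg: "(p, r, {?k, ?j}, (VCmp A p q r \<cdot> (s \<boxtimes> \<gamma>)) \<cdot> ?i) = ?s \<odot>[A] ?g"
    using v so \<gamma> p P j pr_ty[OF v] pr_comp[OF v(1,2) so(3) \<gamma> v(3-5)]
    by (simp add: gel_def ecomp_def comp_assoc mon_ty VCmp_ty insert_commute)
  have se: "el A ?s = El q r {?k}" and ge: "el A ?g = El p q {?j}"
    using so \<gamma> p by (simp_all add: gel_el)
  have sgty: "ty (VCmp A p q r \<cdot> (s \<boxtimes> \<gamma>)) = Arr (k \<otimes> j) (VHom A p r)" using so \<gamma> p P by (simp add: mon_ty VCmp_ty)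
  have as: "(?s \<odot>[A] ?g) \<odot>[A] g = ?s \<odot>[A] (?g \<odot>[A] g)" if "el A g = El y p S" "S \<inter> {?k, ?j} = {}" for g y S
    by (rule ecomp_assoc[OF A se ge that(1)]) (use that in auto)
  have ce: "el A (?g \<odot>[A] g) = El y q (insert ?j S)" if "el A g = El y p S" "S \<inter> {?k, ?j} = {}" for g y S
    using ecomp_el[OF P ge that(1)] that by auto
  show ?thesis
  proof
    assume c: "is_cotensor V A (k \<otimes> j) r p (VCmp A p q r \<cdot> (s \<boxtimes> \<gamma>))"
    have "is_cotensor V A (fst ?j) q p \<gamma>"
    proof (rule cotI[OF P so(2) p _ finite.insertI[OF finite.emptyI, of ?k]])
      show "ty \<gamma> = Arr (fst ?j) (VHom A p q)" using \<gamma> by simp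
      fix y S h assume d: "?j \<notin> S" "S \<inter> {?k} = {}" and h: "el A h = El y q (insert ?j S)"
      then have d': "S \<inter> {?k, ?j} = {}" "?k \<notin> insert ?j S" by auto
      have sh: "el A (?s \<odot>[A] h) = El y r ({?k, ?j} \<union> S)" using ecomp_el[OF P se h] d' by (simp add: insert_commute)
      have "\<exists>!g. el A g = El y p S \<and> (?s \<odot>[A] ?g) \<odot>[A] g = ?s \<odot>[A] h"
        using c d'(1) sh unfolding cot_iff_el[OF P i(3,1,2) finite.emptyI] sg by blast
      moreover have "(?s \<odot>[A] ?g) \<odot>[A] g = ?s \<odot>[A] h \<longleftrightarrow> ?g \<odot>[A] g = h" if g: "el A g = El y p S" for g
        unfolding as[OF g d'(1)] using cot_mono[OF P s _ d'(2) ce[OF g d'(1)] h] by auto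
      ultimately show "\<exists>!g. el A g = El y p S \<and> ?g \<odot>[A] g = h" by blast
    qed
    then show "is_cotensor V A j q p \<gamma>" by simp
  next
    assume c: "is_cotensor V A j q p \<gamma>"
    show "is_cotensor V A (k \<otimes> j) r p (VCmp A p q r \<cdot> (s \<boxtimes> \<gamma>))"
      unfolding cot_iff_el[OF P i(3,1,2) finite.emptyI] sg
    proof (intro conjI allI impI)
      fix y S h assume d: "S \<inter> {?k, ?j} = {}" and h: "el A h = El y r ({?k, ?j} \<union> S)"
      have h': "el A h = El y r (insert ?k (insert ?j S))" using h by simp
      have "\<exists>!g. el A g = El y q (insert ?j S) \<and> ?s \<odot>[A] g = h"
        by (rule cot_lift[OF P s _ _ h']) (use d in auto)
      then obtain g1 where g1: "el A g1 = El y q (insert ?j S)" "?s \<odot>[A] g1 = h" by blast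
      have "\<exists>!g. el A g = El y p S \<and> ?g \<odot>[A] g = g1"
        by (rule cot_lift[OF P c _ _ g1(1)]) (use d in auto)
      then obtain g where g: "el A g = El y p S" "?g \<odot>[A] g = g1" by blast
      show "\<exists>!g. el A g = El y p S \<and> (?s \<odot>[A] ?g) \<odot>[A] g = h"
      proof (rule ex1I[of _ g])
        show "el A g = El y p S \<and> (?s \<odot>[A] ?g) \<odot>[A] g = h" using as[OF g(1) d] g g1 by simp
        fix g' assume g': "el A g' = El y p S \<and> (?s \<odot>[A] ?g) \<odot>[A] g' = h"
        then have "?s \<odot>[A] (?g \<odot>[A] g') = ?s \<odot>[A] g1" using as[of g' y S] d g1 by simp
        then have "?g \<odot>[A] g' = g1"
          by (intro cot_mono[OF P s _ _ ce g1(1)]) (use g' d in auto)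
        then show "g' = g" by (intro cot_mono[where l = ?j, OF P c _ _ _ g(1)]) (use g' g d in auto)
      qed
    qed (use so p sgty in auto)
  qed
qed

text \<open>Lifts through the new counit are the old lifts followed by the inverse v of u.\<close>

lemma cot_iso:
  assumes A: "enriched_category V A" and c: "is_cotensor V A j x p \<gamma>" and i: "inverse0 V A p' p u v"
    and p': "p' \<in> VOb A" and \<gamma>': "ty \<gamma>' = Arr j (VHom A p' x)" and l: "fst l = j"
    and e: "gel p' x l \<gamma>' = gel p x l \<gamma> \<odot>[A] (p', p, {}, u)"
  shows "is_cotensor V A j x p' \<gamma>'"
proof -
  note P = enriched_pre[OF A]
  note co = cot_obs[OF c]
  have u: "el A (p', p, {}, u) = El p' p {}" "el A (p, p', {}, v) = El p p' {}"
    "(p', p, {}, u) \<odot>[A] (p, p', {}, v) = idn A p" "(p, p', {}, v) \<odot>[A] (p', p, {}, u) = idn A p'"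
    using i p' co by (auto simp: inverse0_iff intro: el_const)
  have ge: "el A (gel p x l \<gamma>) = El p x {l}" using co l by (simp add: gel_el)
  have as: "gel p' x l \<gamma>' \<odot>[A] g = gel p x l \<gamma> \<odot>[A] ((p', p, {}, u) \<odot>[A] g)"
    if "el A g = El y p' S" "l \<notin> S" for g y S
    unfolding e by (rule ecomp_assoc[OF A ge u(1) that(1)]) (use that in auto)
  have "is_cotensor V A (fst l) x p' \<gamma>'"
  proof (rule cotI[OF P co(1) p' _ finite.emptyI])
    show "ty \<gamma>' = Arr (fst l) (VHom A p' x)" using \<gamma>' l by simp
    fix y S h assume S: "l \<notin> S" and h: "el A h = El y x (insert l S)"
    obtain g where g: "el A g = El y p S" "gel p x l \<gamma> \<odot>[A] g = h" using cot_lift[OF P c l S h] by blast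
    have vg: "el A ((p, p', {}, v) \<odot>[A] g) = El y p' S" using ecomp_el[OF P u(2) g(1)] by simp
    have uvg: "(p', p, {}, u) \<odot>[A] ((p, p', {}, v) \<odot>[A] g) = g"
      using ecomp_assoc[OF A u(1,2) g(1)] u(3) ecomp_idn[OF A g(1)] by simp
    show "\<exists>!g. el A g = El y p' S \<and> gel p' x l \<gamma>' \<odot>[A] g = h"
    proof (rule ex1I[of _ "(p, p', {}, v) \<odot>[A] g"])
      show "el A ((p, p', {}, v) \<odot>[A] g) = El y p' S \<and> gel p' x l \<gamma>' \<odot>[A] ((p, p', {}, v) \<odot>[A] g) = h"
        using vg as[OF vg S] uvg g by simp
      fix g' assume g': "el A g' = El y p' S \<and> gel p' x l \<gamma>' \<odot>[A] g' = h"
      have ug: "el A ((p', p, {}, u) \<odot>[A] g') = El y p S" using ecomp_el[OF P u(1)] g' by fastforce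
      have "(p', p, {}, u) \<odot>[A] g' = g"
        by (rule cot_mono[OF P c l S ug g(1)]) (use as[of g' y S] g' S g in simp)
      then show "g' = (p, p', {}, v) \<odot>[A] g"
        using ecomp_assoc[OF A u(2,1), of g' y S] u(4) ecomp_idn(1)[OF A, of g' y p' S] g' by auto
    qed
  qed
  then show ?thesis using l by simp
qed

text \<open>Each counit is lifted through the other at the empty stage; that the lifts are mutually
  inverse follows by cancelling the counits.\<close>

lemma cot_unique:
  assumes A: "enriched_category V A" and c: "is_cotensor V A j x p \<gamma>" and c': "is_cotensor V A j x p' \<gamma>'"
    and l: "fst l = j"
  shows "\<exists>u v. inverse0 V A p' p u v \<and> gel p' x l \<gamma>' = gel p x l \<gamma> \<odot>[A] (p', p, {}, u)"
proof -
  note P = enriched_pre[OF A]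
  note co = cot_obs[OF c] and co' = cot_obs[OF c']
  have ge: "el A (gel p x l \<gamma>) = El p x {l}" "el A (gel p' x l \<gamma>') = El p' x {l}" using co co' l by (simp_all add: gel_el)
  obtain u where u: "el A u = El p' p {}" "gel p x l \<gamma> \<odot>[A] u = gel p' x l \<gamma>'"
    using cot_lift[OF P c l _ ge(2)] by blast
  obtain v where v: "el A v = El p p' {}" "gel p' x l \<gamma>' \<odot>[A] v = gel p x l \<gamma>"
    using cot_lift[OF P c' l _ ge(1)] by blast
  have uv: "u \<odot>[A] v = idn A p"
  proof (rule cot_mono[OF P c l])
    show "el A (u \<odot>[A] v) = El p p {}" "el A (idn A p) = El p p {}"
      using ecomp_el[OF P u(1) v(1)] idn_el[OF P co(2)] by auto
    show "gel p x l \<gamma> \<odot>[A] (u \<odot>[A] v) = gel p x l \<gamma> \<odot>[A] idn A p"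
      using ecomp_assoc[OF A ge(1) u(1) v(1)] u v ecomp_idn(2)[OF A ge(1)] by simp
  qed simp
  have vu: "v \<odot>[A] u = idn A p'"
  proof (rule cot_mono[OF P c' l])
    show "el A (v \<odot>[A] u) = El p' p' {}" "el A (idn A p') = El p' p' {}"
      using ecomp_el[OF P v(1) u(1)] idn_el[OF P co'(2)] by auto
    show "gel p' x l \<gamma>' \<odot>[A] (v \<odot>[A] u) = gel p' x l \<gamma>' \<odot>[A] idn A p'"
      using ecomp_assoc[OF A ge(2) v(1) u(1)] u v ecomp_idn(2)[OF A ge(2)] by simp
  qed simp
  obtain f where f: "u = (p', p, {}, f)" "ty f = Arr \<one> (VHom A p' p)" using u(1) by (auto elim: elE simp: tn_simps)
  obtain g where g: "v = (p, p', {}, g)" "ty g = Arr \<one> (VHom A p p')" using v(1) by (auto elim: elE simp: tn_simps)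
  show ?thesis
    by (intro exI[of _ f] exI[of _ g]) (use f g u uv vu in \<open>simp add: inverse0_iff\<close>)
qed

end

section \<open>Theories\<close>

context symmetric_monoidal_closed_category
begin

lemma vfun_eqI_gvar:
  assumes F: "enriched_functor V A B F" and G: "enriched_functor V A B G"
    and ob: "\<And>a. a \<in> VOb A \<Longrightarrow> FOb F a = FOb G a"
    and ar: "\<And>a b. a \<in> VOb A \<Longrightarrow> b \<in> VOb A \<Longrightarrow> fap F (gvar A 0 a b) = fap G (gvar A 0 a b)"
  shows "F = G"
proof (rule vfun_eqI[OF F G ob])
  fix a b assume o: "a \<in> VOb A" "b \<in> VOb A"
  note P = enriched_pre[OF enr_functor_cats(1)[OF F]]
  have "FHm F a b \<cdot> var (VHom A a b, 0) = FHm G a b \<cdot> var (VHom A a b, 0)"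
    using ar[OF o] by (simp add: fap_def gvar_def)
  then show "FHm F a b = FHm G a b"
    by (rule iso_cancel_right) (use o ob FHm_ty[OF F o] FHm_ty[OF G o] VHom_ob[OF P o] var_iso[of "(VHom A a b, 0)"] var_ty[of "(VHom A a b, 0)"] in simp_all)
qed simp

end

context system_of_arities
begin

abbreviation Aop :: "('o, 'o, 'm) vcat" where "Aop \<equiv> arity_op V J"

lemma J_ob: "j \<in> J \<Longrightarrow> j \<in> Ob V"
  using J_Ob by blast

text \<open>A functor out of a category whose objects are cotensors of \<open>I\<close> preserves all cotensors as soon
  as it preserves the given ones: if \<open>p = [j, x]\<close> and \<open>x = [x, I]\<close>, then \<open>p = [x \<otimes> j, I]\<close>.\<close>

lemma preserves_from_structure:
  assumes T: "enriched_category V T" "VOb T = J"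
    and s: "\<And>j. j \<in> J \<Longrightarrow> is_cotensor V T j \<one> j (s j)"
    and F: "enriched_functor V T C F"
    and Fs: "\<And>j. j \<in> J \<Longrightarrow> is_cotensor V C j (FOb F \<one>) (FOb F j) (FHm F j \<one> \<cdot> s j)"
  shows "preserves_cotensors V J T C F"
  unfolding preserves_cotensors_def
proof (intro ballI allI impI)
  fix j x p \<gamma> assume j: "j \<in> J" and c: "is_cotensor V T j x p \<gamma>"
  note P = enriched_pre[OF T(1)]
  have C: "enriched_category V C" using enr_functor_cats[OF F] by simp
  note co = cot_obs[OF c]
  have x: "x \<in> J" and p: "p \<in> J" using co T by auto
  have xj: "x \<otimes> j \<in> J" using x j by (rule J_tensor)
  let ?g = "VCmp T p x \<one> \<cdot> (s x \<boxtimes> \<gamma>)" and ?l = "(x \<otimes> j, 0 :: nat)"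
  note sx = cot_obs[OF s[OF x]] and sxj = cot_obs[OF s[OF xj]]
  have g: "is_cotensor V T (x \<otimes> j) \<one> p ?g"
    using cot_compose[OF T(1) s[OF x] co(3,2)] c by simp
  \<comment> \<open>Both p, with counit \<open>?g\<close>, and x \<otimes> j, with its given counit,
    are cotensors of I by x \<otimes> j in T. The resulting isomorphism is carried by F, so the
    image of p is a cotensor because that of x \<otimes> j is.\<close>
  obtain u v where uv: "inverse0 V T p (x \<otimes> j) u v" "gel p \<one> ?l ?g = gel (x \<otimes> j) \<one> ?l (s (x \<otimes> j)) \<odot>[T] (p, x \<otimes> j, {}, u)"
    using cot_unique[OF T(1) s[OF xj] g, of ?l] by auto
  note go = cot_obs[OF g]
  have u: "el T (p, x \<otimes> j, {}, u) = El p (x \<otimes> j) {}" "el T (x \<otimes> j, p, {}, v) = El (x \<otimes> j) p {}"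
    using uv(1) p xj T by (auto simp: inverse0_iff intro: el_const)
  have Fg: "is_cotensor V C (x \<otimes> j) (FOb F \<one>) (FOb F p) (FHm F p \<one> \<cdot> ?g)"
  proof (rule cot_iso[OF C Fs[OF xj], where l = ?l])
    show "inverse0 V C (FOb F p) (FOb F (x \<otimes> j)) (FHm F p (x \<otimes> j) \<cdot> u) (FHm F (x \<otimes> j) p \<cdot> v)"
      using arg_cong[of _ _ "fap F", OF conjunct1[OF uv(1)[unfolded inverse0_iff, THEN conjunct2, THEN conjunct2]]]
        arg_cong[of _ _ "fap F", OF conjunct2[OF uv(1)[unfolded inverse0_iff, THEN conjunct2, THEN conjunct2]]]
        fap_ecomp[OF F u] fap_ecomp[OF F u(2,1)] fap_idn[OF F] uv(1) p xj T(2) FHm_ty[OF F] FOb_ob[OF F]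
      by (simp add: inverse0_iff fap_def mon_ty)
    show "gel (FOb F p) (FOb F \<one>) ?l (FHm F p \<one> \<cdot> ?g) = gel (FOb F (x \<otimes> j)) (FOb F \<one>) ?l (FHm F (x \<otimes> j) \<one> \<cdot> s (x \<otimes> j)) \<odot>[C] (FOb F p, FOb F (x \<otimes> j), {}, FHm F p (x \<otimes> j) \<cdot> u)"
    proof -
      have sg: "el T (gel (x \<otimes> j) \<one> ?l (s (x \<otimes> j))) = El (x \<otimes> j) \<one> {?l}"
        by (rule gel_el) (use sxj in simp_all)
      have "gel (FOb F p) (FOb F \<one>) ?l (FHm F p \<one> \<cdot> ?g) = fap F (gel p \<one> ?l ?g)"
        using go by (simp add: fap_gel[OF F])
      also have "\<dots> = fap F (gel (x \<otimes> j) \<one> ?l (s (x \<otimes> j))) \<odot>[C] fap F (p, x \<otimes> j, {}, u)"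
        unfolding uv(2) by (rule fap_ecomp[OF F sg u(1)]) simp
      finally show ?thesis using sxj by (simp add: fap_gel[OF F]) (simp add: fap_def)
    qed
  qed (use p T FOb_ob[OF F] FHm_ty[OF F] go in \<open>simp_all add: mon_ty\<close>)
  \<comment> \<open>Functoriality splits the image of \<open>?g\<close> into the images of
    \<open>s x\<close> and \<gamma>; \<open>cot_compose\<close> in C then separates the
    latter.\<close>
  have "FHm F p \<one> \<cdot> ?g = (FHm F p \<one> \<cdot> VCmp T p x \<one>) \<cdot> (s x \<boxtimes> \<gamma>)"
    using P co sx p T FHm_ty[OF F] by (simp add: comp_assoc mon_ty VCmp_ty)
  also have "\<dots> = VCmp C (FOb F p) (FOb F x) (FOb F \<one>) \<cdot> ((FHm F x \<one> \<cdot> s x) \<boxtimes> (FHm F p x \<cdot> \<gamma>))"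
    using P co sx p x T FHm_ty[OF F] FOb_ob[OF F] enriched_pre[OF C] enriched_functor.FHm_VCmp[OF F, of p x \<one>]
    by (simp add: comp_assoc mon_ty VCmp_ty tensor_comp)
  finally have "is_cotensor V C (x \<otimes> j) (FOb F \<one>) (FOb F p)
      (VCmp C (FOb F p) (FOb F x) (FOb F \<one>) \<cdot> ((FHm F x \<one> \<cdot> s x) \<boxtimes> (FHm F p x \<cdot> \<gamma>)))"
    using Fg by simp
  then show "is_cotensor V C j (FOb F x) (FOb F p) (FHm F p x \<cdot> \<gamma>)"
    by (subst (asm) cot_compose[OF C Fs[OF x]]) (use co p T FHm_ty[OF F] FOb_ob[OF F] in \<open>simp_all add: mon_ty\<close>)
qed

section \<open>The opposite of the category of arities\<close>

lemma Aop_simps: "VOb Aop = J" "a \<in> J \<Longrightarrow> b \<in> J \<Longrightarrow> VHom Aop a b = ihom V b a"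
  using J_Ob by (auto simp: arity_op_def op_vcat_def full_subcategory_def self_enriched_def)

text \<open>An element of \<open>Aop\<close> from \<open>a\<close> to \<open>b\<close> is applied to an element of \<open>b\<close>, giving one of \<open>a\<close>.\<close>

definition app :: "('o, 'o, 'm) elt \<Rightarrow> ('o \<times> nat) set \<Rightarrow> 'm \<Rightarrow> 'm" where
  "app x W w = (case x of (a, b, S, f) \<Rightarrow> ev V b a \<cdot> pr S W f w)"

lemma app_ty:
  assumes "el Aop x = El a b S" "ty w = Arr (tn W) b" "stage W" "S \<inter> W = {}"
  shows "ty (app x W w) = Arr (tn (S \<union> W)) a"
  using assms by (auto elim!: elE simp: app_def Aop_simps mon_ty pr_ty J_ob)

lemma Aop_VCmp:
  assumes "a \<in> J" "b \<in> J" "c \<in> J"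
  shows "ev V c a \<cdot> (VCmp Aop a b c \<boxtimes> \<iota> c) = ev V b a \<cdot> (\<iota> (ihom V b a) \<boxtimes> ev V c b)
    \<cdot> \<alpha> (ihom V b a) (ihom V c b) c \<cdot> (\<beta> (ihom V c b) (ihom V b a) \<boxtimes> \<iota> c)"
proof -
  note o = assms[THEN J_ob]
  let ?k = "ev V b a \<cdot> (\<iota> (ihom V b a) \<boxtimes> ev V c b) \<cdot> \<alpha> (ihom V b a) (ihom V c b) c"
  have k: "ty ?k = Arr ((ihom V b a \<otimes> ihom V c b) \<otimes> c) a" using o by (simp add: mon_ty)
  note c = curry[OF o(3,1) k]
  have e: "VCmp Aop a b c = curry V (ihom V b a \<otimes> ihom V c b) c a ?k \<cdot> \<beta> (ihom V c b) (ihom V b a)"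
    using assms o by (simp add: arity_op_def op_vcat_def full_subcategory_def self_enriched_def)
  have "ev V c a \<cdot> (VCmp Aop a b c \<boxtimes> \<iota> c)
      = (ev V c a \<cdot> (curry V (ihom V b a \<otimes> ihom V c b) c a ?k \<boxtimes> \<iota> c)) \<cdot> (\<beta> (ihom V c b) (ihom V b a) \<boxtimes> \<iota> c)"
    unfolding e using o c(1) by (simp add: comp_assoc tensor_comp mon_ty)
  also have "\<dots> = ?k \<cdot> (\<beta> (ihom V c b) (ihom V b a) \<boxtimes> \<iota> c)" using o c(2) by (simp add: mon_ty)
  finally show ?thesis using o by (simp add: comp_assoc mon_ty)
qed

text \<open>Application is contravariant: x turns an element of c into one of b, and y turns that
  into one of a.\<close>

lemma app_ecomp:
  assumes P: "pre_enriched Aop" and x: "el Aop x = El b c S" and y: "el Aop y = El a b T"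
    and w: "ty w = Arr (tn W) c" "stage W" and d: "S \<inter> T = {}" "S \<inter> W = {}" "T \<inter> W = {}"
  shows "app (x \<odot>[Aop] y) W w = app y (S \<union> W) (app x W w)"
proof -
  obtain f where f: "x = (b, c, S, f)" "b \<in> J" "c \<in> J" "stage S" "ty f = Arr (tn S) (ihom V c b)"
    using x by (auto elim!: elE simp: Aop_simps)
  obtain g where g: "y = (a, b, T, g)" "a \<in> J" "stage T" "ty g = Arr (tn T) (ihom V b a)"
    using y by (auto elim!: elE simp: Aop_simps)
  have o: "a \<in> Ob V" "b \<in> Ob V" "c \<in> Ob V" using f g J_ob by auto
  have C: "ty (VCmp Aop a b c) = Arr (ihom V c b \<otimes> ihom V b a) (ihom V c a)"
    using VCmp_ty[OF P, of a b c] f g by (simp add: Aop_simps)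
  have d': "T \<inter> S = {}" "(S \<union> T) \<inter> W = {}" "(T \<union> S) \<inter> W = {}" "T \<inter> (S \<union> W) = {}" using d by auto
  note ts = f g o w d d' C pr_ty stage_simps mon_ty
  have "app (x \<odot>[Aop] y) W w = ev V c a \<cdot> pr (S \<union> T) W (VCmp Aop a b c \<cdot> pr S T f g) w"
    by (simp add: app_def ecomp_def f(1) g(1))
  also have "pr (S \<union> T) W (VCmp Aop a b c \<cdot> pr S T f g) w = (VCmp Aop a b c \<boxtimes> \<iota> c) \<cdot> pr (S \<union> T) W (pr S T f g) w"
    by (simp add: ts pr_comp)
  also have "ev V c a \<cdot> \<dots> = (ev V c a \<cdot> (VCmp Aop a b c \<boxtimes> \<iota> c)) \<cdot> pr (S \<union> T) W (pr S T f g) w"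
    by (simp add: ts comp_assoc)
  also have "\<dots> = ev V b a \<cdot> (\<iota> (ihom V b a) \<boxtimes> ev V c b) \<cdot> \<alpha> (ihom V b a) (ihom V c b) c
      \<cdot> (\<beta> (ihom V c b) (ihom V b a) \<boxtimes> \<iota> c) \<cdot> pr (S \<union> T) W (pr S T f g) w"
    by (simp add: Aop_VCmp ts comp_assoc)
  also have "(\<beta> (ihom V c b) (ihom V b a) \<boxtimes> \<iota> c) \<cdot> pr (S \<union> T) W (pr S T f g) w = pr (T \<union> S) W (pr T S g f) w"
    by (simp add: ts pr_comp pr_comm Un_commute)
  also have "\<alpha> (ihom V b a) (ihom V c b) c \<cdot> pr (T \<union> S) W (pr T S g f) w = pr T (S \<union> W) g (pr S W f w)"
    by (rule pr_assoc) (simp_all add: ts)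
  also have "(\<iota> (ihom V b a) \<boxtimes> ev V c b) \<cdot> pr T (S \<union> W) g (pr S W f w) = pr T (S \<union> W) g (ev V c b \<cdot> pr S W f w)"
    by (simp add: pr_comp ts)
  finally show ?thesis by (simp add: app_def f(1) g(1))
qed

lemma app_idn:
  assumes "j \<in> J" "ty w = Arr (tn W) j" "stage W"
  shows "app (idn Aop j) W w = w"
proof -
  note o = assms(1)[THEN J_ob]
  have l: "ty (lunit V j) = Arr (\<one> \<otimes> j) j" using o by (simp add: mon_ty)
  note c = curry[OF o o l unit_Ob]
  have i: "VId Aop j = curry V \<one> j j (lunit V j)"
    using assms(1) o by (simp add: arity_op_def op_vcat_def full_subcategory_def self_enriched_def)
  have p: "pr {} W (VId Aop j) w = (VId Aop j \<boxtimes> \<iota> j) \<cdot> pr {} W (\<iota> \<one>) w"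
    using assms o c(1) i by (simp add: pr_comp[OF _ _ _ _ stage_simps(1)] tn_simps mon_ty)
  have "app (idn Aop j) W w = (ev V j j \<cdot> (VId Aop j \<boxtimes> \<iota> j)) \<cdot> pr {} W (\<iota> \<one>) w"
    unfolding app_def idn_def using p assms o c(1) i pr_ty[of "\<iota> \<one>" "{}" \<one> w W j]
    by (simp add: comp_assoc mon_ty tn_simps stage_simps)
  also have "\<dots> = w" unfolding i c(2) using pr_unit(1)[OF assms(2,3)] .
  finally show ?thesis .
qed

text \<open>Currying on elements: an invertible w is as good as a generic element of b, so an
  element of \<open>Aop\<close> is determined by its value at w, and every value occurs.\<close>

lemma app_lift:
  assumes ob: "a \<in> J" "b \<in> J" and w: "ty w = Arr (tn W) b" "stage W" "iso w"
    and S: "stage S" "S \<inter> W = {}" and r: "ty r = Arr (tn (S \<union> W)) a"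
  shows "\<exists>!x. el Aop x = El a b S \<and> app x W w = r"
proof -
  note o = ob[THEN J_ob]
  let ?c = "pr S W (\<iota> (tn S)) w"
  have c: "ty ?c = Arr (tn (S \<union> W)) (tn S \<otimes> b)" "iso ?c"
    using w S by (simp_all add: pr_ty pr_iso mon_ty tn_ob)
  have r': "ty (r \<cdot> inv ?c) = Arr (tn S \<otimes> b) a" using r c by (simp add: mon_ty)
  note cu = curry[OF o(2,1) r' tn_ob[OF S(1)]]
  have key: "ev V b a \<cdot> pr S W f w = r \<longleftrightarrow> ev V b a \<cdot> (f \<boxtimes> \<iota> b) = r \<cdot> inv ?c" if f: "ty f = Arr (tn S) (ihom V b a)" for f
  proof -
    have "ev V b a \<cdot> pr S W f w = (ev V b a \<cdot> (f \<boxtimes> \<iota> b)) \<cdot> ?c"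
      using f w S o c by (simp add: comp_assoc pr_comp mon_ty tn_ob)
    moreover have "ty (ev V b a \<cdot> (f \<boxtimes> \<iota> b)) = Arr (tn S \<otimes> b) a" using f o by (simp add: mon_ty)
    moreover have "(r \<cdot> inv ?c) \<cdot> ?c = r" using c r by (simp add: comp_assoc inv_ty inv_simps comp_ident)
    ultimately show ?thesis using inv_move_right[of "ev V b a \<cdot> (f \<boxtimes> \<iota> b)" ?c r, OF _ c(2,1)] by metis
  qed
  show ?thesis
  proof (rule ex1I[of _ "(a, b, S, curry V (tn S) b a (r \<cdot> inv ?c))"])
    show "el Aop (a, b, S, curry V (tn S) b a (r \<cdot> inv ?c)) = El a b S \<and> app (a, b, S, curry V (tn S) b a (r \<cdot> inv ?c)) W w = r"
      using cu(1,2) key ob S by (simp add: el_tuple Aop_simps app_def)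
    fix x assume x: "el Aop x = El a b S \<and> app x W w = r"
    then obtain f where f: "x = (a, b, S, f)" "ty f = Arr (tn S) (ihom V b a)"
      using ob by (auto elim!: elE simp: Aop_simps)
    then have "f = curry V (tn S) b a (r \<cdot> inv ?c)" using cu(3)[of f] key[of f] x by (simp add: app_def)
    then show "x = (a, b, S, curry V (tn S) b a (r \<cdot> inv ?c))" using f by simp
  qed
qed

text \<open>The canonical arrow from j to the internal hom [I, j], which is the hom-object of
  \<open>Aop\<close> from j to I. It is the counit of j as the cotensor [j, I] there.\<close>

definition eta :: "'o \<Rightarrow> 'm" where
  "eta j = curry V j \<one> j (runit V j)"

lemma eta_ty: "j \<in> J \<Longrightarrow> ty (eta j) = Arr j (VHom Aop j \<one>)"
  using curry(1)[of \<one> j "runit V j" j] J_unit by (simp add: eta_def Aop_simps mon_ty J_ob)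

lemma app_eta:
  assumes "j \<in> J" "ty f = Arr (tn S) j" "stage S"
  shows "app (j, \<one>, S, eta j \<cdot> f) {} (\<iota> \<one>) = f"
proof -
  note o = assms(1)[THEN J_ob]
  have l: "ty (runit V j) = Arr (j \<otimes> \<one>) j" using o by (simp add: mon_ty)
  note c = curry[OF unit_Ob o l o, folded eta_def]
  have "app (j, \<one>, S, eta j \<cdot> f) {} (\<iota> \<one>) = (ev V \<one> j \<cdot> (eta j \<boxtimes> \<iota> \<one>)) \<cdot> pr S {} f (\<iota> \<one>)"
    using assms o c(1) pr_ty[of f S j "\<iota> \<one>" "{}" \<one>]
    by (simp add: app_def comp_assoc mon_ty tn_simps stage_simps pr_comp)
  also have "\<dots> = f" unfolding c(2) using pr_unit(2)[OF assms(2,3)] .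
  finally show ?thesis .
qed

text \<open>Elements into I are compared by applying them to the identity of I. Composition with
  \<open>eta j\<close> then becomes application to the generic element of j, where
  \<open>app_lift\<close> supplies the unique lift.\<close>

lemma eta_cot:
  assumes P: "pre_enriched Aop" and j: "j \<in> J"
  shows "is_cotensor V Aop j \<one> j (eta j)"
proof -
  let ?l = "(j, 0 :: nat)"
  note o = j[THEN J_ob]
  have v: "ty (var ?l) = Arr (tn {?l}) j" "iso (var ?l)" "stage {?l}"
    using var_ty[of ?l] var_iso[of ?l] o by (simp_all add: stage_simps)
  have ge: "el Aop (gel j \<one> ?l (eta j)) = El j \<one> {?l}"
    using j J_unit eta_ty[OF j] by (simp add: gel_el Aop_simps(1))
  have "is_cotensor V Aop (fst ?l) \<one> j (eta j)"
  proof (rule cotI[OF P _ _ _ finite.emptyI])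
    fix y S h assume S: "?l \<notin> S" and h: "el Aop h = El y \<one> (insert ?l S)"
    have y: "y \<in> J" "stage S" using el_obs[OF h] by (simp_all add: Aop_simps stage_simps)
    have u: "ty (\<iota> \<one>) = Arr (tn {}) \<one>" "stage {}" "iso (\<iota> \<one>)" by (simp_all add: mon_ty tn_simps stage_simps)
    have ht: "ty (app h {} (\<iota> \<one>)) = Arr (tn (S \<union> {?l})) y" using app_ty[OF h u(1,2)] by simp
    have key: "gel j \<one> ?l (eta j) \<odot>[Aop] g = h \<longleftrightarrow> app g {?l} (var ?l) = app h {} (\<iota> \<one>)" if g: "el Aop g = El y j S" for g
    proof -
      have e: "el Aop (gel j \<one> ?l (eta j) \<odot>[Aop] g) = El y \<one> (insert ?l S)" using ecomp_el[OF P ge g] S by simp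
      have "app (gel j \<one> ?l (eta j) \<odot>[Aop] g) {} (\<iota> \<one>) = app g ({?l} \<union> {}) (app (gel j \<one> ?l (eta j)) {} (\<iota> \<one>))"
        by (rule app_ecomp[OF P ge g u(1,2)]) (use S in auto)
      then have "app (gel j \<one> ?l (eta j) \<odot>[Aop] g) {} (\<iota> \<one>) = app g {?l} (var ?l)"
        using app_eta[OF j v(1,3)] by (simp add: gel_def)
      moreover have "\<exists>!x. el Aop x = El y \<one> (insert ?l S) \<and> app x {} (\<iota> \<one>) = app h {} (\<iota> \<one>)"
        by (rule app_lift[OF y(1) J_unit u(1,2,3)]) (use ht el_obs[OF h] in simp_all)
      ultimately show ?thesis using e h by metis
    qed
    have "\<exists>!x. el Aop x = El y j S \<and> app x {?l} (var ?l) = app h {} (\<iota> \<one>)"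
      by (rule app_lift[OF y(1) j v(1,3,2) y(2) _ ht]) (use S in auto)
    then show "\<exists>!g. el Aop g = El y j S \<and> gel j \<one> ?l (eta j) \<odot>[Aop] g = h"
      using key by (metis (no_types, lifting))
  qed (use j J_unit eta_ty[OF j] in \<open>simp_all add: Aop_simps(1)\<close>)
  then show ?thesis by simp
qed

text \<open>The second presentation of a theory: the arrow that exhibits j as [j, I]. Theory
  morphisms and algebras are tested on it in \<open>theory_morphismI\<close> and
  \<open>is_algebraI\<close>.\<close>

definition str :: "('o, 'm) jtheory \<Rightarrow> 'o \<Rightarrow> 'm" where
  "str T j = FHm (Tau T) j \<one> \<cdot> eta j"

lemma theoryD:
  assumes "is_theory V J T"
  shows "VOb (Tcat T) = J" "enriched_functor V Aop (Tcat T) (Tau T)" "enriched_category V (Tcat T)"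
    "enriched_category V Aop" "pre_enriched (Tcat T)" "pre_enriched Aop" "j \<in> J \<Longrightarrow> FOb (Tau T) j = j"
proof -
  show 1: "VOb (Tcat T) = J" "enriched_functor V Aop (Tcat T) (Tau T)" "j \<in> J \<Longrightarrow> FOb (Tau T) j = j"
    using assms by (simp_all add: is_theory_def)
  show "enriched_category V (Tcat T)" "enriched_category V Aop" using enr_functor_cats[OF 1(2)] by simp_all
  then show "pre_enriched (Tcat T)" "pre_enriched Aop" by (simp_all add: enriched_pre)
qed

lemma str_cot:
  assumes T: "is_theory V J T" and j: "j \<in> J"
  shows "is_cotensor V (Tcat T) j \<one> j (str T j)"
proof -
  have "preserves_cotensors V J Aop (Tcat T) (Tau T)" using T by (simp add: is_theory_def)
  from this[unfolded preserves_cotensors_def, rule_format, OF j eta_cot[OF theoryD(6)[OF T] j]]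
  show ?thesis using theoryD(7)[OF T] j J_unit by (simp add: str_def)
qed

lemma str_unit:
  assumes T: "is_theory V J T"
  shows "str T \<one> = VId (Tcat T) \<one>"
proof -
  have "eta \<one> = VId Aop \<one>"
    using J_unit unit_Ob by (simp add: eta_def lunit_unit[symmetric] arity_op_def op_vcat_def full_subcategory_def self_enriched_def)
  then show ?thesis
    using enriched_functor.FHm_VId[OF theoryD(2)[OF T], of \<one>] J_unit theoryD(7)[OF T] by (simp add: str_def Aop_simps)
qed

text \<open>Since the counit \<open>str T k\<close> can be cancelled, this law determines the
  structure functor from the structure morphisms. It is the image under the structure functor of an
  identity in \<open>Aop\<close> that is checked by application.\<close>

lemma str_law:
  assumes T: "is_theory V J T" and t: "el Aop t = El j k S" and w: "ty w = Arr (tn W) k" "stage W" and d: "W \<inter> S = {}"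
  shows "(k, \<one>, W, str T k \<cdot> w) \<odot>[Tcat T] fap (Tau T) t = (j, \<one>, W \<union> S, str T j \<cdot> app t W w)"
proof -
  note F = theoryD(2)[OF T] and P = theoryD(6)[OF T]
  have jk: "j \<in> J" "k \<in> J" "stage S" using el_obs[OF t] by (simp_all add: Aop_simps)
  have d': "S \<inter> W = {}" using d by auto
  have tau: "fap (Tau T) (i, \<one>, U, eta i \<cdot> v) = (i, \<one>, U, str T i \<cdot> v)" if "i \<in> J" "ty v = Arr (tn U) i" for i U v
    using that J_unit theoryD(7)[OF T] FHm_ty[OF F, of i \<one>] eta_ty[of i]
    by (simp add: fap_def str_def comp_assoc Aop_simps(1))
  have e1: "el Aop (k, \<one>, W, eta k \<cdot> w) = El k \<one> W"
    using jk w J_unit eta_ty[of k] by (simp add: el_tuple mon_ty Aop_simps(1))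
  have a: "ty (app t W w) = Arr (tn (W \<union> S)) j" using app_ty[OF t w d'] by (simp add: Un_commute)
  have e2: "el Aop (j, \<one>, W \<union> S, eta j \<cdot> app t W w) = El j \<one> (W \<union> S)"
    using jk w J_unit eta_ty[of j] a by (simp add: el_tuple mon_ty Aop_simps(1) stage_simps)
  have u: "ty (\<iota> \<one>) = Arr (tn {}) \<one>" "stage {}" "iso (\<iota> \<one>)" by (simp_all add: mon_ty tn_simps stage_simps)
  have "(k, \<one>, W, eta k \<cdot> w) \<odot>[Aop] t = (j, \<one>, W \<union> S, eta j \<cdot> app t W w)"
  proof -
    have "app ((k, \<one>, W, eta k \<cdot> w) \<odot>[Aop] t) {} (\<iota> \<one>) = app t (W \<union> {}) (app (k, \<one>, W, eta k \<cdot> w) {} (\<iota> \<one>))"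
      by (rule app_ecomp[OF P e1 t u(1,2)]) (use d in auto)
    also have "\<dots> = app t W w" using app_eta[OF jk(2) w] by simp
    also have "\<dots> = app (j, \<one>, W \<union> S, eta j \<cdot> app t W w) {} (\<iota> \<one>)"
      using app_eta[OF jk(1) a] jk w by (simp add: stage_simps)
    finally have "app ((k, \<one>, W, eta k \<cdot> w) \<odot>[Aop] t) {} (\<iota> \<one>) = app (j, \<one>, W \<union> S, eta j \<cdot> app t W w) {} (\<iota> \<one>)" .
    moreover have "\<exists>!x. el Aop x = El j \<one> (W \<union> S) \<and> app x {} (\<iota> \<one>) = app (j, \<one>, W \<union> S, eta j \<cdot> app t W w) {} (\<iota> \<one>)"
      by (rule app_lift[OF jk(1) J_unit u(1,2,3)]) (use jk w app_ty[OF e2 u(1,2)] in \<open>simp_all add: stage_simps\<close>)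
    ultimately show ?thesis using e2 ecomp_el[OF P e1 t d] by metis
  qed
  then show ?thesis
    using fap_ecomp[OF F e1 t d] tau[OF jk(2) w(1)] tau[OF jk(1) a] by simp
qed

lemma theory_morphismD:
  assumes T: "is_theory V J T" and U: "is_theory V J U" and M: "theory_morphism V J T U M"
  shows "enriched_functor V (Tcat T) (Tcat U) M" "j \<in> J \<Longrightarrow> FOb M j = j" "j \<in> J \<Longrightarrow> FHm M j \<one> \<cdot> str T j = str U j"
proof -
  show F: "enriched_functor V (Tcat T) (Tcat U) M" using M by (simp add: theory_morphism_def)
  have c: "comp_vfun V Aop M (Tau T) = Tau U" using M by (simp add: theory_morphism_def)
  show o: "FOb M j = j" if "j \<in> J" for j
    using arg_cong[OF c, of "\<lambda>F. FOb F j"] that theoryD(7)[OF T that] theoryD(7)[OF U that] by (simp add: comp_vfun_def Aop_simps)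
  show "FHm M j \<one> \<cdot> str T j = str U j" if j: "j \<in> J"
  proof -
    have "FHm M j \<one> \<cdot> FHm (Tau T) j \<one> = FHm (Tau U) j \<one>"
      using arg_cong[OF c, of "\<lambda>F. FHm F j \<one>"] j J_unit theoryD(7)[OF T] by (simp add: comp_vfun_def Aop_simps)
    then show ?thesis
      using comp_reduce[of "FHm M j \<one>" "FHm (Tau T) j \<one>" "FHm (Tau U) j \<one>" "eta j"] j J_unit eta_ty[OF j]
        FHm_ty[OF F, of j \<one>] FHm_ty[OF theoryD(2)[OF T], of j \<one>] theoryD(7)[OF T] theoryD(1)[OF T]
      by (simp add: str_def Aop_simps(1))
  qed
qed

text \<open>The two functors out of \<open>Aop\<close> agree after composition with the counit of k
  in U, because \<open>str_law\<close> computes both sides from the structure morphisms.\<close>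

lemma theory_morphismI:
  assumes T: "is_theory V J T" and U: "is_theory V J U" and M: "enriched_functor V (Tcat T) (Tcat U) M"
    and o: "\<And>j. j \<in> J \<Longrightarrow> FOb M j = j" and s: "\<And>j. j \<in> J \<Longrightarrow> FHm M j \<one> \<cdot> str T j = str U j"
  shows "theory_morphism V J T U M"
  unfolding theory_morphism_def
proof (intro conjI M vfun_eqI_gvar[OF comp_vfun_functor[OF theoryD(2)[OF T] M] theoryD(2)[OF U]])
  note PO = theoryD(6)[OF T]
  fix j assume "j \<in> VOb Aop"
  then have j: "j \<in> J" by (simp add: Aop_simps)
  then show "FOb (comp_vfun V Aop M (Tau T)) j = FOb (Tau U) j"
    using theoryD(7)[OF T j] theoryD(7)[OF U j] o[OF j] by (simp add: comp_vfun_def Aop_simps)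
  fix k assume "k \<in> VOb Aop"
  then have k: "k \<in> J" by (simp add: Aop_simps)
  let ?t = "gvar Aop 0 j k" and ?l = "(k, 1 :: nat)"
  let ?S = "{(VHom Aop j k, 0 :: nat)}"
  have t: "el Aop ?t = El j k ?S" using gvar_el[OF PO, of j k 0] j k by (simp add: Aop_simps(1))
  have v: "ty (var ?l) = Arr (tn {?l}) k" "stage {?l}" using var_ty[of ?l] k J_ob by (simp_all add: stage_simps)
  have d: "{?l} \<inter> ?S = {}" by simp
  note ct = str_cot[OF T] and cU = str_cot[OF U]
  have mgel: "fap M (i, \<one>, W, str T i \<cdot> w) = (i, \<one>, W, str U i \<cdot> w)" if "i \<in> J" "ty w = Arr (tn W) i" for i W w
    using that comp_reduce[OF s[OF that(1)] that(2) cot_obs(3)[OF ct[OF that(1)]] FHm_ty[OF M]] J_unit theoryD(1)[OF T] o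
    by (simp add: fap_def)
  have a: "ty (app ?t {?l} (var ?l)) = Arr (tn ({?l} \<union> ?S)) j" using app_ty[OF t v] by (simp add: insert_commute)
  have e1: "el (Tcat T) (k, \<one>, {?l}, str T k \<cdot> var ?l) = El k \<one> {?l}"
    using cot_obs[OF ct[OF k]] v by (simp add: el_tuple mon_ty)
  have e2: "el (Tcat T) (fap (Tau T) ?t) = El j k ?S" using fap_el[OF theoryD(2)[OF T] t] theoryD(7)[OF T] j k by simp
  have c: "fap (comp_vfun V Aop M (Tau T)) ?t = fap M (fap (Tau T) ?t)" by (rule fap_comp_vfun[OF theoryD(2)[OF T] M t])
  show "fap (comp_vfun V Aop M (Tau T)) ?t = fap (Tau U) ?t"
  proof (rule cot_mono[OF theoryD(5)[OF U] cU[OF k], of ?l])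
    show "el (Tcat U) (fap (comp_vfun V Aop M (Tau T)) ?t) = El j k ?S"
      using fap_el[OF M e2] c o j k by simp
    show "el (Tcat U) (fap (Tau U) ?t) = El j k ?S" using fap_el[OF theoryD(2)[OF U] t] theoryD(7)[OF U] j k by simp
    have "gel k \<one> ?l (str U k) \<odot>[Tcat U] fap M (fap (Tau T) ?t) = fap M ((k, \<one>, {?l}, str T k \<cdot> var ?l) \<odot>[Tcat T] fap (Tau T) ?t)"
      using fap_ecomp[OF M e1 e2 d] mgel[OF k v(1)] by (simp add: gel_def)
    also have "\<dots> = gel k \<one> ?l (str U k) \<odot>[Tcat U] fap (Tau U) ?t"
      unfolding str_law[OF T t v d] gel_def str_law[OF U t v d] by (rule mgel[OF j a])
    finally show "gel k \<one> ?l (str U k) \<odot>[Tcat U] fap (comp_vfun V Aop M (Tau T)) ?t = gel k \<one> ?l (str U k) \<odot>[Tcat U] fap (Tau U) ?t"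
      unfolding c .
  qed simp_all
qed

text \<open>The arrow on homs exists and is unique by the universal property of \<open>s k\<close>.
  In the form \<open>law\<close> it is composition with the counit that becomes \<open>app\<close>,
  and functoriality of \<open>app\<close> gives functoriality of the structure functor.\<close>

lemma theory_of_structure_is_theory:
  assumes O: "enriched_category V Aop" and T: "enriched_category V T" "VOb T = J"
    and s: "\<And>j. j \<in> J \<Longrightarrow> is_cotensor V T j \<one> j (s j)" and s1: "s \<one> = VId T \<one>"
  shows "is_theory V J (theory_of_structure V J T s)" "j \<in> J \<Longrightarrow> str (theory_of_structure V J T s) j = s j"
proof -
  let ?U = "theory_of_structure V J T s"
  let ?F = "Tau ?U"
  note PO = enriched_pre[OF O] and P = enriched_pre[OF T(1)]
  have Tc: "Tcat ?U = T" by (simp add: theory_of_structure_def)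
  have Fo: "FOb ?F = (\<lambda>j\<in>J. j)" by (simp add: theory_of_structure_def)
  have so: "ty (s j) = Arr j (VHom T j \<one>)" "j \<in> Ob V" if "j \<in> J" for j using cot_obs[OF s[OF that]] by auto
  have Fh: "ty (FHm ?F j k) = Arr (ihom V k j) (VHom T j k) \<and> VCmp T j k \<one> \<cdot> (s k \<boxtimes> FHm ?F j k) \<cdot> \<beta> (ihom V k j) k = s j \<cdot> ev V k j"
    if jk: "j \<in> J" "k \<in> J" for j k
  proof -
    note o = jk[THEN J_ob]
    have "ty (s j \<cdot> ev V k j) = Arr (ihom V k j \<otimes> k) (VHom T j \<one>)" using so[OF jk(1)] o by (simp add: mon_ty)
    then have "\<exists>!t. ty t = Arr (ihom V k j) (VHom T j k) \<and> VCmp T j k \<one> \<cdot> (s k \<boxtimes> t) \<cdot> \<beta> (ihom V k j) k = s j \<cdot> ev V k j"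
      using s[OF jk(2)] jk T(2) o by (simp add: cot_iff_hom[OF P o(2)] mon_ob)
    from theI'[OF this] show ?thesis using jk by (simp add: theory_of_structure_def hom_ty)
  qed
  have Fel: "el T (fap ?F t) = El j k S" if t: "el Aop t = El j k S" for j k S t
  proof -
    obtain f where f: "t = (j, k, S, f)" "j \<in> J" "k \<in> J" "stage S" "ty f = Arr (tn S) (ihom V k j)"
      using t by (auto elim!: elE simp: Aop_simps)
    then show ?thesis using Fh[OF f(2,3)] T(2) by (simp add: fap_def el_tuple Fo mon_ty)
  qed
  have law: "(k, \<one>, W, s k \<cdot> w) \<odot>[T] fap ?F t = (j, \<one>, W \<union> S, s j \<cdot> app t W w)"
    if t: "el Aop t = El j k S" and w: "ty w = Arr (tn W) k" "stage W" and d: "W \<inter> S = {}" for j k S t w W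
  proof -
    obtain f where f: "t = (j, k, S, f)" "j \<in> J" "k \<in> J" "stage S" "ty f = Arr (tn S) (ihom V k j)"
      using t by (auto elim!: elE simp: Aop_simps)
    have d': "S \<inter> W = {}" using d by auto
    note h = Fh[OF f(2,3)] so[OF f(2)] so[OF f(3)]
    have "VCmp T j k \<one> \<cdot> pr W S (s k \<cdot> w) (FHm ?F j k \<cdot> f) = (VCmp T j k \<one> \<cdot> (s k \<boxtimes> FHm ?F j k) \<cdot> \<beta> (ihom V k j) k) \<cdot> pr S W f w"
      using h(2-) conjunct1[OF h(1)] f w d d' P T J_unit VCmp_ty[OF P, of j k \<one>] pr_ty[OF f(5) w(1) f(4) w(2) d']
      by (simp add: comp_assoc mon_ty pr_comp pr_comm pr_ty Un_commute)
    also have "\<dots> = s j \<cdot> app t W w"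
      unfolding conjunct2[OF h(1)]
      using h(2-) f w d' pr_ty[OF f(5) w(1) f(4) w(2) d'] by (simp add: comp_assoc mon_ty app_def)
    finally show ?thesis by (simp add: f(1-3) fap_def Fo ecomp_def)
  qed
  have el_s: "el T (k, \<one>, W, s k \<cdot> w) = El k \<one> W" if "k \<in> J" "ty w = Arr (tn W) k" "stage W" for k W w
    using that so[OF that(1)] T J_unit by (simp add: el_tuple mon_ty)
  have F: "enriched_functor V Aop T ?F"
  proof (rule enriched_functorI[OF O T(1) _ _ gvar_cover[OF PO]])
    show "FOb ?F \<in> VOb Aop \<rightarrow>\<^sub>E VOb T" by (auto simp: Fo Aop_simps T)
    show "FHm ?F \<in> (\<Pi>\<^sub>E a\<in>VOb Aop. \<Pi>\<^sub>E b\<in>VOb Aop. hom V (VHom Aop a b) (VHom T (FOb ?F a) (FOb ?F b)))"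
      unfolding Fo Aop_simps(1) using Fh by (intro PiE_I) (auto simp: hom_ty Aop_simps theory_of_structure_def)
    fix a assume "a \<in> VOb Aop"
    then have a: "a \<in> J" by (simp add: Aop_simps)
    let ?l = "(a, 0 :: nat)"
    have v: "ty (var ?l) = Arr (tn {?l}) a" "stage {?l}" using var_ty[of ?l] so[OF a] by (simp_all add: stage_simps)
    have ia: "el Aop (idn Aop a) = El a a {}" using idn_el[OF PO] a by (simp add: Aop_simps)
    have "fap ?F (idn Aop a) = idn T a"
    proof (rule cot_mono[OF P s[OF a], of ?l])
      show "el T (fap ?F (idn Aop a)) = El a a {}" by (rule Fel[OF ia])
      show "el T (idn T a) = El a a {}" using idn_el[OF P] a T by simp
      show "gel a \<one> ?l (s a) \<odot>[T] fap ?F (idn Aop a) = gel a \<one> ?l (s a) \<odot>[T] idn T a"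
        using law[OF ia v] app_idn[OF a v] ecomp_idn(2)[OF T(1) el_s[OF a v]] by (simp add: gel_def)
    qed simp_all
    then show "fap ?F (idn Aop a) = idn T (FOb ?F a)" using a by (simp add: Fo)
    fix b c assume "b \<in> VOb Aop" "c \<in> VOb Aop"
    then have bc: "b \<in> J" "c \<in> J" by (simp_all add: Aop_simps)
    let ?x = "gvar Aop 1 b c" and ?y = "gvar Aop 0 a b" and ?l = "(c, 2 :: nat)"
    let ?S = "{(VHom Aop b c, 1 :: nat)}" and ?T = "{(VHom Aop a b, 0 :: nat)}"
    have x: "el Aop ?x = El b c ?S" and y: "el Aop ?y = El a b ?T"
      using gvar_el[OF PO, of b c 1] gvar_el[OF PO, of a b 0] a bc by (simp_all add: Aop_simps(1))
    have v: "ty (var ?l) = Arr (tn {?l}) c" "stage {?l}" using var_ty[of ?l] so[OF bc(2)] by (simp_all add: stage_simps)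
    have d: "?S \<inter> ?T = {}" "{?l} \<inter> ?S = {}" "?S \<inter> {?l} = {}" "{?l} \<inter> ?T = {}" "?T \<inter> {?l} = {}" "({?l} \<union> ?S) \<inter> ?T = {}" "{?l} \<inter> (?S \<union> ?T) = {}" by simp_all
    have xy: "el Aop (?x \<odot>[Aop] ?y) = El a c (?S \<union> ?T)" by (rule ecomp_el[OF PO x y d(1)])
    have ax: "ty (app ?x {?l} (var ?l)) = Arr (tn ({?l} \<union> ?S)) b" using app_ty[OF x v d(3)] by (simp add: insert_commute)
    show "fap ?F (?x \<odot>[Aop] ?y) = fap ?F ?x \<odot>[T] fap ?F ?y"
    proof (rule cot_mono[OF P s[OF bc(2)], of ?l])
      show "el T (fap ?F (?x \<odot>[Aop] ?y)) = El a c (?S \<union> ?T)" by (rule Fel[OF xy])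
      show "el T (fap ?F ?x \<odot>[T] fap ?F ?y) = El a c (?S \<union> ?T)" by (rule ecomp_el[OF P Fel[OF x] Fel[OF y] d(1)])
      have "gel c \<one> ?l (s c) \<odot>[T] (fap ?F ?x \<odot>[T] fap ?F ?y) = ((c, \<one>, {?l}, s c \<cdot> var ?l) \<odot>[T] fap ?F ?x) \<odot>[T] fap ?F ?y"
        using ecomp_assoc[OF T(1) el_s[OF bc(2) v] Fel[OF x] Fel[OF y] d(2,4,1)] by (simp add: gel_def)
      also have "\<dots> = (a, \<one>, ({?l} \<union> ?S) \<union> ?T, s a \<cdot> app ?y ({?l} \<union> ?S) (app ?x {?l} (var ?l)))"
        unfolding law[OF x v d(2)] by (rule law[OF y ax _ d(6)]) (use el_obs[OF x] v in \<open>simp add: stage_simps\<close>)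
      also have "\<dots> = (a, \<one>, {?l} \<union> (?S \<union> ?T), s a \<cdot> app (?x \<odot>[Aop] ?y) {?l} (var ?l))"
        unfolding app_ecomp[OF PO x y v d(1,3,5)] by (simp add: insert_commute)
      also have "\<dots> = gel c \<one> ?l (s c) \<odot>[T] fap ?F (?x \<odot>[Aop] ?y)"
        unfolding gel_def law[OF xy v d(7)] ..
      finally show "gel c \<one> ?l (s c) \<odot>[T] fap ?F (?x \<odot>[Aop] ?y) = gel c \<one> ?l (s c) \<odot>[T] (fap ?F ?x \<odot>[T] fap ?F ?y)" ..
    qed simp_all
  qed
  have st: "FHm ?F j \<one> \<cdot> eta j = s j" if j: "j \<in> J" for j
  proof -
    let ?l = "(j, 0 :: nat)"
    have v: "ty (var ?l) = Arr (tn {?l}) j" "stage {?l}" using var_ty[of ?l] so[OF j] by (simp_all add: stage_simps)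
    have e: "el Aop (gel j \<one> ?l (eta j)) = El j \<one> {?l}" using j J_unit eta_ty[OF j] by (simp add: gel_el Aop_simps(1))
    have u: "ty (\<iota> \<one>) = Arr (tn {}) \<one>" "stage {}" by (simp_all add: mon_ty tn_simps stage_simps)
    \<comment> \<open>The normalisation at I makes the left factor of \<open>law\<close> an
      identity, so that the structure functor returns \<open>s j\<close> itself.\<close>
    have i: "(\<one>, \<one>, {}, s \<one> \<cdot> \<iota> \<one>) = idn T \<one>" using s1 VId_ty[OF P, of \<one>] T J_unit by (simp add: idn_def comp_ident)
    have "fap ?F (gel j \<one> ?l (eta j)) = gel j \<one> ?l (s j)"
      using law[OF e u] app_eta[OF j v] unfolding i
      using ecomp_idn(1)[OF T(1) Fel[OF e]] by (simp add: gel_def)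
    then have "gel j \<one> ?l (FHm ?F j \<one> \<cdot> eta j) = gel j \<one> ?l (s j)"
      using fap_gel[OF F, of j \<one> "eta j" ?l] j J_unit eta_ty[OF j] by (simp add: Aop_simps(1) Fo)
    then show ?thesis
      by (rule gel_inj) (use eta_ty[OF j] FHm_ty[OF F, of j \<one>] so[OF j] j J_unit in \<open>simp_all add: mon_ty Aop_simps(1) Fo\<close>)
  qed
  have "preserves_cotensors V J Aop T ?F"
    by (rule preserves_from_structure[OF O _ eta_cot[OF PO] F]) (use s st J_unit in \<open>simp_all add: Aop_simps(1) Fo\<close>)
  then show "is_theory V J ?U" using F T by (simp add: is_theory_def Tc Fo)
  show "j \<in> J \<Longrightarrow> str ?U j = s j" by (simp add: str_def st)
qed

end

section \<open>Algebras\<close>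

context symmetric_monoidal_closed_category
begin

lemma fresh_label:
  assumes "finite S"
  obtains n :: nat where "(X, n) \<notin> S"
proof -
  have "finite {n. (X, n) \<in> S}"
    using assms finite_vimageI[of S "Pair X"] by (simp add: vimage_def inj_on_def)
  then show ?thesis using that ex_new_if_finite[of "{n. (X, n) \<in> S}"] by auto
qed

lemma wedge_arrows:
  assumes A: "enriched_functor V T C A" and B: "enriched_functor V T C B"
    and p: "ty px = Arr e (VHom C (FOb A x) (FOb B x))" "ty py = Arr e (VHom C (FOb A y) (FOb B y))"
    and w: "ty w = Arr (tn S) e" "stage S" and t: "el T (x, y, U, f) = El x y U" and d: "S \<inter> U = {}"
  shows "(FOb A y, FOb B y, S, py \<cdot> w) \<odot>[C] fap A (x, y, U, f) = (FOb A x, FOb B y, S \<union> U,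
      (VCmp C (FOb A x) (FOb A y) (FOb B y) \<cdot> (py \<boxtimes> FHm A x y)) \<cdot> pr S U w f)" (is ?l)
    "fap B (x, y, U, f) \<odot>[C] (FOb A x, FOb B x, S, px \<cdot> w) = (FOb A x, FOb B y, S \<union> U,
      (VCmp C (FOb A x) (FOb B x) (FOb B y) \<cdot> (FHm B x y \<boxtimes> px) \<cdot> \<beta> e (VHom T x y)) \<cdot> pr S U w f)" (is ?r)
proof -
  have t': "x \<in> VOb T" "y \<in> VOb T" "stage U" "ty f = Arr (tn U) (VHom T x y)" using t by (simp_all add: el_tuple)
  have e: "e \<in> Ob V" using ty_obs[OF p(1)] by simp
  have d': "U \<inter> S = {}" using d by auto
  note P = enriched_pre[OF enr_functor_cats(1)[OF A]] enriched_pre[OF enr_functor_cats(2)[OF A]]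
  note ts = p w t' e d d' FHm_ty[OF A t'(1,2)] FHm_ty[OF B t'(1,2)] FOb_ob[OF A t'(1)] FOb_ob[OF A t'(2)] FOb_ob[OF B t'(1)] FOb_ob[OF B t'(2)] P
  show ?l using ts by (simp add: ecomp_def fap_def comp_assoc mon_ty pr_comp VCmp_ty pr_ty VHom_ob)
  show ?r using ts by (simp add: ecomp_def fap_def comp_assoc mon_ty pr_comp pr_comm Un_commute VCmp_ty pr_ty VHom_ob)
qed

lemma wedgeD:
  assumes W: "hom_wedge V C T A B e \<pi>" and A: "enriched_functor V (Tcat T) C A" and B: "enriched_functor V (Tcat T) C B"
    and w: "ty w = Arr (tn S) e" "stage S" and t: "el (Tcat T) t = El x y U" and d: "S \<inter> U = {}"
  shows "(FOb A y, FOb B y, S, \<pi> y \<cdot> w) \<odot>[C] fap A t = fap B t \<odot>[C] (FOb A x, FOb B x, S, \<pi> x \<cdot> w)"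
proof -
  obtain f where f: "t = (x, y, U, f)" "x \<in> VOb (Tcat T)" "y \<in> VOb (Tcat T)" using t by (rule elE)
  have p: "ty (\<pi> z) = Arr e (VHom C (FOb A z) (FOb B z))" if "z \<in> VOb (Tcat T)" for z
    using W that unfolding hom_wedge_def hom_ty[symmetric] by (blast dest: PiE_mem)
  show ?thesis
    unfolding f(1) wedge_arrows[OF A B p[OF f(2)] p[OF f(3)] w t[unfolded f(1)] d]
    using W f(2,3) by (simp add: hom_wedge_def)
qed

text \<open>Generic elements of the hom-objects of T can be given fresh labels, so the test may
  avoid the stage of i. The set W keeps further labels away, such as that of an auxiliary
  counit.\<close>

lemma wedgeI:
  assumes A: "enriched_functor V (Tcat T) C A" and B: "enriched_functor V (Tcat T) C B"
    and ext: "\<pi> \<in> extensional (VOb (Tcat T))"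
    and p: "\<And>x. x \<in> VOb (Tcat T) \<Longrightarrow> ty (\<pi> x) = Arr e (VHom C (FOb A x) (FOb B x))"
    and i: "ty i = Arr (tn S) e" "stage S" "iso i" and W: "finite W"
    and n: "\<And>x y t U. \<lbrakk>el (Tcat T) t = El x y U; S \<inter> U = {}; W \<inter> U = {}\<rbrakk> \<Longrightarrow>
      (FOb A y, FOb B y, S, \<pi> y \<cdot> i) \<odot>[C] fap A t = fap B t \<odot>[C] (FOb A x, FOb B x, S, \<pi> x \<cdot> i)"
  shows "hom_wedge V C T A B e \<pi>"
  unfolding hom_wedge_def
proof (intro conjI ballI)
  show e: "e \<in> Ob V" using ty_obs[OF i(1)] by simp
  show "\<pi> \<in> (\<Pi>\<^sub>E x\<in>VOb (Tcat T). hom V e (VHom C (FOb A x) (FOb B x)))"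
    using ext p by (auto simp: PiE_def hom_ty)
  fix x y assume o: "x \<in> VOb (Tcat T)" "y \<in> VOb (Tcat T)"
  note P = enriched_pre[OF enr_functor_cats(1)[OF A]] enriched_pre[OF enr_functor_cats(2)[OF A]]
  obtain n where n': "(VHom (Tcat T) x y, n) \<notin> S \<union> W"
    using fresh_label[of "S \<union> W"] stage_slist(2)[OF i(2)] W by blast
  let ?t = "gvar (Tcat T) n x y" and ?U = "{(VHom (Tcat T) x y, n)}" and ?f = "var (VHom (Tcat T) x y, n)"
  note t = gvar_el[OF P(1) o, of n]
  have f: "ty ?f = Arr (tn ?U) (VHom (Tcat T) x y)" "iso ?f" "stage ?U" "S \<inter> ?U = {}" "W \<inter> ?U = {}"
    using var_ty[of "(VHom (Tcat T) x y, n)"] var_iso[of "(VHom (Tcat T) x y, n)"] VHom_ob[OF P(1) o] n' by (simp_all add: stage_simps)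
  have eq: "(VCmp C (FOb A x) (FOb A y) (FOb B y) \<cdot> (\<pi> y \<boxtimes> FHm A x y)) \<cdot> pr S ?U i ?f
    = (VCmp C (FOb A x) (FOb B x) (FOb B y) \<cdot> (FHm B x y \<boxtimes> \<pi> x) \<cdot> \<beta> e (VHom (Tcat T) x y)) \<cdot> pr S ?U i ?f"
    using n[OF t f(4,5)] wedge_arrows[OF A B p[OF o(1)] p[OF o(2)] i(1,2) t[unfolded gvar_def] f(4)] by (simp add: gvar_def)
  show "VCmp C (FOb A x) (FOb A y) (FOb B y) \<cdot> (\<pi> y \<boxtimes> FHm A x y)
    = VCmp C (FOb A x) (FOb B x) (FOb B y) \<cdot> (FHm B x y \<boxtimes> \<pi> x) \<cdot> \<beta> e (VHom (Tcat T) x y)"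
    by (rule iso_cancel_right[OF eq pr_iso[OF i(1) f(1) i(2) f(3,4) i(3) f(2)] pr_ty[OF i(1) f(1) i(2) f(3,4)]])
      (use p[OF o(1)] p[OF o(2)] o P e FHm_ty[OF A o] FHm_ty[OF B o] FOb_ob[OF A] FOb_ob[OF B] in \<open>simp_all add: mon_ty VCmp_ty VHom_ob\<close>)
qed

end

section \<open>Designated cotensors of C and hom-objects of algebras\<close>

locale admissible_category = system_of_arities V J
  for V :: "('o, 'm) smc" (structure) and J :: "'o set" +
  fixes C :: "('c, 'o, 'm) vcat" and ct :: "'o \<Rightarrow> 'c \<Rightarrow> 'c" and cu :: "'o \<Rightarrow> 'c \<Rightarrow> 'm"
  assumes adm: "admissible V J C ct cu"
begin

lemma C_cat: "enriched_category V C" and C_pre: "pre_enriched C"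
  using adm enriched_pre by (auto simp: admissible_def)

lemma ct_cot: "j \<in> J \<Longrightarrow> x \<in> VOb C \<Longrightarrow> is_cotensor V C j x (ct j x) (cu j x)"
  and ct_unit: "x \<in> VOb C \<Longrightarrow> ct \<one> x = x" "x \<in> VOb C \<Longrightarrow> cu \<one> x = VId C x"
  using adm by (auto simp: admissible_def designated_cotensors_def)

lemma ct_ob: "j \<in> J \<Longrightarrow> x \<in> VOb C \<Longrightarrow> ct j x \<in> VOb C"
  and cu_ty: "j \<in> J \<Longrightarrow> x \<in> VOb C \<Longrightarrow> ty (cu j x) = Arr j (VHom C (ct j x) x)"
  using cot_obs[OF ct_cot] by auto

lemma algebraD:
  assumes "is_algebra V J C T A"
  shows "enriched_functor V (Tcat T) C A" "preserves_cotensors V J (Tcat T) C A"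
  using assms by (simp_all add: is_algebra_def)

lemma algebra_cot:
  assumes T: "is_theory V J T" and A: "is_algebra V J C T A" and j: "j \<in> J"
  shows "is_cotensor V C j (FOb A \<one>) (FOb A j) (FHm A j \<one> \<cdot> str T j)"
  using algebraD(2)[OF A] str_cot[OF T j] j by (simp add: preserves_cotensors_def)

text \<open>By \<open>preserves_from_structure\<close>, the cotensors of I control all cotensors of
  a theory with exponents in J.\<close>

lemma is_algebraI:
  assumes T: "is_theory V J T" and A: "enriched_functor V (Tcat T) C A"
    and c: "\<And>j. j \<in> J \<Longrightarrow> is_cotensor V C j (FOb A \<one>) (FOb A j) (FHm A j \<one> \<cdot> str T j)"
  shows "is_algebra V J C T A"
  unfolding is_algebra_def
  using A preserves_from_structure[OF theoryD(3,1)[OF T] str_cot[OF T] A c] by simp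

text \<open>The V-functor [j, -] on C. A pointwise cotensor of algebras is a composite with it
  (\<open>alg_cotensor_eq\<close>).\<close>

definition ctf :: "'o \<Rightarrow> ('c, 'c, 'm) vfun" where
  "ctf j = \<lparr>FOb = (\<lambda>x\<in>VOb C. ct j x), FHm = (\<lambda>x\<in>VOb C. \<lambda>y\<in>VOb C. cotensor_hom V C ct cu j x y)\<rparr>"

lemma ctf_simps: "x \<in> VOb C \<Longrightarrow> FOb (ctf j) x = ct j x"
  "x \<in> VOb C \<Longrightarrow> y \<in> VOb C \<Longrightarrow> FHm (ctf j) x y = cotensor_hom V C ct cu j x y"
  by (simp_all add: ctf_def)

lemma cotensor_hom:
  assumes j: "j \<in> J" and o: "x \<in> VOb C" "y \<in> VOb C"
  shows "ty (cotensor_hom V C ct cu j x y) = Arr (VHom C x y) (VHom C (ct j x) (ct j y))"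
    "VCmp C (ct j x) (ct j y) y \<cdot> (cu j y \<boxtimes> cotensor_hom V C ct cu j x y) \<cdot> \<beta> (VHom C x y) j
     = VCmp C (ct j x) x y \<cdot> (\<iota> (VHom C x y) \<boxtimes> cu j x)"
proof -
  note ts = ct_ob[OF j o(1)] ct_ob[OF j o(2)] cu_ty[OF j o(1)] cu_ty[OF j o(2)] o j[THEN J_ob] C_pre
  have r: "ty (VCmp C (ct j x) x y \<cdot> (\<iota> (VHom C x y) \<boxtimes> cu j x)) = Arr (VHom C x y \<otimes> j) (VHom C (ct j x) y)"
    using ts by (simp add: mon_ty VCmp_ty VHom_ob)
  have "\<exists>!h. ty h = Arr (VHom C x y) (VHom C (ct j x) (ct j y)) \<and>
      VCmp C (ct j x) (ct j y) y \<cdot> (cu j y \<boxtimes> h) \<cdot> \<beta> (VHom C x y) j = VCmp C (ct j x) x y \<cdot> (\<iota> (VHom C x y) \<boxtimes> cu j x)"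
    using ct_cot[OF j o(2)] r ts unfolding cot_iff_hom[OF C_pre J_ob[OF j]] by (simp add: VHom_ob)
  from theI'[OF this] show "ty (cotensor_hom V C ct cu j x y) = Arr (VHom C x y) (VHom C (ct j x) (ct j y))"
    "VCmp C (ct j x) (ct j y) y \<cdot> (cu j y \<boxtimes> cotensor_hom V C ct cu j x y) \<cdot> \<beta> (VHom C x y) j
     = VCmp C (ct j x) x y \<cdot> (\<iota> (VHom C x y) \<boxtimes> cu j x)"
    by (simp_all add: cotensor_hom_def hom_ty)
qed

lemma ctf_el: "j \<in> J \<Longrightarrow> el C t = El x y S \<Longrightarrow> el C (fap (ctf j) t) = El (ct j x) (ct j y) S"
  by (auto elim!: elE simp: fap_def el_tuple ctf_simps ct_ob cotensor_hom(1) mon_ty)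

lemma cu_gel_el: "x \<in> VOb C \<Longrightarrow> fst l \<in> J \<Longrightarrow> el C (gel (ct (fst l) x) x l (cu (fst l) x)) = El (ct (fst l) x) x {l}"
  by (simp add: gel_el ct_ob cu_ty)

text \<open>The equation that defines \<open>cotensor_hom\<close>, read on elements: the designated
  counits are natural. With cancellation of counits it yields the functor laws of [j, -].\<close>

lemma ctf_law:
  assumes j: "fst l \<in> J" and t: "el C t = El x y S" and d: "l \<notin> S"
  shows "gel (ct (fst l) y) y l (cu (fst l) y) \<odot>[C] fap (ctf (fst l)) t = t \<odot>[C] gel (ct (fst l) x) x l (cu (fst l) x)"
proof -
  let ?j = "fst l"
  obtain f where f: "t = (x, y, S, f)" "x \<in> VOb C" "y \<in> VOb C" "stage S" "ty f = Arr (tn S) (VHom C x y)"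
    using t by (rule elE)
  have v: "ty (var l) = Arr (tn {l}) ?j" "stage {l}" "{l} \<inter> S = {}" "S \<inter> {l} = {}"
    using var_ty[of l] J_ob[OF j] d by (simp_all add: stage_simps)
  note h = cotensor_hom[OF j f(2,3)]
  note ts = ct_ob[OF j f(2)] ct_ob[OF j f(3)] cu_ty[OF j f(2)] cu_ty[OF j f(3)] h(1) j[THEN J_ob] C_pre
  have "VCmp C (ct ?j x) (ct ?j y) y \<cdot> pr {l} S (cu ?j y \<cdot> var l) (cotensor_hom V C ct cu ?j x y \<cdot> f)
      = (VCmp C (ct ?j x) (ct ?j y) y \<cdot> (cu ?j y \<boxtimes> cotensor_hom V C ct cu ?j x y) \<cdot> \<beta> (VHom C x y) ?j) \<cdot> pr S {l} f (var l)"
    using ts f v VCmp_ty[OF C_pre, of "ct ?j x" "ct ?j y" y] pr_ty[OF f(5) v(1) f(4) v(2,4)]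
    by (simp add: comp_assoc mon_ty pr_comp pr_comm pr_ty VHom_ob Un_commute)
  also have "\<dots> = VCmp C (ct ?j x) x y \<cdot> pr S {l} f (cu ?j x \<cdot> var l)"
    unfolding h(2)
    using ts f v VCmp_ty[OF C_pre, of "ct ?j x" x y] pr_ty[OF f(5) v(1) f(4) v(2,4)]
    by (simp add: comp_assoc mon_ty pr_comp pr_ty VHom_ob)
  finally show ?thesis using f by (simp add: gel_def fap_def ecomp_def ctf_simps Un_commute)
qed

lemma ctf_functor:
  assumes j: "j \<in> J"
  shows "enriched_functor V C C (ctf j)"
proof (rule enriched_functorI[OF C_cat C_cat _ _ gvar_cover[OF C_pre]])
  show "FOb (ctf j) \<in> VOb C \<rightarrow>\<^sub>E VOb C" using ct_ob[OF j] by (auto simp: ctf_def)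
  show "FHm (ctf j) \<in> (\<Pi>\<^sub>E a\<in>VOb C. \<Pi>\<^sub>E b\<in>VOb C. hom V (VHom C a b) (VHom C (FOb (ctf j) a) (FOb (ctf j) b)))"
    using cotensor_hom(1)[OF j] by (auto simp: ctf_def hom_ty)
  fix a assume a: "a \<in> VOb C"
  \<comment> \<open>The numbers 0 and 1 are reserved for the generic elements of hom-objects
    below.\<close>
  let ?l = "(j, 2 :: nat)"
  note cm = cot_mono[OF C_pre ct_cot[OF j], where l = ?l]
  have ge: "el C (gel (ct j x) x ?l (cu j x)) = El (ct j x) x {?l}" if "x \<in> VOb C" for x
    using cu_gel_el[of x ?l] that j by simp
  have law: "gel (ct j y) y ?l (cu j y) \<odot>[C] fap (ctf j) t = t \<odot>[C] gel (ct j x) x ?l (cu j x)"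
    if "el C t = El x y S" "?l \<notin> S" for x y S t
    using ctf_law[of ?l, OF _ that] j by simp
  have ia: "el C (idn C a) = El a a {}" "el C (idn C (ct j a)) = El (ct j a) (ct j a) {}"
    using idn_el[OF C_pre] a ct_ob[OF j a] by simp_all
  show "fap (ctf j) (idn C a) = idn C (FOb (ctf j) a)"
    unfolding ctf_simps(1)[OF a]
    by (rule cm[OF a _ _ ctf_el[OF j ia(1)] ia(2)])
      (use law[OF ia(1)] ecomp_idn(1)[OF C_cat ge[OF a]] ecomp_idn(2)[OF C_cat ge[OF a]] in simp_all)
  fix b c assume bc: "b \<in> VOb C" "c \<in> VOb C"
  let ?x = "gvar C 1 b c" and ?y = "gvar C 0 a b"
  note x = gvar_el[OF C_pre bc, of 1] and y = gvar_el[OF C_pre a bc(1), of 0]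
  have xy: "el C (?x \<odot>[C] ?y) = El a c ({(VHom C b c, 1)} \<union> {(VHom C a b, 0)})"
    by (rule ecomp_el[OF C_pre x y]) simp
  show "fap (ctf j) (?x \<odot>[C] ?y) = fap (ctf j) ?x \<odot>[C] fap (ctf j) ?y"
  proof (rule cm[OF bc(2) _ _ ctf_el[OF j xy]])
    show "el C (fap (ctf j) ?x \<odot>[C] fap (ctf j) ?y) = El (ct j a) (ct j c) ({(VHom C b c, 1)} \<union> {(VHom C a b, 0)})"
      by (rule ecomp_el[OF C_pre ctf_el[OF j x] ctf_el[OF j y]]) simp
    have "gel (ct j c) c ?l (cu j c) \<odot>[C] (fap (ctf j) ?x \<odot>[C] fap (ctf j) ?y)
        = (gel (ct j c) c ?l (cu j c) \<odot>[C] fap (ctf j) ?x) \<odot>[C] fap (ctf j) ?y"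
      by (rule ecomp_assoc[OF C_cat ge[OF bc(2)] ctf_el[OF j x] ctf_el[OF j y], symmetric]) simp_all
    also have "\<dots> = (?x \<odot>[C] gel (ct j b) b ?l (cu j b)) \<odot>[C] fap (ctf j) ?y" using law[OF x] by simp
    also have "\<dots> = ?x \<odot>[C] (gel (ct j b) b ?l (cu j b) \<odot>[C] fap (ctf j) ?y)"
      by (rule ecomp_assoc[OF C_cat x ge[OF bc(1)] ctf_el[OF j y]]) simp_all
    also have "\<dots> = ?x \<odot>[C] (?y \<odot>[C] gel (ct j a) a ?l (cu j a))" using law[OF y] by simp
    also have "\<dots> = (?x \<odot>[C] ?y) \<odot>[C] gel (ct j a) a ?l (cu j a)"
      by (rule ecomp_assoc[OF C_cat x y ge[OF a], symmetric]) simp_all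
    also have "\<dots> = gel (ct j c) c ?l (cu j c) \<odot>[C] fap (ctf j) (?x \<odot>[C] ?y)" using law[OF xy] by simp
    finally show "gel (ct j c) c ?l (cu j c) \<odot>[C] fap (ctf j) (?x \<odot>[C] ?y)
        = gel (ct j c) c ?l (cu j c) \<odot>[C] (fap (ctf j) ?x \<odot>[C] fap (ctf j) ?y)" ..
  qed simp_all
qed

text \<open>Cotensors commute with cotensors. Lifting through the image of \<gamma> is reduced, by
  composing with the counits of [j, -], to lifting through \<gamma> and then through the counit of
  [j, p]; the two labels are kept distinct.\<close>

lemma ctf_preserves:
  assumes j: "j \<in> J" and c: "is_cotensor V C k x p \<gamma>"
  shows "is_cotensor V C k (ct j x) (ct j p) (FHm (ctf j) p x \<cdot> \<gamma>)"
proof -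
  let ?j = "(j, 1 :: nat)" and ?k = "(k, 0 :: nat)"
  note co = cot_obs[OF c] and F = ctf_functor[OF j]
  let ?g = "gel p x ?k \<gamma>" and ?Fg = "gel (ct j p) (ct j x) ?k (FHm (ctf j) p x \<cdot> \<gamma>)"
  let ?cp = "gel (ct j p) p ?j (cu j p)" and ?cx = "gel (ct j x) x ?j (cu j x)"
  have g: "el C ?g = El p x {?k}" using co by (simp add: gel_el)
  have Fg: "fap (ctf j) ?g = ?Fg" using fap_gel[OF F co(2,1), of \<gamma> ?k] co by (simp add: ctf_simps)
  have Fge: "el C ?Fg = El (ct j p) (ct j x) {?k}" using ctf_el[OF j g] Fg by simp
  have cp: "el C ?cp = El (ct j p) p {?j}" and cx: "el C ?cx = El (ct j x) x {?j}"
    using cu_gel_el[of p ?j] cu_gel_el[of x ?j] co j by simp_all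
  have law: "?cx \<odot>[C] ?Fg = ?g \<odot>[C] ?cp" using ctf_law[of ?j, OF _ g] j Fg by simp
  have "is_cotensor V C (fst ?k) (ct j x) (ct j p) (FHm (ctf j) p x \<cdot> \<gamma>)"
  proof (rule cotI[OF C_pre _ _ _ finite.insertI[OF finite.emptyI, of ?j]])
    fix y S h assume d: "?k \<notin> S" "S \<inter> {?j} = {}" and h: "el C h = El y (ct j x) (insert ?k S)"
    have d': "?j \<notin> insert ?k S" "?j \<notin> S" "?k \<notin> insert ?j S" using d by auto
    have key: "?Fg \<odot>[C] g = h \<longleftrightarrow> ?g \<odot>[C] (?cp \<odot>[C] g) = ?cx \<odot>[C] h" if e: "el C g = El y (ct j p) S" for g
    proof -
      have "?g \<odot>[C] (?cp \<odot>[C] g) = (?g \<odot>[C] ?cp) \<odot>[C] g"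
        by (rule ecomp_assoc[OF C_cat g cp e, symmetric]) (use d d' in auto)
      also have "\<dots> = ?cx \<odot>[C] (?Fg \<odot>[C] g)"
        unfolding law[symmetric] by (rule ecomp_assoc[OF C_cat cx Fge e]) (use d d' in auto)
      finally have eq: "?g \<odot>[C] (?cp \<odot>[C] g) = ?cx \<odot>[C] (?Fg \<odot>[C] g)" .
      have t: "el C (?Fg \<odot>[C] g) = El y (ct j x) (insert ?k S)" using ecomp_el[OF C_pre Fge e] d by simp
      show ?thesis unfolding eq using cot_mono[OF C_pre ct_cot[OF j co(1)], where l = ?j, OF _ d'(1) t h] by auto
    qed
    have "el C (?cx \<odot>[C] h) = El y x (insert ?k (insert ?j S))"
      using ecomp_el[OF C_pre cx h] d' by (simp add: insert_commute)
    from cot_lift[OF C_pre c _ d'(3) this]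
    obtain h1 where h1: "el C h1 = El y p (insert ?j S)" "?g \<odot>[C] h1 = ?cx \<odot>[C] h" by auto
    have u: "\<exists>!g. el C g = El y (ct j p) S \<and> ?cp \<odot>[C] g = h1"
      by (rule cot_lift[OF C_pre ct_cot[OF j co(2)] _ d'(2) h1(1)]) simp
    have "?Fg \<odot>[C] g = h \<longleftrightarrow> ?cp \<odot>[C] g = h1" if e: "el C g = El y (ct j p) S" for g
    proof -
      have t: "el C (?cp \<odot>[C] g) = El y p (insert ?j S)" using ecomp_el[OF C_pre cp e] d' by simp
      show ?thesis unfolding key[OF e] h1(2)[symmetric]
        using cot_mono[OF C_pre c, where l = ?k, OF _ d'(3) t h1(1)] by auto
    qed
    then show "\<exists>!g. el C g = El y (ct j p) S \<and> ?Fg \<odot>[C] g = h" using u by blast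
  qed (use co ct_ob[OF j] FHm_ty[OF F co(2,1)] in \<open>simp_all add: mon_ty ctf_simps\<close>)
  then show ?thesis by simp
qed

lemma alg_cotensor_eq:
  assumes "enriched_functor V (Tcat T) C A"
  shows "alg_cotensor V C ct cu T j A = comp_vfun V (Tcat T) (ctf j) A"
  using FOb_ob[OF assms] by (auto simp: alg_cotensor_def comp_vfun_def ctf_simps intro!: restrict_ext)

lemma alg_cotensor_algebra:
  assumes j: "j \<in> J" and A: "is_algebra V J C T A"
  shows "is_algebra V J C T (alg_cotensor V C ct cu T j A)"
proof -
  note F = algebraD(1)[OF A]
  have p: "is_cotensor V C k (FOb A x) (FOb A p) (FHm A p x \<cdot> \<gamma>)" if "k \<in> J" "is_cotensor V (Tcat T) k x p \<gamma>" for k x p \<gamma>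
    using algebraD(2)[OF A] that by (simp add: preserves_cotensors_def)
  have "is_cotensor V C k (FOb (comp_vfun V (Tcat T) (ctf j) A) x) (FOb (comp_vfun V (Tcat T) (ctf j) A) p) (FHm (comp_vfun V (Tcat T) (ctf j) A) p x \<cdot> \<gamma>)"
    if "k \<in> J" and c: "is_cotensor V (Tcat T) k x p \<gamma>" for k x p \<gamma>
  proof -
    note co = cot_obs[OF c]
    show ?thesis using ctf_preserves[OF j p[OF that]] co FHm_ty[OF F co(2,1)] FOb_ob[OF F]
        FHm_ty[OF ctf_functor[OF j], of "FOb A p" "FOb A x"]
      by (simp add: comp_vfun_def ctf_simps comp_assoc)
  qed
  then show ?thesis unfolding alg_cotensor_eq[OF F] is_algebra_def preserves_cotensors_def
    using comp_vfun_functor[OF F ctf_functor[OF j]] by blast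
qed

lemma alg_cotensor_ob: "x \<in> VOb (Tcat T) \<Longrightarrow> FOb (alg_cotensor V C ct cu T j A) x = ct j (FOb A x)"
  by (simp add: alg_cotensor_def)

lemma fap_alg_cotensor:
  assumes "enriched_functor V (Tcat T) C A" "j \<in> J" "el (Tcat T) t = El x y S"
  shows "fap (alg_cotensor V C ct cu T j A) t = fap (ctf j) (fap A t)"
  unfolding alg_cotensor_eq[OF assms(1)] by (rule fap_comp_vfun[OF assms(1) ctf_functor[OF assms(2)] assms(3)])

text \<open>With identity counits the identity solves the equation that defines
  \<open>cotensor_hom\<close>. As a consequence [I, A] = A holds as an equality in
  \<open>alg_cotensor_unit\<close>, which the typing of the commutant relies on.\<close>

lemma cotensor_hom_unit:
  assumes o: "x \<in> VOb C" "y \<in> VOb C"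
  shows "cotensor_hom V C ct cu \<one> x y = \<iota> (VHom C x y)"
proof -
  let ?H = "VHom C x y"
  note u = ct_unit(1)[OF o(1)] ct_unit(1)[OF o(2)] ct_unit(2)[OF o(1)] ct_unit(2)[OF o(2)]
  note ts = VHom_ob[OF C_pre o] VHom_ob[OF C_pre o(2,2)] VHom_ob[OF C_pre o(1,1)] VId_ty[OF C_pre] o C_pre
  have "VCmp C x y y \<cdot> (VId C y \<boxtimes> \<iota> ?H) \<cdot> \<beta> ?H \<one> = (VCmp C x y y \<cdot> (VId C y \<boxtimes> \<iota> ?H)) \<cdot> \<beta> ?H \<one>"
    using ts by (simp add: comp_assoc mon_ty VCmp_ty)
  also have "\<dots> = runit V ?H"
    using enriched_category.VCmp_VId_left[OF C_cat o] lunit_braid[OF ts(1)] by simp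
  finally have r: "VCmp C x y y \<cdot> (VId C y \<boxtimes> \<iota> ?H) \<cdot> \<beta> ?H \<one> = runit V ?H" .
  have "ty (runit V ?H) = Arr (VHom C x y \<otimes> \<one>) ?H" using ts by (simp add: mon_ty)
  then have "\<exists>!h. ty h = Arr ?H ?H \<and>
      VCmp C x y y \<cdot> (VId C y \<boxtimes> h) \<cdot> \<beta> ?H \<one> = runit V ?H"
    using ct_cot[OF J_unit o(2)] ts unfolding cot_iff_hom[OF C_pre unit_Ob] u by blast
  moreover have "ty (\<iota> ?H) = Arr ?H ?H" using ts by (simp add: mon_ty)
  moreover have "VCmp C x x y \<cdot> (\<iota> ?H \<boxtimes> VId C x) = runit V ?H"
    by (rule enriched_category.VCmp_VId_right[OF C_cat o])
  ultimately show ?thesis using cotensor_hom[OF J_unit o] r unfolding u by metis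
qed

lemma alg_cotensor_unit:
  assumes A: "is_algebra V J C T A"
  shows "alg_cotensor V C ct cu T \<one> A = A"
proof -
  note F = algebraD(1)[OF A] and F' = algebraD(1)[OF alg_cotensor_algebra[OF J_unit A]]
  show ?thesis
    by (rule vfun_eqI[OF F' F])
      (use FOb_ob[OF F] FHm_ty[OF F] in \<open>simp_all add: alg_cotensor_def ct_unit cotensor_hom_unit comp_ident\<close>)
qed

lemma end_hom_end:
  assumes "is_theory V J T" "is_algebra V J C T A" "is_algebra V J C T B"
  shows "is_hom_end V C T A B (alg_hom V C T A B) (alg_eval V C T A B)"
proof -
  have "\<forall>T A B. is_theory V J T \<longrightarrow> is_algebra V J C T A \<longrightarrow> is_algebra V J C T B \<longrightarrow> (\<exists>e \<pi>. is_hom_end V C T A B e \<pi>)"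
    using adm unfolding admissible_def by (elim conjE)
  from this[rule_format, OF assms] obtain e \<pi> where "is_hom_end V C T A B e \<pi>" by (elim exE)
  then have "\<exists>z. case z of (e, \<pi>) \<Rightarrow> is_hom_end V C T A B e \<pi>" by auto
  then have "case hom_end V C T A B of (e, \<pi>) \<Rightarrow> is_hom_end V C T A B e \<pi>"
    unfolding hom_end_def by (rule someI_ex)
  then show ?thesis by (simp add: alg_hom_def alg_eval_def split_beta)
qed

lemma end_wedge:
  assumes "is_theory V J T" "is_algebra V J C T A" "is_algebra V J C T B"
  shows "hom_wedge V C T A B (alg_hom V C T A B) (alg_eval V C T A B)"
  using end_hom_end[OF assms] by (simp add: is_hom_end_def)

lemma end_universal:
  assumes "is_theory V J T" "is_algebra V J C T A" "is_algebra V J C T B" "hom_wedge V C T A B e \<pi>"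
  shows "\<exists>!h. ty h = Arr e (alg_hom V C T A B) \<and> (\<forall>x \<in> J. alg_eval V C T A B x \<cdot> h = \<pi> x)"
  using end_hom_end[OF assms(1-3)] assms(4) theoryD(1)[OF assms(1)] by (simp add: is_hom_end_def hom_ty)

lemma end_ob:
  assumes "is_theory V J T" "is_algebra V J C T A" "is_algebra V J C T B"
  shows "alg_hom V C T A B \<in> Ob V"
  using end_wedge[OF assms] by (simp add: hom_wedge_def)

lemma eval_ty:
  assumes "is_theory V J T" "is_algebra V J C T A" "is_algebra V J C T B" "x \<in> J"
  shows "ty (alg_eval V C T A B x) = Arr (alg_hom V C T A B) (VHom C (FOb A x) (FOb B x))"
proof -
  have "alg_eval V C T A B \<in> (\<Pi>\<^sub>E x \<in> VOb (Tcat T). hom V (alg_hom V C T A B) (VHom C (FOb A x) (FOb B x)))"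
    using end_wedge[OF assms(1-3)] by (simp add: hom_wedge_def)
  from PiE_mem[OF this, of x] show ?thesis using assms(4) theoryD(1)[OF assms(1)] by (simp add: hom_ty)
qed

end

section \<open>Commutants\<close>

context admissible_category
begin

abbreviation AV :: "('o, 'm) jtheory \<Rightarrow> (('o, 'c, 'm) vfun, 'o, 'm) vcat" where "AV T \<equiv> Alg_vcat V J C T"

text \<open>Evaluation at x sends elements of T-Alg(C) to elements of C. The evaluations are jointly
  injective (\<open>evx_inj\<close>), so equations in T-Alg(C) are proved in C.\<close>

definition evx :: "('o, 'm) jtheory \<Rightarrow> 'o \<Rightarrow> (('o, 'c, 'm) vfun, 'o, 'm) elt \<Rightarrow> ('c, 'o, 'm) elt" where
  "evx T x p = (case p of (A, B, S, f) \<Rightarrow> (FOb A x, FOb B x, S, alg_eval V C T A B x \<cdot> f))"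

context
  fixes T :: "('o, 'm) jtheory"
  assumes T: "is_theory V J T"
begin

lemma AV_simps: "A \<in> VOb (AV T) \<longleftrightarrow> is_algebra V J C T A"
  "is_algebra V J C T A \<Longrightarrow> is_algebra V J C T B \<Longrightarrow> VHom (AV T) A B = alg_hom V C T A B"
  by (simp_all add: Alg_vcat_def Let_def)

lemma AV_el: "el (AV T) (A, B, S, f) = El A' B' S' \<longleftrightarrow> A = A' \<and> B = B' \<and> S = S' \<and>
    is_algebra V J C T A \<and> is_algebra V J C T B \<and> stage S \<and> ty f = Arr (tn S) (alg_hom V C T A B)"
  by (auto simp: el_tuple AV_simps)

lemma AV_elE:
  assumes "el (AV T) p = El A B S"
  obtains f where "p = (A, B, S, f)" "is_algebra V J C T A" "is_algebra V J C T B" "stage S"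
    "ty f = Arr (tn S) (alg_hom V C T A B)"
  using assms by (cases p) (auto simp: AV_el)

lemma alg_ob: "is_algebra V J C T A \<Longrightarrow> x \<in> J \<Longrightarrow> FOb A x \<in> VOb C"
  using FOb_ob[OF algebraD(1)] theoryD(1)[OF T] by simp

lemma evx_el:
  assumes "el (AV T) p = El A B S" "x \<in> J"
  shows "el C (evx T x p) = El (FOb A x) (FOb B x) S"
  using assms by (auto elim!: AV_elE simp: evx_def el_tuple alg_ob eval_ty[OF T] mon_ty)

lemma evx_nat:
  assumes p: "el (AV T) p = El A B S" and t: "el (Tcat T) t = El x y U" and d: "S \<inter> U = {}"
  shows "evx T y p \<odot>[C] fap A t = fap B t \<odot>[C] evx T x p"
proof -
  obtain f where f: "p = (A, B, S, f)" "is_algebra V J C T A" "is_algebra V J C T B" "stage S"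
    "ty f = Arr (tn S) (alg_hom V C T A B)"
    using p by (rule AV_elE)
  show ?thesis
    using wedgeD[OF end_wedge[OF T f(2,3)] algebraD(1)[OF f(2)] algebraD(1)[OF f(3)] f(5,4) t d] f(1)
    by (simp add: evx_def)
qed

text \<open>The universal property of the end, read at stage S: a natural family of elements is a
  wedge with vertex \<open>tn S\<close>, and its factorisation is the glued element.\<close>

lemma evx_ex:
  assumes A: "is_algebra V J C T A" and B: "is_algebra V J C T B" and S: "stage S" and W: "finite W"
    and P: "\<And>x. x \<in> J \<Longrightarrow> el C (P x) = El (FOb A x) (FOb B x) S"
    and n: "\<And>x y t U. \<lbrakk>el (Tcat T) t = El x y U; S \<inter> U = {}; W \<inter> U = {}\<rbrakk> \<Longrightarrow> P y \<odot>[C] fap A t = fap B t \<odot>[C] P x"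
  shows "\<exists>!p. el (AV T) p = El A B S \<and> (\<forall>x \<in> J. evx T x p = P x)"
proof -
  let ?\<pi> = "\<lambda>x\<in>J. el_arr (P x)"
  have Pa: "P x = (FOb A x, FOb B x, S, el_arr (P x))" "ty (el_arr (P x)) = Arr (tn S) (VHom C (FOb A x) (FOb B x))"
    if "x \<in> J" for x
    using P[OF that] by (auto elim!: elE simp: el_arr_def)
  have i: "ty (\<iota> (tn S)) = Arr (tn S) (tn S)" "iso (\<iota> (tn S))" using tn_ob[OF S] by (simp_all add: mon_ty)
  have "hom_wedge V C T A B (tn S) ?\<pi>"
  proof (rule wedgeI[OF algebraD(1)[OF A] algebraD(1)[OF B] _ _ i(1) S i(2) W])
    show "?\<pi> \<in> extensional (VOb (Tcat T))" using theoryD(1)[OF T] by simp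
    show "ty (?\<pi> x) = Arr (tn S) (VHom C (FOb A x) (FOb B x))" if "x \<in> VOb (Tcat T)" for x
      using that theoryD(1)[OF T] Pa(2) by simp
    fix x y t U assume t: "el (Tcat T) t = El x y U" "S \<inter> U = {}" "W \<inter> U = {}"
    have xy: "x \<in> J" "y \<in> J" using el_obs[OF t(1)] theoryD(1)[OF T] by simp_all
    show "(FOb A y, FOb B y, S, ?\<pi> y \<cdot> \<iota> (tn S)) \<odot>[C] fap A t = fap B t \<odot>[C] (FOb A x, FOb B x, S, ?\<pi> x \<cdot> \<iota> (tn S))"
      using n[OF t] Pa[OF xy(1)] Pa[OF xy(2)] xy by (simp add: comp_ident)
  qed
  from end_universal[OF T A B this]
  have u: "\<exists>!h. ty h = Arr (tn S) (alg_hom V C T A B) \<and> (\<forall>x\<in>J. alg_eval V C T A B x \<cdot> h = el_arr (P x))" by simp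
  then obtain h where h: "ty h = Arr (tn S) (alg_hom V C T A B)" "\<forall>x\<in>J. alg_eval V C T A B x \<cdot> h = el_arr (P x)" by blast
  show ?thesis
  proof (rule ex1I[of _ "(A, B, S, h)"])
    show "el (AV T) (A, B, S, h) = El A B S \<and> (\<forall>x\<in>J. evx T x (A, B, S, h) = P x)"
      using h A B S Pa(1) by (simp add: AV_el evx_def)
    fix p assume p: "el (AV T) p = El A B S \<and> (\<forall>x\<in>J. evx T x p = P x)"
    then obtain f where f: "p = (A, B, S, f)" "ty f = Arr (tn S) (alg_hom V C T A B)" by (auto elim: AV_elE)
    have "\<forall>x\<in>J. alg_eval V C T A B x \<cdot> f = el_arr (P x)"
    proof
      fix x assume x: "x \<in> J"
      have "el_arr (evx T x p) = el_arr (P x)" using p x by simp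
      then show "alg_eval V C T A B x \<cdot> f = el_arr (P x)" using f(1) by (simp add: evx_def el_arr_def)
    qed
    then have "f = h" using u h f(2) by blast
    then show "p = (A, B, S, h)" using f by simp
  qed
qed

lemma evx_inj:
  assumes p: "el (AV T) p = El A B S" "el (AV T) q = El A B S" and e: "\<And>x. x \<in> J \<Longrightarrow> evx T x p = evx T x q"
  shows "p = q"
proof -
  have o: "is_algebra V J C T A" "is_algebra V J C T B" "stage S" using p(1) by (auto elim: AV_elE)
  have "\<exists>!r. el (AV T) r = El A B S \<and> (\<forall>x\<in>J. evx T x r = evx T x q)"
    by (rule evx_ex[OF o finite.emptyI]) (use evx_el[OF p(2)] evx_nat[OF p(2)] in simp_all)
  then show ?thesis using p e by blast
qed

text \<open>The description in \<open>Alg_vcat\<close> denotes because pointwise composites of two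
  wedges form a wedge again. This is seen by sliding an element of T past one factor at a
  time.\<close>

lemma AV_VCmp:
  assumes A: "is_algebra V J C T A" and B: "is_algebra V J C T B" and D: "is_algebra V J C T D"
  shows "ty (VCmp (AV T) A B D) = Arr (alg_hom V C T B D \<otimes> alg_hom V C T A B) (alg_hom V C T A D)"
    "x \<in> J \<Longrightarrow> alg_eval V C T A D x \<cdot> VCmp (AV T) A B D
      = VCmp C (FOb A x) (FOb B x) (FOb D x) \<cdot> (alg_eval V C T B D x \<boxtimes> alg_eval V C T A B x)"
proof -
  let ?X = "alg_hom V C T B D" and ?Y = "alg_hom V C T A B"
  let ?m = "(?X, 1 :: nat)" and ?n = "(?Y, 0 :: nat)"
  let ?S = "{?m, ?n}" and ?i = "pr {?m} {?n} (var ?m) (var ?n)"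
  let ?\<pi> = "\<lambda>x\<in>J. VCmp C (FOb A x) (FOb B x) (FOb D x) \<cdot> (alg_eval V C T B D x \<boxtimes> alg_eval V C T A B x)"
  note F = algebraD(1)[OF A] algebraD(1)[OF B] algebraD(1)[OF D]
  note J' = theoryD(1)[OF T]
  have o: "?X \<in> Ob V" "?Y \<in> Ob V" using end_ob[OF T B D] end_ob[OF T A B] .
  have v: "ty (var ?m) = Arr (tn {?m}) ?X" "ty (var ?n) = Arr (tn {?n}) ?Y" "stage {?m}" "stage {?n}" "{?m} \<inter> {?n} = {}"
    using var_ty[of ?m] var_ty[of ?n] o by (simp_all add: stage_simps)
  have i: "ty ?i = Arr (tn ?S) (?X \<otimes> ?Y)" "stage ?S" "iso ?i"
    using pr_ty[OF v] pr_iso[OF v] var_iso[of ?m] var_iso[of ?n] o by (simp_all add: stage_simps insert_commute)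
  have pty: "ty (?\<pi> x) = Arr (?X \<otimes> ?Y) (VHom C (FOb A x) (FOb D x))" if "x \<in> J" for x
    using that eval_ty[OF T A B that] eval_ty[OF T B D that] VCmp_ty[OF C_pre alg_ob[OF A that] alg_ob[OF B that] alg_ob[OF D that]]
    by (simp add: mon_ty)
  \<comment> \<open>The generic elements of the two hom-objects, evaluated at x; their composite
    represents \<open>?\<pi> x\<close> in C.\<close>
  define q where "q x = (FOb B x, FOb D x, {?m}, alg_eval V C T B D x \<cdot> var ?m)" for x
  define p where "p x = (FOb A x, FOb B x, {?n}, alg_eval V C T A B x \<cdot> var ?n)" for x
  have qe: "el C (q x) = El (FOb B x) (FOb D x) {?m}" and pe: "el C (p x) = El (FOb A x) (FOb B x) {?n}" if "x \<in> J" for x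
    using that v o eval_ty[OF T A B that] eval_ty[OF T B D that] alg_ob[OF A that] alg_ob[OF B that] alg_ob[OF D that]
    by (simp_all add: q_def p_def el_tuple mon_ty)
  have qp: "(FOb A x, FOb D x, ?S, ?\<pi> x \<cdot> ?i) = q x \<odot>[C] p x" if x: "x \<in> J" for x
    using x v eval_ty[OF T A B x] eval_ty[OF T B D x] VCmp_ty[OF C_pre alg_ob[OF A x] alg_ob[OF B x] alg_ob[OF D x]] pr_ty[OF v]
      pr_comp[OF v(1,2) eval_ty[OF T B D x] eval_ty[OF T A B x] v(3-5)]
    by (simp add: q_def p_def ecomp_def comp_assoc mon_ty insert_commute)
  have "hom_wedge V C T A D (?X \<otimes> ?Y) ?\<pi>"
  proof (rule wedgeI[OF F(1,3) _ _ i finite.emptyI])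
    show "?\<pi> \<in> extensional (VOb (Tcat T))" using J' by simp
    show "ty (?\<pi> x) = Arr (?X \<otimes> ?Y) (VHom C (FOb A x) (FOb D x))" if "x \<in> VOb (Tcat T)" for x
      using that pty J' by simp
    fix x y t U assume t: "el (Tcat T) t = El x y U" and d: "?S \<inter> U = {}"
    have xy: "x \<in> J" "y \<in> J" using el_obs[OF t] J' by simp_all
    have d': "{?m} \<inter> U = {}" "{?n} \<inter> U = {}" "U \<inter> {?m} = {}" "U \<inter> {?n} = {}" "{?m} \<inter> {?n} = {}" using d by auto
    note te = fap_el[OF F(1) t] fap_el[OF F(2) t] fap_el[OF F(3) t]
    have "(q y \<odot>[C] p y) \<odot>[C] fap A t = q y \<odot>[C] (p y \<odot>[C] fap A t)"
      by (rule ecomp_assoc[OF C_cat qe[OF xy(2)] pe[OF xy(2)] te(1) d'(5,1,2)])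
    also have "p y \<odot>[C] fap A t = fap B t \<odot>[C] p x"
      unfolding p_def by (rule wedgeD[OF end_wedge[OF T A B] F(1,2) v(2,4) t d'(2)])
    also have "q y \<odot>[C] (fap B t \<odot>[C] p x) = (q y \<odot>[C] fap B t) \<odot>[C] p x"
      by (rule ecomp_assoc[OF C_cat qe[OF xy(2)] te(2) pe[OF xy(1)] d'(1,5,4), symmetric])
    also have "q y \<odot>[C] fap B t = fap D t \<odot>[C] q x"
      unfolding q_def by (rule wedgeD[OF end_wedge[OF T B D] F(2,3) v(1,3) t d'(1)])
    also have "(fap D t \<odot>[C] q x) \<odot>[C] p x = fap D t \<odot>[C] (q x \<odot>[C] p x)"
      by (rule ecomp_assoc[OF C_cat te(3) qe[OF xy(1)] pe[OF xy(1)] d'(3,4,5)])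
    finally show "(FOb A y, FOb D y, ?S, ?\<pi> y \<cdot> ?i) \<odot>[C] fap A t = fap D t \<odot>[C] (FOb A x, FOb D x, ?S, ?\<pi> x \<cdot> ?i)"
      unfolding qp[OF xy(1)] qp[OF xy(2)] .
  qed
  from theI'[OF end_universal[OF T A D this]]
  have "ty (VCmp (AV T) A B D) = Arr (?X \<otimes> ?Y) (alg_hom V C T A D) \<and>
      (\<forall>x\<in>J. alg_eval V C T A D x \<cdot> VCmp (AV T) A B D = ?\<pi> x)"
    using A B D by (simp add: Alg_vcat_def Let_def hom_ty J' cong: ball_cong)
  then show "ty (VCmp (AV T) A B D) = Arr (?X \<otimes> ?Y) (alg_hom V C T A D)"
    "x \<in> J \<Longrightarrow> alg_eval V C T A D x \<cdot> VCmp (AV T) A B D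
      = VCmp C (FOb A x) (FOb B x) (FOb D x) \<cdot> (alg_eval V C T B D x \<boxtimes> alg_eval V C T A B x)"
    by auto
qed

lemma AV_VId:
  assumes A: "is_algebra V J C T A"
  shows "ty (VId (AV T) A) = Arr \<one> (alg_hom V C T A A)" "x \<in> J \<Longrightarrow> alg_eval V C T A A x \<cdot> VId (AV T) A = VId C (FOb A x)"
proof -
  let ?\<pi> = "\<lambda>x\<in>J. VId C (FOb A x)"
  note F = algebraD(1)[OF A] and J' = theoryD(1)[OF T]
  have "hom_wedge V C T A A \<one> ?\<pi>"
  proof (rule wedgeI[OF F F _ _ _ _ _ finite.emptyI, where S = "{}" and i = "\<iota> \<one>"])
    fix x y t U assume t: "el (Tcat T) t = El x y U"
    have xy: "x \<in> J" "y \<in> J" using el_obs[OF t] J' by simp_all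
    show "(FOb A y, FOb A y, {}, ?\<pi> y \<cdot> \<iota> \<one>) \<odot>[C] fap A t = fap A t \<odot>[C] (FOb A x, FOb A x, {}, ?\<pi> x \<cdot> \<iota> \<one>)"
      using ecomp_idn[OF C_cat fap_el[OF F t]] xy VId_ty[OF C_pre alg_ob[OF A xy(1)]] VId_ty[OF C_pre alg_ob[OF A xy(2)]]
      by (simp add: comp_ident idn_def)
  qed (use J' VId_ty[OF C_pre alg_ob[OF A]] in \<open>simp_all add: mon_ty tn_simps stage_simps\<close>)
  from theI'[OF end_universal[OF T A A this]]
  have "ty (VId (AV T) A) = Arr \<one> (alg_hom V C T A A) \<and> (\<forall>x\<in>J. alg_eval V C T A A x \<cdot> VId (AV T) A = ?\<pi> x)"
    using A by (simp add: Alg_vcat_def Let_def hom_ty J' cong: ball_cong)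
  then show "ty (VId (AV T) A) = Arr \<one> (alg_hom V C T A A)" "x \<in> J \<Longrightarrow> alg_eval V C T A A x \<cdot> VId (AV T) A = VId C (FOb A x)"
    by auto
qed

lemma AV_pre: "pre_enriched (AV T)"
  unfolding pre_enriched_def
proof (intro conjI PiE_I)
  fix A B D assume "A \<in> VOb (AV T)" "B \<in> VOb (AV T)" "D \<in> VOb (AV T)"
  then have o: "is_algebra V J C T A" "is_algebra V J C T B" "is_algebra V J C T D" by (simp_all add: AV_simps)
  show "VHom (AV T) A B \<in> Ob V" using o end_ob[OF T] by (simp add: AV_simps)
  show "VId (AV T) A \<in> hom V \<one> (VHom (AV T) A A)" using o AV_VId(1) by (simp add: AV_simps hom_ty)
  show "VCmp (AV T) A B D \<in> hom V (VHom (AV T) B D \<otimes> VHom (AV T) A B) (VHom (AV T) A D)"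
    using o AV_VCmp(1) by (simp add: AV_simps hom_ty)
qed (simp_all add: Alg_vcat_def Let_def)

lemma evx_ecomp:
  assumes p: "el (AV T) p = El B D S" and q: "el (AV T) q = El A B U" and d: "S \<inter> U = {}" and x: "x \<in> J"
  shows "evx T x (p \<odot>[AV T] q) = evx T x p \<odot>[C] evx T x q"
proof -
  obtain f where f: "p = (B, D, S, f)" "is_algebra V J C T B" "is_algebra V J C T D" "stage S"
    "ty f = Arr (tn S) (alg_hom V C T B D)" using p by (rule AV_elE)
  obtain g where g: "q = (A, B, U, g)" "is_algebra V J C T A" "stage U"
    "ty g = Arr (tn U) (alg_hom V C T A B)" using q by (rule AV_elE)
  note e = eval_ty[OF T g(2) f(2) x] eval_ty[OF T f(2,3) x] eval_ty[OF T g(2) f(3) x]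
  note c = AV_VCmp[OF g(2) f(2,3)]
  have "alg_eval V C T A D x \<cdot> VCmp (AV T) A B D \<cdot> pr S U f g = (alg_eval V C T A D x \<cdot> VCmp (AV T) A B D) \<cdot> pr S U f g"
    using e c(1) f g d pr_ty[OF f(5) g(4) f(4) g(3) d] by (simp add: comp_assoc)
  also have "\<dots> = VCmp C (FOb A x) (FOb B x) (FOb D x) \<cdot> pr S U (alg_eval V C T B D x \<cdot> f) (alg_eval V C T A B x \<cdot> g)"
    unfolding c(2)[OF x]
    using e f g d pr_ty[OF f(5) g(4) f(4) g(3) d] VCmp_ty[OF C_pre alg_ob[OF g(2) x] alg_ob[OF f(2) x] alg_ob[OF f(3) x]]
    by (simp add: comp_assoc mon_ty pr_comp)
  finally show ?thesis by (simp add: f(1) g(1) evx_def ecomp_def)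
qed

lemma evx_idn: "is_algebra V J C T A \<Longrightarrow> x \<in> J \<Longrightarrow> evx T x (idn (AV T) A) = idn C (FOb A x)"
  by (simp add: evx_def idn_def AV_VId)

text \<open>Every axiom holds after each evaluation, because evaluation commutes with composition
  and identities and C is a V-category.\<close>

lemma AV_cat: "enriched_category V (AV T)"
proof (rule enriched_categoryI[OF AV_pre gvar_cover[OF AV_pre]])
  note P = AV_pre
  let ?l = "\<lambda>n A B. {(VHom (AV T) A B, n :: nat)}"
  fix A B assume o: "A \<in> VOb (AV T)" "B \<in> VOb (AV T)"
  let ?z = "gvar (AV T) 0 A B"
  note z = gvar_el[OF P o, of 0]
  have i: "el (AV T) (idn (AV T) A) = El A A {}" "el (AV T) (idn (AV T) B) = El B B {}"
    using idn_el[OF P] o by simp_all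
  have c: "el (AV T) (idn (AV T) B \<odot>[AV T] ?z) = El A B (?l 0 A B)" "el (AV T) (?z \<odot>[AV T] idn (AV T) A) = El A B (?l 0 A B)"
    using ecomp_el[OF P i(2) z] ecomp_el[OF P z i(1)] by simp_all
  show "idn (AV T) B \<odot>[AV T] ?z = ?z"
    by (rule evx_inj[OF c(1) z])
      (use evx_ecomp[OF i(2) z] evx_idn[of B] ecomp_idn(1)[OF C_cat evx_el[OF z]] o in \<open>simp_all add: AV_simps\<close>)
  show "?z \<odot>[AV T] idn (AV T) A = ?z"
    by (rule evx_inj[OF c(2) z])
      (use evx_ecomp[OF z i(1)] evx_idn[of A] ecomp_idn(2)[OF C_cat evx_el[OF z]] o in \<open>simp_all add: AV_simps\<close>)
  fix D E assume o': "D \<in> VOb (AV T)" "E \<in> VOb (AV T)"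
  let ?y = "gvar (AV T) 1 B D" and ?x = "gvar (AV T) 2 D E"
  note y = gvar_el[OF P o(2) o'(1), of 1] and x = gvar_el[OF P o', of 2]
  have d: "?l 2 D E \<inter> ?l 1 B D = {}" "?l 2 D E \<inter> ?l 0 A B = {}" "?l 1 B D \<inter> ?l 0 A B = {}"
    "(?l 2 D E \<union> ?l 1 B D) \<inter> ?l 0 A B = {}" "?l 2 D E \<inter> (?l 1 B D \<union> ?l 0 A B) = {}" by auto
  note xy = ecomp_el[OF P x y d(1)] and yz = ecomp_el[OF P y z d(3)]
  show "(?x \<odot>[AV T] ?y) \<odot>[AV T] ?z = ?x \<odot>[AV T] (?y \<odot>[AV T] ?z)"
  proof (rule evx_inj[OF ecomp_el[OF P xy z d(4)]])
    show "el (AV T) (?x \<odot>[AV T] (?y \<odot>[AV T] ?z)) = El A E (?l 2 D E \<union> ?l 1 B D \<union> ?l 0 A B)"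
      using ecomp_el[OF P x yz d(5)] by (simp only: Un_assoc)
    fix j assume j: "j \<in> J"
    show "evx T j ((?x \<odot>[AV T] ?y) \<odot>[AV T] ?z) = evx T j (?x \<odot>[AV T] (?y \<odot>[AV T] ?z))"
      unfolding evx_ecomp[OF xy z d(4) j] evx_ecomp[OF x y d(1) j] evx_ecomp[OF x yz d(5) j] evx_ecomp[OF y z d(3) j]
      by (rule ecomp_assoc[OF C_cat evx_el[OF x j] evx_el[OF y j] evx_el[OF z j] d(1-3)])
  qed
qed

end

section \<open>The commutant theory of a fixed algebra\<close>

context
  fixes T :: "('o, 'm) jtheory" and A :: "('o, 'c, 'm) vfun"
  assumes T: "is_theory V J T" and A: "is_algebra V J C T A"
begin

abbreviation "cA j \<equiv> alg_cotensor V C ct cu T j A"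
abbreviation "CV \<equiv> commutant_vcat V J C ct cu (T, A)"

lemmas cA_alg = alg_cotensor_algebra[OF _ A]

lemma cA_ob: "x \<in> J \<Longrightarrow> FOb (cA j) x = ct j (FOb A x)"
  using alg_cotensor_ob theoryD(1)[OF T] by simp

lemma CV_simps: "VOb CV = J" "j \<in> J \<Longrightarrow> k \<in> J \<Longrightarrow> VHom CV j k = VHom (AV T) (cA j) (cA k)"
  "j \<in> J \<Longrightarrow> k \<in> J \<Longrightarrow> l \<in> J \<Longrightarrow> VCmp CV j k l = VCmp (AV T) (cA j) (cA k) (cA l)"
  "j \<in> J \<Longrightarrow> VId CV j = VId (AV T) (cA j)"
  by (simp_all add: commutant_vcat_def)

lemma CV_cat: "enriched_category V CV"
proof -
  note P = AV_pre[OF T] and E = AV_cat[OF T]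
  have o: "j \<in> J \<Longrightarrow> cA j \<in> VOb (AV T)" for j using cA_alg by (simp add: AV_simps[OF T])
  have "pre_enriched CV"
    unfolding pre_enriched_def CV_simps(1)
  proof (intro conjI PiE_I)
    fix j k l assume j: "j \<in> J" "k \<in> J" "l \<in> J"
    show "VHom CV j k \<in> Ob V" "VCmp CV j k l \<in> hom V (VHom CV k l \<otimes> VHom CV j k) (VHom CV j l)" "VId CV j \<in> hom V \<one> (VHom CV j j)"
      using j VHom_ob[OF P o o] VCmp_ty[OF P o o o] VId_ty[OF P o] by (simp_all add: CV_simps hom_ty)
  qed (simp_all add: commutant_vcat_def)
  then show ?thesis
    unfolding enriched_category_def enriched_category_axioms_def pre_enriched_def
    using symmetric_monoidal_closed_category_axioms enriched_category.VCmp_assoc[OF E o o o o]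
      enriched_category.VCmp_VId_left[OF E o o] enriched_category.VCmp_VId_right[OF E o o]
    by (auto simp only: CV_simps)
qed

lemmas CV_pre = enriched_pre[OF CV_cat]

text \<open>The commutant has J as its objects, and its hom-objects are those between pointwise
  cotensors. As [j, A] does not determine j, an element of the commutant is transferred to T-Alg(C)
  by renaming its endpoints.\<close>

definition up :: "('o, 'o, 'm) elt \<Rightarrow> (('o, 'c, 'm) vfun, 'o, 'm) elt" where
  "up u = (case u of (j, k, S, f) \<Rightarrow> (cA j, cA k, S, f))"

lemma up_el: "el CV u = El j k S \<Longrightarrow> el (AV T) (up u) = El (cA j) (cA k) S"
  using cA_alg by (auto elim!: elE simp: up_def el_tuple CV_simps AV_simps[OF T])

lemma up_ecomp: "el CV u = El k l S \<Longrightarrow> el CV v = El j k U \<Longrightarrow> up (u \<odot>[CV] v) = up u \<odot>[AV T] up v"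
  by (auto elim!: elE simp: up_def ecomp_def CV_simps)

lemma up_idn: "j \<in> J \<Longrightarrow> up (idn CV j) = idn (AV T) (cA j)"
  by (simp add: up_def idn_def CV_simps)

lemma up_inj: "el CV u = El j k S \<Longrightarrow> el CV v = El j k S \<Longrightarrow> up u = up v \<Longrightarrow> u = v"
  by (auto elim!: elE simp: up_def)

lemma up_surj: "el (AV T) p = El (cA j) (cA k) S \<Longrightarrow> j \<in> J \<Longrightarrow> k \<in> J \<Longrightarrow> \<exists>u. el CV u = El j k S \<and> up u = p"
  by (rule exI[of _ "(j, k, S, el_arr p)"])
    (auto elim!: elE simp: up_def el_tuple CV_simps AV_simps[OF T] el_arr_def)

lemma CV_eqI:
  assumes "el CV u = El j k S" "el CV v = El j k S" "\<And>x. x \<in> J \<Longrightarrow> evx T x (up u) = evx T x (up v)"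
  shows "u = v"
  using up_inj[OF assms(1,2)] evx_inj[OF T up_el up_el] assms by blast

text \<open>Evaluation at x as a functor out of the commutant. At I it is the algebra belonging to
  the commutant; the other x supply the functors D(x, -) of the bifold algebra built from a
  commuting pair.\<close>

definition cev :: "'o \<Rightarrow> ('o, 'c, 'm) vfun" where
  "cev x = \<lparr>FOb = (\<lambda>j\<in>J. ct j (FOb A x)), FHm = (\<lambda>j\<in>J. \<lambda>k\<in>J. alg_eval V C T (cA j) (cA k) x)\<rparr>"

lemma cev_ob: "j \<in> J \<Longrightarrow> FOb (cev x) j = ct j (FOb A x)"
  by (simp add: cev_def)

lemma fap_cev: "el CV u = El j k S \<Longrightarrow> x \<in> J \<Longrightarrow> fap (cev x) u = evx T x (up u)"
  by (auto elim!: elE simp: fap_def evx_def up_def cev_def cA_ob CV_simps)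

lemma cev_functor:
  assumes x: "x \<in> J"
  shows "enriched_functor V CV C (cev x)"
proof (rule enriched_functorI[OF CV_cat C_cat _ _ gvar_cover[OF CV_pre]])
  note Ax = alg_ob[OF T A x]
  show "FOb (cev x) \<in> VOb CV \<rightarrow>\<^sub>E VOb C" unfolding CV_simps(1) using ct_ob[OF _ Ax] by (auto simp: cev_def)
  show "FHm (cev x) \<in> (\<Pi>\<^sub>E a\<in>VOb CV. \<Pi>\<^sub>E b\<in>VOb CV. hom V (VHom CV a b) (VHom C (FOb (cev x) a) (FOb (cev x) b)))"
    unfolding CV_simps(1)
    using eval_ty[OF T cA_alg cA_alg x] cA_alg by (auto simp: cev_def hom_ty CV_simps AV_simps[OF T] cA_ob[OF x])
  fix a assume "a \<in> VOb CV"
  then have a: "a \<in> J" by (simp add: CV_simps)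
  show "fap (cev x) (idn CV a) = idn C (FOb (cev x) a)"
    using fap_cev[OF idn_el[OF CV_pre] x, of a] a x evx_idn[OF T cA_alg[OF a] x] by (simp add: CV_simps up_idn cA_ob cev_ob)
  fix b c assume "b \<in> VOb CV" "c \<in> VOb CV"
  then have bc: "b \<in> VOb CV" "c \<in> VOb CV" "a \<in> VOb CV" using a by (simp_all add: CV_simps)
  let ?x = "gvar CV 1 b c" and ?y = "gvar CV 0 a b"
  note u = gvar_el[OF CV_pre bc(1,2), of 1] and v = gvar_el[OF CV_pre bc(3,1), of 0]
  have d: "{(VHom CV b c, 1 :: nat)} \<inter> {(VHom CV a b, 0)} = {}" by simp
  note uv = ecomp_el[OF CV_pre u v d]
  show "fap (cev x) (?x \<odot>[CV] ?y) = fap (cev x) ?x \<odot>[C] fap (cev x) ?y"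
    unfolding fap_cev[OF u x] fap_cev[OF v x] fap_cev[OF uv x] up_ecomp[OF u v]
    by (rule evx_ecomp[OF T up_el[OF u] up_el[OF v] d x])
qed

abbreviation "cc j \<equiv> alg_cotensor_counit V C ct cu T j A"

text \<open>By \<open>ctf_law\<close> the designated counits are natural in x, so they form a wedge
  and the description of the counit denotes.\<close>

lemma cc:
  assumes j: "j \<in> J"
  shows "ty (cc j) = Arr j (alg_hom V C T (cA j) A)" "x \<in> J \<Longrightarrow> alg_eval V C T (cA j) A x \<cdot> cc j = cu j (FOb A x)"
proof -
  let ?\<pi> = "\<lambda>x\<in>J. cu j (FOb A x)" and ?l = "(j, 0 :: nat)"
  note F = algebraD(1)[OF A] and J' = theoryD(1)[OF T]
  have v: "ty (var ?l) = Arr (tn {?l}) j" "iso (var ?l)" "stage {?l}"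
    using var_ty[of ?l] var_iso[of ?l] J_ob[OF j] by (simp_all add: stage_simps)
  have "hom_wedge V C T (cA j) A j ?\<pi>"
  proof (rule wedgeI[OF algebraD(1)[OF cA_alg[OF j]] F _ _ v(1,3,2) finite.emptyI])
    fix x y t U assume t: "el (Tcat T) t = El x y U" and d: "{?l} \<inter> U = {}"
    have xy: "x \<in> J" "y \<in> J" using el_obs[OF t] J' by simp_all
    show "(FOb (cA j) y, FOb A y, {?l}, ?\<pi> y \<cdot> var ?l) \<odot>[C] fap (cA j) t = fap A t \<odot>[C] (FOb (cA j) x, FOb A x, {?l}, ?\<pi> x \<cdot> var ?l)"
      using ctf_law[of ?l, OF _ fap_el[OF F t]] d j xy fap_alg_cotensor[OF F j t] by (simp add: gel_def cA_ob)
  qed (use J' cu_ty[OF j alg_ob[OF T A]] in \<open>simp_all add: cA_ob\<close>)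
  from theI'[OF end_universal[OF T cA_alg[OF j] A this]]
  have "ty (cc j) = Arr j (alg_hom V C T (cA j) A) \<and> (\<forall>x\<in>J. alg_eval V C T (cA j) A x \<cdot> cc j = ?\<pi> x)"
    by (simp add: alg_cotensor_counit_def hom_ty J' cong: ball_cong)
  then show "ty (cc j) = Arr j (alg_hom V C T (cA j) A)" "x \<in> J \<Longrightarrow> alg_eval V C T (cA j) A x \<cdot> cc j = cu j (FOb A x)" by auto
qed

lemma cA_unit: "cA \<one> = A"
  by (rule alg_cotensor_unit[OF A])

lemma cc_ty: "j \<in> J \<Longrightarrow> ty (cc j) = Arr j (VHom CV j \<one>)"
  using cc(1)[of j] cA_alg[of j] J_unit A by (simp add: CV_simps cA_unit AV_simps[OF T])

lemma evx_cc: "fst l \<in> J \<Longrightarrow> x \<in> J \<Longrightarrow>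
    evx T x (up (gel (fst l) \<one> l (cc (fst l)))) = gel (ct (fst l) (FOb A x)) (FOb A x) l (cu (fst l) (FOb A x))"
  using comp_reduce[OF cc(2) var_ty[of l] cc(1) eval_ty[OF T cA_alg A]] J_ob[of "fst l"]
  by (simp add: evx_def up_def gel_def cA_unit cA_ob)

text \<open>At each x the lift exists uniquely in C. Cancelling the designated counits shows that
  these lifts are natural in x, so \<open>evx_ex\<close> glues them to an element of the commutant;
  uniqueness is again checked pointwise.\<close>

lemma cc_cot:
  assumes j: "j \<in> J"
  shows "is_cotensor V CV j \<one> j (cc j)"
proof -
  let ?l = "(j, 0 :: nat)"
  have s: "el CV (gel j \<one> ?l (cc j)) = El j \<one> {?l}" using j J_unit cc_ty[OF j] by (simp add: gel_el CV_simps(1))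
  have "is_cotensor V CV (fst ?l) \<one> j (cc j)"
  proof (rule cotI[OF CV_pre _ _ _ finite.emptyI])
    fix y S h assume S: "?l \<notin> S" and h: "el CV h = El y \<one> (insert ?l S)"
    have y: "y \<in> J" "stage S" using el_obs[OF h] by (simp_all add: CV_simps stage_simps)
    note hx = evx_el[OF T up_el[OF h]]
    let ?g = "\<lambda>x. gel (ct j (FOb A x)) (FOb A x) ?l (cu j (FOb A x))"
    have ge: "el C (?g x) = El (ct j (FOb A x)) (FOb A x) {?l}" if "x \<in> J" for x
      using cu_gel_el[of "FOb A x" ?l] j alg_ob[OF T A that] by simp
    have "\<exists>!g. el C g = El (ct y (FOb A x)) (ct j (FOb A x)) S \<and> ?g x \<odot>[C] g = evx T x (up h)" if "x \<in> J" for x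
      by (rule cot_lift[OF C_pre ct_cot[OF j alg_ob[OF T A that]]]) (use S hx[OF that] that cA_unit in \<open>simp_all add: cA_ob\<close>)
    then obtain P where P: "\<And>x. x \<in> J \<Longrightarrow> el C (P x) = El (ct y (FOb A x)) (ct j (FOb A x)) S \<and> ?g x \<odot>[C] P x = evx T x (up h)"
      by metis
    have ev: "evx T x (up (gel j \<one> ?l (cc j) \<odot>[CV] g)) = ?g x \<odot>[C] evx T x (up g)"
      if "el CV g = El y j S" "x \<in> J" for g x
      using up_ecomp[OF s that(1)] evx_ecomp[OF T up_el[OF s] up_el[OF that(1)] _ that(2)] S evx_cc[of ?l x] j that(2) by simp
    have "\<exists>!p. el (AV T) p = El (cA y) (cA j) S \<and> (\<forall>x\<in>J. evx T x p = P x)"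
    proof (rule evx_ex[OF T cA_alg[OF y(1)] cA_alg[OF j] y(2) finite.insertI[OF finite.emptyI, of ?l]])
      show "el C (P x) = El (FOb (cA y) x) (FOb (cA j) x) S" if "x \<in> J" for x using P[OF that] that by (simp add: cA_ob)
      fix x x' t U assume t: "el (Tcat T) t = El x x' U" and d: "S \<inter> U = {}" "{?l} \<inter> U = {}"
      have x: "x \<in> J" "x' \<in> J" using el_obs[OF t] theoryD(1)[OF T] by simp_all
      have d': "?l \<notin> U" "U \<inter> {?l} = {}" "U \<inter> S = {}" "insert ?l S \<inter> U = {}" "{?l} \<inter> S = {}" "U \<inter> insert ?l S = {}" "?l \<notin> S \<union> U" using d S by auto
      note F = algebraD(1)[OF A]
      note At = fap_el[OF F t]
      have ty: "el C (fap (cA y) t) = El (ct y (FOb A x)) (ct y (FOb A x')) U" "el C (fap (cA j) t) = El (ct j (FOb A x)) (ct j (FOb A x')) U"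
        using fap_el[OF algebraD(1)[OF cA_alg[OF y(1)]] t] fap_el[OF algebraD(1)[OF cA_alg[OF j]] t] x by (simp_all add: cA_ob)
      have Px: "el C (P x) = El (ct y (FOb A x)) (ct j (FOb A x)) S" "?g x \<odot>[C] P x = evx T x (up h)"
        "el C (P x') = El (ct y (FOb A x')) (ct j (FOb A x')) S" "?g x' \<odot>[C] P x' = evx T x' (up h)"
        using P x by simp_all
      show "P x' \<odot>[C] fap (cA y) t = fap (cA j) t \<odot>[C] P x"
      proof (rule cot_mono[OF C_pre ct_cot[OF j alg_ob[OF T A x(2)]], where l = ?l])
        show "el C (P x' \<odot>[C] fap (cA y) t) = El (ct y (FOb A x)) (ct j (FOb A x')) (S \<union> U)"
          by (rule ecomp_el[OF C_pre Px(3) ty(1) d(1)])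
        show "el C (fap (cA j) t \<odot>[C] P x) = El (ct y (FOb A x)) (ct j (FOb A x')) (S \<union> U)"
          using ecomp_el[OF C_pre ty(2) Px(1) d'(3)] by (simp add: Un_commute)
        have "?g x' \<odot>[C] (P x' \<odot>[C] fap (cA y) t) = (?g x' \<odot>[C] P x') \<odot>[C] fap (cA y) t"
          by (rule ecomp_assoc[OF C_cat ge[OF x(2)] Px(3) ty(1) d'(5) d(2,1), symmetric])
        also have "\<dots> = fap A t \<odot>[C] (?g x \<odot>[C] P x)"
          unfolding Px(2,4) using evx_nat[OF T up_el[OF h] t d'(4)] by (simp add: cA_unit)
        also have "\<dots> = (fap A t \<odot>[C] ?g x) \<odot>[C] P x"
          by (rule ecomp_assoc[OF C_cat At ge[OF x(1)] Px(1) d'(2,3,5), symmetric])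
        also have "fap A t \<odot>[C] ?g x = ?g x' \<odot>[C] fap (cA j) t"
          using ctf_law[of ?l, OF _ At] j d'(1) fap_alg_cotensor[OF F j t] by simp
        also have "(?g x' \<odot>[C] fap (cA j) t) \<odot>[C] P x = ?g x' \<odot>[C] (fap (cA j) t \<odot>[C] P x)"
          by (rule ecomp_assoc[OF C_cat ge[OF x(2)] ty(2) Px(1) d(2) d'(5,3)])
        finally show "?g x' \<odot>[C] (P x' \<odot>[C] fap (cA y) t) = ?g x' \<odot>[C] (fap (cA j) t \<odot>[C] P x)" .
      qed (use d' in simp_all)
    qed
    then obtain p where p: "el (AV T) p = El (cA y) (cA j) S" "\<And>x. x \<in> J \<Longrightarrow> evx T x p = P x" by blast
    obtain g where g: "el CV g = El y j S" "up g = p" using up_surj[OF p(1) y(1) j] by blast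
    have ge': "el CV (gel j \<one> ?l (cc j) \<odot>[CV] g) = El y \<one> (insert ?l S)" if "el CV g = El y j S" for g
      using ecomp_el[OF CV_pre s that] S by simp
    show "\<exists>!g. el CV g = El y j S \<and> gel j \<one> ?l (cc j) \<odot>[CV] g = h"
    proof (rule ex1I[of _ g])
      show "el CV g = El y j S \<and> gel j \<one> ?l (cc j) \<odot>[CV] g = h"
        using g CV_eqI[OF ge'[OF g(1)] h] ev[OF g(1)] p(2) P by simp
      fix g' assume g': "el CV g' = El y j S \<and> gel j \<one> ?l (cc j) \<odot>[CV] g' = h"
      show "g' = g"
      proof (rule CV_eqI[OF _ g(1)])
        show e: "el CV g' = El y j S" using g' by simp
        fix x assume x: "x \<in> J"
        have "el C (evx T x (up g')) = El (ct y (FOb A x)) (ct j (FOb A x)) S"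
          using evx_el[OF T up_el[OF e] x] x by (simp add: cA_ob)
        moreover have "?g x \<odot>[C] evx T x (up g') = ?g x \<odot>[C] P x" using ev[OF e x] g' P[OF x] by simp
        ultimately show "evx T x (up g') = evx T x (up g)"
          using cot_mono[OF C_pre ct_cot[OF j alg_ob[OF T A x]], where l = ?l] S P[OF x] g(2) p(2)[OF x] by simp
      qed
    qed
  qed (use j J_unit cc_ty[OF j] in \<open>simp_all add: CV_simps(1)\<close>)
  then show ?thesis by simp
qed

text \<open>The normalisation that \<open>theory_of_structure_is_theory\<close> requires, inherited
  pointwise from the identity counits of C.\<close>

lemma cc_unit: "cc \<one> = VId CV \<one>"
proof -
  have "gel \<one> \<one> (\<one>, 0) (cc \<one>) = gel \<one> \<one> (\<one>, 0) (VId CV \<one>)"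
  proof (rule CV_eqI)
    have i: "ty (VId CV \<one>) = Arr \<one> (VHom CV \<one> \<one>)" using VId_ty[OF CV_pre] J_unit by (simp add: CV_simps(1))
    show "el CV (gel \<one> \<one> (\<one>, 0) (cc \<one>)) = El \<one> \<one> {(\<one>, 0)}" "el CV (gel \<one> \<one> (\<one>, 0) (VId CV \<one>)) = El \<one> \<one> {(\<one>, 0)}"
      using J_unit cc_ty[OF J_unit] i by (simp_all add: gel_el CV_simps(1))
    fix x assume x: "x \<in> J"
    show "evx T x (up (gel \<one> \<one> (\<one>, 0) (cc \<one>))) = evx T x (up (gel \<one> \<one> (\<one>, 0) (VId CV \<one>)))"
      using evx_cc[of "(\<one>, 0)" x] comp_reduce[OF AV_VId(2)[OF T A x] var_ty[of "(\<one>, 0)", unfolded fst_conv] AV_VId(1)[OF T A] eval_ty[OF T A A x]]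
        x J_unit unit_Ob ct_unit[OF alg_ob[OF T A x]]
      by (simp add: gel_def evx_def up_def cA_unit CV_simps)
  qed
  then show ?thesis
    by (rule gel_inj) (use cc_ty[OF J_unit] VId_ty[OF CV_pre] J_unit in \<open>simp_all add: CV_simps(1)\<close>)
qed

lemma commutant_theory_eq: "commutant_theory V J C ct cu (T, A) = theory_of_structure V J CV cc"
  by (simp add: commutant_theory_def)

lemma commutant_Tcat: "Tcat (commutant_theory V J C ct cu (T, A)) = CV"
  by (simp add: commutant_theory_eq theory_of_structure_def)

lemma commutant_is_theory: "is_theory V J (commutant_theory V J C ct cu (T, A))"
  and commutant_str: "j \<in> J \<Longrightarrow> str (commutant_theory V J C ct cu (T, A)) j = cc j"
  unfolding commutant_theory_eq
  using theory_of_structure_is_theory[OF theoryD(4)[OF T] CV_cat CV_simps(1) cc_cot cc_unit] by blast+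

lemma commutant_eq: "commutant V J C ct cu (T, A) = (commutant_theory V J C ct cu (T, A), cev \<one>)"
  by (simp add: commutant_def cev_def carrier_def)

lemma cev_str: "x \<in> J \<Longrightarrow> j \<in> J \<Longrightarrow> FHm (cev x) j \<one> \<cdot> cc j = cu j (FOb A x)"
  using J_unit cc(2)[of j x] by (simp add: cev_def cA_unit)

lemma cev_cot: "x \<in> J \<Longrightarrow> j \<in> J \<Longrightarrow> is_cotensor V C j (FOb (cev x) \<one>) (FOb (cev x) j) (FHm (cev x) j \<one> \<cdot> cc j)"
  using ct_cot[of j "FOb A x"] alg_ob[OF T A, of x] J_unit by (simp add: cev_str cev_ob ct_unit)

lemma cev_algebra: "x \<in> J \<Longrightarrow> is_algebra V J C (commutant_theory V J C ct cu (T, A)) (cev x)"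
  using cev_functor[of x] cev_cot commutant_str
  by (intro is_algebraI[OF commutant_is_theory]) (simp_all add: commutant_Tcat)

text \<open>A functor into the commutant amounts to functors \<open>G x\<close> into C, one for each
  x, compatible with the action of T. Compatibility is the wedge condition that yields the arrows on
  homs, and the functor laws follow from those of each \<open>G x\<close>.\<close>

lemma commutant_functor_ex:
  assumes U: "enriched_category V U" "VOb U = J"
    and G: "\<And>x. x \<in> J \<Longrightarrow> enriched_functor V U C (G x)" "\<And>x k. x \<in> J \<Longrightarrow> k \<in> J \<Longrightarrow> FOb (G x) k = ct k (FOb A x)"
    and n: "\<And>x y t k k' u S S'. \<lbrakk>el (Tcat T) t = El x y S; el U u = El k k' S'; S' \<inter> S = {}\<rbrakk>
      \<Longrightarrow> fap (G y) u \<odot>[C] fap (cA k) t = fap (cA k') t \<odot>[C] fap (G x) u"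
  shows "\<exists>N. enriched_functor V U CV N \<and> (\<forall>k \<in> J. FOb N k = k) \<and>
    (\<forall>x \<in> J. \<forall>u k k' S. el U u = El k k' S \<longrightarrow> evx T x (up (fap N u)) = fap (G x) u)"
proof -
  note P = enriched_pre[OF U(1)] and J' = theoryD(1)[OF T]
  have "\<exists>!h. ty h = Arr (VHom U k k') (alg_hom V C T (cA k) (cA k')) \<and> (\<forall>x\<in>J. alg_eval V C T (cA k) (cA k') x \<cdot> h = FHm (G x) k k')"
    if k: "k \<in> J" "k' \<in> J" for k k'
  proof -
    let ?\<pi> = "\<lambda>x\<in>J. FHm (G x) k k'" and ?l = "(VHom U k k', 0 :: nat)"
    have o: "VHom U k k' \<in> Ob V" using VHom_ob[OF P] k U by simp
    have v: "ty (var ?l) = Arr (tn {?l}) (VHom U k k')" "iso (var ?l)" "stage {?l}"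
      using var_ty[of ?l] var_iso[of ?l] o by (simp_all add: stage_simps)
    have g: "el U (gvar U 0 k k') = El k k' {?l}" using gvar_el[OF P] k U by simp
    have "hom_wedge V C T (cA k) (cA k') (VHom U k k') ?\<pi>"
    proof (rule wedgeI[OF algebraD(1)[OF cA_alg[OF k(1)]] algebraD(1)[OF cA_alg[OF k(2)]] _ _ v(1,3,2) finite.emptyI])
      fix x y t S assume t: "el (Tcat T) t = El x y S" and d: "{?l} \<inter> S = {}"
      have xy: "x \<in> J" "y \<in> J" using el_obs[OF t] J' by simp_all
      show "(FOb (cA k) y, FOb (cA k') y, {?l}, ?\<pi> y \<cdot> var ?l) \<odot>[C] fap (cA k) t = fap (cA k') t \<odot>[C] (FOb (cA k) x, FOb (cA k') x, {?l}, ?\<pi> x \<cdot> var ?l)"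
        using n[OF t g d] k xy G(2) by (simp add: fap_def gvar_def cA_ob)
    qed (use J' k U(2) FHm_ty[OF G(1), of _ k k'] G(2) in \<open>simp_all add: cA_ob\<close>)
    from end_universal[OF T cA_alg[OF k(1)] cA_alg[OF k(2)] this] show ?thesis by simp
  qed
  then obtain h where h: "\<And>k k'. k \<in> J \<Longrightarrow> k' \<in> J \<Longrightarrow> ty (h k k') = Arr (VHom U k k') (alg_hom V C T (cA k) (cA k')) \<and>
      (\<forall>x\<in>J. alg_eval V C T (cA k) (cA k') x \<cdot> h k k' = FHm (G x) k k')" by metis
  define N where "N = \<lparr>FOb = (\<lambda>k\<in>J. k), FHm = (\<lambda>k\<in>J. \<lambda>k'\<in>J. h k k')\<rparr>"
  have No: "FOb N k = k" if "k \<in> J" for k using that by (simp add: N_def)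
  have Nel: "el CV (fap N u) = El k k' S" if u: "el U u = El k k' S" for u k k' S
  proof -
    obtain f where f: "u = (k, k', S, f)" "k \<in> J" "k' \<in> J" "stage S" "ty f = Arr (tn S) (VHom U k k')"
      using u U(2) by (auto elim!: elE)
    then show ?thesis using h[OF f(2,3)] cA_alg[OF f(2)] cA_alg[OF f(3)]
      by (simp add: fap_def N_def el_tuple CV_simps AV_simps[OF T] mon_ty)
  qed
  have Nev: "evx T x (up (fap N u)) = fap (G x) u" if u: "el U u = El k k' S" and x: "x \<in> J" for u k k' S x
  proof -
    obtain f where f: "u = (k, k', S, f)" "k \<in> J" "k' \<in> J" "ty f = Arr (tn S) (VHom U k k')" using u U(2) by (auto elim!: elE)
    have "alg_eval V C T (cA k) (cA k') x \<cdot> h k k' \<cdot> f = FHm (G x) k k' \<cdot> f"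
      using comp_reduce[of "alg_eval V C T (cA k) (cA k') x" "h k k'" _ f] h[OF f(2,3)] x f(4) eval_ty[OF T cA_alg[OF f(2)] cA_alg[OF f(3)] x] by simp
    then show ?thesis using f x by (simp add: fap_def evx_def up_def N_def cA_ob G(2))
  qed
  have "enriched_functor V U CV N"
  proof (rule enriched_functorI[OF U(1) CV_cat _ _ gvar_cover[OF P]])
    show "FOb N \<in> VOb U \<rightarrow>\<^sub>E VOb CV" by (simp add: N_def U CV_simps)
    show "FHm N \<in> (\<Pi>\<^sub>E a\<in>VOb U. \<Pi>\<^sub>E b\<in>VOb U. hom V (VHom U a b) (VHom CV (FOb N a) (FOb N b)))"
      unfolding U(2) using h cA_alg by (intro PiE_I) (auto simp: N_def hom_ty CV_simps AV_simps[OF T])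
    fix a assume a: "a \<in> VOb U"
    have ia: "el U (idn U a) = El a a {}" using idn_el[OF P a] .
    have aJ: "a \<in> J" using a U by simp
    have "fap N (idn U a) = idn CV a"
      by (rule CV_eqI[OF Nel[OF ia]])
        (use idn_el[OF CV_pre, of a] aJ a Nev[OF ia] fap_idn[OF G(1) a] evx_idn[OF T cA_alg[OF aJ]] G(2) in \<open>simp_all add: CV_simps up_idn cA_ob\<close>)
    then show "fap N (idn U a) = idn CV (FOb N a)" using No[OF aJ] by simp
    fix b c assume bc: "b \<in> VOb U" "c \<in> VOb U"
    let ?x = "gvar U 1 b c" and ?y = "gvar U 0 a b"
    note u = gvar_el[OF P bc, of 1] and v = gvar_el[OF P a bc(1), of 0]
    have d: "{(VHom U b c, 1 :: nat)} \<inter> {(VHom U a b, 0)} = {}" by simp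
    note uv = ecomp_el[OF P u v d]
    show "fap N (?x \<odot>[U] ?y) = fap N ?x \<odot>[CV] fap N ?y"
    proof (rule CV_eqI[OF Nel[OF uv] ecomp_el[OF CV_pre Nel[OF u] Nel[OF v] d]])
      fix x assume x: "x \<in> J"
      show "evx T x (up (fap N (?x \<odot>[U] ?y))) = evx T x (up (fap N ?x \<odot>[CV] fap N ?y))"
        unfolding Nev[OF uv x] up_ecomp[OF Nel[OF u] Nel[OF v]] evx_ecomp[OF T up_el[OF Nel[OF u]] up_el[OF Nel[OF v]] d x] Nev[OF u x] Nev[OF v x]
        by (rule fap_ecomp[OF G(1)[OF x] u v d])
    qed
  qed
  then show ?thesis using No Nev by blast
qed

end

end

section \<open>Functors of two variables\<close>

context symmetric_monoidal_closed_category
begin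

text \<open>A pair of elements with disjoint labels, as an element of the tensor product of
  categories. By \<open>tcov_cover\<close> such pairs suffice to test equations there.\<close>

definition prd :: "('a, 'o, 'm) elt \<Rightarrow> ('b, 'o, 'm) elt \<Rightarrow> ('a \<times> 'b, 'o, 'm) elt" where
  "prd x y = (case x of (a, b, S, f) \<Rightarrow> case y of (a', b', U, g) \<Rightarrow> ((a, a'), (b, b'), S \<union> U, pr S U f g))"

lemma tensor_vcat_simps:
  "VOb (tensor_vcat V A B) = VOb A \<times> VOb B"
  "\<lbrakk>a \<in> VOb A; b \<in> VOb A; a' \<in> VOb B; b' \<in> VOb B\<rbrakk>
    \<Longrightarrow> VHom (tensor_vcat V A B) (a, a') (b, b') = VHom A a b \<otimes> VHom B a' b'"
  "\<lbrakk>a \<in> VOb A; b \<in> VOb A; c \<in> VOb A; a' \<in> VOb B; b' \<in> VOb B; c' \<in> VOb B\<rbrakk>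
    \<Longrightarrow> VCmp (tensor_vcat V A B) (a, a') (b, b') (c, c') = (VCmp A a b c \<boxtimes> VCmp B a' b' c') \<cdot>
       interchange V (VHom A b c) (VHom B b' c') (VHom A a b) (VHom B a' b')"
  "\<lbrakk>a \<in> VOb A; a' \<in> VOb B\<rbrakk>
    \<Longrightarrow> VId (tensor_vcat V A B) (a, a') = (VId A a \<boxtimes> VId B a') \<cdot> inv (lunit V \<one>)"
  by (simp_all add: tensor_vcat_def)

text \<open>Even numbers label the elements of A and odd ones those of B, so all the stages involved
  are disjoint even if hom-objects of A and B coincide.\<close>

definition tcov :: "('a, 'o, 'm) vcat \<Rightarrow> ('b, 'o, 'm) vcat \<Rightarrow> nat \<Rightarrow> 'a \<times> 'b \<Rightarrow> 'a \<times> 'b \<Rightarrow> ('a \<times> 'b, 'o, 'm) elt" where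
  "tcov A B n p q = prd (gvar A (2 * n) (fst p) (fst q)) (gvar B (2 * n + 1) (snd p) (snd q))"

definition tst :: "('a, 'o, 'm) vcat \<Rightarrow> ('b, 'o, 'm) vcat \<Rightarrow> nat \<Rightarrow> 'a \<times> 'b \<Rightarrow> 'a \<times> 'b \<Rightarrow> ('o \<times> nat) set" where
  "tst A B n p q = {(VHom A (fst p) (fst q), 2 * n)} \<union> {(VHom B (snd p) (snd q), 2 * n + 1)}"

context
  fixes A :: "('a, 'o, 'm) vcat" and B :: "('b, 'o, 'm) vcat"
  assumes A: "enriched_category V A" and B: "enriched_category V B"
begin

abbreviation "AB \<equiv> tensor_vcat V A B"

lemmas A_pre = enriched_pre[OF A] and B_pre = enriched_pre[OF B]

lemma tensor_pre: "pre_enriched AB"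
  unfolding pre_enriched_def tensor_vcat_simps(1)
proof (intro conjI PiE_I)
  fix p q r assume "p \<in> VOb A \<times> VOb B" "q \<in> VOb A \<times> VOb B" "r \<in> VOb A \<times> VOb B"
  then obtain a a' b b' c c' where o: "p = (a, a')" "q = (b, b')" "r = (c, c')" "a \<in> VOb A" "b \<in> VOb A" "c \<in> VOb A"
    "a' \<in> VOb B" "b' \<in> VOb B" "c' \<in> VOb B" by auto
  note ts = o VHom_ob[OF A_pre] VHom_ob[OF B_pre] VCmp_ty[OF A_pre] VCmp_ty[OF B_pre] VId_ty[OF A_pre] VId_ty[OF B_pre]
  show "VHom AB p q \<in> Ob V" "VId AB p \<in> hom V \<one> (VHom AB p p)" "VCmp AB p q r \<in> hom V (VHom AB q r \<otimes> VHom AB p q) (VHom AB p r)"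
    by (simp_all add: ts tensor_vcat_simps hom_ty mon_ty interchange_ty)
qed (auto simp: tensor_vcat_def split: if_splits)

lemma prd_el: "el A x = El a b S \<Longrightarrow> el B y = El a' b' U \<Longrightarrow> S \<inter> U = {} \<Longrightarrow> el AB (prd x y) = El (a, a') (b, b') (S \<union> U)"
  by (auto elim!: elE simp: prd_def el_tuple tensor_vcat_simps stage_simps pr_ty)

text \<open>Composition in the tensor product is defined through \<open>interchange\<close>, which
  \<open>pr_interchange\<close> absorbs into a regrouping of stages.\<close>

lemma prd_ecomp:
  assumes x: "el A x = El b c S" and y: "el B y = El b' c' U" and x': "el A x' = El a b S'" and y': "el B y' = El a' b' U'"
    and d: "S \<inter> U = {}" "S \<inter> S' = {}" "S \<inter> U' = {}" "U \<inter> S' = {}" "U \<inter> U' = {}" "S' \<inter> U' = {}"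
  shows "prd x y \<odot>[AB] prd x' y' = prd (x \<odot>[A] x') (y \<odot>[B] y')"
proof -
  obtain f where f: "x = (b, c, S, f)" "b \<in> VOb A" "c \<in> VOb A" "stage S" "ty f = Arr (tn S) (VHom A b c)" using x by (rule elE)
  obtain g where g: "y = (b', c', U, g)" "b' \<in> VOb B" "c' \<in> VOb B" "stage U" "ty g = Arr (tn U) (VHom B b' c')" using y by (rule elE)
  obtain f' where f': "x' = (a, b, S', f')" "a \<in> VOb A" "stage S'" "ty f' = Arr (tn S') (VHom A a b)" using x' by (rule elE)
  obtain g' where g': "y' = (a', b', U', g')" "a' \<in> VOb B" "stage U'" "ty g' = Arr (tn U') (VHom B a' b')" using y' by (rule elE)
  have d': "(S \<union> U) \<inter> (S' \<union> U') = {}" "(S \<union> S') \<inter> (U \<union> U') = {}" using d by auto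
  have o: "VHom A b c \<in> Ob V" "VHom A a b \<in> Ob V" "VHom B b' c' \<in> Ob V" "VHom B a' b' \<in> Ob V"
    using f(2,3) g(2,3) f'(2) g'(2) VHom_ob[OF A_pre] VHom_ob[OF B_pre] by simp_all
  note st = f(4) g(4) f'(3) g'(3)
  note pt = pr_ty[OF f(5) g(5) st(1,2) d(1)] pr_ty[OF f'(4) g'(4) st(3,4) d(6)] pr_ty[OF f(5) f'(4) st(1,3) d(2)] pr_ty[OF g(5) g'(4) st(2,4) d(5)]
  note cty = VCmp_ty[OF A_pre f'(2) f(2,3)] VCmp_ty[OF B_pre g'(2) g(2,3)]
  have p: "ty (pr (S \<union> U) (S' \<union> U') (pr S U f g) (pr S' U' f' g')) = Arr (tn (S \<union> U \<union> (S' \<union> U'))) ((VHom A b c \<otimes> VHom B b' c') \<otimes> (VHom A a b \<otimes> VHom B a' b'))"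
    using pt st d' by (simp add: pr_ty stage_simps)
  have "VCmp AB (a, a') (b, b') (c, c') \<cdot> pr (S \<union> U) (S' \<union> U') (pr S U f g) (pr S' U' f' g')
      = (VCmp A a b c \<boxtimes> VCmp B a' b' c') \<cdot> (interchange V (VHom A b c) (VHom B b' c') (VHom A a b) (VHom B a' b') \<cdot> pr (S \<union> U) (S' \<union> U') (pr S U f g) (pr S' U' f' g'))"
    using f(2,3) g(2,3) f'(2) g'(2) cty p o by (simp add: tensor_vcat_simps comp_assoc mon_ty interchange_ty)
  also have "interchange V (VHom A b c) (VHom B b' c') (VHom A a b) (VHom B a' b') \<cdot> pr (S \<union> U) (S' \<union> U') (pr S U f g) (pr S' U' f' g')
      = pr (S \<union> S') (U \<union> U') (pr S S' f f') (pr U U' g g')"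
    by (rule pr_interchange[OF f(5) g(5) f'(4) g'(4) st d])
  also have "(VCmp A a b c \<boxtimes> VCmp B a' b' c') \<cdot> pr (S \<union> S') (U \<union> U') (pr S S' f f') (pr U U' g g')
      = pr (S \<union> S') (U \<union> U') (VCmp A a b c \<cdot> pr S S' f f') (VCmp B a' b' c' \<cdot> pr U U' g g')"
    using pt(3,4) cty st d' by (simp add: pr_comp stage_simps)
  finally show ?thesis by (simp add: f(1) g(1) f'(1) g'(1) prd_def ecomp_def Un_ac)
qed

lemma prd_idn: "a \<in> VOb A \<Longrightarrow> a' \<in> VOb B \<Longrightarrow> prd (idn A a) (idn B a') = idn AB (a, a')"
  by (simp add: prd_def idn_def tensor_vcat_simps pr_def mg_unit tn_simps lunit_unit)

lemma tcov_el:
  assumes "p \<in> VOb AB" "q \<in> VOb AB"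
  shows "el A (gvar A (2 * n) (fst p) (fst q)) = El (fst p) (fst q) {(VHom A (fst p) (fst q), 2 * n)}"
    "el B (gvar B (2 * n + 1) (snd p) (snd q)) = El (snd p) (snd q) {(VHom B (snd p) (snd q), 2 * n + 1)}"
  using assms gvar_el[OF A_pre] gvar_el[OF B_pre] by (auto simp: tensor_vcat_simps)

lemma tcov_cover: "cover AB (tst A B) (tcov A B)"
  unfolding cover_def
proof (intro conjI allI ballI impI)
  fix n :: nat and p q assume pq: "p \<in> VOb AB" "q \<in> VOb AB"
  let ?S = "{(VHom A (fst p) (fst q), 2 * n)}" and ?U = "{(VHom B (snd p) (snd q), 2 * n + 1)}"
  note e = tcov_el[OF pq, where n = n]
  have d: "?S \<inter> ?U = {}" by simp
  show "el AB (tcov A B n p q) = El p q (tst A B n p q)"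
    using prd_el[OF e d] by (simp add: tcov_def tst_def)
  have o: "VHom A (fst p) (fst q) \<in> Ob V" "VHom B (snd p) (snd q) \<in> Ob V"
    using pq VHom_ob[OF A_pre] VHom_ob[OF B_pre] by (auto simp: tensor_vcat_simps)
  have "iso (pr ?S ?U (var (VHom A (fst p) (fst q), 2 * n)) (var (VHom B (snd p) (snd q), 2 * n + 1)))"
    using var_ty[of "(VHom A (fst p) (fst q), 2 * n)"] var_ty[of "(VHom B (snd p) (snd q), 2 * n + 1)"] o d
      var_iso[of "(VHom A (fst p) (fst q), 2 * n)"] var_iso[of "(VHom B (snd p) (snd q), 2 * n + 1)"]
    by (intro pr_iso) (simp_all add: stage_simps)
  then show "iso (el_arr (tcov A B n p q))" by (simp add: tcov_def prd_def gvar_def el_arr_def)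
next
  fix m n :: nat and a b c d assume "m \<noteq> n"
  then show "tst A B m a b \<inter> tst A B n c d = {}" by (auto simp: tst_def)
qed

lemma tensor_cat: "enriched_category V AB"
proof (rule enriched_categoryI[OF tensor_pre tcov_cover])
  fix p q assume pq: "p \<in> VOb AB" "q \<in> VOb AB"
  note e = tcov_el[OF pq, of 0]
  obtain a a' b b' where o: "p = (a, a')" "q = (b, b')" "a \<in> VOb A" "b \<in> VOb A" "a' \<in> VOb B" "b' \<in> VOb B"
    using pq by (auto simp: tensor_vcat_simps)
  note ia = idn_el[OF A_pre] and ib = idn_el[OF B_pre]
  show "idn AB q \<odot>[AB] tcov A B 0 p q = tcov A B 0 p q"
    using prd_ecomp[OF ia[OF o(4)] ib[OF o(6)] e[unfolded o fst_conv snd_conv]] prd_idn[OF o(4,6)]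
      ecomp_idn(1)[OF A e(1)] ecomp_idn(1)[OF B e(2)] o by (simp add: tcov_def)
  show "tcov A B 0 p q \<odot>[AB] idn AB p = tcov A B 0 p q"
    using prd_ecomp[OF e[unfolded o fst_conv snd_conv] ia[OF o(3)] ib[OF o(5)]] prd_idn[OF o(3,5)]
      ecomp_idn(2)[OF A e(1)] ecomp_idn(2)[OF B e(2)] o by (simp add: tcov_def)
  fix r s assume rs: "r \<in> VOb AB" "s \<in> VOb AB"
  note f = tcov_el[OF pq(2) rs(1), of 1] and g = tcov_el[OF rs, of 2]
  let ?x0 = "gvar A (2 * 0) (fst p) (fst q)" and ?y0 = "gvar B (2 * 0 + 1) (snd p) (snd q)"
  let ?x1 = "gvar A (2 * 1) (fst q) (fst r)" and ?y1 = "gvar B (2 * 1 + 1) (snd q) (snd r)"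
  let ?x2 = "gvar A (2 * 2) (fst r) (fst s)" and ?y2 = "gvar B (2 * 2 + 1) (snd r) (snd s)"
  have c: "tcov A B 0 p q = prd ?x0 ?y0" "tcov A B 1 q r = prd ?x1 ?y1" "tcov A B 2 r s = prd ?x2 ?y2"
    by (simp_all only: tcov_def)
  have s1: "prd ?x2 ?y2 \<odot>[AB] prd ?x1 ?y1 = prd (?x2 \<odot>[A] ?x1) (?y2 \<odot>[B] ?y1)"
    using prd_ecomp[OF g f] by simp
  have s2: "prd (?x2 \<odot>[A] ?x1) (?y2 \<odot>[B] ?y1) \<odot>[AB] prd ?x0 ?y0 = prd ((?x2 \<odot>[A] ?x1) \<odot>[A] ?x0) ((?y2 \<odot>[B] ?y1) \<odot>[B] ?y0)"
    using prd_ecomp[OF ecomp_el[OF A_pre g(1) f(1)] ecomp_el[OF B_pre g(2) f(2)] e] by simp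
  have s3: "prd ?x1 ?y1 \<odot>[AB] prd ?x0 ?y0 = prd (?x1 \<odot>[A] ?x0) (?y1 \<odot>[B] ?y0)"
    using prd_ecomp[OF f e] by simp
  have s4: "prd ?x2 ?y2 \<odot>[AB] prd (?x1 \<odot>[A] ?x0) (?y1 \<odot>[B] ?y0) = prd (?x2 \<odot>[A] (?x1 \<odot>[A] ?x0)) (?y2 \<odot>[B] (?y1 \<odot>[B] ?y0))"
    using prd_ecomp[OF g ecomp_el[OF A_pre f(1) e(1)] ecomp_el[OF B_pre f(2) e(2)]] by simp
  have "(prd ?x2 ?y2 \<odot>[AB] prd ?x1 ?y1) \<odot>[AB] prd ?x0 ?y0 = prd ?x2 ?y2 \<odot>[AB] (prd ?x1 ?y1 \<odot>[AB] prd ?x0 ?y0)"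
    unfolding s1 s2 s3 s4 using ecomp_assoc[OF A g(1) f(1) e(1)] ecomp_assoc[OF B g(2) f(2) e(2)] by simp
  then show "(tcov A B 2 r s \<odot>[AB] tcov A B 1 q r) \<odot>[AB] tcov A B 0 p q = tcov A B 2 r s \<odot>[AB] (tcov A B 1 q r \<odot>[AB] tcov A B 0 p q)"
    unfolding c .
qed

end

lemma tensor_functor_eqI:
  assumes A: "enriched_category V A" and B: "enriched_category V B"
    and "enriched_category V C" "FOb D \<in> VOb A \<times> VOb B \<rightarrow>\<^sub>E VOb C"
    "FHm D \<in> (\<Pi>\<^sub>E p \<in> VOb A \<times> VOb B. \<Pi>\<^sub>E q \<in> VOb A \<times> VOb B. hom V (VHom (tensor_vcat V A B) p q) (VHom C (FOb D p) (FOb D q)))"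
    and i: "\<And>a b. a \<in> VOb A \<Longrightarrow> b \<in> VOb B \<Longrightarrow> fap D (prd (idn A a) (idn B b)) = idn C (FOb D (a, b))"
    and c: "\<And>a a2 a3 b b2 b3 x x' y y' S S' U U'. \<lbrakk>el A x = El a2 a3 S; el B y = El b2 b3 U; el A x' = El a a2 S'; el B y' = El b b2 U';
        S \<inter> U = {}; S \<inter> S' = {}; S \<inter> U' = {}; U \<inter> S' = {}; U \<inter> U' = {}; S' \<inter> U' = {}\<rbrakk>
      \<Longrightarrow> fap D (prd (x \<odot>[A] x') (y \<odot>[B] y')) = fap D (prd x y) \<odot>[C] fap D (prd x' y')"
  shows "enriched_functor V (tensor_vcat V A B) C D"
proof (rule enriched_functorI[OF tensor_cat[OF A B] assms(3) _ _ tcov_cover[OF A B]])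
  show "FOb D \<in> VOb (tensor_vcat V A B) \<rightarrow>\<^sub>E VOb C" using assms(4) by (simp add: tensor_vcat_simps)
  show "FHm D \<in> (\<Pi>\<^sub>E a\<in>VOb (tensor_vcat V A B). \<Pi>\<^sub>E b\<in>VOb (tensor_vcat V A B). hom V (VHom (tensor_vcat V A B) a b) (VHom C (FOb D a) (FOb D b)))"
    using assms(5) by (simp add: tensor_vcat_simps)
  fix p assume p: "p \<in> VOb (tensor_vcat V A B)"
  show "fap D (idn (tensor_vcat V A B) p) = idn C (FOb D p)"
    using p i prd_idn[OF A B] by (auto simp: tensor_vcat_simps)
  fix q r assume q: "q \<in> VOb (tensor_vcat V A B)" and r: "r \<in> VOb (tensor_vcat V A B)"
  note e = tcov_el[OF A B p q, of 0] and f = tcov_el[OF A B q r, of 1]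
  have "tcov A B 1 q r \<odot>[tensor_vcat V A B] tcov A B 0 p q
      = prd (gvar A (2 * 1) (fst q) (fst r) \<odot>[A] gvar A (2 * 0) (fst p) (fst q)) (gvar B (2 * 1 + 1) (snd q) (snd r) \<odot>[B] gvar B (2 * 0 + 1) (snd p) (snd q))"
    unfolding tcov_def by (rule prd_ecomp[OF A B f e]) simp_all
  then show "fap D (tcov A B 1 q r \<odot>[tensor_vcat V A B] tcov A B 0 p q) = fap D (tcov A B 1 q r) \<odot>[C] fap D (tcov A B 0 p q)"
    using c[OF f e] by (simp add: tcov_def)
qed

section \<open>Partial functors and factorisation in each variable\<close>

context
  fixes A :: "('a, 'o, 'm) vcat" and B :: "('b, 'o, 'm) vcat" and C :: "('c, 'o, 'm) vcat" and D :: "('a \<times> 'b, 'c, 'm) vfun"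
  assumes A: "enriched_category V A" and B: "enriched_category V B" and D: "enriched_functor V (tensor_vcat V A B) C D"
begin

lemma fap_partial_left:
  assumes x: "el A x = El a a' S" and b: "b \<in> VOb B"
  shows "fap (partial_left V A B b D) x = fap D (prd x (idn B b))"
proof -
  note P = enriched_pre[OF A] enriched_pre[OF B]
  obtain f where f: "x = (a, a', S, f)" "a \<in> VOb A" "a' \<in> VOb A" "stage S" "ty f = Arr (tn S) (VHom A a a')" using x by (rule elE)
  note o = VHom_ob[OF P(1) f(2,3)] VHom_ob[OF P(2) b b] VId_ty[OF P(2) b] tn_ob[OF f(4)]
  have t: "ty (FHm D (a, b) (a', b)) = Arr (VHom A a a' \<otimes> VHom B b b) (VHom C (FOb D (a, b)) (FOb D (a', b)))"
    using FHm_ty[OF D, of "(a, b)" "(a', b)"] f b by (simp add: tensor_vcat_simps)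
  have "(\<iota> (VHom A a a') \<boxtimes> VId B b) \<cdot> inv (runit V (VHom A a a')) \<cdot> f = (\<iota> (VHom A a a') \<boxtimes> VId B b) \<cdot> (f \<boxtimes> \<iota> \<one>) \<cdot> inv (runit V (tn S))"
    using inv_runit_nat[OF f(5)] by simp
  also have "\<dots> = (f \<boxtimes> VId B b) \<cdot> inv (runit V (tn S))" using f o by (simp add: tensor_comp2 mon_ty)
  finally show ?thesis using f b t o
    by (simp add: fap_def partial_left_def prd_def idn_def pr_def mg_unit comp_assoc mon_ty)
qed

lemma fap_partial_right:
  assumes y: "el B y = El b b' S" and a: "a \<in> VOb A"
  shows "fap (partial_right V A B a D) y = fap D (prd (idn A a) y)"
proof -
  note P = enriched_pre[OF A] enriched_pre[OF B]
  obtain f where f: "y = (b, b', S, f)" "b \<in> VOb B" "b' \<in> VOb B" "stage S" "ty f = Arr (tn S) (VHom B b b')" using y by (rule elE)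
  note o = VHom_ob[OF P(2) f(2,3)] VHom_ob[OF P(1) a a] VId_ty[OF P(1) a] tn_ob[OF f(4)]
  have t: "ty (FHm D (a, b) (a, b')) = Arr (VHom A a a \<otimes> VHom B b b') (VHom C (FOb D (a, b)) (FOb D (a, b')))"
    using FHm_ty[OF D, of "(a, b)" "(a, b')"] f a by (simp add: tensor_vcat_simps)
  have "(VId A a \<boxtimes> \<iota> (VHom B b b')) \<cdot> inv (lunit V (VHom B b b')) \<cdot> f = (VId A a \<boxtimes> \<iota> (VHom B b b')) \<cdot> (\<iota> \<one> \<boxtimes> f) \<cdot> inv (lunit V (tn S))"
    using inv_lunit_nat[OF f(5)] by simp
  also have "\<dots> = (VId A a \<boxtimes> f) \<cdot> inv (lunit V (tn S))" using f o by (simp add: tensor_comp2 mon_ty)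
  finally show ?thesis using f a t o
    by (simp add: fap_def partial_right_def prd_def idn_def pr_def mg_unit comp_assoc mon_ty)
qed

text \<open>A pair is a composite of two pairs with one identity each, in either order, because
  identities have empty stage. Comparing both orders shows that the two partial actions
  commute.\<close>

lemma prd_factor:
  assumes x: "el A x = El a a' S" and y: "el B y = El b b' U" and d: "S \<inter> U = {}"
  shows "fap D (prd x y) = fap D (prd x (idn B b')) \<odot>[C] fap D (prd (idn A a) y)"
    "fap D (prd x y) = fap D (prd (idn A a') y) \<odot>[C] fap D (prd x (idn B b))"
proof -
  note P = enriched_pre[OF A] enriched_pre[OF B]
  have i: "el A (idn A a) = El a a {}" "el A (idn A a') = El a' a' {}" "el B (idn B b) = El b b {}" "el B (idn B b') = El b' b' {}"
    using idn_el[OF P(1)] idn_el[OF P(2)] el_obs[OF x] el_obs[OF y] by simp_all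
  have d': "U \<inter> S = {}" using d by auto
  have e: "el (tensor_vcat V A B) (prd x (idn B b')) = El (a, b') (a', b') S" "el (tensor_vcat V A B) (prd (idn A a) y) = El (a, b) (a, b') U"
    "el (tensor_vcat V A B) (prd (idn A a') y) = El (a', b) (a', b') U" "el (tensor_vcat V A B) (prd x (idn B b)) = El (a, b) (a', b) S"
    using prd_el[OF A B x i(4)] prd_el[OF A B i(1) y] prd_el[OF A B i(2) y] prd_el[OF A B x i(3)] by simp_all
  have "prd x (idn B b') \<odot>[tensor_vcat V A B] prd (idn A a) y = prd x y"
    using prd_ecomp[OF A B x i(4) i(1) y] d ecomp_idn[OF A x] ecomp_idn[OF B y] by simp
  then show "fap D (prd x y) = fap D (prd x (idn B b')) \<odot>[C] fap D (prd (idn A a) y)"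
    using fap_ecomp[OF D e(1,2) d] by simp
  have "prd (idn A a') y \<odot>[tensor_vcat V A B] prd x (idn B b) = prd x y"
    using prd_ecomp[OF A B i(2) y x i(3)] d' ecomp_idn[OF A x] ecomp_idn[OF B y] by simp
  then show "fap D (prd x y) = fap D (prd (idn A a') y) \<odot>[C] fap D (prd x (idn B b))"
    using fap_ecomp[OF D e(3,4) d'] by simp
qed

lemma prd_el_C:
  assumes x: "el A x = El a a' S" and y: "el B y = El b b' U" and d: "S \<inter> U = {}"
  shows "el C (fap D (prd x y)) = El (FOb D (a, b)) (FOb D (a', b')) (S \<union> U)"
  by (rule fap_el[OF D prd_el[OF A B x y d]])

lemma partial_left_functor:
  assumes b: "b \<in> VOb B"
  shows "enriched_functor V A C (partial_left V A B b D)"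
proof (rule enriched_functorI[OF A enr_functor_cats(2)[OF D] _ _ gvar_cover])
  let ?F = "partial_left V A B b D" and ?P = "tensor_vcat V A B"
  note P = enriched_pre[OF A] enriched_pre[OF B]
  have ib: "el B (idn B b) = El b b {}" using idn_el[OF P(2) b] .
  show "pre_enriched A" by (rule P(1))
  show "FOb ?F \<in> VOb A \<rightarrow>\<^sub>E VOb C"
    using FOb_ob[OF D] b by (auto simp: partial_left_def tensor_vcat_simps)
  have "ty (FHm D (x, b) (y, b) \<cdot> (\<iota> (VHom A x y) \<boxtimes> VId B b) \<cdot> inv (runit V (VHom A x y))) = Arr (VHom A x y) (VHom C (FOb D (x, b)) (FOb D (y, b)))"
    if "x \<in> VOb A" "y \<in> VOb A" for x y
    using that b FHm_ty[OF D, of "(x, b)" "(y, b)"] VHom_ob[OF P(1) that] VId_ty[OF P(2) b] by (simp add: tensor_vcat_simps mon_ty)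
  then show "FHm ?F \<in> (\<Pi>\<^sub>E x\<in>VOb A. \<Pi>\<^sub>E y\<in>VOb A. hom V (VHom A x y) (VHom C (FOb ?F x) (FOb ?F y)))"
    by (auto simp: partial_left_def hom_ty)
  fix x assume x: "x \<in> VOb A"
  have px: "FOb ?F x = FOb D (x, b)" using x by (simp add: partial_left_def)
  show "fap ?F (idn A x) = idn C (FOb ?F x)"
    unfolding px fap_partial_left[OF idn_el[OF P(1) x] b] prd_idn[OF A B x b]
    by (rule fap_idn[OF D]) (use x b in \<open>simp add: tensor_vcat_simps\<close>)
  fix y z assume yz: "y \<in> VOb A" "z \<in> VOb A"
  note u = gvar_el[OF P(1) yz, of 1] and v = gvar_el[OF P(1) x yz(1), of 0]
  have d: "{(VHom A y z, 1 :: nat)} \<inter> {(VHom A x y, 0)} = {}" by simp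
  have e: "el ?P (prd (gvar A 1 y z) (idn B b)) = El (y, b) (z, b) {(VHom A y z, 1)}"
    "el ?P (prd (gvar A 0 x y) (idn B b)) = El (x, b) (y, b) {(VHom A x y, 0)}"
    using prd_el[OF A B u ib] prd_el[OF A B v ib] by simp_all
  have "prd (gvar A 1 y z) (idn B b) \<odot>[?P] prd (gvar A 0 x y) (idn B b) = prd (gvar A 1 y z \<odot>[A] gvar A 0 x y) (idn B b)"
    using prd_ecomp[OF A B u ib v ib] ecomp_idn[OF B ib] by simp
  then show "fap ?F (gvar A 1 y z \<odot>[A] gvar A 0 x y)
      = fap ?F (gvar A 1 y z) \<odot>[C] fap ?F (gvar A 0 x y)"
    unfolding fap_partial_left[OF u b] fap_partial_left[OF v b] fap_partial_left[OF ecomp_el[OF P(1) u v d] b]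
    using fap_ecomp[OF D e d] by simp
qed

lemma partial_right_functor:
  assumes a: "a \<in> VOb A"
  shows "enriched_functor V B C (partial_right V A B a D)"
proof (rule enriched_functorI[OF B enr_functor_cats(2)[OF D] _ _ gvar_cover])
  let ?F = "partial_right V A B a D" and ?P = "tensor_vcat V A B"
  note P = enriched_pre[OF A] enriched_pre[OF B]
  have ia: "el A (idn A a) = El a a {}" using idn_el[OF P(1) a] .
  show "pre_enriched B" by (rule P(2))
  show "FOb ?F \<in> VOb B \<rightarrow>\<^sub>E VOb C"
    using FOb_ob[OF D] a by (auto simp: partial_right_def tensor_vcat_simps)
  have "ty (FHm D (a, x) (a, y) \<cdot> (VId A a \<boxtimes> \<iota> (VHom B x y)) \<cdot> inv (lunit V (VHom B x y))) = Arr (VHom B x y) (VHom C (FOb D (a, x)) (FOb D (a, y)))"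
    if "x \<in> VOb B" "y \<in> VOb B" for x y
    using that a FHm_ty[OF D, of "(a, x)" "(a, y)"] VHom_ob[OF P(2) that] VId_ty[OF P(1) a] by (simp add: tensor_vcat_simps mon_ty)
  then show "FHm ?F \<in> (\<Pi>\<^sub>E x\<in>VOb B. \<Pi>\<^sub>E y\<in>VOb B. hom V (VHom B x y) (VHom C (FOb ?F x) (FOb ?F y)))"
    by (auto simp: partial_right_def hom_ty)
  fix x assume x: "x \<in> VOb B"
  have px: "FOb ?F x = FOb D (a, x)" using x by (simp add: partial_right_def)
  show "fap ?F (idn B x) = idn C (FOb ?F x)"
    unfolding px fap_partial_right[OF idn_el[OF P(2) x] a] prd_idn[OF A B a x]
    by (rule fap_idn[OF D]) (use x a in \<open>simp add: tensor_vcat_simps\<close>)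
  fix y z assume yz: "y \<in> VOb B" "z \<in> VOb B"
  note u = gvar_el[OF P(2) yz, of 1] and v = gvar_el[OF P(2) x yz(1), of 0]
  have d: "{(VHom B y z, 1 :: nat)} \<inter> {(VHom B x y, 0)} = {}" by simp
  have e: "el ?P (prd (idn A a) (gvar B 1 y z)) = El (a, y) (a, z) {(VHom B y z, 1)}"
    "el ?P (prd (idn A a) (gvar B 0 x y)) = El (a, x) (a, y) {(VHom B x y, 0)}"
    using prd_el[OF A B ia u] prd_el[OF A B ia v] by simp_all
  have "prd (idn A a) (gvar B 1 y z) \<odot>[?P] prd (idn A a) (gvar B 0 x y) = prd (idn A a) (gvar B 1 y z \<odot>[B] gvar B 0 x y)"
    using prd_ecomp[OF A B ia u ia v] ecomp_idn[OF A ia] by simp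
  then show "fap ?F (gvar B 1 y z \<odot>[B] gvar B 0 x y)
      = fap ?F (gvar B 1 y z) \<odot>[C] fap ?F (gvar B 0 x y)"
    unfolding fap_partial_right[OF u a] fap_partial_right[OF v a] fap_partial_right[OF ecomp_el[OF P(2) u v d] a]
    using fap_ecomp[OF D e d] by simp
qed

end

lemma tensor_vfun_functor:
  assumes A: "enriched_category V A" and B: "enriched_category V B"
    and F: "enriched_functor V A A' F" and G: "enriched_functor V B B' G"
  shows "enriched_functor V (tensor_vcat V A B) (tensor_vcat V A' B') (tensor_vfun V A B F G)"
    "\<lbrakk>el A x = El a a2 S; el B y = El b b2 U; S \<inter> U = {}\<rbrakk> \<Longrightarrow> fap (tensor_vfun V A B F G) (prd x y) = prd (fap F x) (fap G y)"
proof -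
  let ?K = "tensor_vfun V A B F G" and ?Q = "tensor_vcat V A' B'" and ?P = "tensor_vcat V A B"
  note A' = enr_functor_cats(2)[OF F] and B' = enr_functor_cats(2)[OF G]
  note P = enriched_pre[OF A] enriched_pre[OF B]
  have T: "fap ?K (prd x y) = prd (fap F x) (fap G y)"
    if x: "el A x = El a a2 S" and y: "el B y = El b b2 U" and d: "S \<inter> U = {}" for x y a a2 S b b2 U
    using x y d
    by (auto elim!: elE simp: fap_def prd_def tensor_vfun_def pr_comp FHm_ty[OF F] FHm_ty[OF G])
  then show "\<lbrakk>el A x = El a a2 S; el B y = El b b2 U; S \<inter> U = {}\<rbrakk> \<Longrightarrow> fap ?K (prd x y) = prd (fap F x) (fap G y)" .
  have Fo: "a \<in> VOb A \<Longrightarrow> b \<in> VOb B \<Longrightarrow> FOb ?K (a, b) = (FOb F a, FOb G b)" for a b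
    by (simp add: tensor_vfun_def)
  have Fh: "a \<in> VOb A \<Longrightarrow> b \<in> VOb B \<Longrightarrow> a2 \<in> VOb A \<Longrightarrow> b2 \<in> VOb B \<Longrightarrow> FHm ?K (a, b) (a2, b2) = FHm F a a2 \<boxtimes> FHm G b b2" for a b a2 b2
    by (simp add: tensor_vfun_def)
  show "enriched_functor V ?P ?Q ?K"
  proof (rule tensor_functor_eqI[OF A B tensor_cat[OF A' B']])
    show "FOb ?K \<in> VOb A \<times> VOb B \<rightarrow>\<^sub>E VOb ?Q"
      using FOb_ob[OF F] FOb_ob[OF G] by (auto simp: tensor_vfun_def tensor_vcat_simps)
    show "FHm ?K \<in> (\<Pi>\<^sub>E p\<in>VOb A \<times> VOb B. \<Pi>\<^sub>E q\<in>VOb A \<times> VOb B. hom V (VHom ?P p q) (VHom ?Q (FOb ?K p) (FOb ?K q)))"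
    proof (intro PiE_I)
      fix p q assume "p \<in> VOb A \<times> VOb B" "q \<in> VOb A \<times> VOb B"
      then show "FHm ?K p q \<in> hom V (VHom ?P p q) (VHom ?Q (FOb ?K p) (FOb ?K q))"
        using FHm_ty[OF F] FHm_ty[OF G] FOb_ob[OF F] FOb_ob[OF G] by (auto simp: Fo Fh tensor_vcat_simps hom_ty mon_ty)
    qed (auto simp: tensor_vfun_def split: if_splits)
    fix a b assume ab: "a \<in> VOb A" "b \<in> VOb B"
    show "fap ?K (prd (idn A a) (idn B b)) = idn ?Q (FOb ?K (a, b))"
      using T[OF idn_el[OF P(1) ab(1)] idn_el[OF P(2) ab(2)]] fap_idn[OF F ab(1)] fap_idn[OF G ab(2)]
        prd_idn[OF A' B' FOb_ob[OF F ab(1)] FOb_ob[OF G ab(2)]] ab by (simp add: Fo)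
  next
    fix a a2 a3 b b2 b3 x x' y y' S S' U U'
    assume e: "el A x = El a2 a3 S" "el B y = El b2 b3 U" "el A x' = El a a2 S'" "el B y' = El b b2 U'"
      and d: "S \<inter> U = {}" "S \<inter> S' = {}" "S \<inter> U' = {}" "U \<inter> S' = {}" "U \<inter> U' = {}" "S' \<inter> U' = {}"
    have d': "(S \<union> S') \<inter> (U \<union> U') = {}" using d by auto
    show "fap ?K (prd (x \<odot>[A] x') (y \<odot>[B] y'))
      = fap ?K (prd x y) \<odot>[?Q] fap ?K (prd x' y')"
      unfolding T[OF e(1,2) d(1)] T[OF e(3,4) d(6)] T[OF ecomp_el[OF P(1) e(1,3) d(2)] ecomp_el[OF P(2) e(2,4) d(5)] d']
        fap_ecomp[OF F e(1,3) d(2)] fap_ecomp[OF G e(2,4) d(5)]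
      using prd_ecomp[OF A' B' fap_el[OF F e(1)] fap_el[OF G e(2)] fap_el[OF F e(3)] fap_el[OF G e(4)] d] by simp
  qed
qed

text \<open>By \<open>prd_factor\<close> a naturality square on a pair is pasted from one square in
  each variable.\<close>

lemma vnatural_tensorI:
  assumes A: "enriched_category V A" and B: "enriched_category V B"
    and F: "enriched_functor V (tensor_vcat V A B) C F" and G: "enriched_functor V (tensor_vcat V A B) C G"
    and ext: "\<phi> \<in> extensional (VOb A \<times> VOb B)"
    and t: "\<And>a b. a \<in> VOb A \<Longrightarrow> b \<in> VOb B \<Longrightarrow> el C (nt F G \<phi> (a, b)) = El (FOb F (a, b)) (FOb G (a, b)) {}"
    and l: "\<And>a a' b x S. el A x = El a a' S \<Longrightarrow> b \<in> VOb B
      \<Longrightarrow> nt F G \<phi> (a', b) \<odot>[C] fap F (prd x (idn B b)) = fap G (prd x (idn B b)) \<odot>[C] nt F G \<phi> (a, b)"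
    and r: "\<And>b b' a y U. el B y = El b b' U \<Longrightarrow> a \<in> VOb A
      \<Longrightarrow> nt F G \<phi> (a, b') \<odot>[C] fap F (prd (idn A a) y) = fap G (prd (idn A a) y) \<odot>[C] nt F G \<phi> (a, b)"
  shows "vnatural V (tensor_vcat V A B) C F G \<phi>"
proof (rule vnaturalI[OF F G tcov_cover[OF A B]])
  show "\<phi> \<in> extensional (VOb (tensor_vcat V A B))" using ext by (simp add: tensor_vcat_simps)
  show "el C (nt F G \<phi> p) = El (FOb F p) (FOb G p) {}" if "p \<in> VOb (tensor_vcat V A B)" for p
    using that t by (auto simp: tensor_vcat_simps)
  fix p q assume pq: "p \<in> VOb (tensor_vcat V A B)" "q \<in> VOb (tensor_vcat V A B)"
  note C = enr_functor_cats(2)[OF F] and P = enriched_pre[OF A] enriched_pre[OF B]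
  obtain a b a' b' where o: "p = (a, b)" "q = (a', b')" "a \<in> VOb A" "b \<in> VOb B" "a' \<in> VOb A" "b' \<in> VOb B"
    using pq by (auto simp: tensor_vcat_simps)
  let ?x = "gvar A 0 a a'" and ?y = "gvar B 1 b b'"
  let ?S = "{(VHom A a a', 0 :: nat)}" and ?U = "{(VHom B b b', 1 :: nat)}"
  note x = gvar_el[OF P(1) o(3,5), of 0] and y = gvar_el[OF P(2) o(4,6), of 1]
  have d: "?S \<inter> ?U = {}" by simp
  have i: "el A (idn A a) = El a a {}" "el B (idn B b') = El b' b' {}" using idn_el[OF P(1) o(3)] idn_el[OF P(2) o(6)] by simp_all
  have e: "el C (fap F (prd ?x (idn B b'))) = El (FOb F (a, b')) (FOb F (a', b')) ?S" "el C (fap F (prd (idn A a) ?y)) = El (FOb F (a, b)) (FOb F (a, b')) ?U"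
    "el C (fap G (prd ?x (idn B b'))) = El (FOb G (a, b')) (FOb G (a', b')) ?S" "el C (fap G (prd (idn A a) ?y)) = El (FOb G (a, b)) (FOb G (a, b')) ?U"
    using prd_el_C[OF A B F x i(2)] prd_el_C[OF A B F i(1) y] prd_el_C[OF A B G x i(2)] prd_el_C[OF A B G i(1) y] by simp_all
  have "nt F G \<phi> (a', b') \<odot>[C] fap F (prd ?x ?y) = nt F G \<phi> (a', b') \<odot>[C] (fap F (prd ?x (idn B b')) \<odot>[C] fap F (prd (idn A a) ?y))"
    using prd_factor(1)[OF A B F x y d] by simp
  also have "\<dots> = (fap G (prd ?x (idn B b')) \<odot>[C] nt F G \<phi> (a, b')) \<odot>[C] fap F (prd (idn A a) ?y)"
    using ecomp_assoc[OF C t[OF o(5,6)] e(1,2)] d l[OF x o(6)] by simp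
  also have "\<dots> = fap G (prd ?x (idn B b')) \<odot>[C] (fap G (prd (idn A a) ?y) \<odot>[C] nt F G \<phi> (a, b))"
    using ecomp_assoc[OF C e(3) t[OF o(3,6)] e(2)] d r[OF y o(3)] by simp
  also have "\<dots> = fap G (prd ?x ?y) \<odot>[C] nt F G \<phi> (a, b)"
    using ecomp_assoc[OF C e(3,4) t[OF o(3,4)]] d prd_factor(1)[OF A B G x y d] by simp
  finally show "nt F G \<phi> q \<odot>[C] fap F (tcov A B 0 p q) = fap G (tcov A B 0 p q) \<odot>[C] nt F G \<phi> p"
    by (simp add: tcov_def o)
qed

text \<open>The functor of two variables assembled from prospective partial functors that agree on
  objects and commute. On homs the second variable acts first.\<close>

definition bifun :: "('a, 'o, 'm) vcat \<Rightarrow> ('b, 'o, 'm) vcat \<Rightarrow> ('c, 'o, 'm) vcat \<Rightarrow>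
    ('b \<Rightarrow> ('a, 'c, 'm) vfun) \<Rightarrow> ('a \<Rightarrow> ('b, 'c, 'm) vfun) \<Rightarrow> ('a \<times> 'b, 'c, 'm) vfun" where
  "bifun A B C L R = \<lparr>FOb = (\<lambda>(a, b) \<in> VOb A \<times> VOb B. FOb (L b) a),
     FHm = (\<lambda>(a, b) \<in> VOb A \<times> VOb B. \<lambda>(a', b') \<in> VOb A \<times> VOb B.
       VCmp C (FOb (L b) a) (FOb (L b') a) (FOb (L b') a') \<cdot> (FHm (L b') a a' \<boxtimes> FHm (R a) b b'))\<rparr>"

context
  fixes A :: "('a, 'o, 'm) vcat" and B :: "('b, 'o, 'm) vcat" and C :: "('c, 'o, 'm) vcat"
    and L :: "'b \<Rightarrow> ('a, 'c, 'm) vfun" and R :: "'a \<Rightarrow> ('b, 'c, 'm) vfun"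
  assumes A: "enriched_category V A" and B: "enriched_category V B"
    and L: "\<And>b. b \<in> VOb B \<Longrightarrow> enriched_functor V A C (L b)"
    and R: "\<And>a. a \<in> VOb A \<Longrightarrow> enriched_functor V B C (R a)"
    and LR: "\<And>a b. a \<in> VOb A \<Longrightarrow> b \<in> VOb B \<Longrightarrow> FOb (R a) b = FOb (L b) a"
    and C: "enriched_category V C"
    and comm: "\<And>a a' b b' x y S U. \<lbrakk>el A x = El a a' S; el B y = El b b' U; S \<inter> U = {}\<rbrakk>
      \<Longrightarrow> fap (L b') x \<odot>[C] fap (R a) y = fap (R a') y \<odot>[C] fap (L b) x"
begin

lemma bifun_prd:
  assumes x: "el A x = El a a' S" and y: "el B y = El b b' U" and d: "S \<inter> U = {}"
  shows "fap (bifun A B C L R) (prd x y) = fap (L b') x \<odot>[C] fap (R a) y"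
proof -
  obtain f where f: "x = (a, a', S, f)" "a \<in> VOb A" "a' \<in> VOb A" "stage S" "ty f = Arr (tn S) (VHom A a a')" using x by (rule elE)
  obtain g where g: "y = (b, b', U, g)" "b \<in> VOb B" "b' \<in> VOb B" "stage U" "ty g = Arr (tn U) (VHom B b b')" using y by (rule elE)
  note t = FHm_ty[OF L[OF g(3)] f(2,3)] FHm_ty[OF R[OF f(2)] g(2,3)] FOb_ob[OF L[OF g(2)] f(2)] FOb_ob[OF L[OF g(3)] f(2)] FOb_ob[OF L[OF g(3)] f(3)]
    LR[OF f(2) g(2)] LR[OF f(2) g(3)]
  have "(VCmp C (FOb (L b) a) (FOb (L b') a) (FOb (L b') a') \<cdot> (FHm (L b') a a' \<boxtimes> FHm (R a) b b')) \<cdot> pr S U f g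
      = VCmp C (FOb (L b) a) (FOb (L b') a) (FOb (L b') a') \<cdot> pr S U (FHm (L b') a a' \<cdot> f) (FHm (R a) b b' \<cdot> g)"
    using t f g d enriched_pre[OF C] pr_ty[OF f(5) g(5) f(4) g(4) d]
    by (simp add: comp_assoc mon_ty VCmp_ty pr_comp)
  then show ?thesis using f g t by (simp add: fap_def prd_def bifun_def ecomp_def)
qed

lemma bifun_functor: "enriched_functor V (tensor_vcat V A B) C (bifun A B C L R)"
proof (rule tensor_functor_eqI[OF A B C])
  let ?F = "bifun A B C L R"
  note P = enriched_pre[OF A] enriched_pre[OF B] enriched_pre[OF C]
  show "FOb ?F \<in> VOb A \<times> VOb B \<rightarrow>\<^sub>E VOb C"
    using FOb_ob[OF L] by (auto simp: bifun_def)
  show "FHm ?F \<in> (\<Pi>\<^sub>E p\<in>VOb A \<times> VOb B. \<Pi>\<^sub>E q\<in>VOb A \<times> VOb B. hom V (VHom (tensor_vcat V A B) p q) (VHom C (FOb ?F p) (FOb ?F q)))"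
  proof (intro PiE_I)
    fix p q assume "p \<in> VOb A \<times> VOb B" "q \<in> VOb A \<times> VOb B"
    then obtain a b a' b' where o: "p = (a, b)" "q = (a', b')" "a \<in> VOb A" "b \<in> VOb B" "a' \<in> VOb A" "b' \<in> VOb B" by auto
    show "FHm ?F p q \<in> hom V (VHom (tensor_vcat V A B) p q) (VHom C (FOb ?F p) (FOb ?F q))"
      using o FHm_ty[OF L[OF o(6)] o(3,5)] FHm_ty[OF R[OF o(3)] o(4,6)] FOb_ob[OF L[OF o(4)] o(3)] FOb_ob[OF L[OF o(6)] o(3)] FOb_ob[OF L[OF o(6)] o(5)]
        LR[OF o(3,4)] LR[OF o(3,6)] P
      by (simp add: bifun_def tensor_vcat_simps hom_ty mon_ty VCmp_ty)
  qed (auto simp: bifun_def split: if_splits)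
  fix a b assume ab: "a \<in> VOb A" "b \<in> VOb B"
  show "fap ?F (prd (idn A a) (idn B b)) = idn C (FOb ?F (a, b))"
    using bifun_prd[OF idn_el[OF P(1) ab(1)] idn_el[OF P(2) ab(2)]] fap_idn[OF L[OF ab(2)] ab(1)] fap_idn[OF R[OF ab(1)] ab(2)]
      LR[OF ab] ecomp_idn(1)[OF C idn_el[OF P(3) FOb_ob[OF L[OF ab(2)] ab(1)]]] ab by (simp add: bifun_def)
next
  let ?F = "bifun A B C L R"
  note P = enriched_pre[OF A] enriched_pre[OF B] enriched_pre[OF C]
  fix a a2 a3 b b2 b3 x x' y y' S S' U U'
  assume e: "el A x = El a2 a3 S" "el B y = El b2 b3 U" "el A x' = El a a2 S'" "el B y' = El b b2 U'"
    and d: "S \<inter> U = {}" "S \<inter> S' = {}" "S \<inter> U' = {}" "U \<inter> S' = {}" "U \<inter> U' = {}" "S' \<inter> U' = {}"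
  have d': "(S \<union> S') \<inter> (U \<union> U') = {}" "S' \<inter> U = {}" "S \<inter> (S' \<union> U') = {}" "U \<inter> (S' \<union> U') = {}" "S' \<inter> (U \<union> U') = {}" using d by auto
  note o = el_obs(1,2)[OF e(1)] el_obs(1,2)[OF e(2)] el_obs(1,2)[OF e(3)] el_obs(1,2)[OF e(4)]
  have Lx: "el C (fap (L b3) x) = El (FOb (L b3) a2) (FOb (L b3) a3) S" by (rule fap_el[OF L[OF o(4)] e(1)])
  have Lx': "el C (fap (L b3) x') = El (FOb (L b3) a) (FOb (L b3) a2) S'" by (rule fap_el[OF L[OF o(4)] e(3)])
  have Ly: "el C (fap (L b2) x') = El (FOb (L b2) a) (FOb (L b2) a2) S'" by (rule fap_el[OF L[OF o(3)] e(3)])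
  have Ry: "el C (fap (R a) y) = El (FOb (L b2) a) (FOb (L b3) a) U" "el C (fap (R a2) y) = El (FOb (L b2) a2) (FOb (L b3) a2) U"
    using fap_el[OF R[OF o(5)] e(2)] fap_el[OF R[OF o(6)] e(2)] LR o by simp_all
  have Ry': "el C (fap (R a) y') = El (FOb (L b) a) (FOb (L b2) a) U'" using fap_el[OF R[OF o(5)] e(4)] LR o by simp
  note xx = ecomp_el[OF P(1) e(1,3) d(2)] and yy = ecomp_el[OF P(2) e(2,4) d(5)]
  have "fap ?F (prd (x \<odot>[A] x') (y \<odot>[B] y')) = (fap (L b3) x \<odot>[C] fap (L b3) x') \<odot>[C] (fap (R a) y \<odot>[C] fap (R a) y')"
    unfolding bifun_prd[OF xx yy d'(1)] fap_ecomp[OF L[OF o(4)] e(1,3) d(2)] fap_ecomp[OF R[OF o(5)] e(2,4) d(5)] ..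
  also have "\<dots> = fap (L b3) x \<odot>[C] (fap (L b3) x' \<odot>[C] (fap (R a) y \<odot>[C] fap (R a) y'))"
    using ecomp_assoc[OF C Lx Lx' ecomp_el[OF P(3) Ry(1) Ry' d(5)]] d d' by (simp add: Int_Un_distrib)
  also have "\<dots> = fap (L b3) x \<odot>[C] ((fap (L b3) x' \<odot>[C] fap (R a) y) \<odot>[C] fap (R a) y')"
    using ecomp_assoc[OF C Lx' Ry(1) Ry' d'(2) d(6,5)] by simp
  \<comment> \<open>Here \<open>comm\<close> exchanges the two inner factors, which separates the
    unprimed pair from the primed one.\<close>
  also have "\<dots> = fap (L b3) x \<odot>[C] ((fap (R a2) y \<odot>[C] fap (L b2) x') \<odot>[C] fap (R a) y')"
    unfolding comm[OF e(3,2) d'(2)] ..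
  also have "\<dots> = fap (L b3) x \<odot>[C] (fap (R a2) y \<odot>[C] (fap (L b2) x' \<odot>[C] fap (R a) y'))"
    using ecomp_assoc[OF C Ry(2) Ly Ry' d(4,5,6)] by simp
  also have "\<dots> = (fap (L b3) x \<odot>[C] fap (R a2) y) \<odot>[C] (fap (L b2) x' \<odot>[C] fap (R a) y')"
    using ecomp_assoc[OF C Lx Ry(2) ecomp_el[OF P(3) Ly Ry' d(6)] d(1) d'(3,4)] by simp
  also have "\<dots> = fap ?F (prd x y) \<odot>[C] fap ?F (prd x' y')"
    unfolding bifun_prd[OF e(1,2) d(1)] bifun_prd[OF e(3,4) d(6)] ..
  finally show "fap ?F (prd (x \<odot>[A] x') (y \<odot>[B] y')) = fap ?F (prd x y) \<odot>[C] fap ?F (prd x' y')" .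
qed

lemma bifun_left:
  assumes b: "b \<in> VOb B"
  shows "partial_left V A B b (bifun A B C L R) = L b"
proof (rule vfun_eqI_gvar[OF partial_left_functor[OF A B bifun_functor b] L[OF b]])
  note P = enriched_pre[OF A] enriched_pre[OF B]
  fix a a' assume a: "a \<in> VOb A" "a' \<in> VOb A"
  note x = gvar_el[OF P(1) a, of 0]
  show "fap (partial_left V A B b (bifun A B C L R)) (gvar A 0 a a') = fap (L b) (gvar A 0 a a')"
    unfolding fap_partial_left[OF A B bifun_functor x b]
    using bifun_prd[OF x idn_el[OF P(2) b]] fap_idn[OF R[OF a(1)] b] LR[OF a(1) b] ecomp_idn(2)[OF C fap_el[OF L[OF b] x]] by simp
qed (use b in \<open>simp add: partial_left_def bifun_def\<close>)

lemma bifun_right: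
  assumes a: "a \<in> VOb A"
  shows "partial_right V A B a (bifun A B C L R) = R a"
proof (rule vfun_eqI_gvar[OF partial_right_functor[OF A B bifun_functor a] R[OF a]])
  note P = enriched_pre[OF A] enriched_pre[OF B]
  fix b b' assume b: "b \<in> VOb B" "b' \<in> VOb B"
  note y = gvar_el[OF P(2) b, of 0]
  show "fap (partial_right V A B a (bifun A B C L R)) (gvar B 0 b b') = fap (R a) (gvar B 0 b b')"
    unfolding fap_partial_right[OF A B bifun_functor y a]
    using bifun_prd[OF idn_el[OF P(1) a] y] fap_idn[OF L[OF b(2)] a] LR[OF a b(2)] ecomp_idn(1)[OF C fap_el[OF R[OF a] y]] by simp
qed (use a LR in \<open>simp add: partial_right_def bifun_def\<close>)

end

end

section \<open>Categories of algebras, pairs and bifold algebras\<close>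

text \<open>The quasi-inverse chooses a preimage of each object up to an isomorphism
  \<open>e b\<close>. Arrows are conjugated by these isomorphisms and lifted by full faithfulness,
  and lifting the inverses of \<open>e\<close> gives the unit.\<close>

lemma equivalence_of_categoriesI:
  assumes F: "cat_functor A B F"
    and full: "\<And>a a' g. \<lbrakk>a \<in> Ob A; a' \<in> Ob A; g \<in> hom B (Fo F a) (Fo F a')\<rbrakk> \<Longrightarrow> \<exists>f \<in> hom A a a'. Fa F f = g"
    and faithful: "\<And>a a' f f'. \<lbrakk>f \<in> hom A a a'; f' \<in> hom A a a'; Fa F f = Fa F f'\<rbrakk> \<Longrightarrow> f = f'"
    and surj: "\<And>b. b \<in> Ob B \<Longrightarrow> \<exists>a \<in> Ob A. \<exists>e \<in> hom B (Fo F a) b. iso_arrow B e"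
  shows "equivalence_of_categories A B F"
proof -
  interpret A: category A using F by (simp add: cat_functor_def)
  interpret B: category B using F by (simp add: cat_functor_def)
  interpret F: cat_functor A B F by (rule F)
  obtain G0 e where G0: "\<And>b. b \<in> Ob B \<Longrightarrow> G0 b \<in> Ob A \<and> e b \<in> hom B (Fo F (G0 b)) b \<and> iso_arrow B (e b)"
    using surj by metis
  have FoB: "a \<in> Ob A \<Longrightarrow> Fo F a \<in> Ob B" for a using F.Fo_PiE by blast
  let ?i = "\<lambda>b. inv_arrow B (e b)"
  have G0o: "b \<in> Ob B \<Longrightarrow> G0 b \<in> Ob A" and ei: "b \<in> Ob B \<Longrightarrow> iso_arrow B (e b)"
    and et: "b \<in> Ob B \<Longrightarrow> B.ty (e b) = Arr (Fo F (G0 b)) b" for b using G0 by (simp_all add: B.hom_ty)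
  have it: "b \<in> Ob B \<Longrightarrow> B.ty (?i b) = Arr b (Fo F (G0 b))" for b using et G0 B.inv_ty by blast
  define L where "L a a' g = (THE f. A.ty f = Arr a a' \<and> Fa F f = g)" for a a' g
  have L: "A.ty (L a a' g) = Arr a a'" "Fa F (L a a' g) = g"
    if "a \<in> Ob A" "a' \<in> Ob A" "B.ty g = Arr (Fo F a) (Fo F a')" for a a' g
  proof -
    have "\<exists>!f. A.ty f = Arr a a' \<and> Fa F f = g"
      using full[OF that(1,2), of g] faithful that(3) unfolding Bex_def A.hom_ty B.hom_ty by blast
    from theI'[OF this] show "A.ty (L a a' g) = Arr a a'" "Fa F (L a a' g) = g" by (simp_all add: L_def)
  qed
  have Fty: "B.ty (Fa F f) = Arr (Fo F a) (Fo F a')" if "A.ty f = Arr a a'" for f a a'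
    using F.Fa_hom that unfolding A.hom_ty B.hom_ty by blast
  have LF: "L a a' (Fa F f) = f" if f: "A.ty f = Arr a a'" for a a' f
    using faithful[unfolded A.hom_ty, OF L(1) f L(2)] A.ty_obs[OF f] Fty[OF f] by blast
  have Lc: "Comp A (L b c h) (L a b g) = L a c (Comp B h g)"
    if o: "a \<in> Ob A" "b \<in> Ob A" "c \<in> Ob A" and t: "B.ty g = Arr (Fo F a) (Fo F b)" "B.ty h = Arr (Fo F b) (Fo F c)" for a b c g h
  proof -
    note l = L[OF o(1,2) t(1)] L[OF o(2,3) t(2)]
    show ?thesis using LF[OF A.comp_ty[OF l(1,3)]] F.Fa_Comp[unfolded A.hom_ty, OF l(1,3)] l by simp
  qed
  have Li: "L a a (Ident B (Fo F a)) = Ident A a" if "a \<in> Ob A" for a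
    using LF[OF A.ident_ty[OF that]] F.Fa_Ident[OF that] by simp
  \<comment> \<open>Conjugation makes g run between images under F of chosen objects, so that
    \<open>L\<close> can lift it.\<close>
  define cf where "cf g = Comp B (?i (Cod B g)) (Comp B g (e (Dom B g)))" for g
  let ?G = "\<lparr>Fo = (\<lambda>b\<in>Ob B. G0 b), Fa = (\<lambda>g\<in>Ar B. L (G0 (Dom B g)) (G0 (Cod B g)) (cf g))\<rparr>"
  have cf: "g \<in> Ar B" "Dom B g = a" "Cod B g = b" "cf g = Comp B (?i b) (Comp B g (e a))" "B.ty (cf g) = Arr (Fo F (G0 a)) (Fo F (G0 b))"
    if g: "B.ty g = Arr a b" for g a b
  proof -
    show "g \<in> Ar B" "Dom B g = a" "Cod B g = b" using g by (simp_all add: B.ty_iff)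
    then show "cf g = Comp B (?i b) (Comp B g (e a))" by (simp add: cf_def)
    then show "B.ty (cf g) = Arr (Fo F (G0 a)) (Fo F (G0 b))" using g B.ty_obs[OF g] et it by (simp add: B.comp_ty)
  qed
  have Ga: "Fa ?G g = L (G0 a) (G0 b) (Comp B (?i b) (Comp B g (e a)))" if "B.ty g = Arr a b" for g a b
    using cf[OF that] by simp
  have G: "cat_functor B A ?G"
  proof (intro cat_functor.intro cat_functor_axioms.intro A.category_axioms B.category_axioms)
    show "Fo ?G \<in> Ob B \<rightarrow>\<^sub>E Ob A" using G0 by auto
    show "Fa ?G \<in> extensional (Ar B)" by simp
    fix g a b assume "g \<in> hom B a b"
    then have g: "B.ty g = Arr a b" by (simp add: B.hom_ty)
    note o = B.ty_obs[OF g]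
    show "Fa ?G g \<in> hom A (Fo ?G a) (Fo ?G b)" unfolding A.hom_ty using cf[OF g] L(1)[OF G0o[OF o(1)] G0o[OF o(2)]] o by simp
    fix h c assume "h \<in> hom B b c"
    then have h: "B.ty h = Arr b c" by (simp add: B.hom_ty)
    note c = B.ty_obs(2)[OF h]
    have "Comp B (cf h) (cf g) = Comp B (?i c) (Comp B (Comp B h g) (e a))"
      using g h et[OF o(1)] et[OF o(2)] it[OF c] it[OF o(2)] ei[OF o(2)]
      by (simp add: cf(4)[OF g] cf(4)[OF h] B.comp_assoc B.comp_ty B.inv_simps)
    then show "Fa ?G (Comp B h g) = Comp A (Fa ?G h) (Fa ?G g)"
      unfolding Ga[OF g] Ga[OF h] Ga[OF B.comp_ty[OF g h]]
      using Lc[OF G0o[OF o(1)] G0o[OF o(2)] G0o[OF c] cf(5)[OF g] cf(5)[OF h]] by (simp add: cf(4)[OF g] cf(4)[OF h])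
  next
    fix a assume a: "a \<in> Ob B"
    show "Fa ?G (Ident B a) = Ident A (Fo ?G a)" unfolding Ga[OF B.ident_ty[OF a]]
      using Li[OF G0o[OF a]] a et[OF a] ei[OF a] by (simp add: B.comp_ident B.inv_simps)
  qed
  let ?n = "\<lambda>a. L a (G0 (Fo F a)) (?i (Fo F a))"
  have n: "A.ty (?n a) = Arr a (G0 (Fo F a))" "iso_arrow A (?n a)" if a: "a \<in> Ob A" for a
  proof -
    note b = FoB[OF a]
    note l = L(1)[OF a G0o[OF b] it[OF b]] and l' = L(1)[OF G0o[OF b] a et[OF b]]
    show "A.ty (?n a) = Arr a (G0 (Fo F a))" by (rule l)
    show "iso_arrow A (?n a)"
      by (rule A.isoI(1)[OF l l'])
        (use Lc[OF a G0o[OF b] a it[OF b] et[OF b]] Lc[OF G0o[OF b] a G0o[OF b] et[OF b] it[OF b]] Li[OF a] Li[OF G0o[OF b]] et[OF b] ei[OF b]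
          in \<open>simp_all add: B.inv_simps\<close>)
  qed
  have nat1: "natural_iso A A (id_ftor A) (comp_ftor A ?G F) ?n"
    unfolding natural_iso_def
  proof (intro conjI ballI)
    fix a assume a: "a \<in> Ob A"
    show "?n a \<in> hom A (Fo (id_ftor A) a) (Fo (comp_ftor A ?G F) a)" "iso_arrow A (?n a)"
      using a n[OF a] FoB[OF a] by (simp_all add: id_ftor_def comp_ftor_def compose_def A.hom_ty)
  next
    fix f assume f: "f \<in> Ar A"
    let ?a = "Dom A f" and ?b = "Cod A f"
    have ft: "A.ty f = Arr ?a ?b" using f by (simp add: A.ty_iff)
    note ab = A.ty_obs[OF ft] and Ff = Fty[OF ft]
    note o = FoB[OF ab(1)] FoB[OF ab(2)]
    have "Comp A (?n ?b) (L ?a ?b (Fa F f)) = Comp A (Fa ?G (Fa F f)) (?n ?a)"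
      unfolding Ga[OF Ff] Lc[OF ab G0o[OF o(2)] Ff it[OF o(2)]] Lc[OF ab(1) G0o[OF o(1)] G0o[OF o(2)] it[OF o(1)] cf(5)[OF Ff, unfolded cf(4)[OF Ff]]]
      using Ff et[OF o(1)] it[OF o(1)] it[OF o(2)] ei[OF o(1)] by (simp add: B.comp_assoc B.comp_ty B.inv_simps B.comp_ident)
    then show "Comp A (?n ?b) (Fa (id_ftor A) f) = Comp A (Fa (comp_ftor A ?G F) f) (?n ?a)"
      using f LF[OF ft] by (simp add: id_ftor_def comp_ftor_def compose_def)
  qed
  have nat2: "natural_iso B B (comp_ftor B F ?G) (id_ftor B) e"
    unfolding natural_iso_def
  proof (intro conjI ballI)
    fix b assume b: "b \<in> Ob B"
    show "e b \<in> hom B (Fo (comp_ftor B F ?G) b) (Fo (id_ftor B) b)" "iso_arrow B (e b)"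
      using b G0[OF b] by (simp_all add: id_ftor_def comp_ftor_def compose_def)
  next
    fix g assume g: "g \<in> Ar B"
    then have gt: "B.ty g = Arr (Dom B g) (Cod B g)" by (simp add: B.ty_iff)
    note o = B.ty_obs[OF gt]
    show "Comp B (e (Cod B g)) (Fa (comp_ftor B F ?G) g) = Comp B (Fa (id_ftor B) g) (e (Dom B g))"
      using g gt et[OF o(1)] et[OF o(2)] ei[OF o(2)] L(2)[OF G0o[OF o(1)] G0o[OF o(2)] cf(5)[OF gt]]
      by (simp add: id_ftor_def comp_ftor_def compose_def cf_def B.comp_ty B.inv_simps)
  qed
  show ?thesis unfolding equivalence_of_categories_def using F G nat1 nat2 by blast
qed

section \<open>Transport of functors and counits along isomorphisms\<close>

context symmetric_monoidal_closed_category
begin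

lemma comp_vfun_assoc:
  assumes F: "enriched_functor V A B F" and G: "enriched_functor V B C G" and H: "enriched_functor V C D H"
  shows "comp_vfun V A H (comp_vfun V A G F) = comp_vfun V A (comp_vfun V B H G) F"
  by (rule vfun_eqI[OF comp_vfun_functor[OF comp_vfun_functor[OF F G] H] comp_vfun_functor[OF F comp_vfun_functor[OF G H]]])
    (simp_all add: comp_vfun_def FOb_ob[OF F] FOb_ob[OF G] comp_assoc FHm_ty[OF F] FHm_ty[OF G] FHm_ty[OF H])

lemma comp_id_vfun:
  assumes F: "enriched_functor V A B F"
  shows "comp_vfun V A F (id_vfun V A) = F" "comp_vfun V A (id_vfun V B) F = F"
proof -
  note A = enr_functor_cats(1)[OF F] and B = enr_functor_cats(2)[OF F]
  show "comp_vfun V A F (id_vfun V A) = F"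
    by (rule vfun_eqI[OF comp_vfun_functor[OF id_vfun_functor[OF A] F] F])
      (simp_all add: comp_vfun_def id_vfun_def comp_ident FHm_ty[OF F])
  show "comp_vfun V A (id_vfun V B) F = F"
    by (rule vfun_eqI[OF comp_vfun_functor[OF F id_vfun_functor[OF B]] F])
      (simp_all add: comp_vfun_def id_vfun_def comp_ident FHm_ty[OF F] FOb_ob[OF F])
qed

lemma inv0_inverse:
  assumes "enriched_category V A" "a \<in> VOb A" "b \<in> VOb A" "inverse0 V A a b f g"
  shows "inverse0 V A a b f (inv0 V A a b f)" "inv0 V A b a (inv0 V A a b f) = f"
  using assms inv0_eq[OF assms] inv0_eq[OF assms(1,3,2) inverse0_sym[OF assms(4)]] by simp_all

lemma inv0_comp0:
  assumes A: "enriched_category V A" and ob: "a \<in> VOb A" "b \<in> VOb A" "c \<in> VOb A"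
    and i: "inverse0 V A a b f f'" "inverse0 V A b c g g'"
  shows "inv0 V A a c (comp0 V A a b c g f) = comp0 V A c b a (inv0 V A a b f) (inv0 V A b c g)"
  using inv0_eq[OF A ob(1,3) inverse0_comp0[OF A ob i]] inv0_eq[OF A ob(1,2) i(1)] inv0_eq[OF A ob(2,3) i(2)] by simp

text \<open>Composing with the constant u is postcomposition with the fixed arrow \<open>?K\<close>.
  The equation therefore says that \<gamma>' is \<gamma> followed by \<open>?K\<close>, which does
  not involve the number in the label.\<close>

lemma gel_relabel:
  assumes A: "pre_enriched A" and ob: "p \<in> VOb A" "p' \<in> VOb A" "x \<in> VOb A"
    and t: "ty \<gamma> = Arr (fst l) (VHom A p x)" "ty \<gamma>' = Arr (fst l) (VHom A p' x)" "ty u = Arr \<one> (VHom A p' p)"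
    and e: "gel p' x l \<gamma>' = gel p x l \<gamma> \<odot>[A] (p', p, {}, u)" and l: "fst l' = fst l"
  shows "gel p' x l' \<gamma>' = gel p x l' \<gamma> \<odot>[A] (p', p, {}, u)"
proof -
  let ?K = "VCmp A p' p x \<cdot> (\<iota> (VHom A p x) \<boxtimes> u) \<cdot> inv (runit V (VHom A p x))"
  have o: "VHom A p x \<in> Ob V" "VHom A p' p \<in> Ob V" "VHom A p' x \<in> Ob V" "fst l \<in> Ob V"
    using VHom_ob[OF A] ob ty_obs[OF t(1)] by simp_all
  have K: "ty ?K = Arr (VHom A p x) (VHom A p' x)" using o t VCmp_ty[OF A ob(2,1,3)] by (simp add: mon_ty inv_ty)
  have c: "el A (p', p, {}, u) = El p' p {}" using el_const[OF ob(2,1) t(3)] .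
  have g: "gel p x m \<gamma> \<odot>[A] (p', p, {}, u) = gel p' x m (?K \<cdot> \<gamma>)" if "fst m = fst l" for m
  proof -
    have "el A (gel p x m \<gamma>) = El p x {m}" using gel_el[OF ob(1,3), of \<gamma> m] t(1) that by simp
    from ecomp_const_right[OF A this[unfolded gel_def] c]
    show ?thesis using comp_assoc[OF var_ty, of m \<gamma> "VHom A p x" ?K] K t(1) that o by (simp add: gel_def)
  qed
  have "gel p' x l \<gamma>' = gel p' x l (?K \<cdot> \<gamma>)" using e g by simp
  from gel_inj[OF this t(2)] have "\<gamma>' = ?K \<cdot> \<gamma>" using K t(1) by (simp add: comp_ty)
  then show ?thesis using g[OF l] by simp
qed

text \<open>Transport of structure: a functor isomorphic to F with prescribed values on objects. It
  replaces arbitrary cotensors by designated ones in \<open>faces_commute\<close>.\<close>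

lemma conjugate_functor:
  assumes F: "enriched_functor V A B F" and p: "\<And>a. a \<in> VOb A \<Longrightarrow> p a \<in> VOb B"
    and i: "\<And>a. a \<in> VOb A \<Longrightarrow> inverse0 V B (FOb F a) (p a) (u a) (v a)"
  shows "\<exists>G. enriched_functor V A B G \<and> (\<forall>a \<in> VOb A. FOb G a = p a) \<and> (\<forall>x a b S. el A x = El a b S \<longrightarrow>
    fap G x = (FOb F b, p b, {}, u b) \<odot>[B] (fap F x \<odot>[B] (p a, FOb F a, {}, v a)))"
proof -
  note A = enr_functor_cats(1)[OF F] and B = enr_functor_cats(2)[OF F]
  note PB = enriched_pre[OF B] and PA = enriched_pre[OF A] and i' = i[unfolded inverse0_iff]
  have o: "FOb F a \<in> VOb B" "p a \<in> VOb B" if "a \<in> VOb A" for a using FOb_ob[OF F that] p[OF that] by simp_all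
  let ?u = "\<lambda>b. (FOb F b, p b, {}, u b)" and ?v = "\<lambda>a. (p a, FOb F a, {}, v a)"
  have ue: "el B (?u a) = El (FOb F a) (p a) {}" "el B (?v a) = El (p a) (FOb F a) {}" if "a \<in> VOb A" for a
    using i'[OF that] o[OF that] by (auto intro: el_const)
  \<comment> \<open>Conjugation by u and v has to be an arrow between hom-objects of B in order to
    define the new action on homs; \<open>K2\<close> says what it does to elements.\<close>
  define K where "K a b = (VCmp B (p a) (FOb F b) (p b) \<cdot> (u b \<boxtimes> \<iota> (VHom B (p a) (FOb F b))) \<cdot> inv (lunit V (VHom B (p a) (FOb F b)))) \<cdot>
    (VCmp B (p a) (FOb F a) (FOb F b) \<cdot> (\<iota> (VHom B (FOb F a) (FOb F b)) \<boxtimes> v a) \<cdot> inv (runit V (VHom B (FOb F a) (FOb F b))))" for a b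
  have K: "ty (K a b) = Arr (VHom B (FOb F a) (FOb F b)) (VHom B (p a) (p b))" if "a \<in> VOb A" "b \<in> VOb A" for a b
    unfolding K_def using i'[OF that(1)] i'[OF that(2)] o[OF that(1)] o[OF that(2)]
    by (simp add: mon_ty inv_ty VCmp_ty[OF PB] VHom_ob[OF PB])
  have K2: "?u b \<odot>[B] (y \<odot>[B] ?v a) = (p a, p b, S, K a b \<cdot> f)"
    if y: "y = (FOb F a, FOb F b, S, f)" "el B y = El (FOb F a) (FOb F b) S" and ab: "a \<in> VOb A" "b \<in> VOb A" for y a b S f
  proof -
    have e: "y \<odot>[B] ?v a = (p a, FOb F b, S, (VCmp B (p a) (FOb F a) (FOb F b) \<cdot> (\<iota> (VHom B (FOb F a) (FOb F b)) \<boxtimes> v a) \<cdot> inv (runit V (VHom B (FOb F a) (FOb F b)))) \<cdot> f)"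
      unfolding y(1) by (rule ecomp_const_right[OF PB y(2)[unfolded y(1)] ue(2)[OF ab(1)]])
    have ft: "ty f = Arr (tn S) (VHom B (FOb F a) (FOb F b))" using y by (simp add: el_tuple)
    have "el B (y \<odot>[B] ?v a) = El (p a) (FOb F b) S" using ecomp_el[OF PB y(2) ue(2)[OF ab(1)]] by simp
    from ecomp_const_left[OF PB ue(1)[OF ab(2)] this[unfolded e]]
    show ?thesis unfolding e K_def using i'[OF ab(1)] i'[OF ab(2)] o[OF ab(1)] o[OF ab(2)] ft
      by (simp add: comp_assoc comp_ty mon_ty inv_ty VCmp_ty[OF PB] VHom_ob[OF PB])
  qed
  let ?G = "\<lparr>FOb = (\<lambda>a\<in>VOb A. p a), FHm = (\<lambda>a\<in>VOb A. \<lambda>b\<in>VOb A. K a b \<cdot> FHm F a b)\<rparr>"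
  have fG: "fap ?G x = ?u b \<odot>[B] (fap F x \<odot>[B] ?v a)" if x: "el A x = El a b S" for x a b S
  proof -
    obtain f where f: "x = (a, b, S, f)" "a \<in> VOb A" "b \<in> VOb A" "ty f = Arr (tn S) (VHom A a b)" using x by (rule elE)
    have "fap F x = (FOb F a, FOb F b, S, FHm F a b \<cdot> f)" by (simp add: fap_def f)
    from K2[OF this fap_el[OF F x] f(2,3)] show ?thesis
      using f comp_assoc[OF f(4) FHm_ty[OF F f(2,3)] K[OF f(2,3)]] by (simp add: fap_def)
  qed
  have "enriched_functor V A B ?G"
  proof (rule enriched_functorI[OF A B _ _ gvar_cover[OF PA]])
    show "FOb ?G \<in> VOb A \<rightarrow>\<^sub>E VOb B" using p by auto
    show "FHm ?G \<in> (\<Pi>\<^sub>E a\<in>VOb A. \<Pi>\<^sub>E b\<in>VOb A. hom V (VHom A a b) (VHom B (FOb ?G a) (FOb ?G b)))"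
      using K FHm_ty[OF F] by (auto simp: hom_ty comp_ty)
    fix a assume a: "a \<in> VOb A"
    show "fap ?G (idn A a) = idn B (FOb ?G a)"
      using fG[OF idn_el[OF PA a]] fap_idn[OF F a] ecomp_idn[OF B ue(2)[OF a]] i'[OF a] a by simp
    fix b c assume bc: "b \<in> VOb A" "c \<in> VOb A"
    let ?x = "gvar A 1 b c" and ?y = "gvar A 0 a b"
    note x = gvar_el[OF PA bc, of 1] and y = gvar_el[OF PA a bc(1), of 0]
    note Fx = fap_el[OF F x] and Fy = fap_el[OF F y]
    have d: "{(VHom A b c, 1 :: nat)} \<inter> {(VHom A a b, 0)} = {}" by simp
    note yv = ecomp_el[OF PB Fy ue(2)[OF a], simplified]
    note Gy = ecomp_el[OF PB ue(1)[OF bc(1)] yv, simplified]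
    have "fap ?G ?x \<odot>[B] fap ?G ?y = (?u c \<odot>[B] (fap F ?x \<odot>[B] ?v b)) \<odot>[B] (?u b \<odot>[B] (fap F ?y \<odot>[B] ?v a))"
      using fG[OF x] fG[OF y] by simp
    also have "\<dots> = ?u c \<odot>[B] ((fap F ?x \<odot>[B] ?v b) \<odot>[B] (?u b \<odot>[B] (fap F ?y \<odot>[B] ?v a)))"
      using ecomp_assoc[OF B ue(1)[OF bc(2)] ecomp_el[OF PB Fx ue(2)[OF bc(1)], simplified] Gy] d by simp
    also have "\<dots> = ?u c \<odot>[B] (fap F ?x \<odot>[B] (?v b \<odot>[B] (?u b \<odot>[B] (fap F ?y \<odot>[B] ?v a))))"
      using ecomp_assoc[OF B Fx ue(2)[OF bc(1)] Gy] d by simp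
    also have "?v b \<odot>[B] (?u b \<odot>[B] (fap F ?y \<odot>[B] ?v a)) = fap F ?y \<odot>[B] ?v a"
      using ecomp_assoc[OF B ue(2)[OF bc(1)] ue(1)[OF bc(1)] yv] i'[OF bc(1)] ecomp_idn[OF B yv] by simp
    also have "fap F ?x \<odot>[B] (fap F ?y \<odot>[B] ?v a) = fap F (?x \<odot>[A] ?y) \<odot>[B] ?v a"
      using ecomp_assoc[OF B Fx Fy ue(2)[OF a]] fap_ecomp[OF F x y] d by simp
    also have "?u c \<odot>[B] \<dots> = fap ?G (?x \<odot>[A] ?y)" using fG[OF ecomp_el[OF PA x y]] d by simp
    finally show "fap ?G (?x \<odot>[A] ?y) = fap ?G ?x \<odot>[B] fap ?G ?y" ..
  qed
  then show ?thesis using fG by (intro exI[of _ ?G]) simp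
qed

lemma inverse0_functor:
  assumes F: "enriched_functor V A B F" and ob: "a \<in> VOb A" "b \<in> VOb A" and i: "inverse0 V A a b f g"
  shows "inverse0 V B (FOb F a) (FOb F b) (FHm F a b \<cdot> f) (FHm F b a \<cdot> g)"
proof -
  note i = i[unfolded inverse0_iff]
  have e: "el A (a, b, {}, f) = El a b {}" "el A (b, a, {}, g) = El b a {}" using i ob by (auto intro: el_const)
  have "fap F (b, a, {}, g) \<odot>[B] fap F (a, b, {}, f) = idn B (FOb F a)"
    using fap_ecomp[OF F e(2,1)] fap_idn[OF F ob(1)] i by simp
  moreover have "fap F (a, b, {}, f) \<odot>[B] fap F (b, a, {}, g) = idn B (FOb F b)"
    using fap_ecomp[OF F e(1,2)] fap_idn[OF F ob(2)] i by simp
  ultimately show ?thesis using i FHm_ty[OF F ob] FHm_ty[OF F ob(2,1)] by (simp add: inverse0_iff fap_def comp_ty)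
qed

text \<open>Both sides are f after the generic element of I at l. The case arises because the
  structure morphism at I is an identity but is still read at a non-empty stage.\<close>

lemma unit_gel_central:
  assumes A: "enriched_category V A" and f: "el A (p, q, {}, f) = El p q {}" and l: "fst l = \<one>"
  shows "gel q q l (VId A q) \<odot>[A] (p, q, {}, f) = (p, q, {}, f) \<odot>[A] gel p p l (VId A p)"
proof -
  note P = enriched_pre[OF A] and ob = el_obs(1,2)[OF f]
  have t: "ty f = Arr \<one> (VHom A p q)" "ty (VId A p) = Arr \<one> (VHom A p p)" "ty (VId A q) = Arr \<one> (VHom A q q)" "ty (var l) = Arr (tn {l}) \<one>"
    using f ob VId_ty[OF P] var_ty[of l] l unit_Ob by (simp_all add: el_tuple tn_simps)
  let ?L = "VCmp A p p q \<cdot> (f \<boxtimes> \<iota> (VHom A p p)) \<cdot> inv (lunit V (VHom A p p))"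
  let ?R = "VCmp A p q q \<cdot> (\<iota> (VHom A q q) \<boxtimes> f) \<cdot> inv (runit V (VHom A q q))"
  have T: "ty ?L = Arr (VHom A p p) (VHom A p q)" "ty ?R = Arr (VHom A q q) (VHom A p q)"
    using t ob by (simp_all add: mon_ty inv_ty VCmp_ty[OF P] VHom_ob[OF P])
  note iq = idn_el[OF P ob(2)] and ip = idn_el[OF P ob(1)]
  have "?L \<cdot> VId A p = f" using ecomp_const_left[OF P f ip[unfolded idn_def]] ecomp_idn(2)[OF A f] by (simp add: idn_def)
  moreover have "?R \<cdot> VId A q = f" using ecomp_const_right[OF P iq[unfolded idn_def] f] ecomp_idn(1)[OF A f] by (simp add: idn_def)
  moreover have "el A (gel p p l (VId A p)) = El p p {l}" "el A (gel q q l (VId A q)) = El q q {l}"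
    using gel_el[OF ob(1,1)] gel_el[OF ob(2,2)] t l by simp_all
  ultimately show ?thesis
    using ecomp_const_left[OF P f, of p "{l}" "VId A p \<cdot> var l"] ecomp_const_right[OF P _ f, of q "{l}" "VId A q \<cdot> var l"]
      comp_assoc[OF t(4,2) T(1)] comp_assoc[OF t(4,3) T(2)] by (simp add: gel_def)
qed

end

context system_of_arities
begin

lemma theory_obs:
  assumes "is_theory V J T" "el (Tcat T) t = El j k S"
  shows "j \<in> J" "k \<in> J"
  using el_obs[OF assms(2)] theoryD(1)[OF assms(1)] by simp_all

lemma theory_morphism_el:
  assumes T: "is_theory V J T" and U: "is_theory V J U" and M: "theory_morphism V J T U M" and t: "el (Tcat T) t = El j k S"
  shows "el (Tcat U) (fap M t) = El j k S"
  using fap_el[OF theory_morphismD(1)[OF T U M] t] theory_morphismD(2)[OF T U M] theory_obs[OF T t] by simp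

lemma theory_morphism_id:
  assumes T: "is_theory V J T"
  shows "theory_morphism V J T T (id_vfun V (Tcat T))"
  by (rule theory_morphismI[OF T T id_vfun_functor[OF theoryD(3)[OF T]]])
    (use theoryD(1)[OF T] J_unit cot_obs(3)[OF str_cot[OF T]] in \<open>simp_all add: id_vfun_def comp_ident\<close>)

lemma theory_morphism_comp:
  assumes T: "is_theory V J T" and U: "is_theory V J U" and W: "is_theory V J W"
    and M: "theory_morphism V J T U M" and N: "theory_morphism V J U W N"
  shows "theory_morphism V J T W (comp_vfun V (Tcat T) N M)"
proof (rule theory_morphismI[OF T W comp_vfun_functor[OF theory_morphismD(1)[OF T U M] theory_morphismD(1)[OF U W N]]])
  note mD = theory_morphismD[OF T U M] and nD = theory_morphismD[OF U W N]
  note J1 = theoryD(1)[OF T] theoryD(1)[OF U] J_unit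
  fix j assume j: "j \<in> J"
  show "FOb (comp_vfun V (Tcat T) N M) j = j" using j J1 mD(2) nD(2) by (simp add: comp_vfun_def)
  have "(FHm N j \<one> \<cdot> FHm M j \<one>) \<cdot> str T j = FHm N j \<one> \<cdot> FHm M j \<one> \<cdot> str T j"
    using comp_assoc[OF cot_obs(3)[OF str_cot[OF T j]], of "FHm M j \<one>" _ "FHm N j \<one>"] FHm_ty[OF mD(1), of j \<one>] FHm_ty[OF nD(1), of j \<one>] j J1 mD(2) by simp
  then show "FHm (comp_vfun V (Tcat T) N M) j \<one> \<cdot> str T j = str W j"
    using j J1 mD nD by (simp add: comp_vfun_def)
qed

end

section \<open>The category of algebras and strong morphisms\<close>

context admissible_category
begin

text \<open>Theory morphisms are the identity on objects, so the values of BM are written as those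
  of B. Invertibility is required only pointwise, as the inverses are natural automatically.\<close>

abbreviation alg_iso where
  "alg_iso T A B M f \<equiv> f \<in> extensional J \<and> (\<forall>j \<in> J. \<exists>g. inverse0 V C (FOb A j) (FOb B j) (f j) g) \<and>
    (\<forall>j k S t. el (Tcat T) t = El j k S \<longrightarrow>
      (FOb A k, FOb B k, {}, f k) \<odot>[C] fap A t = fap B (fap M t) \<odot>[C] (FOb A j, FOb B j, {}, f j))"

lemma alg_arrow_iff:
  assumes T: "is_theory V J T" and U: "is_theory V J U" and A: "is_algebra V J C T A" and B: "is_algebra V J C U B"
    and M: "theory_morphism V J T U M"
  shows "vnatural_iso V (Tcat T) C A (comp_vfun V (Tcat T) B M) f \<longleftrightarrow> alg_iso T A B M f"
proof -
  let ?G = "comp_vfun V (Tcat T) B M"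
  note mD = theory_morphismD[OF T U M] and J1 = theoryD(1)[OF T]
  note F = algebraD(1)[OF A] and G = comp_vfun_functor[OF mD(1) algebraD(1)[OF B]]
  have Go: "FOb ?G j = FOb B j" if "j \<in> J" for j using that J1 mD(2) by (simp add: comp_vfun_def)
  have n: "nt A ?G f j = (FOb A j, FOb B j, {}, f j)" if "j \<in> J" for j using Go[OF that] by (simp add: nt_def)
  have Gf: "fap ?G t = fap B (fap M t)" if "el (Tcat T) t = El j k S" for t j k S
    by (rule fap_comp_vfun[OF mD(1) algebraD(1)[OF B] that])
  show ?thesis
  proof (intro iffI conjI ballI allI impI)
    assume h: "vnatural_iso V (Tcat T) C A ?G f"
    then have v: "vnatural V (Tcat T) C A ?G f" by (simp add: vnatural_iso_def)
    then show "f \<in> extensional J" unfolding vnatural_def J1 by (auto simp: PiE_def)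
    show "\<exists>g. inverse0 V C (FOb A j) (FOb B j) (f j) g" if "j \<in> J" for j
      using vnatural_iso_inv0[OF h F G, of j] that J1 Go by auto
    fix j k S t assume t: "el (Tcat T) t = El j k S"
    have jk: "j \<in> J" "k \<in> J" using el_obs[OF t] J1 by simp_all
    show "(FOb A k, FOb B k, {}, f k) \<odot>[C] fap A t = fap B (fap M t) \<odot>[C] (FOb A j, FOb B j, {}, f j)"
      using vnaturalD[OF v F G t] n[OF jk(1)] n[OF jk(2)] Gf[OF t] by simp
  next
    assume h: "alg_iso T A B M f"
    have "vnatural V (Tcat T) C A ?G f"
    proof (rule vnaturalI[OF F G gvar_cover[OF theoryD(5)[OF T]]])
      show "f \<in> extensional (VOb (Tcat T))" using h J1 by simp
      fix j assume "j \<in> VOb (Tcat T)"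
      then have j: "j \<in> J" using J1 by simp
      then obtain g where "inverse0 V C (FOb A j) (FOb B j) (f j) g" using h by blast
      then show "el C (nt A ?G f j) = El (FOb A j) (FOb ?G j) {}"
        unfolding n[OF j] Go[OF j] using alg_ob[OF T A j] alg_ob[OF U B j] by (auto simp: inverse0_iff intro: el_const)
      fix k assume "k \<in> VOb (Tcat T)"
      then have k: "k \<in> J" using J1 by simp
      note t = gvar_el[OF theoryD(5)[OF T] \<open>j \<in> VOb (Tcat T)\<close> \<open>k \<in> VOb (Tcat T)\<close>, of 0]
      show "nt A ?G f k \<odot>[C] fap A (gvar (Tcat T) 0 j k) = fap ?G (gvar (Tcat T) 0 j k) \<odot>[C] nt A ?G f j"
        unfolding n[OF j] n[OF k] Gf[OF t] using h t by blast
    qed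
    then show "vnatural_iso V (Tcat T) C A ?G f"
      by (rule vnatural_isoI[OF F G]) (use h J1 Go in auto)
  qed
qed

abbreviation Alg where "Alg \<equiv> AlgS V J C"

lemma Alg_ob: "(T, A) \<in> Ob Alg \<longleftrightarrow> is_theory V J T \<and> is_algebra V J C T A"
  by (simp add: AlgS_def)

lemma Alg_hom:
  "x \<in> hom Alg X Y \<longleftrightarrow> (\<exists>T A M f U B. X = (T, A) \<and> Y = (U, B) \<and> x = (X, (M, f), Y) \<and>
    is_theory V J T \<and> is_algebra V J C T A \<and> is_theory V J U \<and> is_algebra V J C U B \<and> theory_morphism V J T U M \<and>
    alg_iso T A B M f)"
  (is "_ \<longleftrightarrow> ?r")
proof
  assume "x \<in> hom Alg X Y"
  then obtain T A M f U B where x: "x = ((T, A), (M, f), (U, B))" "X = (T, A)" "Y = (U, B)"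
    and o: "is_theory V J T" "is_theory V J U" "is_algebra V J C T A" "is_algebra V J C U B" "theory_morphism V J T U M"
    and n: "vnatural_iso V (Tcat T) C A (comp_vfun V (Tcat T) B M) f"
    by (auto simp: hom_def AlgS_def)
  show ?r using x o n alg_arrow_iff[OF o, of f] by blast
next
  assume ?r
  then obtain T A M f U B where x: "x = ((T, A), (M, f), (U, B))" "X = (T, A)" "Y = (U, B)"
    and o: "is_theory V J T" "is_theory V J U" "is_algebra V J C T A" "is_algebra V J C U B" "theory_morphism V J T U M"
    and n: "alg_iso T A B M f"
    by blast
  have "vnatural_iso V (Tcat T) C A (comp_vfun V (Tcat T) B M) f" using alg_arrow_iff[OF o] n by blast
  then show "x \<in> hom Alg X Y" using x o by (auto simp: hom_def AlgS_def)
qed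

lemma Alg_homI:
  assumes "is_theory V J T" "is_algebra V J C T A" "is_theory V J U" "is_algebra V J C U B" "theory_morphism V J T U M"
    and "f \<in> extensional J" and "\<And>j. j \<in> J \<Longrightarrow> \<exists>g. inverse0 V C (FOb A j) (FOb B j) (f j) g"
    and "\<And>j k S t. el (Tcat T) t = El j k S \<Longrightarrow>
      (FOb A k, FOb B k, {}, f k) \<odot>[C] fap A t = fap B (fap M t) \<odot>[C] (FOb A j, FOb B j, {}, f j)"
  shows "((T, A), (M, f), (U, B)) \<in> hom Alg (T, A) (U, B)"
  unfolding Alg_hom using assms by blast

lemma Alg_homD:
  assumes h: "((T, A), (M, f), (U, B)) \<in> hom Alg (T, A) (U, B)"
  shows "is_theory V J T" "is_algebra V J C T A" "is_theory V J U" "is_algebra V J C U B" "theory_morphism V J T U M" "f \<in> extensional J"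
    "j \<in> J \<Longrightarrow> inverse0 V C (FOb A j) (FOb B j) (f j) (inv0 V C (FOb A j) (FOb B j) (f j))"
    "j \<in> J \<Longrightarrow> el C (FOb A j, FOb B j, {}, f j) = El (FOb A j) (FOb B j) {}"
    "el (Tcat T) t = El j k S \<Longrightarrow>
      (FOb A k, FOb B k, {}, f k) \<odot>[C] fap A t = fap B (fap M t) \<odot>[C] (FOb A j, FOb B j, {}, f j)"
proof -
  show 1: "is_theory V J T" "is_algebra V J C T A" "is_theory V J U" "is_algebra V J C U B" "theory_morphism V J T U M" "f \<in> extensional J"
    "el (Tcat T) t = El j k S \<Longrightarrow>
      (FOb A k, FOb B k, {}, f k) \<odot>[C] fap A t = fap B (fap M t) \<odot>[C] (FOb A j, FOb B j, {}, f j)"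
    using h unfolding Alg_hom by blast+
  assume j: "j \<in> J"
  note o = alg_ob[OF 1(1,2) j] alg_ob[OF 1(3,4) j]
  obtain g where i: "inverse0 V C (FOb A j) (FOb B j) (f j) g" using h j unfolding Alg_hom by blast
  show "inverse0 V C (FOb A j) (FOb B j) (f j) (inv0 V C (FOb A j) (FOb B j) (f j))" using inv0_inverse(1)[OF C_cat o i] .
  show "el C (FOb A j, FOb B j, {}, f j) = El (FOb A j) (FOb B j) {}" using i o by (auto simp: inverse0_iff intro: el_const)
qed

lemma Alg_homE:
  assumes "x \<in> hom Alg X Y"
  obtains T A M f U B where "X = (T, A)" "Y = (U, B)" "x = ((T, A), (M, f), (U, B))"
    "((T, A), (M, f), (U, B)) \<in> hom Alg (T, A) (U, B)"
  using assms unfolding Alg_hom by blast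

lemma Alg_comp_hom:
  assumes x: "x \<in> hom Alg X Y" and y: "y \<in> hom Alg Y Z"
  shows "Comp Alg y x \<in> hom Alg X Z"
proof -
  obtain T A M f U B where 1: "X = (T, A)" "Y = (U, B)" "x = ((T, A), (M, f), (U, B))" and h: "((T, A), (M, f), (U, B)) \<in> hom Alg (T, A) (U, B)"
    using x by (rule Alg_homE)
  obtain N g W E where 2: "Z = (W, E)" "y = ((U, B), (N, g), (W, E))" and k: "((U, B), (N, g), (W, E)) \<in> hom Alg (U, B) (W, E)"
    using y unfolding 1(2) by (rule Alg_homE) simp
  note h = Alg_homD[OF h] and k = Alg_homD[OF k]
  note mD = theory_morphismD[OF h(1,3,5)] and nD = theory_morphismD[OF k(1,3,5)]
  let ?h = "\<lambda>j\<in>J. comp0 V C (FOb A j) (FOb B j) (FOb E j) (g j) (f j)"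
  have e: "Comp Alg y x = ((T, A), (comp_vfun V (Tcat T) N M, ?h), (W, E))"
    using mD(2) nD(2) by (auto simp: AlgS_def 1 2 intro!: restrict_ext)
  show ?thesis
    unfolding e unfolding 1(1) 2(1)
  proof (rule Alg_homI[OF h(1,2) k(3,4) theory_morphism_comp[OF h(1,3) k(3) h(5) k(5)]])
    show "?h \<in> extensional J" by simp
    fix j assume j: "j \<in> J"
    show "\<exists>h'. inverse0 V C (FOb A j) (FOb E j) (?h j) h'"
      using inverse0_comp0[OF C_cat alg_ob[OF h(1,2) j] alg_ob[OF h(3,4) j] alg_ob[OF k(3,4) j] h(7)[OF j] k(7)[OF j]] j by auto
  next
    fix j l S t assume t: "el (Tcat T) t = El j l S"
    note jl = theory_obs[OF h(1) t] and Mt = theory_morphism_el[OF h(1,3,5) t]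
    note NMt = theory_morphism_el[OF k(1,3,5) Mt]
    have h': "(FOb A i, FOb E i, {}, ?h i) = (FOb B i, FOb E i, {}, g i) \<odot>[C] (FOb A i, FOb B i, {}, f i)" if "i \<in> J" for i
      using that by (simp add: ecomp_comp0)
    note ty = fap_el[OF algebraD(1)[OF h(2)] t] fap_el[OF algebraD(1)[OF h(4)] Mt] fap_el[OF algebraD(1)[OF k(4)] NMt]
    show "(FOb A l, FOb E l, {}, ?h l) \<odot>[C] fap A t = fap E (fap (comp_vfun V (Tcat T) N M) t) \<odot>[C] (FOb A j, FOb E j, {}, ?h j)"
      unfolding h'[OF jl(1)] h'[OF jl(2)] fap_comp_vfun[OF mD(1) nD(1) t]
      using ecomp_assoc[OF C_cat k(8)[OF jl(2)] h(8)[OF jl(2)] ty(1)] h(9)[OF t]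
        ecomp_assoc[OF C_cat k(8)[OF jl(2)] ty(2) h(8)[OF jl(1)]] k(9)[OF Mt]
        ecomp_assoc[OF C_cat ty(3) k(8)[OF jl(1)] h(8)[OF jl(1)]] by simp
  qed
qed

lemma Alg_cat: "category Alg"
proof
  fix f assume "f \<in> Ar Alg"
  then show "Dom Alg f \<in> Ob Alg" "Cod Alg f \<in> Ob Alg" by (auto simp: AlgS_def)
next
  fix X assume "X \<in> Ob Alg"
  then obtain T A where X: "X = (T, A)" "is_theory V J T" "is_algebra V J C T A" by (auto simp: AlgS_def)
  have i: "Ident Alg X = (X, (id_vfun V (Tcat T), \<lambda>j\<in>J. VId C (FOb A j)), X)" by (simp add: AlgS_def X)
  show "Ident Alg X \<in> hom Alg X X"
    unfolding i unfolding X(1)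
  proof (rule Alg_homI[OF X(2,3) X(2,3) theory_morphism_id[OF X(2)]])
    show "\<exists>g. inverse0 V C (FOb A j) (FOb A j) ((\<lambda>j\<in>J. VId C (FOb A j)) j) g" if "j \<in> J" for j
      using inverse0_id[OF C_cat alg_ob[OF X(2,3) that]] that by auto
    fix j k S t assume t: "el (Tcat T) t = El j k S"
    show "(FOb A k, FOb A k, {}, (\<lambda>j\<in>J. VId C (FOb A j)) k) \<odot>[C] fap A t = fap A (fap (id_vfun V (Tcat T)) t) \<odot>[C] (FOb A j, FOb A j, {}, (\<lambda>j\<in>J. VId C (FOb A j)) j)"
      using ecomp_idn[OF C_cat fap_el[OF algebraD(1)[OF X(3)] t]] theory_obs[OF X(2) t] fap_id_vfun[OF t] by (simp add: idn_def)
  qed simp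
next
  fix x y X Y Z assume "x \<in> hom Alg X Y" "y \<in> hom Alg Y Z"
  then show "Comp Alg y x \<in> hom Alg X Z" by (rule Alg_comp_hom)
next
  fix x X Y assume "x \<in> hom Alg X Y"
  then obtain T A M f U B where 1: "X = (T, A)" "Y = (U, B)" "x = ((T, A), (M, f), (U, B))" and h: "((T, A), (M, f), (U, B)) \<in> hom Alg (T, A) (U, B)"
    by (rule Alg_homE)
  note h = Alg_homD[OF h]
  note mD = theory_morphismD[OF h(1,3,5)]
  have u: "comp0 V C (FOb A j) (FOb A j) (FOb B j) (f j) (VId C (FOb A j)) = f j"
    "comp0 V C (FOb A j) (FOb B j) (FOb B j) (VId C (FOb B j)) (f j) = f j" if "j \<in> J" for j
    using ecomp_idn[OF C_cat h(8)[OF that]] by (simp_all add: idn_def ecomp_comp0)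
  have "(\<lambda>j\<in>J. comp0 V C (FOb A j) (FOb A j) (FOb B j) (f j) (VId C (FOb A j))) = f"
    "(\<lambda>j\<in>J. comp0 V C (FOb A j) (FOb B j) (FOb B j) (VId C (FOb B j)) (f j)) = f"
    using h(6) u by (auto intro!: extensionalityI[of _ J])
  then show "Comp Alg x (Ident Alg X) = x" "Comp Alg (Ident Alg Y) x = x"
    using comp_id_vfun[OF mD(1)] mD(2) theoryD(1)[OF h(1)] theoryD(1)[OF h(3)]
    by (simp_all add: AlgS_def 1 id_vfun_def cong: restrict_cong)
next
  fix x y z X Y Z Q assume xyz: "x \<in> hom Alg X Y" "y \<in> hom Alg Y Z" "z \<in> hom Alg Z Q"
  obtain T A M f U B where 1: "X = (T, A)" "Y = (U, B)" "x = ((T, A), (M, f), (U, B))" and h: "((T, A), (M, f), (U, B)) \<in> hom Alg (T, A) (U, B)"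
    using xyz(1) by (rule Alg_homE)
  obtain N g W E where 2: "Z = (W, E)" "y = ((U, B), (N, g), (W, E))" and k: "((U, B), (N, g), (W, E)) \<in> hom Alg (U, B) (W, E)"
    using xyz(2) unfolding 1(2) by (rule Alg_homE) simp
  obtain P p R G where 3: "Q = (R, G)" "z = ((W, E), (P, p), (R, G))" and l: "((W, E), (P, p), (R, G)) \<in> hom Alg (W, E) (R, G)"
    using xyz(3) unfolding 2(1) by (rule Alg_homE) simp
  note h = Alg_homD[OF h] and k = Alg_homD[OF k] and l = Alg_homD[OF l]
  note mD = theory_morphismD[OF h(1,3,5)] and nD = theory_morphismD[OF k(1,3,5)] and pD = theory_morphismD[OF l(1,3,5)]
  have "comp0 V C (FOb A j) (FOb B j) (FOb G j) (comp0 V C (FOb B j) (FOb E j) (FOb G j) (p j) (g j)) (f j)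
      = comp0 V C (FOb A j) (FOb E j) (FOb G j) (p j) (comp0 V C (FOb A j) (FOb B j) (FOb E j) (g j) (f j))" if "j \<in> J" for j
    using ecomp_assoc[OF C_cat l(8)[OF that] k(8)[OF that] h(8)[OF that]] by (simp add: ecomp_comp0)
  then show "Comp Alg (Comp Alg z y) x = Comp Alg z (Comp Alg y x)"
    using comp_vfun_assoc[OF mD(1) nD(1) pD(1)] mD(2) nD(2) pD(2) theoryD(1)[OF h(1)] theoryD(1)[OF h(3)]
    by (simp add: AlgS_def 1 2 3 comp_vfun_def cong: restrict_cong)
qed

section \<open>Bifold algebras, their partial algebras and their arrows\<close>

abbreviation bif where "bif T U D \<equiv> is_theory V J T \<and> is_theory V J U \<and> is_bifold_algebra V J C T U D"
abbreviation lf where "lf T U D k \<equiv> partial_left V (Tcat T) (Tcat U) k D"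
abbreviation rf where "rf T U D j \<equiv> partial_right V (Tcat T) (Tcat U) j D"

context
  fixes T U :: "('o, 'm) jtheory" and D :: "('o \<times> 'o, 'c, 'm) vfun"
  assumes TUD: "bif T U D"
begin

lemma bif_functor: "enriched_functor V (tensor_vcat V (Tcat T) (Tcat U)) C D"
  using TUD by (simp add: is_bifold_algebra_def)

lemmas bif_cats = theoryD(3)[OF TUD[THEN conjunct1]] theoryD(3)[OF TUD[THEN conjunct2, THEN conjunct1]]
  theoryD(1)[OF TUD[THEN conjunct1]] theoryD(1)[OF TUD[THEN conjunct2, THEN conjunct1]]

lemma lf_alg: "k \<in> J \<Longrightarrow> is_algebra V J C T (lf T U D k)"
  and rf_alg: "j \<in> J \<Longrightarrow> is_algebra V J C U (rf T U D j)"
  using TUD partial_left_functor[OF bif_cats(1,2) bif_functor, of k] partial_right_functor[OF bif_cats(1,2) bif_functor, of j] bif_cats(3,4)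
  by (simp_all add: is_algebra_def is_bifold_algebra_def)

lemma lf_ob: "j \<in> J \<Longrightarrow> FOb (lf T U D k) j = FOb D (j, k)"
  and rf_ob: "k \<in> J \<Longrightarrow> FOb (rf T U D j) k = FOb D (j, k)"
  using bif_cats(3,4) by (simp_all add: partial_left_def partial_right_def)

lemma bif_ob: "j \<in> J \<Longrightarrow> k \<in> J \<Longrightarrow> FOb D (j, k) \<in> VOb C"
  using alg_ob[OF _ lf_alg, of k j] TUD lf_ob[of j k] by simp

lemma lf_fap: "el (Tcat T) x = El j j' S \<Longrightarrow> k \<in> J \<Longrightarrow> fap (lf T U D k) x = fap D (prd x (idn (Tcat U) k))"
  using fap_partial_left[OF bif_cats(1,2) bif_functor] bif_cats(4) by simp

lemma rf_fap: "el (Tcat U) y = El k k' S \<Longrightarrow> j \<in> J \<Longrightarrow> fap (rf T U D j) y = fap D (prd (idn (Tcat T) j) y)"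
  using fap_partial_right[OF bif_cats(1,2) bif_functor] bif_cats(3) by simp

lemma lf_el: "el (Tcat T) x = El j j' S \<Longrightarrow> k \<in> J \<Longrightarrow> el C (fap (lf T U D k) x) = El (FOb D (j, k)) (FOb D (j', k)) S"
  using fap_el[OF algebraD(1)[OF lf_alg], of k x j j' S] el_obs[of "Tcat T" x j j' S] bif_cats(3) lf_ob by simp

lemma rf_el: "el (Tcat U) y = El k k' S \<Longrightarrow> j \<in> J \<Longrightarrow> el C (fap (rf T U D j) y) = El (FOb D (j, k)) (FOb D (j, k')) S"
  using fap_el[OF algebraD(1)[OF rf_alg], of j y k k' S] el_obs[of "Tcat U" y k k' S] bif_cats(4) rf_ob by simp

lemma bif_comm:
  assumes x: "el (Tcat T) x = El j j' S" and y: "el (Tcat U) y = El k k' S'" and d: "S \<inter> S' = {}"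
  shows "fap (lf T U D k') x \<odot>[C] fap (rf T U D j) y = fap (rf T U D j') y \<odot>[C] fap (lf T U D k) x"
proof -
  have o: "j \<in> J" "j' \<in> J" "k \<in> J" "k' \<in> J" using el_obs[OF x] el_obs[OF y] bif_cats(3,4) by simp_all
  show ?thesis
    using prd_factor[OF bif_cats(1,2) bif_functor x y d] lf_fap[OF x] rf_fap[OF y] o by simp
qed

end

text \<open>An arrow of bifold algebras restricted to a fixed second or first argument. The second
  restriction takes inverses and runs backwards, because N goes from \<open>U'\<close> to
  \<open>U\<close> whereas a strong morphism of algebras follows its morphism of theories.\<close>

abbreviation larr where "larr X M f Y k \<equiv> case X of (T, U, D) \<Rightarrow> case Y of (T', U', D') \<Rightarrow>
  ((T, lf T U D k), (M, \<lambda>j\<in>J. f (j, k)), (T', lf T' U' D' k))"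
abbreviation rarr where "rarr X N f Y j \<equiv> case X of (T, U, D) \<Rightarrow> case Y of (T', U', D') \<Rightarrow>
  ((U', rf T' U' D' j), (N, \<lambda>k\<in>J. inv0 V C (FOb D (j, k)) (FOb D' (j, k)) (f (j, k))), (U, rf T U D j))"

context
  fixes T U D T' U' D' M N
  assumes B: "bif T U D" and B': "bif T' U' D'"
    and M: "theory_morphism V J T T' M" and N: "theory_morphism V J U' U N"
begin

private lemma cats: "is_theory V J T" "is_theory V J T'" "is_theory V J U" "is_theory V J U'"
  using B B' by simp_all

private lemmas mD = theory_morphismD[OF cats(1,2) M] and nD = theory_morphismD[OF cats(4,3) N]
  and tc = theoryD(3)[OF cats(1)] theoryD(3)[OF cats(4)]

private abbreviation "TU \<equiv> tensor_vcat V (Tcat T) (Tcat U')"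
private abbreviation "F \<equiv> comp_vfun V TU D (tensor_vfun V (Tcat T) (Tcat U') (id_vfun V (Tcat T)) N)"
private abbreviation "G \<equiv> comp_vfun V TU D' (tensor_vfun V (Tcat T) (Tcat U') M (id_vfun V (Tcat U')))"

private lemmas tF = tensor_vfun_functor[OF tc id_vfun_functor[OF tc(1)] nD(1)]
  and tG = tensor_vfun_functor[OF tc mD(1) id_vfun_functor[OF tc(2)]]

private lemma FG: "enriched_functor V TU C F" "enriched_functor V TU C G"
  by (rule comp_vfun_functor[OF tF(1) bif_functor[OF B]], rule comp_vfun_functor[OF tG(1) bif_functor[OF B']])

private lemma FG_ob: assumes "j \<in> J" "k \<in> J" shows "FOb F (j, k) = FOb D (j, k)" "FOb G (j, k) = FOb D' (j, k)"
  using assms mD(2) nD(2) theoryD(1)[OF cats(1)] theoryD(1)[OF cats(4)]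
  by (simp_all add: comp_vfun_def tensor_vfun_def id_vfun_def tensor_vcat_simps)

private lemma FG_left:
  assumes x: "el (Tcat T) x = El j j' S" and k: "k \<in> J"
  shows "fap F (prd x (idn (Tcat U') k)) = fap (lf T U D k) x" "fap G (prd x (idn (Tcat U') k)) = fap (lf T' U' D' k) (fap M x)"
proof -
  have k': "k \<in> VOb (Tcat U')" using k theoryD(1)[OF cats(4)] by simp
  note i = idn_el[OF theoryD(5)[OF cats(4)] k']
  have e: "el TU (prd x (idn (Tcat U') k)) = El (j, k) (j', k) (S \<union> {})" by (rule prd_el[OF tc x i]) simp
  have "fap F (prd x (idn (Tcat U') k)) = fap D (prd x (idn (Tcat U) k))"
    using fap_comp_vfun[OF tF(1) bif_functor[OF B] e] tF(2)[OF x i] fap_id_vfun[OF x] fap_idn[OF nD(1) k'] nD(2)[OF k] by simp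
  then show "fap F (prd x (idn (Tcat U') k)) = fap (lf T U D k) x" using lf_fap[OF B x k] by simp
  have "fap G (prd x (idn (Tcat U') k)) = fap D' (prd (fap M x) (idn (Tcat U') k))"
    using fap_comp_vfun[OF tG(1) bif_functor[OF B'] e] tG(2)[OF x i] fap_id_vfun[OF i] by simp
  then show "fap G (prd x (idn (Tcat U') k)) = fap (lf T' U' D' k) (fap M x)" using lf_fap[OF B' fap_el[OF mD(1) x] k] by simp
qed

private lemma FG_right:
  assumes y: "el (Tcat U') y = El k k' S" and j: "j \<in> J"
  shows "fap F (prd (idn (Tcat T) j) y) = fap (rf T U D j) (fap N y)" "fap G (prd (idn (Tcat T) j) y) = fap (rf T' U' D' j) y"
proof -
  have j': "j \<in> VOb (Tcat T)" using j theoryD(1)[OF cats(1)] by simp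
  note i = idn_el[OF theoryD(5)[OF cats(1)] j']
  have e: "el TU (prd (idn (Tcat T) j) y) = El (j, k) (j, k') ({} \<union> S)" by (rule prd_el[OF tc i y]) simp
  have "fap G (prd (idn (Tcat T) j) y) = fap D' (prd (idn (Tcat T') j) y)"
    using fap_comp_vfun[OF tG(1) bif_functor[OF B'] e] tG(2)[OF i y] fap_id_vfun[OF y] fap_idn[OF mD(1) j'] mD(2)[OF j] by simp
  then show "fap G (prd (idn (Tcat T) j) y) = fap (rf T' U' D' j) y" using rf_fap[OF B' y j] by simp
  have "fap F (prd (idn (Tcat T) j) y) = fap D (prd (idn (Tcat T) j) (fap N y))"
    using fap_comp_vfun[OF tF(1) bif_functor[OF B] e] tF(2)[OF i y] fap_id_vfun[OF i] by simp
  then show "fap F (prd (idn (Tcat T) j) y) = fap (rf T U D j) (fap N y)" using rf_fap[OF B fap_el[OF nD(1) y] j] by simp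
qed

private abbreviation "D0 j k \<equiv> FOb D (j, k)"
private abbreviation "D1 j k \<equiv> FOb D' (j, k)"

text \<open>Naturality in two variables splits into naturality in each. In the second variable the
  components go from D(j, N-) to D'(j, -), and \<open>square_inverse\<close> turns them into a
  strong morphism from D'(j, -) to D(j, -) over N.\<close>

lemma bif_arrow_iff:
  "vnatural_iso V TU C F G f \<longleftrightarrow> f \<in> extensional (J \<times> J) \<and>
    (\<forall>k \<in> J. larr (T, U, D) M f (T', U', D') k \<in> hom Alg (T, lf T U D k) (T', lf T' U' D' k)) \<and>
    (\<forall>j \<in> J. rarr (T, U, D) N f (T', U', D') j \<in> hom Alg (U', rf T' U' D' j) (U, rf T U D j))"
  (is "?v \<longleftrightarrow> ?x \<and> ?l \<and> ?r")
proof -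
  let ?i = "\<lambda>j. \<lambda>k\<in>J. inv0 V C (D0 j k) (D1 j k) (f (j, k))"
  let ?L = "lf T U D" and ?R = "rf T U D" and ?L' = "lf T' U' D'" and ?R' = "rf T' U' D'"
  note C = C_cat
  have n: "nt F G f (j, k) = (D0 j k, D1 j k, {}, f (j, k))" if "j \<in> J" "k \<in> J" for j k using FG_ob[OF that] by (simp add: nt_def)
  have obs: "D0 j k \<in> VOb C" "D1 j k \<in> VOb C" if "j \<in> J" "k \<in> J" for j k using bif_ob[OF B that] bif_ob[OF B' that] by simp_all
  show ?thesis
  proof
    assume h: ?v
    then have v: "vnatural V TU C F G f" by (simp add: vnatural_iso_def)
    then have x: ?x unfolding vnatural_def tensor_vcat_simps theoryD(1)[OF cats(1)] theoryD(1)[OF cats(4)] by (auto simp: PiE_def)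
    have i: "inverse0 V C (D0 j k) (D1 j k) (f (j, k)) (inv0 V C (D0 j k) (D1 j k) (f (j, k)))" if "j \<in> J" "k \<in> J" for j k
      using vnatural_iso_inv0[OF h FG, of "(j, k)"] that theoryD(1)[OF cats(1)] theoryD(1)[OF cats(4)] FG_ob[OF that]
      by (simp add: tensor_vcat_simps)
    have l: ?l unfolding prod.case
    proof (intro ballI, rule Alg_homI[OF cats(1) lf_alg[OF B] cats(2) lf_alg[OF B'] M])
      fix k j assume k: "k \<in> J" and j: "j \<in> J"
      show "\<exists>g. inverse0 V C (FOb (?L k) j) (FOb (?L' k) j) ((\<lambda>j\<in>J. f (j, k)) j) g"
        using i[OF j k] j lf_ob[OF B] lf_ob[OF B'] by auto
    next
      fix k j j' S t assume k: "k \<in> J" and t: "el (Tcat T) t = El j j' S"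
      note j = theory_obs[OF cats(1) t]
      have k': "k \<in> VOb (Tcat U')" using k theoryD(1)[OF cats(4)] by simp
      have e: "el TU (prd t (idn (Tcat U') k)) = El (j, k) (j', k) (S \<union> {})"
        by (rule prd_el[OF tc t idn_el[OF theoryD(5)[OF cats(4)] k']]) simp
      show "(FOb (?L k) j', FOb (?L' k) j', {}, (\<lambda>j\<in>J. f (j, k)) j') \<odot>[C] fap (?L k) t
          = fap (?L' k) (fap M t) \<odot>[C] (FOb (?L k) j, FOb (?L' k) j, {}, (\<lambda>j\<in>J. f (j, k)) j)"
        using vnaturalD[OF v FG e] n[OF j(1) k] n[OF j(2) k] FG_left[OF t k] lf_ob[OF B] lf_ob[OF B'] j by simp
    qed simp_all
    have r: ?r unfolding prod.case
    proof (intro ballI, rule Alg_homI[OF cats(4) rf_alg[OF B'] cats(3) rf_alg[OF B] N])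
      fix k j assume j: "j \<in> J" and k: "k \<in> J"
      show "\<exists>g. inverse0 V C (FOb (?R' j) k) (FOb (?R j) k) ((?i j) k) g"
        using inverse0_sym[OF i[OF j k]] k rf_ob[OF B] rf_ob[OF B'] by auto
    next
      fix j k k' S t assume j: "j \<in> J" and t: "el (Tcat U') t = El k k' S"
      note k = theory_obs[OF cats(4) t]
      have j': "j \<in> VOb (Tcat T)" using j theoryD(1)[OF cats(1)] by simp
      have e: "el TU (prd (idn (Tcat T) j) t) = El (j, k) (j, k') ({} \<union> S)"
        by (rule prd_el[OF tc idn_el[OF theoryD(5)[OF cats(1)] j'] t]) simp
      note Nt = theory_morphism_el[OF cats(4,3) N t]
      have "(D0 j k', D1 j k', {}, f (j, k')) \<odot>[C] fap (?R j) (fap N t) = fap (?R' j) t \<odot>[C] (D0 j k, D1 j k, {}, f (j, k))"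
        using vnaturalD[OF v FG e] n[OF j k(1)] n[OF j k(2)] FG_right[OF t j] by simp
      from square_inverse[OF C rf_el[OF B Nt j] rf_el[OF B' t j] i[OF j k(1)] i[OF j k(2)] this]
      show "(FOb (?R' j) k', FOb (?R j) k', {}, ?i j k') \<odot>[C] fap (?R' j) t
        = fap (?R j) (fap N t) \<odot>[C] (FOb (?R' j) k, FOb (?R j) k, {}, (?i j) k)"
        using k rf_ob[OF B] rf_ob[OF B'] by simp
    qed simp_all
    show "?x \<and> ?l \<and> ?r" using x l r by blast
  next
    assume "?x \<and> ?l \<and> ?r"
    then have x: ?x and l: "\<And>k. k \<in> J \<Longrightarrow> larr (T, U, D) M f (T', U', D') k \<in> hom Alg (T, ?L k) (T', ?L' k)"
      and r: "\<And>j. j \<in> J \<Longrightarrow> rarr (T, U, D) N f (T', U', D') j \<in> hom Alg (U', ?R' j) (U, ?R j)" by blast+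
    have i: "inverse0 V C (D0 j k) (D1 j k) (f (j, k)) (inv0 V C (D0 j k) (D1 j k) (f (j, k)))" if "j \<in> J" "k \<in> J" for j k
    proof -
      have "\<exists>g. inverse0 V C (FOb (?L k) j) (FOb (?L' k) j) ((\<lambda>j\<in>J. f (j, k)) j) g"
        using l[OF that(2), unfolded Alg_hom prod.case] that(1) by blast
      then have "\<exists>g. inverse0 V C (D0 j k) (D1 j k) (f (j, k)) g"
        using that lf_ob[OF B that(1)] lf_ob[OF B' that(1)] by simp
      then show ?thesis using inv0_eq[OF C obs[OF that]] by metis
    qed
    have "vnatural V TU C F G f"
    proof (rule vnatural_tensorI[OF tc FG])
      show "f \<in> extensional (VOb (Tcat T) \<times> VOb (Tcat U'))" using x theoryD(1)[OF cats(1)] theoryD(1)[OF cats(4)] by simp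
    next
      fix j k assume "j \<in> VOb (Tcat T)" "k \<in> VOb (Tcat U')"
      then have o: "j \<in> J" "k \<in> J" using theoryD(1)[OF cats(1)] theoryD(1)[OF cats(4)] by simp_all
      show "el C (nt F G f (j, k)) = El (FOb F (j, k)) (FOb G (j, k)) {}"
        unfolding n[OF o] FG_ob[OF o] using i[OF o] obs[OF o] by (auto simp: inverse0_iff intro: el_const)
    next
      fix j j' k t S assume t: "el (Tcat T) t = El j j' S" and "k \<in> VOb (Tcat U')"
      then have k: "k \<in> J" using theoryD(1)[OF cats(4)] by simp
      note j = theory_obs[OF cats(1) t]
      have "(FOb (?L k) j', FOb (?L' k) j', {}, (\<lambda>j\<in>J. f (j, k)) j') \<odot>[C] fap (?L k) t
          = fap (?L' k) (fap M t) \<odot>[C] (FOb (?L k) j, FOb (?L' k) j, {}, (\<lambda>j\<in>J. f (j, k)) j)"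
        using l[OF k, unfolded Alg_hom prod.case] t by blast
      then show "nt F G f (j', k) \<odot>[C] fap F (prd t (idn (Tcat U') k)) = fap G (prd t (idn (Tcat U') k)) \<odot>[C] nt F G f (j, k)"
        using n[OF j(1) k] n[OF j(2) k] FG_left[OF t k] lf_ob[OF B] lf_ob[OF B'] j by simp
    next
      fix k k' j t S assume t: "el (Tcat U') t = El k k' S" and "j \<in> VOb (Tcat T)"
      then have j: "j \<in> J" using theoryD(1)[OF cats(1)] by simp
      note k = theory_obs[OF cats(4) t]
      note Nt = theory_morphism_el[OF cats(4,3) N t]
      have "(FOb (?R' j) k', FOb (?R j) k', {}, ?i j k') \<odot>[C] fap (?R' j) t
        = fap (?R j) (fap N t) \<odot>[C] (FOb (?R' j) k, FOb (?R j) k, {}, (?i j) k)"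
        using r[OF j, unfolded Alg_hom prod.case] t by blast
      then have "(D1 j k', D0 j k', {}, inv0 V C (D0 j k') (D1 j k') (f (j, k'))) \<odot>[C] fap (?R' j) t
        = fap (?R j) (fap N t) \<odot>[C] (D1 j k, D0 j k, {}, inv0 V C (D0 j k) (D1 j k) (f (j, k)))"
        using k rf_ob[OF B] rf_ob[OF B'] by simp
      from square_inverse[OF C rf_el[OF B' t j] rf_el[OF B Nt j] inverse0_sym[OF i[OF j k(1)]] inverse0_sym[OF i[OF j k(2)]] this]
      show "nt F G f (j, k') \<odot>[C] fap F (prd (idn (Tcat T) j) t) = fap G (prd (idn (Tcat T) j) t) \<odot>[C] nt F G f (j, k)"
        using n[OF j k(1)] n[OF j k(2)] FG_right[OF t j] by simp
    qed
    then show ?v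
    proof (rule vnatural_isoI[OF FG])
      fix a assume "a \<in> VOb TU"
      then obtain j k where a: "a = (j, k)" "j \<in> J" "k \<in> J" using theoryD(1)[OF cats(1)] theoryD(1)[OF cats(4)] by (auto simp: tensor_vcat_simps)
      show "\<exists>g. inverse0 V C (FOb F a) (FOb G a) (f a) g" unfolding a(1) FG_ob[OF a(2,3)] using i[OF a(2,3)] by blast
    qed
  qed
qed

end

abbreviation BA where "BA \<equiv> BAlg V J C"
abbreviation CP where "CP \<equiv> CPair V J C ct cu"

text \<open>The partial algebras at all k, of which the left face is the case I. Keeping all of
  them, here and in the next three definitions, lets the laws for arrows of bifold algebras be
  reduced to those of algebras.\<close>

definition obL :: "'o \<Rightarrow> ('o, 'c, 'm) bifold \<Rightarrow> ('o, 'c, 'm) alg" where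
  "obL k X = (case X of (T, U, D) \<Rightarrow> (T, lf T U D k))"
definition obR :: "'o \<Rightarrow> ('o, 'c, 'm) bifold \<Rightarrow> ('o, 'c, 'm) alg" where
  "obR j X = (case X of (T, U, D) \<Rightarrow> (U, rf T U D j))"
definition faceL :: "'o \<Rightarrow> ('o, 'c, 'm) bifold_arrow \<Rightarrow> ('o, 'c, 'm) alg_arrow" where
  "faceL k x = (case x of (X, (M, N, f), Y) \<Rightarrow> (obL k X, (M, \<lambda>j\<in>J. f (j, k)), obL k Y))"
definition faceR :: "'o \<Rightarrow> ('o, 'c, 'm) bifold_arrow \<Rightarrow> ('o, 'c, 'm) alg_arrow" where
  "faceR j x = (case x of (X, (M, N, f), Y) \<Rightarrow>
     (obR j Y, (N, \<lambda>k\<in>J. inv0 V C (FOb (snd (snd X)) (j, k)) (FOb (snd (snd Y)) (j, k)) (f (j, k))), obR j X))"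

lemma BA_ob: "(T, U, D) \<in> Ob BA \<longleftrightarrow> bif T U D"
  by (simp add: BAlg_def)

lemma BA_homI:
  assumes X: "X \<in> Ob BA" "Y \<in> Ob BA" and f: "f \<in> extensional (J \<times> J)"
    and l: "\<And>k. k \<in> J \<Longrightarrow> faceL k (X, (M, N, f), Y) \<in> hom Alg (obL k X) (obL k Y)"
    and r: "\<And>j. j \<in> J \<Longrightarrow> faceR j (X, (M, N, f), Y) \<in> hom Alg (obR j Y) (obR j X)"
  shows "(X, (M, N, f), Y) \<in> hom BA X Y"
proof -
  obtain T U D T' U' D' where e: "X = (T, U, D)" "Y = (T', U', D')" by (metis prod_cases3)
  have b: "bif T U D" "bif T' U' D'" using X by (simp_all add: e BA_ob)
  have M: "theory_morphism V J T T' M" using Alg_homD(5) l[OF J_unit] by (simp add: faceL_def obL_def e)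
  have N: "theory_morphism V J U' U N" using Alg_homD(5) r[OF J_unit] by (simp add: faceR_def obR_def e)
  have "vnatural_iso V (tensor_vcat V (Tcat T) (Tcat U')) C
         (comp_vfun V (tensor_vcat V (Tcat T) (Tcat U')) D (tensor_vfun V (Tcat T) (Tcat U') (id_vfun V (Tcat T)) N))
         (comp_vfun V (tensor_vcat V (Tcat T) (Tcat U')) D' (tensor_vfun V (Tcat T) (Tcat U') M (id_vfun V (Tcat U')))) f"
    unfolding bif_arrow_iff[OF b M N] using f l r by (simp add: faceL_def obL_def faceR_def obR_def e)
  then show ?thesis using b M N by (simp add: hom_def BAlg_def e)
qed

lemma BA_homE:
  assumes "x \<in> hom BA X Y"
  obtains T U D M N f T' U' D' where "X = (T, U, D)" "Y = (T', U', D')" "x = (X, (M, N, f), Y)" "bif T U D" "bif T' U' D'"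
    "theory_morphism V J T T' M" "theory_morphism V J U' U N" "f \<in> extensional (J \<times> J)"
    "\<And>k. k \<in> J \<Longrightarrow> faceL k x \<in> hom Alg (obL k X) (obL k Y)" "\<And>j. j \<in> J \<Longrightarrow> faceR j x \<in> hom Alg (obR j Y) (obR j X)"
    "\<And>j k. j \<in> J \<Longrightarrow> k \<in> J \<Longrightarrow>
      inverse0 V C (FOb D (j, k)) (FOb D' (j, k)) (f (j, k)) (inv0 V C (FOb D (j, k)) (FOb D' (j, k)) (f (j, k)))"
proof -
  obtain T U D M N f T' U' D' where e: "X = (T, U, D)" "Y = (T', U', D')" "x = (X, (M, N, f), Y)"
    and b: "bif T U D" "bif T' U' D'" and mn: "theory_morphism V J T T' M" "theory_morphism V J U' U N"
    and v: "vnatural_iso V (tensor_vcat V (Tcat T) (Tcat U')) C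
         (comp_vfun V (tensor_vcat V (Tcat T) (Tcat U')) D (tensor_vfun V (Tcat T) (Tcat U') (id_vfun V (Tcat T)) N))
         (comp_vfun V (tensor_vcat V (Tcat T) (Tcat U')) D' (tensor_vfun V (Tcat T) (Tcat U') M (id_vfun V (Tcat U')))) f"
    using assms by (auto simp: hom_def BAlg_def)
  note h = v[unfolded bif_arrow_iff[OF b mn]]
  have l: "faceL k x \<in> hom Alg (obL k X) (obL k Y)" if "k \<in> J" for k
    using h that by (simp add: faceL_def obL_def e)
  have i: "inverse0 V C (FOb D (j, k)) (FOb D' (j, k)) (f (j, k)) (inv0 V C (FOb D (j, k)) (FOb D' (j, k)) (f (j, k)))"
    if j: "j \<in> J" and k: "k \<in> J" for j k
    using Alg_homD(7)[of T "lf T U D k" M "\<lambda>j\<in>J. f (j, k)" T' "lf T' U' D' k" j] l[OF k] j lf_ob[OF b(1) j] lf_ob[OF b(2) j]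
    by (simp add: faceL_def obL_def e)
  show thesis by (rule that[OF e b mn _ l _ i]) (use h in \<open>simp_all add: faceR_def obR_def e\<close>)
qed

text \<open>The left restrictions already carry all components and M, so the right one is consulted
  only for N.\<close>

lemma BA_eqI:
  assumes x: "x \<in> hom BA X Y" "y \<in> hom BA X Y" and l: "\<And>k. k \<in> J \<Longrightarrow> faceL k x = faceL k y" and r: "faceR \<one> x = faceR \<one> y"
  shows "x = y"
proof -
  obtain M N f where 1: "x = (X, (M, N, f), Y)" "f \<in> extensional (J \<times> J)" using x(1) by (rule BA_homE) blast
  obtain M' N' f' where 2: "y = (X, (M', N', f'), Y)" "f' \<in> extensional (J \<times> J)" using x(2) by (rule BA_homE) blast
  have "f (j, k) = f' (j, k)" if "j \<in> J" "k \<in> J" for j k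
    using l[OF that(2)] that(1) by (auto simp: faceL_def 1 2 dest!: fun_cong[of _ _ j])
  then have "f = f'" using 1 2 by (auto intro!: extensionalityI[of _ "J \<times> J"])
  then show ?thesis using l[OF J_unit] r by (simp add: 1 2 faceL_def faceR_def)
qed

lemma BA_comp:
  assumes x: "x \<in> hom BA X Y" and y: "y \<in> hom BA Y Z"
  shows "Comp BA y x \<in> hom BA X Z" "k \<in> J \<Longrightarrow> faceL k (Comp BA y x) = Comp Alg (faceL k y) (faceL k x)"
    "j \<in> J \<Longrightarrow> faceR j (Comp BA y x) = Comp Alg (faceR j x) (faceR j y)"
proof -
  from x obtain T U D M N f T' U' D' where 1: "X = (T, U, D)" "Y = (T', U', D')" "x = (X, (M, N, f), Y)" "bif T U D" "bif T' U' D'"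
    "theory_morphism V J T T' M" "theory_morphism V J U' U N"
    and l1: "\<And>k. k \<in> J \<Longrightarrow> faceL k x \<in> hom Alg (obL k X) (obL k Y)" and r1: "\<And>j. j \<in> J \<Longrightarrow> faceR j x \<in> hom Alg (obR j Y) (obR j X)"
    and i1: "\<And>j k. j \<in> J \<Longrightarrow> k \<in> J \<Longrightarrow> inverse0 V C (FOb D (j, k)) (FOb D' (j, k)) (f (j, k)) (inv0 V C (FOb D (j, k)) (FOb D' (j, k)) (f (j, k)))"
    by (rule BA_homE) blast
  from y obtain T1 U1 D1 M' N' f' T'' U'' D'' where Y: "Y = (T1, U1, D1)" and s2: "Z = (T'', U'', D'')" "y = (Y, (M', N', f'), Z)" "bif T'' U'' D''"
    "theory_morphism V J T1 T'' M'" "theory_morphism V J U'' U1 N'"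
    and l2: "\<And>k. k \<in> J \<Longrightarrow> faceL k y \<in> hom Alg (obL k Y) (obL k Z)" and r2: "\<And>j. j \<in> J \<Longrightarrow> faceR j y \<in> hom Alg (obR j Z) (obR j Y)"
    and i2': "\<And>j k. j \<in> J \<Longrightarrow> k \<in> J \<Longrightarrow> inverse0 V C (FOb D1 (j, k)) (FOb D'' (j, k)) (f' (j, k)) (inv0 V C (FOb D1 (j, k)) (FOb D'' (j, k)) (f' (j, k)))"
    by (rule BA_homE) blast
  have Y: "T1 = T'" "U1 = U'" "D1 = D'" using Y 1(2) by simp_all
  note 2 = s2[unfolded Y] and i2 = i2'[unfolded Y]
  have th: "is_theory V J T" "is_theory V J T'" "is_theory V J T''" "is_theory V J U" "is_theory V J U'" "is_theory V J U''"
    using 1(4,5) 2(3) by simp_all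
  have o: "FOb M j = j" "FOb N j = j" "FOb M' j = j" "FOb N' j = j" if "j \<in> J" for j
    using theory_morphismD(2)[OF th(1,2) 1(6) that] theory_morphismD(2)[OF th(5,4) 1(7) that]
      theory_morphismD(2)[OF th(2,3) 2(4) that] theory_morphismD(2)[OF th(6,5) 2(5) that] by simp_all
  let ?h = "\<lambda>(j, k) \<in> J \<times> J. comp0 V C (FOb D (j, k)) (FOb D' (j, k)) (FOb D'' (j, k)) (f' (j, k)) (f (j, k))"
  have c: "Comp BA y x = (X, (comp_vfun V (Tcat T) M' M, comp_vfun V (Tcat U'') N N', ?h), Z)"
    by (auto simp: BAlg_def 1(1-3) 2(1,2) o intro!: restrict_ext)
  have l: "faceL k (Comp BA y x) = Comp Alg (faceL k y) (faceL k x)" if k: "k \<in> J" for k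
    unfolding c using k lf_ob[OF 1(4)] lf_ob[OF 1(5)] lf_ob[OF 2(3)]
    by (auto simp: faceL_def obL_def 1(1-3) 2(1,2) AlgS_def o intro!: restrict_ext)
  have r: "faceR j (Comp BA y x) = Comp Alg (faceR j x) (faceR j y)" if j: "j \<in> J" for j
    unfolding c using j rf_ob[OF 1(4)] rf_ob[OF 1(5)] rf_ob[OF 2(3)]
      inv0_comp0[OF C_cat bif_ob[OF 1(4)] bif_ob[OF 1(5)] bif_ob[OF 2(3)] i1 i2]
    by (auto simp: faceR_def obR_def 1(1-3) 2(1,2) AlgS_def o intro!: restrict_ext)
  show "k \<in> J \<Longrightarrow> faceL k (Comp BA y x) = Comp Alg (faceL k y) (faceL k x)" by (rule l)
  show "j \<in> J \<Longrightarrow> faceR j (Comp BA y x) = Comp Alg (faceR j x) (faceR j y)" by (rule r)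
  have "faceL k (Comp BA y x) \<in> hom Alg (obL k X) (obL k Z)" if "k \<in> J" for k unfolding l[OF that] by (rule Alg_comp_hom[OF l1 l2]) fact+
  moreover have "faceR j (Comp BA y x) \<in> hom Alg (obR j Z) (obR j X)" if "j \<in> J" for j unfolding r[OF that] by (rule Alg_comp_hom[OF r2 r1]) fact+
  ultimately show "Comp BA y x \<in> hom BA X Z" unfolding c
    by (intro BA_homI) (use 1(4) 2(3) in \<open>auto simp: 1(1) 2(1) BA_ob\<close>)
qed

lemma BA_id:
  assumes X: "X \<in> Ob BA"
  shows "Ident BA X \<in> hom BA X X" "k \<in> J \<Longrightarrow> faceL k (Ident BA X) = Ident Alg (obL k X)"
    "j \<in> J \<Longrightarrow> faceR j (Ident BA X) = Ident Alg (obR j X)"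
proof -
  obtain T U D where e: "X = (T, U, D)" by (rule prod_cases3)
  have b: "bif T U D" using X by (simp add: e BA_ob)
  have th: "is_theory V J T" "is_theory V J U" using b by simp_all
  have c: "Ident BA X = (X, (id_vfun V (Tcat T), id_vfun V (Tcat U), \<lambda>x \<in> J \<times> J. VId C (FOb D x)), X)"
    by (simp add: BAlg_def e)
  have l: "faceL k (Ident BA X) = Ident Alg (obL k X)" if k: "k \<in> J" for k
    unfolding c using k lf_ob[OF b] by (auto simp: faceL_def obL_def e AlgS_def intro!: restrict_ext)
  have r: "faceR j (Ident BA X) = Ident Alg (obR j X)" if j: "j \<in> J" for j
    unfolding c using j rf_ob[OF b] inv0_eq[OF C_cat bif_ob[OF b] bif_ob[OF b] inverse0_id[OF C_cat bif_ob[OF b]]]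
    by (auto simp: faceR_def obR_def e AlgS_def intro!: restrict_ext)
  show "k \<in> J \<Longrightarrow> faceL k (Ident BA X) = Ident Alg (obL k X)" by (rule l)
  show "j \<in> J \<Longrightarrow> faceR j (Ident BA X) = Ident Alg (obR j X)" by (rule r)
  have "faceL k (Ident BA X) \<in> hom Alg (obL k X) (obL k X)" if "k \<in> J" for k
    unfolding l[OF that] by (rule category.Ident_hom[OF Alg_cat]) (use lf_alg[OF b that] th in \<open>simp add: obL_def e Alg_ob\<close>)
  moreover have "faceR j (Ident BA X) \<in> hom Alg (obR j X) (obR j X)" if "j \<in> J" for j
    unfolding r[OF that] by (rule category.Ident_hom[OF Alg_cat]) (use rf_alg[OF b that] th in \<open>simp add: obR_def e Alg_ob\<close>)
  ultimately show "Ident BA X \<in> hom BA X X" unfolding c by (intro BA_homI X) auto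
qed

lemma BA_face_hom:
  assumes "x \<in> hom BA X Y"
  shows "k \<in> J \<Longrightarrow> faceL k x \<in> hom Alg (obL k X) (obL k Y)" "j \<in> J \<Longrightarrow> faceR j x \<in> hom Alg (obR j Y) (obR j X)"
    "X \<in> Ob BA" "Y \<in> Ob BA"
  using assms by (auto elim!: BA_homE simp: BA_ob)

text \<open>Restriction respects identities and composition, covariantly on the left and
  contravariantly on the right, so each law holds because it holds in \<open>Alg\<close>.\<close>

lemma BA_cat: "category BA"
proof
  fix x assume "x \<in> Ar BA"
  then have "x \<in> hom BA (Dom BA x) (Cod BA x)" by (simp add: hom_def)
  from BA_face_hom(3,4)[OF this] show "Dom BA x \<in> Ob BA" "Cod BA x \<in> Ob BA" .
next
  fix X assume "X \<in> Ob BA" then show "Ident BA X \<in> hom BA X X" by (rule BA_id)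
next
  fix x y X Y Z assume "x \<in> hom BA X Y" "y \<in> hom BA Y Z" then show "Comp BA y x \<in> hom BA X Z" by (rule BA_comp)
next
  fix x X Y assume x: "x \<in> hom BA X Y"
  note h = BA_face_hom[OF x] and iX = BA_id[OF BA_face_hom(3)[OF x]] and iY = BA_id[OF BA_face_hom(4)[OF x]]
  show "Comp BA x (Ident BA X) = x"
    by (rule BA_eqI[OF BA_comp(1)[OF iX(1) x] x])
      (simp_all add: J_unit BA_comp[OF iX(1) x] iX category.Comp_Ident_right[OF Alg_cat h(1)] category.Comp_Ident_left[OF Alg_cat h(2)])
  show "Comp BA (Ident BA Y) x = x"
    by (rule BA_eqI[OF BA_comp(1)[OF x iY(1)] x])
      (simp_all add: J_unit BA_comp[OF x iY(1)] iY category.Comp_Ident_left[OF Alg_cat h(1)] category.Comp_Ident_right[OF Alg_cat h(2)])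
next
  fix x y z X Y Z W assume x: "x \<in> hom BA X Y" and y: "y \<in> hom BA Y Z" and z: "z \<in> hom BA Z W"
  note yx = BA_comp[OF x y] and zy = BA_comp[OF y z]
  show "Comp BA (Comp BA z y) x = Comp BA z (Comp BA y x)"
    by (rule BA_eqI[OF BA_comp(1)[OF x zy(1)] BA_comp(1)[OF yx(1) z]])
      (simp_all add: J_unit BA_comp[OF x zy(1)] BA_comp[OF yx(1) z] yx zy
        category.Comp_assoc[OF Alg_cat BA_face_hom(1)[OF x] BA_face_hom(1)[OF y] BA_face_hom(1)[OF z]]
        category.Comp_assoc[OF Alg_cat BA_face_hom(2)[OF z] BA_face_hom(2)[OF y] BA_face_hom(2)[OF x]])
qed

section \<open>The category of commuting algebra pairs\<close>

lemma underlying_inverse: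
  assumes "x \<in> hom Alg X Y"
  shows "inverse0 V C (carrier V X) (carrier V Y) (underlying V x) (inv0 V C (carrier V X) (carrier V Y) (underlying V x))"
    "carrier V X \<in> VOb C" "carrier V Y \<in> VOb C"
proof -
  obtain T A M f U B where 1: "X = (T, A)" "Y = (U, B)" "x = ((T, A), (M, f), (U, B))" and h: "((T, A), (M, f), (U, B)) \<in> hom Alg (T, A) (U, B)"
    using assms by (rule Alg_homE)
  note h = Alg_homD[OF h]
  show "inverse0 V C (carrier V X) (carrier V Y) (underlying V x) (inv0 V C (carrier V X) (carrier V Y) (underlying V x))"
    "carrier V X \<in> VOb C" "carrier V Y \<in> VOb C"
    using h(7)[OF J_unit] alg_ob[OF h(1,2) J_unit] alg_ob[OF h(3,4) J_unit] by (simp_all add: 1 carrier_def underlying_def)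
qed

lemma underlying_comp:
  assumes x: "x \<in> hom Alg X Y" and y: "y \<in> hom Alg Y Z"
  shows "underlying V (Comp Alg y x) = comp0 V C (carrier V X) (carrier V Y) (carrier V Z) (underlying V y) (underlying V x)"
proof -
  obtain T A M f U B where 1: "X = (T, A)" "Y = (U, B)" "x = ((T, A), (M, f), (U, B))" and h1: "((T, A), (M, f), (U, B)) \<in> hom Alg (T, A) (U, B)"
    using x by (rule Alg_homE)
  obtain N g W E where 2: "Z = (W, E)" "y = ((U, B), (N, g), (W, E))" and h2: "((U, B), (N, g), (W, E)) \<in> hom Alg (U, B) (W, E)"
    using y unfolding 1(2) by (rule Alg_homE) simp
  note h1 = Alg_homD[OF h1] and h2 = Alg_homD[OF h2]
  show ?thesis using J_unit theory_morphismD(2)[OF h1(1,3,5) J_unit] theory_morphismD(2)[OF h2(1,3,5) J_unit]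
    by (simp add: 1 2 AlgS_def underlying_def carrier_def)
qed

lemma underlying_id: "X \<in> Ob Alg \<Longrightarrow> underlying V (Ident Alg X) = VId C (carrier V X)"
  using J_unit by (auto simp: AlgS_def underlying_def carrier_def)

lemma CP_hom: "x \<in> hom CP P Q \<longleftrightarrow> P \<in> Ob CP \<and> Q \<in> Ob CP \<and> (\<exists>f g. x = (P, (f, g), Q) \<and>
    f \<in> hom Alg (fst P) (fst Q) \<and> g \<in> hom Alg (snd Q) (snd P) \<and>
    underlying V f = inv0 V C (carrier V (snd Q)) (carrier V (snd P)) (underlying V g))"
  by (cases P; cases Q) (auto simp: hom_def CPair_def Let_def)

lemma CP_ob: "P \<in> Ob CP \<longleftrightarrow> fst P \<in> Ob Alg \<and> snd P \<in> Ob Alg \<and> carrier V (fst P) = carrier V (snd P) \<and>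
    commutes_with V J C ct cu (fst P) (snd P)"
  by (cases P) (auto simp: CPair_def Let_def)

lemma CP_comp: "Comp CP (Q, (f', g'), R) (P, (f, g), Q) = (P, (Comp Alg f' f, Comp Alg g g'), R)"
  by (simp add: CPair_def Let_def)

lemma CP_id: "Ident CP P = (P, (Ident Alg (fst P), Ident Alg (snd P)), P)"
  by (cases P) (simp add: CPair_def Let_def)

lemma CP_cat: "category CP"
proof -
  interpret A: category Alg by (rule Alg_cat)
  show ?thesis
  proof
    fix x assume "x \<in> Ar CP"
    then have "x \<in> hom CP (Dom CP x) (Cod CP x)" by (simp add: hom_def)
    then show "Dom CP x \<in> Ob CP" "Cod CP x \<in> Ob CP" unfolding CP_hom by blast+
  next
    fix P assume P: "P \<in> Ob CP"
    have o: "fst P \<in> Ob Alg" "snd P \<in> Ob Alg" "carrier V (fst P) = carrier V (snd P)" using P by (auto simp: CP_ob)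
    note i = A.Ident_hom[OF o(1)] A.Ident_hom[OF o(2)]
    show "Ident CP P \<in> hom CP P P" unfolding CP_hom CP_id
      using P i underlying_id[OF o(1)] underlying_id[OF o(2)] o(3) underlying_inverse(2)[OF i(2)]
        inv0_eq[OF C_cat _ _ inverse0_id[OF C_cat]] by simp
  next
    fix x y P Q R assume x: "x \<in> hom CP P Q" and y: "y \<in> hom CP Q R"
    obtain f g where 1: "x = (P, (f, g), Q)" "f \<in> hom Alg (fst P) (fst Q)" "g \<in> hom Alg (snd Q) (snd P)"
      "underlying V f = inv0 V C (carrier V (snd Q)) (carrier V (snd P)) (underlying V g)" "P \<in> Ob CP" "Q \<in> Ob CP"
      using x unfolding CP_hom by blast
    obtain f' g' where 2: "y = (Q, (f', g'), R)" "f' \<in> hom Alg (fst Q) (fst R)" "g' \<in> hom Alg (snd R) (snd Q)"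
      "underlying V f' = inv0 V C (carrier V (snd R)) (carrier V (snd Q)) (underlying V g')" "R \<in> Ob CP"
      using y unfolding CP_hom by blast
    have c: "carrier V (fst P) = carrier V (snd P)" "carrier V (fst Q) = carrier V (snd Q)" "carrier V (fst R) = carrier V (snd R)"
      using 1(5,6) 2(5) by (auto simp: CP_ob)
    note u = underlying_inverse[OF 2(3)] underlying_inverse[OF 1(3)]
    have "underlying V (Comp Alg f' f) = inv0 V C (carrier V (snd R)) (carrier V (snd P)) (underlying V (Comp Alg g g'))"
      unfolding underlying_comp[OF 1(2) 2(2)] underlying_comp[OF 2(3) 1(3)] inv0_comp0[OF C_cat u(2,3,6) u(1,4)] 1(4) 2(4) c ..
    then show "Comp CP y x \<in> hom CP P R" unfolding CP_hom 1(1) 2(1) CP_comp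
      using 1(5) 2(5) A.Comp_hom[OF 1(2) 2(2)] A.Comp_hom[OF 2(3) 1(3)] by blast
  next
    fix x P Q assume "x \<in> hom CP P Q"
    then obtain f g where 1: "x = (P, (f, g), Q)" "f \<in> hom Alg (fst P) (fst Q)" "g \<in> hom Alg (snd Q) (snd P)"
      unfolding CP_hom by blast
    show "Comp CP x (Ident CP P) = x" "Comp CP (Ident CP Q) x = x" unfolding 1(1) CP_id CP_comp
      using A.Comp_Ident_right[OF 1(2)] A.Comp_Ident_left[OF 1(2)] A.Comp_Ident_right[OF 1(3)] A.Comp_Ident_left[OF 1(3)] by simp_all
  next
    fix x y z P Q R S assume x: "x \<in> hom CP P Q" and y: "y \<in> hom CP Q R" and z: "z \<in> hom CP R S"
    obtain f g where 1: "x = (P, (f, g), Q)" "f \<in> hom Alg (fst P) (fst Q)" "g \<in> hom Alg (snd Q) (snd P)"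
      using x unfolding CP_hom by blast
    obtain f' g' where 2: "y = (Q, (f', g'), R)" "f' \<in> hom Alg (fst Q) (fst R)" "g' \<in> hom Alg (snd R) (snd Q)"
      using y unfolding CP_hom by blast
    obtain f'' g'' where 3: "z = (R, (f'', g''), S)" "f'' \<in> hom Alg (fst R) (fst S)" "g'' \<in> hom Alg (snd S) (snd R)"
      using z unfolding CP_hom by blast
    show "Comp CP (Comp CP z y) x = Comp CP z (Comp CP y x)" unfolding 1(1) 2(1) 3(1) CP_comp
      using A.Comp_assoc[OF 1(2) 2(2) 3(2)] A.Comp_assoc[OF 3(3) 2(3) 1(3)] by simp
  qed
qed

section \<open>The two faces of a bifold algebra commute\<close>

context
  fixes T U :: "('o, 'm) jtheory" and D :: "('o \<times> 'o, 'c, 'm) vfun"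
  assumes B: "bif T U D"
begin

private lemma th: "is_theory V J T" "is_theory V J U" using B by simp_all

lemma rf_cot: "j \<in> J \<Longrightarrow> k \<in> J \<Longrightarrow> is_cotensor V C k (FOb D (j, \<one>)) (FOb D (j, k)) (FHm (rf T U D j) k \<one> \<cdot> str U k)"
  using algebra_cot[OF th(2) rf_alg[OF B], of j k] rf_ob[OF B] J_unit by simp

lemma rf_str:
  assumes "j \<in> J" "fst l \<in> J"
  shows "el (Tcat U) (gel (fst l) \<one> l (str U (fst l))) = El (fst l) \<one> {l}"
    "fap (rf T U D j) (gel (fst l) \<one> l (str U (fst l))) = gel (FOb D (j, fst l)) (FOb D (j, \<one>)) l (FHm (rf T U D j) (fst l) \<one> \<cdot> str U (fst l))"
    "el C (gel (FOb D (j, fst l)) (FOb D (j, \<one>)) l (FHm (rf T U D j) (fst l) \<one> \<cdot> str U (fst l))) = El (FOb D (j, fst l)) (FOb D (j, \<one>)) {l}"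
proof -
  note co = cot_obs[OF str_cot[OF th(2) assms(2)]]
  show e: "el (Tcat U) (gel (fst l) \<one> l (str U (fst l))) = El (fst l) \<one> {l}" using gel_el[OF co(2,1,3)] .
  show f: "fap (rf T U D j) (gel (fst l) \<one> l (str U (fst l))) = gel (FOb D (j, fst l)) (FOb D (j, \<one>)) l (FHm (rf T U D j) (fst l) \<one> \<cdot> str U (fst l))"
    using fap_gel[OF algebraD(1)[OF rf_alg[OF B assms(1)]] co(2,1,3)] rf_ob[OF B] assms J_unit by simp
  show "el C (gel (FOb D (j, fst l)) (FOb D (j, \<one>)) l (FHm (rf T U D j) (fst l) \<one> \<cdot> str U (fst l))) = El (FOb D (j, fst l)) (FOb D (j, \<one>)) {l}"
    using rf_el[OF B e assms(1)] f by simp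
qed

lemma rf_str_unit: "j \<in> J \<Longrightarrow> FHm (rf T U D j) \<one> \<one> \<cdot> str U \<one> = VId C (FOb D (j, \<one>))"
  using fap_idn[OF algebraD(1)[OF rf_alg[OF B]], of j \<one>] rf_ob[OF B] J_unit theoryD(1)[OF th(2)]
  by (simp add: str_unit[OF th(2)] idn_def fap_def)

text \<open>D(x, -) preserves cotensors, so D(x, k) is a cotensor of D(x, I) by k with counit the
  image of the structure morphism. Comparison with the designated cotensor gives u, and
  \<open>gel_relabel\<close> frees the equation from the chosen label.\<close>

lemma comparison_ex:
  "\<exists>u v. \<forall>x \<in> J. \<forall>k \<in> J. inverse0 V C (FOb D (x, k)) (ct k (FOb D (x, \<one>))) (u x k) (v x k) \<and>
    (\<forall>l. fst l = k \<longrightarrow> gel (FOb D (x, k)) (FOb D (x, \<one>)) l (FHm (rf T U D x) k \<one> \<cdot> str U k)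
      = gel (ct k (FOb D (x, \<one>))) (FOb D (x, \<one>)) l (cu k (FOb D (x, \<one>))) \<odot>[C] (FOb D (x, k), ct k (FOb D (x, \<one>)), {}, u x k))"
proof -
  have "\<exists>u v. inverse0 V C (FOb D (x, k)) (ct k (FOb D (x, \<one>))) u v \<and>
    (\<forall>l. fst l = k \<longrightarrow> gel (FOb D (x, k)) (FOb D (x, \<one>)) l (FHm (rf T U D x) k \<one> \<cdot> str U k)
      = gel (ct k (FOb D (x, \<one>))) (FOb D (x, \<one>)) l (cu k (FOb D (x, \<one>))) \<odot>[C] (FOb D (x, k), ct k (FOb D (x, \<one>)), {}, u))"
    if x: "x \<in> J" and k: "k \<in> J" for x k
  proof -
    let ?l = "(k, 0 :: nat)"
    note c = ct_cot[OF k bif_ob[OF B x J_unit]] and c' = rf_cot[OF x k]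
    note co = cot_obs[OF c] and co' = cot_obs[OF c']
    obtain u v where i: "inverse0 V C (FOb D (x, k)) (ct k (FOb D (x, \<one>))) u v"
      and e: "gel (FOb D (x, k)) (FOb D (x, \<one>)) ?l (FHm (rf T U D x) k \<one> \<cdot> str U k)
      = gel (ct k (FOb D (x, \<one>))) (FOb D (x, \<one>)) ?l (cu k (FOb D (x, \<one>))) \<odot>[C] (FOb D (x, k), ct k (FOb D (x, \<one>)), {}, u)"
      using cot_unique[OF C_cat c c', of ?l] by auto
    have "ty u = Arr \<one> (VHom C (FOb D (x, k)) (ct k (FOb D (x, \<one>))))" using i by (simp add: inverse0_iff)
    from gel_relabel[OF C_pre co(2) co'(2) co(1) _ _ this e] i show ?thesis using co(3) co'(3) by auto
  qed
  then show ?thesis by metis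
qed

text \<open>The point to prove is that the functors D(x, -), once conjugated by u, are compatible
  with the action of T on the pointwise cotensors. This holds because u is natural in x, which in
  turn comes from the commutation of the two actions in D.\<close>

lemma faces_commute: "commutes_with V J C ct cu (T, lf T U D \<one>) (U, rf T U D \<one>)"
proof -
  let ?D = "\<lambda>j k. FOb D (j, k)" and ?L = "lf T U D" and ?R = "rf T U D"
  let ?A = "?L \<one>" and ?B = "?R \<one>" and ?T = "Tcat T" and ?U = "Tcat U"
  note A = lf_alg[OF B J_unit] and C = C_cat and P = C_pre and u1 = J_unit
  obtain u v where i: "\<And>x k. x \<in> J \<Longrightarrow> k \<in> J \<Longrightarrow> inverse0 V C (?D x k) (ct k (?D x \<one>)) (u x k) (v x k)"
    and g: "\<And>x l. x \<in> J \<Longrightarrow> fst l \<in> J \<Longrightarrow> gel (FOb D (x, fst l)) (?D x \<one>) l (FHm (?R x) (fst l) \<one> \<cdot> str U (fst l))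
      = gel (ct (fst l) (?D x \<one>)) (?D x \<one>) l (cu (fst l) (?D x \<one>)) \<odot>[C] (FOb D (x, fst l), ct (fst l) (?D x \<one>), {}, u x (fst l))"
    using comparison_ex by blast
  define p where "p x k = ct k (?D x \<one>)" for x k
  define ue where "ue x k = (?D x k, p x k, {} :: ('o \<times> nat) set, u x k)" for x k
  define ve where "ve x k = (p x k, ?D x k, {} :: ('o \<times> nat) set, v x k)" for x k
  define cg where "cg x l = gel (p x (fst l)) (?D x \<one>) l (cu (fst l) (?D x \<one>))" for x l
  note i = i[folded p_def] and g = g[folded p_def]
  have g: "fap (?R x) (gel (fst l) \<one> l (str U (fst l))) = cg x l \<odot>[C] ue x (fst l)" if "x \<in> J" "fst l \<in> J" for x l
    using g[OF that] rf_str(2)[OF that] by (simp add: cg_def ue_def)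
  have Dob: "?D x k \<in> VOb C" and pob: "p x k \<in> VOb C" if "x \<in> J" "k \<in> J" for x k
    using bif_ob[OF B] that u1 ct_ob by (simp_all add: p_def)
  have uel: "el C (ue x k) = El (?D x k) (p x k) {}" and vel: "el C (ve x k) = El (p x k) (?D x k) {}"
    and uv: "ue x k \<odot>[C] ve x k = idn C (p x k)" "ve x k \<odot>[C] ue x k = idn C (?D x k)" if "x \<in> J" "k \<in> J" for x k
    using i[OF that] Dob[OF that] pob[OF that] by (auto simp: inverse0_iff ue_def ve_def intro: el_const)
  have cgel: "el C (cg x l) = El (p x (fst l)) (?D x \<one>) {l}" if "x \<in> J" "fst l \<in> J" for x l
    using cu_gel_el[OF Dob[OF that(1) u1] that(2)] by (simp add: cg_def p_def)
  have cgm: "y = z" if "x \<in> J" "fst l \<in> J" "l \<notin> S" "el C y = El q (p x (fst l)) S" "el C z = El q (p x (fst l)) S" "cg x l \<odot>[C] y = cg x l \<odot>[C] z"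
    for x l S y z q
    using cot_mono[OF P ct_cot[OF that(2) Dob[OF that(1) u1]], where l = l, OF refl that(3)] that(4-6) by (simp add: cg_def p_def)
  \<comment> \<open>At I both counits are identities, hence so is the comparison. This is what gives
    the morphism into the commutant an identity as its underlying arrow.\<close>
  have u_unit: "ue x \<one> = idn C (?D x \<one>)" "ve x \<one> = idn C (?D x \<one>)" "p x \<one> = ?D x \<one>" if x: "x \<in> J" for x
  proof -
    let ?l = "(\<one>, 0 :: nat)"
    show p1: "p x \<one> = ?D x \<one>" using ct_unit(1)[OF Dob[OF x u1]] by (simp add: p_def)
    have ge: "cg x ?l \<odot>[C] ue x \<one> = cg x ?l"
      using g[OF x, of ?l] rf_str(2)[OF x, of ?l] rf_str_unit[OF x] u1 ct_unit[OF Dob[OF x u1]] by (simp add: cg_def p_def)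
    show 1: "ue x \<one> = idn C (?D x \<one>)"
      by (rule cgm[OF x, of ?l "{}" _ "?D x \<one>"])
        (use uel[OF x u1] u1 p1 idn_el[OF P Dob[OF x u1]] ge ecomp_idn(2)[OF C cgel[OF x, of ?l]] in simp_all)
    show "ve x \<one> = idn C (?D x \<one>)"
      using uv(2)[OF x u1] ecomp_idn(2)[OF C vel[OF x u1]] unfolding 1 p1 by simp
  qed
  have At: "el C (fap ?A t) = El (?D x \<one>) (?D y \<one>) S" if "el ?T t = El x y S" for t x y S using lf_el[OF B that u1] .
  have cAt: "el C (fap (cA T ?A k) t) = El (p x k) (p y k) S" "fap (cA T ?A k) t = fap (ctf k) (fap ?A t)"
    if "el ?T t = El x y S" "k \<in> J" for t x y S k
    using fap_alg_cotensor[OF algebraD(1)[OF A] that(2,1)] ctf_el[OF that(2) At[OF that(1)]] by (simp_all add: p_def)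
  \<comment> \<open>Naturality of u in the first variable is tested against the designated counit.
    There \<open>cg\<close> followed by u is the right action of a structure morphism, which
    commutes with the left action of t.\<close>
  have nat: "ue y k \<odot>[C] fap (?L k) t = fap (cA T ?A k) t \<odot>[C] ue x k" if t: "el ?T t = El x y S" and k: "k \<in> J" for t x y S k
  proof -
    note xy = theory_obs[OF th(1) t]
    have "finite S" using el_obs(3)[OF t] by (simp add: stage_def)
    then obtain n where n: "(k, n) \<notin> S" by (rule fresh_label)
    let ?l = "(k, n)"
    have kl: "fst ?l \<in> J" using k by simp
    note L = lf_el[OF B t k] and c = cAt[OF t k] and s = rf_str[OF _ kl, simplified]
    note cg1 = cgel[OF xy(1) kl, simplified] and cg2 = cgel[OF xy(2) kl, simplified]
    show ?thesis
    proof (rule cgm[OF xy(2) kl n])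
      show "el C (ue y k \<odot>[C] fap (?L k) t) = El (?D x k) (p y (fst ?l)) S" using ecomp_el[OF P uel[OF xy(2) k] L] by simp
      show "el C (fap (cA T ?A k) t \<odot>[C] ue x k) = El (?D x k) (p y (fst ?l)) S" using ecomp_el[OF P c(1) uel[OF xy(1) k]] by simp
      have "cg y ?l \<odot>[C] (ue y k \<odot>[C] fap (?L k) t) = (cg y ?l \<odot>[C] ue y k) \<odot>[C] fap (?L k) t"
        using ecomp_assoc[OF C cg2 uel[OF xy(2) k] L] n by simp
      also have "\<dots> = fap (?R y) (gel k \<one> ?l (str U k)) \<odot>[C] fap (?L k) t" using g[OF xy(2) kl] by simp
      also have "\<dots> = fap ?A t \<odot>[C] fap (?R x) (gel k \<one> ?l (str U k))" using bif_comm[OF B t s(1)[OF u1]] n by simp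
      also have "\<dots> = (fap ?A t \<odot>[C] cg x ?l) \<odot>[C] ue x k"
        using g[OF xy(1) kl] ecomp_assoc[OF C At[OF t] cg1 uel[OF xy(1) k]] n by simp
      also have "fap ?A t \<odot>[C] cg x ?l = cg y ?l \<odot>[C] fap (cA T ?A k) t"
        using ctf_law[of ?l, OF _ At[OF t] n] k c(2) by (simp add: cg_def p_def)
      also have "\<dots> \<odot>[C] ue x k = cg y ?l \<odot>[C] (fap (cA T ?A k) t \<odot>[C] ue x k)"
        using ecomp_assoc[OF C cg2 c(1) uel[OF xy(1) k]] n by simp
      finally show "cg y ?l \<odot>[C] (ue y k \<odot>[C] fap (?L k) t) = cg y ?l \<odot>[C] (fap (cA T ?A k) t \<odot>[C] ue x k)" .
    qed
  qed
  have nat': "ve y k \<odot>[C] fap (cA T ?A k) t = fap (?L k) t \<odot>[C] ve x k" if t: "el ?T t = El x y S" and k: "k \<in> J" for t x y S k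
  proof -
    note xy = theory_obs[OF th(1) t]
    show ?thesis
      using square_inverse[OF C lf_el[OF B t k] cAt(1)[OF t k] i[OF xy(1) k] i[OF xy(2) k] nat[OF t k, unfolded ue_def]]
      by (simp add: ve_def)
  qed
  \<comment> \<open>D(x, -) need not take the designated cotensors as its values, so it is replaced
    by the isomorphic functor that does; only then can it be an evaluation of a functor into the
    commutant.\<close>
  have "\<exists>G. enriched_functor V ?U C G \<and> (\<forall>k \<in> J. FOb G k = p x k) \<and> (\<forall>w k k' S. el ?U w = El k k' S \<longrightarrow>
    fap G w = ue x k' \<odot>[C] (fap (?R x) w \<odot>[C] ve x k))" if x: "x \<in> J" for x
  proof -
    have Jk: "k \<in> J" if "k \<in> VOb ?U" for k using that theoryD(1)[OF th(2)] by simp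
    have ii: "inverse0 V C (FOb (?R x) k) (p x k) (u x k) (v x k)" if "k \<in> VOb ?U" for k
      using i[OF x Jk[OF that]] rf_ob[OF B Jk[OF that]] by simp
    obtain G where G: "enriched_functor V ?U C G" "\<And>k. k \<in> VOb ?U \<Longrightarrow> FOb G k = p x k"
      "\<And>w k k' S. el ?U w = El k k' S \<Longrightarrow>
        fap G w = (FOb (?R x) k', p x k', {}, u x k') \<odot>[C] (fap (?R x) w \<odot>[C] (p x k, FOb (?R x) k, {}, v x k))"
      using conjugate_functor[OF algebraD(1)[OF rf_alg[OF B x]], of "p x" "u x" "v x"] pob[OF x] ii Jk by meson
    have "fap G w = ue x k' \<odot>[C] (fap (?R x) w \<odot>[C] ve x k)" if w: "el ?U w = El k k' S" for w k k' S
      using G(3)[OF w] rf_ob[OF B Jk[OF el_obs(1)[OF w]]] rf_ob[OF B Jk[OF el_obs(2)[OF w]]] by (simp add: ue_def ve_def)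
    then show ?thesis using G(1,2) theoryD(1)[OF th(2)] by (intro exI[of _ G]) simp
  qed
  then obtain G where G: "\<And>x. x \<in> J \<Longrightarrow> enriched_functor V ?U C (G x)" "\<And>x k. x \<in> J \<Longrightarrow> k \<in> J \<Longrightarrow> FOb (G x) k = p x k"
    "\<And>x w k k' S. x \<in> J \<Longrightarrow> el ?U w = El k k' S \<Longrightarrow> fap (G x) w = ue x k' \<odot>[C] (fap (?R x) w \<odot>[C] ve x k)"
    by metis
  have "\<exists>N. enriched_functor V ?U (CV T ?A) N \<and> (\<forall>k \<in> J. FOb N k = k) \<and>
    (\<forall>x \<in> J. \<forall>w k k' S. el ?U w = El k k' S \<longrightarrow> evx T x (up T ?A (fap N w)) = fap (G x) w)"
  proof (rule commutant_functor_ex[OF th(1) A theoryD(3)[OF th(2)] theoryD(1)[OF th(2)] G(1)])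
    show "FOb (G x) k = ct k (FOb ?A x)" if "x \<in> J" "k \<in> J" for x k using G(2)[OF that] lf_ob[OF B that(1)] by (simp add: p_def)
    fix x y t k k' w S S' assume t: "el ?T t = El x y S" and w: "el ?U w = El k k' S'" and d: "S' \<inter> S = {}"
    have o: "x \<in> J" "y \<in> J" "k \<in> J" "k' \<in> J" using el_obs[OF t] el_obs[OF w] theoryD(1)[OF th(1)] theoryD(1)[OF th(2)] by simp_all
    have d: "S \<inter> S' = {}" "S' \<inter> S = {}" using d by auto
    note Ry = rf_el[OF B w o(2)] and Rx = rf_el[OF B w o(1)] and L = lf_el[OF B t o(3)] and L' = lf_el[OF B t o(4)]
    note c = cAt(1)[OF t o(3)] and c' = cAt(1)[OF t o(4)]
    note Rxv = ecomp_el[OF P Rx vel[OF o(1,3)], simplified]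
    have "fap (G y) w \<odot>[C] fap (cA T ?A k) t = ue y k' \<odot>[C] ((fap (?R y) w \<odot>[C] ve y k) \<odot>[C] fap (cA T ?A k) t)"
      using G(3)[OF o(2) w] ecomp_assoc[OF C uel[OF o(2,4)] ecomp_el[OF P Ry vel[OF o(2,3)], simplified] c] d by simp
    also have "\<dots> = ue y k' \<odot>[C] (fap (?R y) w \<odot>[C] (fap (?L k) t \<odot>[C] ve x k))"
      using ecomp_assoc[OF C Ry vel[OF o(2,3)] c] d nat'[OF t o(3)] by simp
    also have "\<dots> = ue y k' \<odot>[C] ((fap (?L k') t \<odot>[C] fap (?R x) w) \<odot>[C] ve x k)"
      using ecomp_assoc[OF C Ry L vel[OF o(1,3)]] d bif_comm[OF B t w] by simp
    also have "\<dots> = (ue y k' \<odot>[C] fap (?L k') t) \<odot>[C] (fap (?R x) w \<odot>[C] ve x k)"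
      using ecomp_assoc[OF C L' Rx vel[OF o(1,3)]] ecomp_assoc[OF C uel[OF o(2,4)] L' Rxv] d by simp
    also have "\<dots> = fap (cA T ?A k') t \<odot>[C] fap (G x) w"
      using nat[OF t o(4)] ecomp_assoc[OF C c' uel[OF o(1,4)] Rxv] d G(3)[OF o(1) w] by simp
    finally show "fap (G y) w \<odot>[C] fap (cA T ?A k) t = fap (cA T ?A k') t \<odot>[C] fap (G x) w" .
  qed
  then obtain N where N: "enriched_functor V ?U (CV T ?A) N" "\<And>k. k \<in> J \<Longrightarrow> FOb N k = k"
    "\<And>x w k k' S. x \<in> J \<Longrightarrow> el ?U w = El k k' S \<Longrightarrow> evx T x (up T ?A (fap N w)) = ue x k' \<odot>[C] (fap (?R x) w \<odot>[C] ve x k)"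
    using G(3) by metis
  let ?W = "commutant_theory V J C ct cu (T, ?A)"
  note W = commutant_is_theory[OF th(1) A] and WT = commutant_Tcat[OF th(1) A]
  have Nm: "theory_morphism V J U ?W N"
  proof (rule theory_morphismI[OF th(2) W _ N(2)])
    show "enriched_functor V ?U (Tcat ?W) N" using N(1) WT by simp
    fix k assume k: "k \<in> J"
    let ?l = "(k, 0 :: nat)" and ?g = "gel k \<one> (k, 0 :: nat) (str U k)"
    note s = rf_str(1)[of \<one> ?l, simplified, OF u1 k] and sc = cot_obs[OF str_cot[OF th(2) k]]
    have cce: "el (CV T ?A) (gel k \<one> ?l (cc T ?A k)) = El k \<one> {?l}"
      using gel_el[of k "CV T ?A" \<one> "cc T ?A k" ?l] cc_ty[OF th(1) A k] CV_simps(1)[OF th(1) A] k u1 by simp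
    have Ng: "fap N ?g = gel k \<one> ?l (FHm N k \<one> \<cdot> str U k)" using fap_gel[OF N(1) sc(2,1), of "str U k" ?l] sc N(2) k u1 by simp
    have "fap N ?g = gel k \<one> ?l (cc T ?A k)"
    proof (rule CV_eqI[OF th(1) A])
      show "el (CV T ?A) (fap N ?g) = El k \<one> {?l}" using fap_el[OF N(1) s] N(2) k u1 by simp
      show "el (CV T ?A) (gel k \<one> ?l (cc T ?A k)) = El k \<one> {?l}" by (rule cce)
      fix x assume x: "x \<in> J"
      note cx = cgel[OF x, of ?l, simplified, OF k]
      \<comment> \<open>The image of the structure morphism is the designated counit after u, so
        conjugation by v leaves the designated counit, which is the value at x of the counit of the
        commutant.\<close>
      have "fap (?R x) ?g \<odot>[C] ve x k = cg x ?l"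
        using g[OF x, of ?l] k ecomp_assoc[OF C cx uel[OF x k] vel[OF x k]] uv(1)[OF x k] ecomp_idn(2)[OF C cx] by simp
      then have "evx T x (up T ?A (fap N ?g)) = cg x ?l"
        using N(3)[OF x s] u_unit[OF x] ecomp_idn(1)[OF C cx] by simp
      also have "\<dots> = evx T x (up T ?A (gel k \<one> ?l (cc T ?A k)))"
        using evx_cc[OF th(1) A, of ?l x] k x lf_ob[OF B x] by (simp add: cg_def p_def)
      finally show "evx T x (up T ?A (fap N ?g)) = evx T x (up T ?A (gel k \<one> ?l (cc T ?A k)))" .
    qed
    from gel_inj[OF this[unfolded Ng]] show "FHm N k \<one> \<cdot> str U k = str ?W k"
      using commutant_str[OF th(1) A k] cc_ty[OF th(1) A k] FHm_ty[OF N(1) sc(2,1)] sc(3) N(2) k u1 by (simp add: comp_ty)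
  qed
  \<comment> \<open>The comparison isomorphisms at x = I lead from the right face to evaluation at I
    after N.\<close>
  let ?f = "\<lambda>k\<in>J. u \<one> k"
  have h: "((U, ?B), (N, ?f), (?W, cev T ?A \<one>)) \<in> hom Alg (U, ?B) (?W, cev T ?A \<one>)"
  proof (rule Alg_homI[OF th(2) rf_alg[OF B u1] W cev_algebra[OF th(1) A u1] Nm])
    have ob: "FOb ?B k = ?D \<one> k" "FOb (cev T ?A \<one>) k = p \<one> k" if "k \<in> J" for k
      using that rf_ob[OF B that] cev_ob[OF th(1) A that] lf_ob[OF B u1] by (simp_all add: p_def)
    show "\<exists>g. inverse0 V C (FOb ?B k) (FOb (cev T ?A \<one>) k) (?f k) g" if "k \<in> J" for k using i[OF u1 that] that ob[OF that] by auto
    fix k k' S w assume w: "el ?U w = El k k' S"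
    note o = theory_obs[OF th(2) w]
    note R = rf_el[OF B w u1]
    have Nw: "el (CV T ?A) (fap N w) = El k k' S" using fap_el[OF N(1) w] N(2) o by simp
    have "(ue \<one> k' \<odot>[C] (fap ?B w \<odot>[C] ve \<one> k)) \<odot>[C] ue \<one> k = ue \<one> k' \<odot>[C] fap ?B w"
      using ecomp_assoc[OF C uel[OF u1 o(2)] ecomp_el[OF P R vel[OF u1 o(1)], simplified] uel[OF u1 o(1)]]
        ecomp_assoc[OF C R vel[OF u1 o(1)] uel[OF u1 o(1)]] uv(2)[OF u1 o(1)] ecomp_idn(2)[OF C R] by simp
    then show "(FOb ?B k', FOb (cev T ?A \<one>) k', {}, ?f k') \<odot>[C] fap ?B w
        = fap (cev T ?A \<one>) (fap N w) \<odot>[C] (FOb ?B k, FOb (cev T ?A \<one>) k, {}, ?f k)"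
      using fap_cev[OF th(1) A Nw u1] N(3)[OF u1 w] o ob[OF o(1)] ob[OF o(2)] by (simp add: ue_def)
  qed simp
  have car: "carrier V (U, ?B) = ?D \<one> \<one>" "carrier V (T, ?A) = ?D \<one> \<one>" "carrier V (?W, cev T ?A \<one>) = ?D \<one> \<one>"
    using rf_ob[OF B u1] lf_ob[OF B u1] cev_ob[OF th(1) A u1] ct_unit(1)[OF Dob[OF u1 u1]] by (simp_all add: carrier_def)
  have "underlying V ((U, ?B), (N, ?f), (?W, cev T ?A \<one>)) = VId C (?D \<one> \<one>)"
    using u_unit(1)[OF u1] u1 by (simp add: underlying_def ue_def idn_def)
  then have "((U, ?B), (N, ?f), (?W, cev T ?A \<one>)) \<in> hom (AlgOn V J C (carrier V (T, ?A))) (U, ?B) (commutant V J C ct cu (T, ?A))"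
    using h car unfolding commutant_eq[OF th(1) A] by (simp add: AlgOn_def hom_def)
  then show ?thesis unfolding commutes_with_def by blast
qed

lemma lf_str:
  assumes "k \<in> J" "fst l \<in> J"
  shows "el (Tcat T) (gel (fst l) \<one> l (str T (fst l))) = El (fst l) \<one> {l}"
    "fap (lf T U D k) (gel (fst l) \<one> l (str T (fst l))) = gel (FOb D (fst l, k)) (FOb D (\<one>, k)) l (FHm (lf T U D k) (fst l) \<one> \<cdot> str T (fst l))"
    "is_cotensor V C (fst l) (FOb D (\<one>, k)) (FOb D (fst l, k)) (FHm (lf T U D k) (fst l) \<one> \<cdot> str T (fst l))"
proof -
  note co = cot_obs[OF str_cot[OF th(1) assms(2)]]
  show "el (Tcat T) (gel (fst l) \<one> l (str T (fst l))) = El (fst l) \<one> {l}" using gel_el[OF co(2,1,3)] .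
  show "fap (lf T U D k) (gel (fst l) \<one> l (str T (fst l))) = gel (FOb D (fst l, k)) (FOb D (\<one>, k)) l (FHm (lf T U D k) (fst l) \<one> \<cdot> str T (fst l))"
    using fap_gel[OF algebraD(1)[OF lf_alg[OF B assms(1)]] co(2,1,3)] lf_ob[OF B] assms J_unit by simp
  show "is_cotensor V C (fst l) (FOb D (\<one>, k)) (FOb D (fst l, k)) (FHm (lf T U D k) (fst l) \<one> \<cdot> str T (fst l))"
    using algebra_cot[OF th(1) lf_alg[OF B assms(1)] assms(2)] lf_ob[OF B] assms J_unit by simp
qed

text \<open>D(j, k) is a cotensor in two ways, of D(I, k) by j and of D(j, I) by k. This lemma and
  \<open>rf_mono\<close> allow cancellation in either variable, according to which of the two
  actions is being tested.\<close>

lemma lf_mono: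
  assumes "k \<in> J" "fst l \<in> J" "l \<notin> S" "el C y = El q (FOb D (fst l, k)) S" "el C z = El q (FOb D (fst l, k)) S"
    "fap (lf T U D k) (gel (fst l) \<one> l (str T (fst l))) \<odot>[C] y = fap (lf T U D k) (gel (fst l) \<one> l (str T (fst l))) \<odot>[C] z"
  shows "y = z"
  using cot_mono[OF C_pre lf_str(3)[OF assms(1,2)], where l = l, OF refl assms(3-5)] assms(6) unfolding lf_str(2)[OF assms(1,2)] .

lemma rf_mono:
  assumes "j \<in> J" "fst l \<in> J" "l \<notin> S" "el C y = El q (FOb D (j, fst l)) S" "el C z = El q (FOb D (j, fst l)) S"
    "fap (rf T U D j) (gel (fst l) \<one> l (str U (fst l))) \<odot>[C] y = fap (rf T U D j) (gel (fst l) \<one> l (str U (fst l))) \<odot>[C] z"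
  shows "y = z"
  using cot_mono[OF C_pre rf_cot[OF assms(1,2)], where l = l, OF refl assms(3-5)] assms(6) unfolding rf_str(2)[OF assms(1,2)] .

end

section \<open>Full faithfulness on arrows of bifold algebras\<close>

lemma theory_morphism_gel:
  assumes T: "is_theory V J T" and U: "is_theory V J U" and M: "theory_morphism V J T U M" and l: "fst l \<in> J"
  shows "fap M (gel (fst l) \<one> l (str T (fst l))) = gel (fst l) \<one> l (str U (fst l))"
  using fap_gel[OF theory_morphismD(1)[OF T U M], of "fst l" \<one> "str T (fst l)" l] cot_obs[OF str_cot[OF T l]] theory_morphismD(2,3)[OF T U M] l J_unit
  by simp

text \<open>The component at (j, k) is a map into a cotensor of D'(j, I) by k. Naturality in the
  second variable at the structure morphism of k expresses its composite with the counit through the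
  component at (j, I).\<close>

lemma BA_faithful:
  assumes x: "x \<in> hom BA X Y" "x' \<in> hom BA X Y" and l: "faceL \<one> x = faceL \<one> x'" and r: "faceR \<one> x = faceR \<one> x'"
  shows "x = x'"
proof -
  obtain T U D where eX: "X = (T, U, D)" by (rule prod_cases3)
  obtain T' U' D' where eY: "Y = (T', U', D')" by (rule prod_cases3)
  have B: "bif T U D" "bif T' U' D'" using BA_face_hom(3,4)[OF x(1)] by (simp_all add: eX eY BA_ob)
  have th: "is_theory V J U" "is_theory V J U'" using B by simp_all
  let ?D = "\<lambda>j k. FOb D (j, k)" and ?R = "rf T U D"
    and ?E = "\<lambda>j k. FOb D' (j, k)" and ?R' = "rf T' U' D'"
  \<comment> \<open>The right restriction gives this square for the inverse components and with N
    applied to the structure morphism. N preserves structure morphisms, and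
    \<open>square_inverse\<close> returns to f.\<close>
  have nat: "(?D j \<one>, ?E j \<one>, {}, f (j, \<one>)) \<odot>[C] fap (?R j) (gel (fst l) \<one> l (str U (fst l)))
      = fap (?R' j) (gel (fst l) \<one> l (str U' (fst l))) \<odot>[C] (?D j (fst l), ?E j (fst l), {}, f (j, fst l)) \<and>
      el C (?D j (fst l), ?E j (fst l), {}, f (j, fst l)) = El (?D j (fst l)) (?E j (fst l)) {}"
    if y: "(X, (M, N, f), Y) \<in> hom BA X Y" and j: "j \<in> J" and k: "fst l \<in> J" for M N f j l
  proof -
    from y have N: "theory_morphism V J U' U N"
      and i: "\<And>k. k \<in> J \<Longrightarrow> inverse0 V C (?D j k) (?E j k) (f (j, k)) (inv0 V C (?D j k) (?E j k) (f (j, k)))"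
      and h: "faceR j (X, (M, N, f), Y) \<in> hom Alg (obR j Y) (obR j X)"
      by (rule BA_homE; use j in \<open>simp add: eX eY\<close>)+
    note s = rf_str(1)[OF B(2) j k] and s0 = rf_str(1)[OF B(1) j k]
    note Ng = theory_morphism_gel[OF th(2,1) N k]
    have "(FOb (?R' j) \<one>, FOb (?R j) \<one>, {}, (\<lambda>k\<in>J. inv0 V C (?D j k) (?E j k) (f (j, k))) \<one>)
        \<odot>[C] fap (?R' j) (gel (fst l) \<one> l (str U' (fst l)))
      = fap (?R j) (fap N (gel (fst l) \<one> l (str U' (fst l))))
        \<odot>[C] (FOb (?R' j) (fst l), FOb (?R j) (fst l), {}, (\<lambda>k\<in>J. inv0 V C (?D j k) (?E j k) (f (j, k))) (fst l))"
      using Alg_homD(9)[OF _ s, of "?R' j" N "\<lambda>k\<in>J. inv0 V C (?D j k) (?E j k) (f (j, k))" U "?R j"] h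
      by (simp only: faceR_def obR_def eX eY prod.case fst_conv snd_conv)
    then have "(?E j \<one>, ?D j \<one>, {}, inv0 V C (?D j \<one>) (?E j \<one>) (f (j, \<one>)))
        \<odot>[C] fap (?R' j) (gel (fst l) \<one> l (str U' (fst l)))
      = fap (?R j) (gel (fst l) \<one> l (str U (fst l)))
        \<odot>[C] (?E j (fst l), ?D j (fst l), {}, inv0 V C (?D j (fst l)) (?E j (fst l)) (f (j, fst l)))"
      using rf_ob[OF B(1)] rf_ob[OF B(2)] k J_unit Ng by simp
    from square_inverse[OF C_cat rf_el[OF B(2) s j] rf_el[OF B(1) s0 j] inverse0_sym[OF i[OF k]] inverse0_sym[OF i[OF J_unit]] this]
    show ?thesis using i[OF k] bif_ob[OF B(1) j k] bif_ob[OF B(2) j k] by (simp add: inverse0_iff el_const)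
  qed
  obtain M N f where 1: "x = (X, (M, N, f), Y)" using x(1) by (rule BA_homE) blast
  obtain M' N' f' where 2: "x' = (X, (M', N', f'), Y)" using x(2) by (rule BA_homE) blast
  have f1: "f (j, \<one>) = f' (j, \<one>)" if "j \<in> J" for j
    using l that by (auto simp: faceL_def 1 2 dest!: fun_cong[of _ _ j])
  have "f (j, k) = f' (j, k)" if j: "j \<in> J" and k: "k \<in> J" for j k
  proof -
    let ?l = "(k, 0 :: nat)"
    have kl: "fst ?l \<in> J" using k by simp
    note n = nat[OF x(1)[unfolded 1] j kl] and n' = nat[OF x(2)[unfolded 2] j kl]
    have "(?D j (fst ?l), ?E j (fst ?l), {} :: ('o \<times> nat) set, f (j, fst ?l)) = (?D j (fst ?l), ?E j (fst ?l), {}, f' (j, fst ?l))"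
      by (rule rf_mono[OF B(2) j kl, of "{}"]) (use n n' f1[OF j] in simp_all)
    then show ?thesis by simp
  qed
  then show ?thesis using x l r by (intro BA_eqI) (auto simp: 1 2 faceL_def)
qed

text \<open>The two variables are treated by cancellation in the opposite one. Naturality in T is
  tested against the right counits, where it becomes naturality of a; naturality in
  \<open>U'\<close> is tested against the left counits, where it becomes naturality of b at x =
  I.\<close>

lemma BA_full:
  assumes B: "bif T U D" and B': "bif T' U' D'"
    and a: "((T, lf T U D \<one>), (M, a), (T', lf T' U' D' \<one>)) \<in> hom Alg (T, lf T U D \<one>) (T', lf T' U' D' \<one>)"
    and b: "((U', rf T' U' D' \<one>), (N, b), (U, rf T U D \<one>)) \<in> hom Alg (U', rf T' U' D' \<one>) (U, rf T U D \<one>)"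
    and ab: "a \<one> = inv0 V C (FOb D' (\<one>, \<one>)) (FOb D (\<one>, \<one>)) (b \<one>)"
  shows "\<exists>f. ((T, U, D), (M, N, f), (T', U', D')) \<in> hom BA (T, U, D) (T', U', D') \<and> (\<lambda>j\<in>J. f (j, \<one>)) = a \<and>
    (\<lambda>k\<in>J. inv0 V C (FOb D (\<one>, k)) (FOb D' (\<one>, k)) (f (\<one>, k))) = b"
proof -
  let ?D = "\<lambda>j k. FOb D (j, k)" and ?L = "lf T U D" and ?R = "rf T U D"
    and ?E = "\<lambda>j k. FOb D' (j, k)" and ?L' = "lf T' U' D'" and ?R' = "rf T' U' D'"
  note C = C_cat and P = C_pre and u1 = J_unit
  have th: "is_theory V J T" "is_theory V J T'" "is_theory V J U" "is_theory V J U'" using B B' by simp_all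
  note ob = bif_ob[OF B] bif_ob[OF B']
  note M = Alg_homD(5)[OF a] and ax = Alg_homD(6)[OF a] and an = Alg_homD(9)[OF a]
    and N = Alg_homD(5)[OF b] and bx = Alg_homD(6)[OF b] and bn = Alg_homD(9)[OF b]
  have ai: "inverse0 V C (?D j \<one>) (?E j \<one>) (a j) (inv0 V C (?D j \<one>) (?E j \<one>) (a j))" if "j \<in> J" for j
    using Alg_homD(7)[OF a that] lf_ob[OF B that] lf_ob[OF B' that] by simp
  have bi: "inverse0 V C (?E \<one> k) (?D \<one> k) (b k) (inv0 V C (?E \<one> k) (?D \<one> k) (b k))" if "k \<in> J" for k
    using Alg_homD(7)[OF b that] rf_ob[OF B that] rf_ob[OF B' that] by simp
  define ae where "ae j = (?D j \<one>, ?E j \<one>, {} :: ('o \<times> nat) set, a j)" for j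
  have ael: "el C (ae j) = El (?D j \<one>) (?E j \<one>) {}" if "j \<in> J" for j
    using ai[OF that] ob[OF that u1] by (auto simp: inverse0_iff ae_def intro: el_const)
  define s where "s j l = fap (?R j) (gel (fst l) \<one> l (str U (fst l)))" for j l
  define s' where "s' j l = fap (?R' j) (gel (fst l) \<one> l (str U' (fst l)))" for j l
  have sel: "el C (s j l) = El (FOb D (j, fst l)) (?D j \<one>) {l}" "el C (s' j l) = El (FOb D' (j, fst l)) (?E j \<one>) {l}"
    if "j \<in> J" "fst l \<in> J" for j l
    using rf_str(2,3)[OF B that] rf_str(2,3)[OF B' that] by (simp_all add: s_def s'_def)
  have "\<exists>f g. inverse0 V C (?D j k) (?E j k) f g \<and>
      (\<forall>l. fst l = k \<longrightarrow> s' j l \<odot>[C] (?D j k, ?E j k, {}, f) = ae j \<odot>[C] s j l)" if j: "j \<in> J" and k: "k \<in> J" for j k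
  proof -
    obtain u v where u: "inverse0 V C (?D j k) (ct k (?D j \<one>)) u v"
      "\<And>l. fst l = k \<Longrightarrow> s j l = gel (ct k (?D j \<one>)) (?D j \<one>) l (cu k (?D j \<one>)) \<odot>[C] (?D j k, ct k (?D j \<one>), {}, u)"
      using comparison_ex[OF B] rf_str(2)[OF B j] j k unfolding s_def by metis
    obtain u' v' where u': "inverse0 V C (?E j k) (ct k (?E j \<one>)) u' v'"
      "\<And>l. fst l = k \<Longrightarrow> s' j l = gel (ct k (?E j \<one>)) (?E j \<one>) l (cu k (?E j \<one>)) \<odot>[C] (?E j k, ct k (?E j \<one>), {}, u')"
      using comparison_ex[OF B'] rf_str(2)[OF B' j] j k unfolding s'_def by metis
    let ?x = "?D j k" and ?x' = "?E j k" and ?y = "?D j \<one>" and ?y' = "?E j \<one>"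
    let ?p = "ct k ?y" and ?p' = "ct k ?y'"
    have o: "?x \<in> VOb C" "?x' \<in> VOb C" "?y \<in> VOb C" "?y' \<in> VOb C" "?p \<in> VOb C" "?p' \<in> VOb C"
      using ob j k u1 ct_ob by simp_all
    have c: "inverse0 V C ?p ?p' (FHm (ctf k) ?y ?y' \<cdot> a j) (FHm (ctf k) ?y' ?y \<cdot> inv0 V C ?y ?y' (a j))"
      using inverse0_functor[OF ctf_functor[OF k] o(3,4) ai[OF j]] o by (simp add: ctf_simps)
    let ?c = "(?p, ?p', {} :: ('o \<times> nat) set, FHm (ctf k) ?y ?y' \<cdot> a j)"
    have cf: "?c = fap (ctf k) (ae j)" using o by (simp add: ae_def fap_def ctf_simps)
    let ?u = "(?x, ?p, {} :: ('o \<times> nat) set, u)" and ?u' = "(?x', ?p', {} :: ('o \<times> nat) set, u')" and ?v' = "(?p', ?x', {} :: ('o \<times> nat) set, v')"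
    have e: "el C ?u = El ?x ?p {}" "el C ?u' = El ?x' ?p' {}" "el C ?v' = El ?p' ?x' {}" "el C ?c = El ?p ?p' {}"
      using u(1) u'(1) c o by (auto simp: inverse0_iff intro: el_const)
    \<comment> \<open>The component is [k, a j], transported along the comparison isomorphisms of
      D(j, k) and D'(j, k) with the designated cotensors.\<close>
    let ?f = "comp0 V C ?x ?p' ?x' v' (comp0 V C ?x ?p ?p' (FHm (ctf k) ?y ?y' \<cdot> a j) u)"
    note cu = ecomp_el[OF P e(4,1), simplified]
    have f: "(?x, ?x', {}, ?f) = ?v' \<odot>[C] (?c \<odot>[C] ?u)" by (simp add: ecomp_comp0)
    have "s' j l \<odot>[C] (?x, ?x', {}, ?f) = ae j \<odot>[C] s j l" if l: "fst l = k" for l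
    proof -
      let ?g = "gel ?p ?y l (cu k ?y)" and ?g' = "gel ?p' ?y' l (cu k ?y')"
      have g: "el C ?g = El ?p ?y {l}" "el C ?g' = El ?p' ?y' {l}" using cu_gel_el[OF o(3), of l] cu_gel_el[OF o(4), of l] l k by simp_all
      have "s' j l \<odot>[C] (?x, ?x', {}, ?f) = ?g' \<odot>[C] (?u' \<odot>[C] (?v' \<odot>[C] (?c \<odot>[C] ?u)))"
        unfolding f u'(2)[OF l] using ecomp_assoc[OF C g(2) e(2) ecomp_el[OF P e(3) cu, simplified]] by simp
      also have "?u' \<odot>[C] (?v' \<odot>[C] (?c \<odot>[C] ?u)) = ?c \<odot>[C] ?u"
        using ecomp_assoc[OF C e(2,3) cu] u'(1) ecomp_idn(1)[OF C cu] by (simp add: inverse0_iff)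
      also have "?g' \<odot>[C] (?c \<odot>[C] ?u) = (?g' \<odot>[C] ?c) \<odot>[C] ?u" using ecomp_assoc[OF C g(2) e(4,1)] by simp
      also have "?g' \<odot>[C] ?c = ae j \<odot>[C] ?g" using ctf_law[of l, OF _ ael[OF j]] l k cf by simp
      also have "\<dots> \<odot>[C] ?u = ae j \<odot>[C] s j l" unfolding u(2)[OF l] using ecomp_assoc[OF C ael[OF j] g(1) e(1)] by simp
      finally show ?thesis .
    qed
    then show ?thesis
      using inverse0_comp0[OF C o(1,6,2) inverse0_comp0[OF C o(1,5,6) u(1) c] inverse0_sym[OF u'(1)]] by blast
  qed
  then obtain f0 where f0i: "\<And>j k. j \<in> J \<Longrightarrow> k \<in> J \<Longrightarrow> \<exists>g. inverse0 V C (?D j k) (?E j k) (f0 j k) g"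
    and f0s: "\<And>j l. j \<in> J \<Longrightarrow> fst l \<in> J \<Longrightarrow> s' j l \<odot>[C] (FOb D (j, fst l), FOb D' (j, fst l), {}, f0 j (fst l)) = ae j \<odot>[C] s j l"
    by metis
  have fi: "inverse0 V C (?D j k) (?E j k) (f0 j k) (inv0 V C (?D j k) (?E j k) (f0 j k))" if "j \<in> J" "k \<in> J" for j k
    using f0i[OF that] inv0_inverse(1)[OF C ob(1)[OF that] ob(2)[OF that]] by blast
  define fe where "fe j k = (?D j k, ?E j k, {} :: ('o \<times> nat) set, f0 j k)" for j k
  have fel: "el C (fe j k) = El (?D j k) (?E j k) {}" if "j \<in> J" "k \<in> J" for j k
    using fi[OF that] ob[OF that] by (auto simp: inverse0_iff fe_def intro: el_const)
  have fs: "s' j l \<odot>[C] fe j (fst l) = ae j \<odot>[C] s j l" if "j \<in> J" "fst l \<in> J" for j l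
    using f0s[OF that] by (simp add: fe_def)
  \<comment> \<open>The counit equation determines the component, which is how the components at (j,
    I) and at (I, k) are identified with the given data.\<close>
  have fu: "y = fe j k" if j: "j \<in> J" and k: "k \<in> J" and y: "el C y = El (?D j k) (?E j k) {}"
    and e: "s' j (k, 0) \<odot>[C] y = ae j \<odot>[C] s j (k, 0)" for j k y
    by (rule rf_mono[OF B' j, of "(k, 0)" "{}"]) (use k y fel[OF j k] e fs[OF j, of "(k, 0)"] in \<open>simp_all add: s'_def\<close>)
  \<comment> \<open>At k = I the structure morphisms act as identities, so a itself satisfies the
    equation by \<open>unit_gel_central\<close>.\<close>
  have f1: "fe j \<one> = ae j" if j: "j \<in> J" for j
  proof (rule fu[OF j u1, symmetric])
    show "el C (ae j) = El (?D j \<one>) (?E j \<one>) {}" using ael[OF j] .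
    show "s' j (\<one>, 0) \<odot>[C] ae j = ae j \<odot>[C] s j (\<one>, 0)"
      using rf_str(2)[OF B j, of "(\<one>, 0)"] rf_str(2)[OF B' j, of "(\<one>, 0)"] rf_str_unit[OF B j] rf_str_unit[OF B' j] u1
        unit_gel_central[OF C ael[OF j, unfolded ae_def], of "(\<one>, 0)"] by (simp add: s_def s'_def ae_def)
  qed
  have natT: "fe j' k \<odot>[C] fap (?L k) t = fap (?L' k) (fap M t) \<odot>[C] fe j k"
    if t: "el (Tcat T) t = El j j' S" and k: "k \<in> J" for j j' k t S
  proof -
    note j = theory_obs[OF th(1) t]
    note Mt = theory_morphism_el[OF th(1,2) M t]
    have "finite S" using el_obs(3)[OF t] by (simp add: stage_def)
    then obtain n where n: "(k, n) \<notin> S" by (rule fresh_label)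
    let ?l = "(k, n)"
    have kl: "fst ?l \<in> J" using k by simp
    note L = lf_el[OF B t k] and L' = lf_el[OF B' Mt k] and L1 = lf_el[OF B t u1] and L1' = lf_el[OF B' Mt u1]
    note sj = sel[OF j(1) kl, simplified] and sj' = sel[OF j(2) kl, simplified] and g = rf_str(1)[OF B u1 kl, simplified] and g' = rf_str(1)[OF B' u1 kl, simplified]
    have ant: "ae j' \<odot>[C] fap (?L \<one>) t = fap (?L' \<one>) (fap M t) \<odot>[C] ae j"
      using an[OF t] lf_ob[OF B] lf_ob[OF B'] j by (simp add: ae_def)
    show ?thesis
    proof (rule rf_mono[OF B' j(2) kl n])
      show "el C (fe j' k \<odot>[C] fap (?L k) t) = El (?D j k) (?E j' (fst ?l)) S" using ecomp_el[OF P fel[OF j(2) k] L] by simp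
      show "el C (fap (?L' k) (fap M t) \<odot>[C] fe j k) = El (?D j k) (?E j' (fst ?l)) S" using ecomp_el[OF P L' fel[OF j(1) k]] by simp
      have "s' j' ?l \<odot>[C] (fe j' k \<odot>[C] fap (?L k) t) = (ae j' \<odot>[C] s j' ?l) \<odot>[C] fap (?L k) t"
        using ecomp_assoc[OF C sj'(2) fel[OF j(2) k] L] n fs[OF j(2) kl] by simp
      also have "\<dots> = ae j' \<odot>[C] (fap (?L \<one>) t \<odot>[C] s j ?l)"
        using ecomp_assoc[OF C ael[OF j(2)] sj'(1) L] n bif_comm[OF B t g] by (simp add: s_def)
      also have "\<dots> = (fap (?L' \<one>) (fap M t) \<odot>[C] ae j) \<odot>[C] s j ?l"
        using ecomp_assoc[OF C ael[OF j(2)] L1 sj(1)] n ant by simp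
      also have "\<dots> = fap (?L' \<one>) (fap M t) \<odot>[C] (s' j ?l \<odot>[C] fe j k)"
        using ecomp_assoc[OF C L1' ael[OF j(1)] sj(1)] n fs[OF j(1) kl] by simp
      also have "\<dots> = (s' j' ?l \<odot>[C] fap (?L' k) (fap M t)) \<odot>[C] fe j k"
        using ecomp_assoc[OF C L1' sj(2) fel[OF j(1) k]] n bif_comm[OF B' Mt g'] by (simp add: s'_def)
      also have "\<dots> = s' j' ?l \<odot>[C] (fap (?L' k) (fap M t) \<odot>[C] fe j k)"
        using ecomp_assoc[OF C sj'(2) L' fel[OF j(1) k]] n by simp
      finally show "fap (?R' j') (gel (fst ?l) \<one> ?l (str U' (fst ?l))) \<odot>[C] (fe j' k \<odot>[C] fap (?L k) t)
        = fap (?R' j') (gel (fst ?l) \<one> ?l (str U' (fst ?l))) \<odot>[C] (fap (?L' k) (fap M t) \<odot>[C] fe j k)"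
        by (simp add: s'_def)
    qed
  qed
  \<comment> \<open>The datum b on right faces runs from D' to D; its inverse points in the
    direction of f.\<close>
  define be where "be k = (?D \<one> k, ?E \<one> k, {} :: ('o \<times> nat) set, inv0 V C (?E \<one> k) (?D \<one> k) (b k))" for k
  have bel: "el C (be k) = El (?D \<one> k) (?E \<one> k) {}" if "k \<in> J" for k
    using bi[OF that] ob[OF u1 that] by (auto simp: inverse0_iff be_def intro: el_const)
  have bnat: "be k' \<odot>[C] fap (?R \<one>) (fap N t) = fap (?R' \<one>) t \<odot>[C] be k" if t: "el (Tcat U') t = El k k' S" for k k' t S
  proof -
    note k = theory_obs[OF th(4) t]
    note Nt = theory_morphism_el[OF th(4,3) N t]
    have "(?E \<one> k', ?D \<one> k', {}, b k') \<odot>[C] fap (?R' \<one>) t = fap (?R \<one>) (fap N t) \<odot>[C] (?E \<one> k, ?D \<one> k, {}, b k)"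
      using bn[OF t] rf_ob[OF B] rf_ob[OF B'] k by simp
    from square_inverse[OF C rf_el[OF B' t u1] rf_el[OF B Nt u1] bi[OF k(1)] bi[OF k(2)] this] show ?thesis by (simp add: be_def)
  qed
  have b1: "be \<one> = ae \<one>" using ab by (simp add: be_def ae_def)
  \<comment> \<open>Naturality of \<open>be\<close> at the structure morphism of k, together with
    agreement on the carrier (\<open>b1\<close>), is the equation that determines the component at
    (I, k).\<close>
  have fb: "be k = fe \<one> k" if k: "k \<in> J" for k
  proof (rule fu[OF u1 k bel[OF k]])
    have kl: "fst (k, 0 :: nat) \<in> J" using k by simp
    show "s' \<one> (k, 0) \<odot>[C] be k = ae \<one> \<odot>[C] s \<one> (k, 0)"
      using bnat[OF rf_str(1)[OF B' u1 kl]] theory_morphism_gel[OF th(4,3) N kl] b1 by (simp add: s_def s'_def)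
  qed
  \<comment> \<open>Composing with the left structure morphism of j moves the square from j to I, by
    \<open>natT\<close> and commutation of the two actions. At I it is the square
    \<open>bnat\<close>.\<close>
  have natU: "fe j k' \<odot>[C] fap (?R j) (fap N t) = fap (?R' j) t \<odot>[C] fe j k"
    if t: "el (Tcat U') t = El k k' S" and j: "j \<in> J" for j k k' t S
  proof -
    note k = theory_obs[OF th(4) t]
    note Nt = theory_morphism_el[OF th(4,3) N t]
    have "finite S" using el_obs(3)[OF t] by (simp add: stage_def)
    then obtain n where n: "(j, n) \<notin> S" by (rule fresh_label)
    let ?l = "(j, n)"
    have jl: "fst ?l \<in> J" using j by simp
    define r where "r k = fap (?L k) (gel j \<one> ?l (str T j))" for k
    define r' where "r' k = fap (?L' k) (gel j \<one> ?l (str T' j))" for k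
    note g = lf_str(1)[OF B u1 jl, simplified] and g' = lf_str(1)[OF B' u1 jl, simplified]
    have rel: "el C (r k) = El (?D j k) (?D \<one> k) {?l}" "el C (r' k) = El (?E j k) (?E \<one> k) {?l}" if "k \<in> J" for k
      using lf_el[OF B g that] lf_el[OF B' g' that] by (simp_all add: r_def r'_def)
    have rn: "r' k \<odot>[C] fe j k = fe \<one> k \<odot>[C] r k" if "k \<in> J" for k
      using natT[OF g that] theory_morphism_gel[OF th(1,2) M jl] by (simp add: r_def r'_def)
    note R = rf_el[OF B Nt j] and R' = rf_el[OF B' t j] and R1 = rf_el[OF B Nt u1] and R1' = rf_el[OF B' t u1]
    have n1: "fe \<one> k' \<odot>[C] fap (?R \<one>) (fap N t) = fap (?R' \<one>) t \<odot>[C] fe \<one> k" using bnat[OF t] fb k by simp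
    show ?thesis
    proof (rule lf_mono[OF B' k(2) jl n])
      show "el C (fe j k' \<odot>[C] fap (?R j) (fap N t)) = El (?D j k) (?E (fst ?l) k') S" using ecomp_el[OF P fel[OF j k(2)] R] by simp
      show "el C (fap (?R' j) t \<odot>[C] fe j k) = El (?D j k) (?E (fst ?l) k') S" using ecomp_el[OF P R' fel[OF j k(1)]] by simp
      have "r' k' \<odot>[C] (fe j k' \<odot>[C] fap (?R j) (fap N t)) = (fe \<one> k' \<odot>[C] r k') \<odot>[C] fap (?R j) (fap N t)"
        using ecomp_assoc[OF C rel(2)[OF k(2)] fel[OF j k(2)] R] n rn[OF k(2)] by simp
      also have "\<dots> = fe \<one> k' \<odot>[C] (fap (?R \<one>) (fap N t) \<odot>[C] r k)"
        using ecomp_assoc[OF C fel[OF u1 k(2)] rel(1)[OF k(2)] R] n bif_comm[OF B g Nt] by (simp add: r_def)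
      also have "\<dots> = (fap (?R' \<one>) t \<odot>[C] fe \<one> k) \<odot>[C] r k"
        using ecomp_assoc[OF C fel[OF u1 k(2)] R1 rel(1)[OF k(1)]] n n1 by simp
      also have "\<dots> = fap (?R' \<one>) t \<odot>[C] (r' k \<odot>[C] fe j k)"
        using ecomp_assoc[OF C R1' fel[OF u1 k(1)] rel(1)[OF k(1)]] n rn[OF k(1)] by simp
      also have "\<dots> = (r' k' \<odot>[C] fap (?R' j) t) \<odot>[C] fe j k"
        using ecomp_assoc[OF C R1' rel(2)[OF k(1)] fel[OF j k(1)]] n bif_comm[OF B' g' t] by (simp add: r'_def)
      also have "\<dots> = r' k' \<odot>[C] (fap (?R' j) t \<odot>[C] fe j k)"
        using ecomp_assoc[OF C rel(2)[OF k(2)] R' fel[OF j k(1)]] n by simp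
      finally show "fap (?L' k') (gel (fst ?l) \<one> ?l (str T' (fst ?l))) \<odot>[C] (fe j k' \<odot>[C] fap (?R j) (fap N t))
        = fap (?L' k') (gel (fst ?l) \<one> ?l (str T' (fst ?l))) \<odot>[C] (fap (?R' j) t \<odot>[C] fe j k)"
        by (simp add: r'_def)
    qed
  qed
  let ?f = "\<lambda>(j, k) \<in> J \<times> J. f0 j k"
  have "((T, U, D), (M, N, ?f), (T', U', D')) \<in> hom BA (T, U, D) (T', U', D')"
  proof (rule BA_homI)
    show "(T, U, D) \<in> Ob BA" "(T', U', D') \<in> Ob BA" using B B' by (simp_all add: BA_ob)
    show "?f \<in> extensional (J \<times> J)" by simp
  next
    fix k assume k: "k \<in> J"
    have "((T, ?L k), (M, \<lambda>j\<in>J. f0 j k), (T', ?L' k)) \<in> hom Alg (T, ?L k) (T', ?L' k)"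
    proof (rule Alg_homI[OF th(1) lf_alg[OF B k] th(2) lf_alg[OF B' k] M])
      show "\<exists>g. inverse0 V C (FOb (?L k) j) (FOb (?L' k) j) ((\<lambda>j\<in>J. f0 j k) j) g" if "j \<in> J" for j
        using f0i[OF that k] lf_ob[OF B] lf_ob[OF B'] that by simp
      fix j j' S t assume t: "el (Tcat T) t = El j j' S"
      then have "j \<in> J" "j' \<in> J" using theory_obs[OF th(1) t] by simp_all
      then show "(FOb (?L k) j', FOb (?L' k) j', {}, (\<lambda>j\<in>J. f0 j k) j') \<odot>[C] fap (?L k) t
          = fap (?L' k) (fap M t) \<odot>[C] (FOb (?L k) j, FOb (?L' k) j, {}, (\<lambda>j\<in>J. f0 j k) j)"
        using natT[OF t k] lf_ob[OF B] lf_ob[OF B'] by (simp add: fe_def)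
    qed simp
    moreover have "(\<lambda>j\<in>J. ?f (j, k)) = (\<lambda>j\<in>J. f0 j k)" using k by (auto intro!: restrict_ext)
    ultimately show "faceL k ((T, U, D), (M, N, ?f), (T', U', D')) \<in> hom Alg (obL k (T, U, D)) (obL k (T', U', D'))"
      by (simp only: faceL_def obL_def prod.case)
  next
    fix j assume j: "j \<in> J"
    have "((U', ?R' j), (N, \<lambda>k\<in>J. inv0 V C (?D j k) (?E j k) (f0 j k)), (U, ?R j)) \<in> hom Alg (U', ?R' j) (U, ?R j)"
    proof (rule Alg_homI[OF th(4) rf_alg[OF B' j] th(3) rf_alg[OF B j] N])
      show "\<exists>g. inverse0 V C (FOb (?R' j) k) (FOb (?R j) k) ((\<lambda>k\<in>J. inv0 V C (?D j k) (?E j k) (f0 j k)) k) g" if "k \<in> J" for k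
        using inverse0_sym[OF fi[OF j that]] rf_ob[OF B] rf_ob[OF B'] that by auto
      fix k k' S t assume t: "el (Tcat U') t = El k k' S"
      note k = theory_obs[OF th(4) t]
      note Nt = theory_morphism_el[OF th(4,3) N t]
      from square_inverse[OF C rf_el[OF B Nt j] rf_el[OF B' t j] fi[OF j k(1)] fi[OF j k(2)] natU[OF t j, unfolded fe_def]]
      show "(FOb (?R' j) k', FOb (?R j) k', {}, (\<lambda>k\<in>J. inv0 V C (?D j k) (?E j k) (f0 j k)) k') \<odot>[C] fap (?R' j) t
          = fap (?R j) (fap N t) \<odot>[C] (FOb (?R' j) k, FOb (?R j) k, {}, (\<lambda>k\<in>J. inv0 V C (?D j k) (?E j k) (f0 j k)) k)"
        using k rf_ob[OF B] rf_ob[OF B'] by simp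
    qed simp
    moreover have "(\<lambda>k\<in>J. inv0 V C (?D j k) (?E j k) (?f (j, k))) = (\<lambda>k\<in>J. inv0 V C (?D j k) (?E j k) (f0 j k))"
      using j by (auto intro!: restrict_ext)
    ultimately show "faceR j ((T, U, D), (M, N, ?f), (T', U', D')) \<in> hom Alg (obR j (T', U', D')) (obR j (T, U, D))"
      by (simp only: faceR_def obR_def prod.case fst_conv snd_conv)
  qed
  moreover have "(\<lambda>j\<in>J. ?f (j, \<one>)) = a"
    using f1 ax u1 by (auto simp: fe_def ae_def intro!: extensionalityI[of _ J])
  moreover have "inv0 V C (?D \<one> k) (?E \<one> k) (f0 \<one> k) = b k" if "k \<in> J" for k
    using fb[OF that] inv0_inverse(2)[OF C ob(2,1)[OF u1 that] bi[OF that]] by (simp add: fe_def be_def)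
  then have "(\<lambda>k\<in>J. inv0 V C (?D \<one> k) (?E \<one> k) (?f (\<one>, k))) = b"
    using bx u1 by (auto intro!: extensionalityI[of _ J])
  ultimately show ?thesis by blast
qed

text \<open>Over an identity of theories a strong morphism is invertible by inverting its
  components; in general it is not, since its morphism of theories need not be invertible.\<close>

lemma Alg_iso_over_id:
  assumes T: "is_theory V J T" and A: "is_algebra V J C T A" and B: "is_algebra V J C T B"
    and h: "((T, A), (id_vfun V (Tcat T), f), (T, B)) \<in> hom Alg (T, A) (T, B)"
  defines "g \<equiv> ((T, B), (id_vfun V (Tcat T), \<lambda>j\<in>J. inv0 V C (FOb A j) (FOb B j) (f j)), (T, A))"
  shows "g \<in> hom Alg (T, B) (T, A)"
    "Comp Alg g ((T, A), (id_vfun V (Tcat T), f), (T, B)) = Ident Alg (T, A)"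
    "Comp Alg ((T, A), (id_vfun V (Tcat T), f), (T, B)) g = Ident Alg (T, B)"
proof -
  note i = Alg_homD(7)[OF h] and C = C_cat
  show "g \<in> hom Alg (T, B) (T, A)" unfolding g_def
  proof (rule Alg_homI[OF T B T A theory_morphism_id[OF T]])
    show "\<exists>g. inverse0 V C (FOb B j) (FOb A j) ((\<lambda>j\<in>J. inv0 V C (FOb A j) (FOb B j) (f j)) j) g" if "j \<in> J" for j
      using inverse0_sym[OF i[OF that]] that by auto
    fix j k S t assume t: "el (Tcat T) t = El j k S"
    note j = theory_obs[OF T t]
    from square_inverse[OF C fap_el[OF algebraD(1)[OF A] t] fap_el[OF algebraD(1)[OF B] t] i[OF j(1)] i[OF j(2)]]
    show "(FOb B k, FOb A k, {}, (\<lambda>j\<in>J. inv0 V C (FOb A j) (FOb B j) (f j)) k) \<odot>[C] fap B t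
        = fap A (fap (id_vfun V (Tcat T)) t) \<odot>[C] (FOb B j, FOb A j, {}, (\<lambda>j\<in>J. inv0 V C (FOb A j) (FOb B j) (f j)) j)"
      using Alg_homD(9)[OF h t] j by (simp add: fap_id_vfun[OF t])
  qed simp
  have o: "FOb (id_vfun V (Tcat T)) j = j" if "j \<in> J" for j using that theoryD(1)[OF T] by (simp add: id_vfun_def)
  have c: "comp0 V C (FOb A j) (FOb B j) (FOb A j) (inv0 V C (FOb A j) (FOb B j) (f j)) (f j) = VId C (FOb A j)"
    "comp0 V C (FOb B j) (FOb A j) (FOb B j) (f j) (inv0 V C (FOb A j) (FOb B j) (f j)) = VId C (FOb B j)" if "j \<in> J" for j
    using i[OF that] by (simp_all add: inverse0_def)
  show "Comp Alg g ((T, A), (id_vfun V (Tcat T), f), (T, B)) = Ident Alg (T, A)"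
    "Comp Alg ((T, A), (id_vfun V (Tcat T), f), (T, B)) g = Ident Alg (T, B)"
    using o c comp_id_vfun(1)[OF id_vfun_functor[OF theoryD(3)[OF T]]]
    by (auto simp: AlgS_def g_def intro!: restrict_ext)
qed

section \<open>The functor of faces: values, essential surjectivity and equivalence\<close>

lemma left_face_eq: "left_face V X = obL \<one> X" and right_face_eq: "right_face V X = obR \<one> X"
  by (cases X; simp add: left_face_def right_face_def obL_def obR_def)+

lemma faces_CP_ob:
  assumes "X \<in> Ob BA"
  shows "(obL \<one> X, obR \<one> X) \<in> Ob CP"
proof -
  obtain T U D where X: "X = (T, U, D)" by (rule prod_cases3)
  have B: "bif T U D" using assms by (simp add: X BA_ob)
  show ?thesis
    using B lf_alg[OF B J_unit] rf_alg[OF B J_unit] faces_commute[OF B] lf_ob[OF B J_unit] rf_ob[OF B J_unit]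
    by (simp add: CP_ob X obL_def obR_def Alg_ob carrier_def)
qed

lemma faces_CP_hom:
  assumes x: "x \<in> hom BA X Y"
  shows "((obL \<one> X, obR \<one> X), (faceL \<one> x, faceR \<one> x), (obL \<one> Y, obR \<one> Y)) \<in> hom CP (obL \<one> X, obR \<one> X) (obL \<one> Y, obR \<one> Y)"
proof -
  note h = BA_face_hom[OF x]
  obtain T U D M N f T' U' D' where e: "X = (T, U, D)" "Y = (T', U', D')" "x = (X, (M, N, f), Y)" and B: "bif T U D" "bif T' U' D'"
    and i: "inverse0 V C (FOb D (\<one>, \<one>)) (FOb D' (\<one>, \<one>)) (f (\<one>, \<one>)) (inv0 V C (FOb D (\<one>, \<one>)) (FOb D' (\<one>, \<one>)) (f (\<one>, \<one>)))"
    using x J_unit by (rule_tac BA_homE) blast+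
  have "underlying V (faceL \<one> x) = inv0 V C (carrier V (obR \<one> Y)) (carrier V (obR \<one> X)) (underlying V (faceR \<one> x))"
    using inv0_inverse(2)[OF C_cat bif_ob[OF B(1) J_unit J_unit] bif_ob[OF B(2) J_unit J_unit] i] J_unit
      rf_ob[OF B(1) J_unit] rf_ob[OF B(2) J_unit]
    by (simp add: underlying_def faceL_def faceR_def obR_def carrier_def e)
  then show ?thesis unfolding CP_hom using faces_CP_ob[OF h(3)] faces_CP_ob[OF h(4)] h(1,2)[OF J_unit] by simp
qed

text \<open>The constructed bifold algebra has A as its left face, since [I, A] = A. Its right face
  is evaluation at I after N, related to B by the isomorphism f that comes with the morphism into
  the commutant; its underlying arrow is an identity, so it pairs with the identity of A.\<close>

lemma CP_essentially_surjective:
  assumes Q: "Q \<in> Ob CP"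
  shows "\<exists>X \<in> Ob BA. \<exists>e \<in> hom CP (obL \<one> X, obR \<one> X) Q. iso_arrow CP e"
proof -
  obtain T A U B where Qe: "Q = ((T, A), (U, B))" by (metis surj_pair)
  have th: "is_theory V J T" "is_theory V J U" and A: "is_algebra V J C T A" and B: "is_algebra V J C U B"
    and com: "commutes_with V J C ct cu (T, A) (U, B)" and c: "carrier V (T, A) = carrier V (U, B)"
    using Q by (auto simp: CP_ob Qe Alg_ob)
  let ?W = "commutant_theory V J C ct cu (T, A)"
  note W = commutant_is_theory[OF th(1) A] and WT = commutant_Tcat[OF th(1) A] and u1 = J_unit and C = C_cat
  obtain h where h: "h \<in> hom Alg (U, B) (?W, cev T A \<one>)" "underlying V h = VId C (carrier V (T, A))"
    using com unfolding commutes_with_def commutant_eq[OF th(1) A] by (auto simp: AlgOn_def hom_def)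
  obtain N f where he: "h = ((U, B), (N, f), (?W, cev T A \<one>))" using h(1) unfolding Alg_hom by blast
  note hD = Alg_homD[OF h(1)[unfolded he]]
  note N = theory_morphismD[OF th(2) W hD(5)]
  have NF: "enriched_functor V (Tcat U) (CV T A) N" using N(1) WT by simp
  let ?L = "\<lambda>k. cA T A k" and ?R = "\<lambda>x. comp_vfun V (Tcat U) (cev T A x) N"
  have L: "is_algebra V J C T (?L k)" if "k \<in> J" for k using alg_cotensor_algebra[OF that A] .
  have cev: "enriched_functor V (CV T A) C (cev T A x)" if "x \<in> J" for x by (rule cev_functor[OF th(1) A that])
  have RF: "enriched_functor V (Tcat U) C (?R x)" if "x \<in> J" for x by (rule comp_vfun_functor[OF NF cev[OF that]])
  have Ro: "FOb (?R x) k = FOb (cev T A x) k" if "x \<in> J" "k \<in> J" for x k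
    using that N(2) theoryD(1)[OF th(2)] by (simp add: comp_vfun_def)
  have Rfap: "fap (?R x) w = evx T x (up T A (fap N w))" if x: "x \<in> J" and w: "el (Tcat U) w = El k k' S" for x w k k' S
    using fap_comp_vfun[OF NF cev[OF x] w] fap_cev[OF th(1) A fap_el[OF NF w] x] by simp
  have R: "is_algebra V J C U (?R x)" if x: "x \<in> J" for x
  proof (rule is_algebraI[OF th(2) RF[OF x]])
    fix j assume j: "j \<in> J"
    \<comment> \<open>N preserves structure morphisms, so the counit of \<open>?R x\<close> is that
      of evaluation at x, which is the designated one.\<close>
    have "FHm (?R x) j \<one> \<cdot> str U j = FHm (cev T A x) j \<one> \<cdot> FHm N j \<one> \<cdot> str U j"
      using comp_assoc[OF cot_obs(3)[OF str_cot[OF th(2) j]], of "FHm N j \<one>" _ "FHm (cev T A x) j \<one>"]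
        FHm_ty[OF NF, of j \<one>] FHm_ty[OF cev[OF x], of j \<one>] j u1 N(2) theoryD(1)[OF th(2)] CV_simps(1)[OF th(1) A]
      by (simp add: comp_vfun_def)
    then show "is_cotensor V C j (FOb (?R x) \<one>) (FOb (?R x) j) (FHm (?R x) j \<one> \<cdot> str U j)"
      using cev_cot[OF th(1) A x j] N(3)[OF j] commutant_str[OF th(1) A j] Ro[OF x j] Ro[OF x u1] by simp
  qed
  define D where "D = bifun (Tcat T) (Tcat U) C ?L ?R"
  note Tc = theoryD(3)[OF th(1)] and Uc = theoryD(3)[OF th(2)]
  have bf: "enriched_functor V (Tcat T) C (?L k)" if "k \<in> VOb (Tcat U)" for k
    using that algebraD(1)[OF L] theoryD(1)[OF th(2)] by simp
  have bg: "enriched_functor V (Tcat U) C (?R x)" if "x \<in> VOb (Tcat T)" for x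
    using that RF theoryD(1)[OF th(1)] by simp
  have bo: "FOb (?R x) k = FOb (?L k) x" if "x \<in> VOb (Tcat T)" "k \<in> VOb (Tcat U)" for x k
    using that Ro[of x k] theoryD(1)[OF th(1)] theoryD(1)[OF th(2)] cev_ob[OF th(1) A, of k x] cA_ob[OF th(1) A, of x k] by simp
  \<comment> \<open>Commutation of the two actions is naturality in x of an element of a hom-object
    of T-Alg(C).\<close>
  have bc: "fap (?L k') t \<odot>[C] fap (?R x) w = fap (?R y) w \<odot>[C] fap (?L k) t"
    if t: "el (Tcat T) t = El x y S" and w: "el (Tcat U) w = El k k' S'" and d: "S \<inter> S' = {}" for x y k k' t w S S'
  proof -
    have o: "x \<in> J" "y \<in> J" "k \<in> J" "k' \<in> J" using el_obs[OF t] el_obs[OF w] theoryD(1)[OF th(1)] theoryD(1)[OF th(2)] by simp_all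
    have "el (CV T A) (fap N w) = El k k' S'" using fap_el[OF NF w] N(2) o by simp
    from evx_nat[OF th(1) up_el[OF th(1) A this] t] show ?thesis using d Rfap[OF o(1) w] Rfap[OF o(2) w] by (simp add: Int_commute)
  qed
  have bif: "enriched_functor V (tensor_vcat V (Tcat T) (Tcat U)) C D"
    unfolding D_def by (rule bifun_functor[OF Tc Uc]) fact+
  have bl: "lf T U D k = ?L k" if k: "k \<in> J" for k
    unfolding D_def by (rule bifun_left[OF Tc Uc]) (fact+, use k theoryD(1)[OF th(2)] in simp)
  have br: "rf T U D x = ?R x" if x: "x \<in> J" for x
    unfolding D_def by (rule bifun_right[OF Tc Uc]) (fact+, use x theoryD(1)[OF th(1)] in simp)
  have B': "bif T U D"
    unfolding is_bifold_algebra_def using th bif bl br L R theoryD(1)[OF th(1)] theoryD(1)[OF th(2)] algebraD(2) by simp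
  have faces: "obL \<one> (T, U, D) = (T, A)" "obR \<one> (T, U, D) = (U, ?R \<one>)"
    using bl[OF u1] br[OF u1] cA_unit[OF th(1) A] by (simp_all add: obL_def obR_def)
  let ?g = "((U, B), (id_vfun V (Tcat U), f), (U, ?R \<one>))"
  have g: "?g \<in> hom Alg (U, B) (U, ?R \<one>)"
  proof (rule Alg_homI[OF th(2) B th(2) R[OF u1] theory_morphism_id[OF th(2)] hD(6)])
    show "\<exists>g. inverse0 V C (FOb B j) (FOb (?R \<one>) j) (f j) g" if "j \<in> J" for j using hD(7)[OF that] Ro[OF u1 that] by auto
    fix j k S t assume t: "el (Tcat U) t = El j k S"
    note j = theory_obs[OF th(2) t]
    show "(FOb B k, FOb (?R \<one>) k, {}, f k) \<odot>[C] fap B t = fap (?R \<one>) (fap (id_vfun V (Tcat U)) t) \<odot>[C] (FOb B j, FOb (?R \<one>) j, {}, f j)"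
      using hD(9)[OF t] Ro[OF u1 j(1)] Ro[OF u1 j(2)] fap_comp_vfun[OF NF cev[OF u1] t] by (simp add: fap_id_vfun[OF t])
  qed
  define g' where "g' = ((U, ?R \<one>), (id_vfun V (Tcat U), \<lambda>j\<in>J. inv0 V C (FOb B j) (FOb (?R \<one>) j) (f j)), (U, B))"
  note g' = Alg_iso_over_id[OF th(2) B R[OF u1] g, folded g'_def]
  let ?X = "(T, U, D)" and ?P = "((T, A), (U, ?R \<one>))"
  have X: "?X \<in> Ob BA" using B' by (simp add: BA_ob)
  have P: "?P \<in> Ob CP" using faces_CP_ob[OF X] faces by simp
  have id: "Ident Alg (T, A) \<in> hom Alg (T, A) (T, A)" "underlying V (Ident Alg (T, A)) = VId C (carrier V (T, A))"
    using category.Ident_hom[OF Alg_cat] underlying_id th A Alg_ob by blast+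
  have cA: "carrier V (T, A) \<in> VOb C" by (rule underlying_inverse(2)[OF id(1)])
  have car: "carrier V (U, ?R \<one>) = carrier V (T, A)"
    using Ro[OF u1 u1] cev_ob[OF th(1) A u1] ct_unit(1)[OF cA] by (simp add: carrier_def)
  have ug: "underlying V ?g = VId C (carrier V (T, A))" using h(2) he by (simp add: underlying_def)
  note i1 = inv0_eq[OF C cA cA inverse0_id[OF C cA]]
  have ug': "underlying V g' = VId C (carrier V (T, A))"
    using ug i1 u1 car c by (simp add: g'_def underlying_def carrier_def)
  \<comment> \<open>Right components of cross-morphisms run backwards, so the arrow from
    \<open>?P\<close> to Q uses \<open>?g\<close>, which starts at B.\<close>
  let ?e = "(?P, (Ident Alg (T, A), ?g), Q)" and ?e' = "(Q, (Ident Alg (T, A), g'), ?P)"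
  have e: "?e \<in> hom CP ?P Q" unfolding CP_hom Qe using P Q[unfolded Qe] id g ug i1 car c by simp
  have e': "?e' \<in> hom CP Q ?P" unfolding CP_hom Qe using P Q[unfolded Qe] id g'(1) ug' i1 car c by simp
  have ii: "Comp Alg (Ident Alg (T, A)) (Ident Alg (T, A)) = Ident Alg (T, A)" by (rule category.Comp_Ident_left[OF Alg_cat id(1)])
  have "inverse_arrows CP ?e ?e'"
    using e e' g'(2,3) ii unfolding inverse_arrows_def CP_comp CP_id by (simp add: hom_def Qe)
  then have "iso_arrow CP ?e" unfolding iso_arrow_def by blast
  then show ?thesis using X e faces by (metis (no_types, lifting))
qed

text \<open>This is the functor \<Theta> of the theorem; on arrows it takes the restrictions at
  I.\<close>

definition faces :: "(('o, 'c, 'm) bifold, ('o, 'c, 'm) bifold_arrow, ('o, 'c, 'm) pair, ('o, 'c, 'm) pair_arrow) ftor" where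
  "faces = \<lparr>Fo = (\<lambda>X\<in>Ob BA. (obL \<one> X, obR \<one> X)),
    Fa = (\<lambda>x\<in>Ar BA. ((obL \<one> (Dom BA x), obR \<one> (Dom BA x)), (faceL \<one> x, faceR \<one> x), (obL \<one> (Cod BA x), obR \<one> (Cod BA x))))\<rparr>"

lemma faces_hom: "x \<in> hom BA X Y \<Longrightarrow>
    Fa faces x = ((obL \<one> X, obR \<one> X), (faceL \<one> x, faceR \<one> x), (obL \<one> Y, obR \<one> Y))"
  by (auto simp: faces_def hom_def)

lemma faces_functor: "cat_functor BA CP faces"
proof (intro cat_functor.intro BA_cat CP_cat cat_functor_axioms.intro)
  show "Fo faces \<in> Ob BA \<rightarrow>\<^sub>E Ob CP" using faces_CP_ob by (auto simp: faces_def)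
  show "Fa faces \<in> extensional (Ar BA)" by (simp add: faces_def)
  fix x X Y assume x: "x \<in> hom BA X Y"
  note o = BA_face_hom(3,4)[OF x]
  show "Fa faces x \<in> hom CP (Fo faces X) (Fo faces Y)" unfolding faces_hom[OF x] using faces_CP_hom[OF x] o by (simp add: faces_def)
  fix y Z assume y: "y \<in> hom BA Y Z"
  show "Fa faces (Comp BA y x) = Comp CP (Fa faces y) (Fa faces x)"
    unfolding faces_hom[OF x] faces_hom[OF y] faces_hom[OF BA_comp(1)[OF x y]] CP_comp using BA_comp(2,3)[OF x y J_unit] by simp
next
  fix X assume X: "X \<in> Ob BA"
  show "Fa faces (Ident BA X) = Ident CP (Fo faces X)"
    unfolding faces_hom[OF BA_id(1)[OF X]] using X BA_id(2,3)[OF X J_unit] by (simp add: faces_def CP_id)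
qed

lemma faces_equivalence: "equivalence_of_categories BA CP faces"
proof (rule equivalence_of_categoriesI[OF faces_functor])
  fix X Y g assume X: "X \<in> Ob BA" and Y: "Y \<in> Ob BA" and g: "g \<in> hom CP (Fo faces X) (Fo faces Y)"
  obtain T U D where eX: "X = (T, U, D)" by (rule prod_cases3)
  obtain T' U' D' where eY: "Y = (T', U', D')" by (rule prod_cases3)
  have B: "bif T U D" "bif T' U' D'" using X Y by (simp_all add: eX eY BA_ob)
  have F: "Fo faces X = (obL \<one> X, obR \<one> X)" "Fo faces Y = (obL \<one> Y, obR \<one> Y)" using X Y by (simp_all add: faces_def)
  obtain p q where pq: "g = ((obL \<one> X, obR \<one> X), (p, q), (obL \<one> Y, obR \<one> Y))" "p \<in> hom Alg (obL \<one> X) (obL \<one> Y)" "q \<in> hom Alg (obR \<one> Y) (obR \<one> X)"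
    "underlying V p = inv0 V C (carrier V (obR \<one> Y)) (carrier V (obR \<one> X)) (underlying V q)"
    using g unfolding F CP_hom by auto
  obtain M a where p: "p = ((T, lf T U D \<one>), (M, a), (T', lf T' U' D' \<one>))" using pq(2) unfolding Alg_hom obL_def eX eY by auto
  obtain N b where q: "q = ((U', rf T' U' D' \<one>), (N, b), (U, rf T U D \<one>))" using pq(3) unfolding Alg_hom obR_def eX eY by auto
  have "a \<one> = inv0 V C (FOb D' (\<one>, \<one>)) (FOb D (\<one>, \<one>)) (b \<one>)"
    using pq(4) rf_ob[OF B(1) J_unit] rf_ob[OF B(2) J_unit] by (simp add: p q underlying_def carrier_def obR_def eX eY)
  with BA_full[OF B, of M a N b] pq(2,3) obtain f where f: "(X, (M, N, f), Y) \<in> hom BA X Y" "(\<lambda>j\<in>J. f (j, \<one>)) = a"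
    "(\<lambda>k\<in>J. inv0 V C (FOb D (\<one>, k)) (FOb D' (\<one>, k)) (f (\<one>, k))) = b"
    by (auto simp: p q obL_def obR_def eX eY)
  have "Fa faces (X, (M, N, f), Y) = g"
    unfolding faces_hom[OF f(1)] pq(1) using f(2,3) by (simp add: p q faceL_def faceR_def obL_def obR_def eX eY)
  then show "\<exists>x \<in> hom BA X Y. Fa faces x = g" using f(1) by blast
next
  fix X Y x x' assume x: "x \<in> hom BA X Y" "x' \<in> hom BA X Y" and e: "Fa faces x = Fa faces x'"
  show "x = x'" by (rule BA_faithful[OF x]) (use e in \<open>simp_all add: faces_hom[OF x(1)] faces_hom[OF x(2)]\<close>)
next
  fix Q assume "Q \<in> Ob CP"
  then obtain X e where "X \<in> Ob BA" "e \<in> hom CP (obL \<one> X, obR \<one> X) Q" "iso_arrow CP e" using CP_essentially_surjective by blast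
  then show "\<exists>X \<in> Ob BA. \<exists>e \<in> hom CP (Fo faces X) Q. iso_arrow CP e" by (auto simp: faces_def)
qed

lemma BAlg_left_Fa: "x \<in> Ar BA \<Longrightarrow> Fa (BAlg_left V J C) x = faceL \<one> x"
  by (cases x) (auto simp: BAlg_left_def faceL_def left_face_eq)

text \<open>\<open>BAlg_right\<close> indexes its components by \<open>FOb N k\<close> and
  \<open>FOb M \<one>\<close>. Theory morphisms fix objects, so these agree with the indices in
  \<open>faceR\<close>.\<close>

lemma BAlg_right_Fa:
  assumes "x \<in> Ar BA"
  shows "Fa (BAlg_right V J C) x = faceR \<one> x"
proof -
  have x: "x \<in> hom BA (Dom BA x) (Cod BA x)" using assms by (simp add: hom_def)
  from x obtain T U D M N f T' U' D' where e: "x = ((T, U, D), (M, N, f), (T', U', D'))"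
    and B: "bif T U D" "bif T' U' D'" and m: "theory_morphism V J T T' M" "theory_morphism V J U' U N"
    by (rule BA_homE) simp
  have "FOb M \<one> = \<one>" "\<And>k. k \<in> J \<Longrightarrow> FOb N k = k"
    using B m J_unit theory_morphismD(2) by blast+
  then show ?thesis using assms unfolding e by (auto simp: BAlg_right_def faceR_def right_face_eq intro!: restrict_ext)
qed

lemma faces_left: "comp_ftor BA (CPair_left V J C ct cu) faces = BAlg_left V J C"
  and faces_right: "comp_ftor BA (CPair_right V J C ct cu) faces = BAlg_right V J C"
proof -
  have a: "Fa faces x \<in> Ar CP \<and> (\<exists>P Q. Fa faces x = (P, (faceL \<one> x, faceR \<one> x), Q))" if "x \<in> Ar BA" for x
  proof -
    have x: "x \<in> hom BA (Dom BA x) (Cod BA x)" using that by (simp add: hom_def)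
    show ?thesis using faces_hom[OF x] faces_CP_hom[OF x] by (simp add: hom_def)
  qed
  have l: "Fa (CPair_left V J C ct cu) (Fa faces x) = Fa (BAlg_left V J C) x"
    and r: "Fa (CPair_right V J C ct cu) (Fa faces x) = Fa (BAlg_right V J C) x" if "x \<in> Ar BA" for x
    using a[OF that] BAlg_left_Fa[OF that] BAlg_right_Fa[OF that] by (auto simp: CPair_left_def CPair_right_def)
  have "Fa (BAlg_left V J C) \<in> extensional (Ar BA)" "Fa (BAlg_right V J C) \<in> extensional (Ar BA)"
    by (simp_all add: BAlg_left_def BAlg_right_def)
  then have "compose (Ar BA) (Fa (CPair_left V J C ct cu)) (Fa faces) = Fa (BAlg_left V J C)"
    "compose (Ar BA) (Fa (CPair_right V J C ct cu)) (Fa faces) = Fa (BAlg_right V J C)"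
    using l r by (auto simp: compose_def intro!: extensionalityI[of _ "Ar BA"])
  moreover have "compose (Ob BA) (Fo (CPair_left V J C ct cu)) (Fo faces) = Fo (BAlg_left V J C)"
    "compose (Ob BA) (Fo (CPair_right V J C ct cu)) (Fo faces) = Fo (BAlg_right V J C)"
    using faces_CP_ob by (auto simp: compose_def CPair_left_def CPair_right_def BAlg_left_def BAlg_right_def faces_def left_face_eq right_face_eq
      intro!: restrict_ext)
  ultimately show "comp_ftor BA (CPair_left V J C ct cu) faces = BAlg_left V J C"
    "comp_ftor BA (CPair_right V J C ct cu) faces = BAlg_right V J C"
    by (simp_all add: comp_ftor_def)
qed

end

theorem theorem11p19:
  fixes V :: "('o, 'm) smc" and J :: "'o set" and C :: "('c, 'o, 'm) vcat"
    and ct :: "'o \<Rightarrow> 'c \<Rightarrow> 'c" and cu :: "'o \<Rightarrow> 'c \<Rightarrow> 'm"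
  assumes "system_of_arities V J" and "has_pullbacks V" and "admissible V J C ct cu"
  shows "\<exists>\<Theta>. equivalence_of_categories (BAlg V J C) (CPair V J C ct cu) \<Theta> \<and>
    (\<forall>D \<in> Ob (BAlg V J C). Fo \<Theta> D = (left_face V D, right_face V D)) \<and>
    comp_ftor (BAlg V J C) (CPair_left V J C ct cu) \<Theta> = BAlg_left V J C \<and>
    comp_ftor (BAlg V J C) (CPair_right V J C ct cu) \<Theta> = BAlg_right V J C"
proof -
  interpret admissible_category V J C ct cu
    using assms(1,3) by (simp add: admissible_category_def admissible_category_axioms_def)
  show ?thesis
    using faces_equivalence faces_left faces_right by (intro exI[of _ faces]) (simp add: faces_def left_face_eq right_face_eq)
qed

end
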